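(* Let $\lambda<\mu$ be elements of $\mathrm{Young}(n-2,2)$, put $m_1=\mu_1-\lambda_1$ and $m_2=\mu_2-\lambda_2$, and for $0\le k\le m_1+m_2$ define partitions $$\tau_k:=\begin{cases}\lambda+ke_1 & \text{if } 0\le k\le m_1,\\ \lambda+m_1e_1+(k-m_1)e_2 & \text{if } m_1\le k\le m_1+m_2.\end{cases}$$ Then the composition map $$\Theta_{\lambda,\mu}\colon \bigotimes_{k=1}^{m_1+m_2}\operatorname{Hom}(\mathbb{S}^{\tau_{k-1}}\mathcal{W},\mathbb{S}^{\tau_k}\mathcal{W})\longrightarrow \operatorname{Hom}(\mathbb{S}^{\lambda}\mathcal{W},\mathbb{S}^{\mu}\mathcal{W}),$$ $$f^{\tau_0}_{v_1}\otimes\cdots\otimes f^{\tau_{m_1-1}}_{v_{m_1}}\otimes g^{\tau_{m_1}}_{v_{m_1+1}}\otimes\cdots\otimes g^{\tau_{m_1+m_2-1}}_{v_{m_1+m_2}}\;\mapsto\; g^{\tau_{m_1+m_2-1}}_{v_{m_1+m_2}}\circ\cdots\circ g^{\tau_{m_1}}_{v_{m_1+1}}\circ f^{\tau_{m_1-1}}_{v_{m_1}}\circ\cdots\circ f^{\tau_0}_{v_1}$$ (where each $v_i\in\{u_1,\dots,u_n\}$, extended linearly) is surjective.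
   Context: Let $\Bbbk$ be an algebraically closed field of characteristic zero, $n\ge 4$, $V=\Bbbk^n$ with a fixed basis $u_1,\dots,u_n$. $\mathrm{Gr}(n,2)$ is the Grassmannian of $2$-dimensional quotients of $V$, and $\mathcal{W}$ is its rank $2$ tautological quotient bundle. $\mathrm{Young}(n-2,2)=\{\lambda=(\lambda_1,\lambda_2)\in\mathbb{Z}^2\mid n-2\ge\lambda_1\ge\lambda_2\ge 0\}$. Write $\lambda\le\mu$ if $\lambda_i\le\mu_i$ for $i=1,2$, and $\lambda<\mu$ if moreover $\lambda\ne\mu$. $e_1,e_2$ is the standard basis of $\mathbb{Z}^2$. $\operatorname{Hom}$ denotes homomorphisms of $\mathcal{O}_{\mathrm{Gr}(n,2)}$-modules; tensor products of Hom spaces are over $\Bbbk$. $\mathbb{S}^\lambda\mathcal{W}$ is the Schur power (the bundle whose fibre is the irreducible $\mathrm{GL}(2)$-module of highest weight $\lambda$), realised as the quotient of $(\bigwedge^2\mathcal{W})^{\otimes\lambda_2}\otimes\mathrm{Sym}^{\lambda_1-\lambda_2}\mathcal{W}$ by the exchange relations. Its sections are written $w^\lambda=\underline{x}\otimes y_1\cdots y_{\lambda_1-\lambda_2}$ with $\underline{x}=x_{1,1}\wedge x_{1,2}\otimes\cdots\otimes x_{\lambda_2,1}\wedge x_{\lambda_2,2}$. The exchange relations are: (E1) for a factor $x_{a,1}\wedge x_{a,2}$ and a variable to its right (some $y_k$ or an entry of a later wedge factor), $w^\lambda$ equals the sum of the two tensors obtained by swapping that variable with $x_{a,1}$, respectively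 with $x_{a,2}$; (E2) $w^\lambda$ equals the tensor obtained by interchanging two wedge factors. For $v\in V$, $z_v\in H^0(\mathrm{Gr}(n,2),\mathcal{W})\cong V$ is the global section corresponding to $v$. For $\lambda,\lambda+e_1\in\mathrm{Young}(n-2,2)$, $f^\lambda_v\colon\mathbb{S}^\lambda\mathcal{W}\to\mathbb{S}^{\lambda+e_1}\mathcal{W}$ is $f^\lambda_v(w^\lambda)=\underline{x}\otimes y_1\cdots y_{\lambda_1-\lambda_2}z_v$. For $\lambda,\lambda+e_2\in\mathrm{Young}(n-2,2)$, $g^\lambda_v\colon\mathbb{S}^\lambda\mathcal{W}\to\mathbb{S}^{\lambda+e_2}\mathcal{W}$ is $g^\lambda_v(w^\lambda)=\sum_{k=1}^{\lambda_1-\lambda_2}\underline{x}\otimes y_k\wedge z_v\otimes\prod_{j\ne k}y_j$. The maps $f^\lambda_{u_1},\dots,f^\lambda_{u_n}$ (resp. $g^\lambda_{u_1},\dots,g^\lambda_{u_n}$) form a basis of $\operatorname{Hom}(\mathbb{S}^\lambda\mathcal{W},\mathbb{S}^{\lambda+e_i}\mathcal{W})$ for $i=1$ (resp. $i=2$). *)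

theory Defs
  imports
    "HOL-Analysis.Finite_Cartesian_Product"
    "HOL-Analysis.Cartesian_Space"
    "HOL-Library.Product_Order"
    "HOL-Library.Product_Plus"
    "HOL-Library.Poly_Mapping"
    "HOL-Library.FuncSet"
    "HOL-Computational_Algebra.Polynomial"
    "HOL-Algebra.AbelCoset"
    "HOL-Algebra.Module"
begin

section \<open>Modules: free modules, quotients, tensor products, linear maps\<close>

text \<open>
  Modules are records of HOL-Algebra. The fields for multiplication and unit, which that record
  type inherits from rings, are irrelevant for modules and left undefined.
\<close>

definition field_ring :: "'k::field ring" where
  "field_ring = \<lparr>carrier = UNIV, mult = (*), one = 1, zero = 0, add = (+)\<rparr>"

definition coord_module :: "('k::field, 'k^'n) module" where
  "coord_module = \<lparr>carrier = UNIV, mult = undefined, one = undefined, zero = 0, add = (+),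
     smult = (*s)\<rparr>"

definition quot_module :: "('r, 'a) module \<Rightarrow> 'a set \<Rightarrow> ('r, 'a set) module" where
  "quot_module M N = \<lparr>carrier = a_rcosets\<^bsub>M\<^esub> N, mult = undefined, one = undefined,
     zero = N, add = set_add M, smult = (\<lambda>c C. \<Union>x\<in>C. N +>\<^bsub>M\<^esub> (c \<odot>\<^bsub>M\<^esub> x))\<rparr>"

definition lin_maps :: "'r ring \<Rightarrow> ('r, 'a) module \<Rightarrow> ('r, 'b) module \<Rightarrow> ('a \<Rightarrow> 'b) set" where
  "lin_maps R M N = {h \<in> carrier M \<rightarrow> carrier N.
     (\<forall>x\<in>carrier M. \<forall>y\<in>carrier M. h (x \<oplus>\<^bsub>M\<^esub> y) = h x \<oplus>\<^bsub>N\<^esub> h y) \<and>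
     (\<forall>c\<in>carrier R. \<forall>x\<in>carrier M. h (c \<odot>\<^bsub>M\<^esub> x) = c \<odot>\<^bsub>N\<^esub> h x)}"

definition fscale :: "'k::field \<Rightarrow> ('g \<Rightarrow>\<^sub>0 'k) \<Rightarrow> ('g \<Rightarrow>\<^sub>0 'k)" where
  "fscale c p = Poly_Mapping.map ((*) c) p"

lemma lookup_fscale: "Poly_Mapping.lookup (fscale c p) g = c * Poly_Mapping.lookup p g"
  by (simp add: fscale_def Poly_Mapping.map.rep_eq when_def)

global_interpretation free: vector_space "fscale :: 'k::field \<Rightarrow> ('g \<Rightarrow>\<^sub>0 'k) \<Rightarrow> ('g \<Rightarrow>\<^sub>0 'k)"
  by unfold_locales
     (auto intro!: poly_mapping_eqI simp: lookup_fscale lookup_add algebra_simps)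

definition free_module :: "'g set \<Rightarrow> ('k::field, 'g \<Rightarrow>\<^sub>0 'k) module" where
  "free_module G = \<lparr>carrier = {p. Poly_Mapping.keys p \<subseteq> G}, mult = undefined, one = undefined,
     zero = 0, add = (+), smult = fscale\<rparr>"

abbreviation gen :: "'g \<Rightarrow> ('g \<Rightarrow>\<^sub>0 'k::field)" where
  "gen w \<equiv> Poly_Mapping.single w 1"

definition lin_ext :: "('g \<Rightarrow> ('h \<Rightarrow>\<^sub>0 'k::field)) \<Rightarrow> ('g \<Rightarrow>\<^sub>0 'k) \<Rightarrow> ('h \<Rightarrow>\<^sub>0 'k)" where
  "lin_ext h p = (\<Sum>w\<in>Poly_Mapping.keys p. fscale (Poly_Mapping.lookup p w) (h w))"

definition presented :: "'g set \<Rightarrow> ('g \<Rightarrow>\<^sub>0 'k::field) set \<Rightarrow> ('k, ('g \<Rightarrow>\<^sub>0 'k) set) module" where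
  "presented G R = quot_module (free_module G) (free.span R)"

definition presented_class :: "'g set \<Rightarrow> ('g \<Rightarrow>\<^sub>0 'k::field) set \<Rightarrow> ('g \<Rightarrow>\<^sub>0 'k) \<Rightarrow> ('g \<Rightarrow>\<^sub>0 'k) set"
  where "presented_class G R p = free.span R +>\<^bsub>free_module G\<^esub> p"

text \<open>
  The tensor product over a field of a list of vector spaces (whose elements share a type) is the
  free vector space on the words with entries in these spaces, modulo multilinearity.
\<close>

definition words :: "('k, 'a) module list \<Rightarrow> 'a list set" where
  "words Ms = {w. list_all2 (\<lambda>x M. x \<in> carrier M) w Ms}"

definition multilinear_rels :: "('k::field, 'a) module list \<Rightarrow> ('a list \<Rightarrow>\<^sub>0 'k) set" where
  "multilinear_rels Ms =
     {gen (w[i := c \<odot>\<^bsub>Ms ! i\<^esub> x \<oplus>\<^bsub>Ms ! i\<^esub> d \<odot>\<^bsub>Ms ! i\<^esub> y])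
        - fscale c (gen (w[i := x])) - fscale d (gen (w[i := y])) | w i c d x y.
      w \<in> words Ms \<and> i < length Ms \<and> x \<in> carrier (Ms ! i) \<and> y \<in> carrier (Ms ! i)}"

definition tensor_module :: "('k::field, 'a) module list \<Rightarrow> ('k, ('a list \<Rightarrow>\<^sub>0 'k) set) module" where
  "tensor_module Ms = presented (words Ms) (multilinear_rels Ms)"

definition pure_tensor :: "('k::field, 'a) module list \<Rightarrow> 'a list \<Rightarrow> ('a list \<Rightarrow>\<^sub>0 'k) set" where
  "pure_tensor Ms w = presented_class (words Ms) (multilinear_rels Ms) (gen w)"


section \<open>Partitions and Schur powers\<close>

definition Young :: "int \<Rightarrow> (int \<times> int) set" where
  "Young a = {l. a \<ge> fst l \<and> fst l \<ge> snd l \<and> snd l \<ge> 0}"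

definition e1 :: "int \<times> int" where "e1 = (1, 0)"
definition e2 :: "int \<times> int" where "e2 = (0, 1)"

definition wedges :: "int \<times> int \<Rightarrow> nat" where
  "wedges l = nat (snd l)"

definition deg :: "int \<times> int \<Rightarrow> nat" where
  "deg l = 2 * wedges l + nat (fst l - snd l)"

text \<open>
  A word $w$ of length \<open>deg l\<close> stands for
  $w_0 \wedge w_1 \otimes \cdots \otimes w_{2p-2} \wedge w_{2p-1} \otimes w_{2p} \cdots w_{d-1}$,
  where $p$ is the number of wedge factors and $d$ the degree.
\<close>

definition swap :: "nat \<Rightarrow> nat \<Rightarrow> 'a list \<Rightarrow> 'a list" where
  "swap i j w = w[i := w ! j, j := w ! i]"

definition schur_words :: "int \<times> int \<Rightarrow> ('k, 'a) module \<Rightarrow> 'a list set" where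
  "schur_words l M = words (replicate (deg l) M)"

definition wedge_sym_rels :: "int \<times> int \<Rightarrow> ('k::field, 'a) module \<Rightarrow> ('a list \<Rightarrow>\<^sub>0 'k) set" where
  "wedge_sym_rels l M =
     {gen w | w a. w \<in> schur_words l M \<and> a < wedges l \<and> w ! (2 * a) = w ! (2 * a + 1)}
     \<union> {gen w - gen (swap i j w) | w i j.
          w \<in> schur_words l M \<and> 2 * wedges l \<le> i \<and> i < j \<and> j < deg l}"

definition exchange_rels1 :: "int \<times> int \<Rightarrow> ('k::field, 'a) module \<Rightarrow> ('a list \<Rightarrow>\<^sub>0 'k) set" where
  "exchange_rels1 l M =
     {gen w - (gen (swap (2 * a) j w) + gen (swap (2 * a + 1) j w)) | w a j.
        w \<in> schur_words l M \<and> a < wedges l \<and> 2 * a + 2 \<le> j \<and> j < deg l}"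

definition exchange_rels2 :: "int \<times> int \<Rightarrow> ('k::field, 'a) module \<Rightarrow> ('a list \<Rightarrow>\<^sub>0 'k) set" where
  "exchange_rels2 l M =
     {gen w - gen (swap (2 * a) (2 * b) (swap (2 * a + 1) (2 * b + 1) w)) | w a b.
        w \<in> schur_words l M \<and> a < b \<and> b < wedges l}"

definition schur_rels :: "int \<times> int \<Rightarrow> ('k::field, 'a) module \<Rightarrow> ('a list \<Rightarrow>\<^sub>0 'k) set" where
  "schur_rels l M = multilinear_rels (replicate (deg l) M) \<union> wedge_sym_rels l M
     \<union> exchange_rels1 l M \<union> exchange_rels2 l M"

definition schur_power ::
  "int \<times> int \<Rightarrow> ('k::field, 'a) module \<Rightarrow> ('k, ('a list \<Rightarrow>\<^sub>0 'k) set) module" where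
  "schur_power l M = presented (schur_words l M) (schur_rels l M)"

definition schur_class ::
  "int \<times> int \<Rightarrow> ('k::field, 'a) module \<Rightarrow> ('a list \<Rightarrow>\<^sub>0 'k) \<Rightarrow> ('a list \<Rightarrow>\<^sub>0 'k) set" where
  "schur_class l M p = presented_class (schur_words l M) (schur_rels l M) p"

text \<open>
  Multiplication by a vector \<open>z\<close> on the level of words, and the maps of Schur powers
  which it induces.
\<close>

definition f_word :: "'a \<Rightarrow> 'a list \<Rightarrow> ('a list \<Rightarrow>\<^sub>0 'k::field)" where
  "f_word z w = gen (w @ [z])"

definition g_word :: "int \<times> int \<Rightarrow> 'a \<Rightarrow> 'a list \<Rightarrow> ('a list \<Rightarrow>\<^sub>0 'k::field)" where
  "g_word l z w = (let x = take (2 * wedges l) w; y = drop (2 * wedges l) w in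
     \<Sum>k<length y. gen (x @ [y ! k, z] @ take k y @ drop (Suc k) y))"

definition schur_f :: "int \<times> int \<Rightarrow> ('k::field, 'a) module \<Rightarrow> 'a
    \<Rightarrow> ('a list \<Rightarrow>\<^sub>0 'k) set \<Rightarrow> ('a list \<Rightarrow>\<^sub>0 'k) set" where
  "schur_f l M z C = (\<Union>p\<in>C. schur_class (l + e1) M (lin_ext (f_word z) p))"

definition schur_g :: "int \<times> int \<Rightarrow> ('k::field, 'a) module \<Rightarrow> 'a
    \<Rightarrow> ('a list \<Rightarrow>\<^sub>0 'k) set \<Rightarrow> ('a list \<Rightarrow>\<^sub>0 'k) set" where
  "schur_g l M z C = (\<Union>p\<in>C. schur_class (l + e2) M (lin_ext (g_word l z) p))"


section \<open>The Grassmannian of two-dimensional quotients\<close>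

text \<open>
  A two-dimensional quotient of the coordinate space is recorded by its kernel. The field being
  algebraically closed, the Grassmannian is treated as a classical variety: closed points, Zariski
  topology and sheaf of regular functions, all induced by the Pluecker embedding.
\<close>

definition Gr :: "('k::field^'n) set set" where
  "Gr = {K. vec.subspace K \<and> vec.dim K + 2 = CARD('n)}"

text \<open>
  A pair of linear forms that cuts out \<open>K\<close> is an isomorphism of the quotient by \<open>K\<close> with
  the plane; the Pluecker coordinates are the coordinates of the wedge products of images of
  standard basis vectors. A change of the pair multiplies all of them by a common unit.
\<close>

definition frames :: "('k::field^'n) set \<Rightarrow> (('k^'n) \<times> ('k^'n)) set" where
  "frames K = {(a, b). K = {x. (\<Sum>i\<in>UNIV. a $ i * x $ i) = 0 \<and> (\<Sum>i\<in>UNIV. b $ i * x $ i) = 0}}"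

definition plucker :: "('k::field^'n) \<times> ('k^'n) \<Rightarrow> 'n \<times> 'n \<Rightarrow> 'k" where
  "plucker = (\<lambda>(a, b) (i, j). a $ i * b $ j - a $ j * b $ i)"

text \<open>Homogeneous polynomials of a given degree, as functions on the affine space.\<close>

inductive hom_poly :: "nat \<Rightarrow> (('i \<Rightarrow> 'k::field) \<Rightarrow> 'k) \<Rightarrow> bool" where
  hom_poly_const: "hom_poly 0 (\<lambda>p. c)"
| hom_poly_var: "hom_poly 1 (\<lambda>p. p i)"
| hom_poly_add: "hom_poly d P \<Longrightarrow> hom_poly d Q \<Longrightarrow> hom_poly d (\<lambda>p. P p + Q p)"
| hom_poly_mult: "hom_poly d P \<Longrightarrow> hom_poly e Q \<Longrightarrow> hom_poly (d + e) (\<lambda>p. P p * Q p)"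

definition opens :: "('k::field^'n) set set set" where
  "opens = {U. \<exists>S. (\<forall>P\<in>S. \<exists>d. hom_poly d P) \<and>
     U = {K \<in> Gr. \<exists>P\<in>S. \<exists>t\<in>frames K. P (plucker t) \<noteq> 0}}"

definition regular_on :: "('k::field^'n) set set \<Rightarrow> (('k^'n) set \<Rightarrow> 'k) \<Rightarrow> bool" where
  "regular_on U s \<longleftrightarrow> (\<forall>K\<in>U. \<exists>N\<in>opens. K \<in> N \<and> N \<subseteq> U \<and>
     (\<exists>d P Q. hom_poly d P \<and> hom_poly d Q \<and>
       (\<forall>L\<in>N. \<forall>t\<in>frames L. Q (plucker t) \<noteq> 0 \<and> s L = P (plucker t) / Q (plucker t))))"

definition structure_sheaf :: "('k::field^'n) set set \<Rightarrow> (('k^'n) set \<Rightarrow> 'k) ring" where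
  "structure_sheaf U = \<lparr>carrier = {s \<in> extensional U. regular_on U s},
     mult = (\<lambda>s t. \<lambda>K\<in>U. s K * t K), one = (\<lambda>K\<in>U. 1),
     zero = (\<lambda>K\<in>U. 0), add = (\<lambda>s t. \<lambda>K\<in>U. s K + t K)\<rparr>"


section \<open>Sheaves of modules on the Grassmannian and their homomorphisms\<close>

type_synonym ('k, 'n, 'x) gr_sheaf =
  "('k^'n) set set \<Rightarrow> (('k^'n) set \<Rightarrow> 'k, ('k^'n) set \<Rightarrow> 'x) module"

type_synonym ('k, 'n, 'x) gr_hom =
  "('k^'n) set set \<Rightarrow> (('k^'n) set \<Rightarrow> 'x) \<Rightarrow> (('k^'n) set \<Rightarrow> 'x)"

text \<open>
  The sheaf of sections of the bundle with fibres \<open>F K\<close> that is generated by a set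
  \<open>G\<close> of global sections: its sections are, locally, combinations of members of \<open>G\<close>
  with regular coefficients. Restriction is restriction of functions.
\<close>

definition bundle_sheaf ::
  "(('k::field^'n) set \<Rightarrow> ('k, 'x) module) \<Rightarrow> (('k^'n) set \<Rightarrow> 'x) set \<Rightarrow> ('k, 'n, 'x) gr_sheaf" where
  "bundle_sheaf F G U = \<lparr>carrier = {s \<in> Pi\<^sub>E U (\<lambda>K. carrier (F K)).
       \<forall>K\<in>U. \<exists>N\<in>opens. K \<in> N \<and> N \<subseteq> U \<and>
         (\<exists>J a. finite J \<and> J \<subseteq> G \<and> (\<forall>g\<in>J. regular_on N (a g)) \<and>
           (\<forall>L\<in>N. s L = (\<Oplus>\<^bsub>F L\<^esub>g\<in>J. a g L \<odot>\<^bsub>F L\<^esub> g L)))},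
     mult = undefined, one = undefined,
     zero = (\<lambda>K\<in>U. \<zero>\<^bsub>F K\<^esub>), add = (\<lambda>s t. \<lambda>K\<in>U. s K \<oplus>\<^bsub>F K\<^esub> t K),
     smult = (\<lambda>a s. \<lambda>K\<in>U. a K \<odot>\<^bsub>F K\<^esub> s K)\<rparr>"

text \<open>
  Homomorphisms of modules over the structure sheaf: linear maps on sections over every open set,
  compatible with restriction. They form a vector space over the base field, whose elements act as
  constant regular functions.
\<close>

definition sheaf_homs ::
  "('k::field, 'n::finite, 'x) gr_sheaf \<Rightarrow> ('k, 'n, 'x) gr_sheaf \<Rightarrow> ('k, 'n, 'x) gr_hom set" where
  "sheaf_homs A B = {\<phi> \<in> extensional opens.
     (\<forall>U\<in>opens. \<phi> U \<in> lin_maps (structure_sheaf U) (A U) (B U) \<inter> extensional (carrier (A U))) \<and>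
     (\<forall>U\<in>opens. \<forall>U'\<in>opens. U' \<subseteq> U \<longrightarrow>
        (\<forall>s\<in>carrier (A U). \<phi> U' (restrict s U') = restrict (\<phi> U s) U'))}"

definition Hom ::
  "('k::field, 'n::finite, 'x) gr_sheaf \<Rightarrow> ('k, 'n, 'x) gr_sheaf \<Rightarrow> ('k, ('k, 'n, 'x) gr_hom) module" where
  "Hom A B = \<lparr>carrier = sheaf_homs A B, mult = undefined, one = undefined,
     zero = (\<lambda>U\<in>opens. \<lambda>s\<in>carrier (A U). \<zero>\<^bsub>B U\<^esub>),
     add = (\<lambda>\<phi> \<psi>. \<lambda>U\<in>opens. \<lambda>s\<in>carrier (A U). \<phi> U s \<oplus>\<^bsub>B U\<^esub> \<psi> U s),
     smult = (\<lambda>c \<phi>. \<lambda>U\<in>opens. \<lambda>s\<in>carrier (A U). (\<lambda>K\<in>U. c) \<odot>\<^bsub>B U\<^esub> \<phi> U s)\<rparr>"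

definition hom_id :: "('k::field, 'n::finite, 'x) gr_sheaf \<Rightarrow> ('k, 'n, 'x) gr_hom" where
  "hom_id A = (\<lambda>U\<in>opens. \<lambda>s\<in>carrier (A U). s)"

definition hom_comp :: "('k::field, 'n::finite, 'x) gr_sheaf \<Rightarrow> ('k, 'n, 'x) gr_hom \<Rightarrow> ('k, 'n, 'x) gr_hom
    \<Rightarrow> ('k, 'n, 'x) gr_hom" where
  "hom_comp A \<psi> \<phi> = (\<lambda>U\<in>opens. compose (carrier (A U)) (\<psi> U) (\<phi> U))"

text \<open>The head of the list is applied first.\<close>

definition hom_comp_list ::
  "('k::field, 'n::finite, 'x) gr_sheaf \<Rightarrow> ('k, 'n, 'x) gr_hom list \<Rightarrow> ('k, 'n, 'x) gr_hom" where
  "hom_comp_list A \<phi>s = foldl (\<lambda>\<psi> \<phi>. hom_comp A \<phi> \<psi>) (hom_id A) \<phi>s"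


section \<open>Schur powers of the tautological quotient bundle\<close>

type_synonym ('k, 'n) schur_elem = "(('k^'n) set list \<Rightarrow>\<^sub>0 'k) set"

definition taut_fibre :: "('k::field^'n) set \<Rightarrow> ('k, ('k^'n) set) module" where
  "taut_fibre K = quot_module coord_module K"

definition taut_section :: "'k::field^'n \<Rightarrow> ('k^'n) set \<Rightarrow> ('k^'n) set" where
  "taut_section v K = K +>\<^bsub>coord_module\<^esub> v"

definition schur_fibre :: "int \<times> int \<Rightarrow> ('k::field^'n) set \<Rightarrow> ('k, ('k, 'n) schur_elem) module" where
  "schur_fibre l K = schur_power l (taut_fibre K)"

text \<open>
  As the sections \<open>taut_section v\<close> generate the tautological quotient bundle, the
  tensors with entries among them generate its Schur powers.
\<close>

definition schur_section :: "int \<times> int \<Rightarrow> ('k::field^'n) list \<Rightarrow> ('k^'n) set \<Rightarrow> ('k, 'n) schur_elem" where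
  "schur_section l vs K = schur_class l (taut_fibre K) (gen (map (\<lambda>v. taut_section v K) vs))"

definition SW :: "int \<times> int \<Rightarrow> ('k::field, 'n::finite, ('k, 'n) schur_elem) gr_sheaf" where
  "SW l = bundle_sheaf (schur_fibre l) {schur_section l vs | vs. length vs = deg l}"

definition f_map :: "int \<times> int \<Rightarrow> 'k::field^'n \<Rightarrow> ('k, 'n, ('k, 'n) schur_elem) gr_hom" where
  "f_map l v = (\<lambda>U\<in>opens. \<lambda>s\<in>carrier (SW l U). \<lambda>K\<in>U.
     schur_f l (taut_fibre K) (taut_section v K) (s K))"

definition g_map :: "int \<times> int \<Rightarrow> 'k::field^'n \<Rightarrow> ('k, 'n, ('k, 'n) schur_elem) gr_hom" where
  "g_map l v = (\<lambda>U\<in>opens. \<lambda>s\<in>carrier (SW l U). \<lambda>K\<in>U.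
     schur_g l (taut_fibre K) (taut_section v K) (s K))"


section \<open>The composition map\<close>

definition m1 :: "int \<times> int \<Rightarrow> int \<times> int \<Rightarrow> nat" where
  "m1 lam mu = nat (fst mu - fst lam)"

definition m2 :: "int \<times> int \<Rightarrow> int \<times> int \<Rightarrow> nat" where
  "m2 lam mu = nat (snd mu - snd lam)"

definition tau :: "int \<times> int \<Rightarrow> int \<times> int \<Rightarrow> nat \<Rightarrow> int \<times> int" where
  "tau lam mu k = (if k \<le> m1 lam mu then lam + (int k, 0)
     else lam + (int (m1 lam mu), 0) + (0, int (k - m1 lam mu)))"

definition step_homs :: "int \<times> int \<Rightarrow> int \<times> int
    \<Rightarrow> ('k::field, ('k, 'n::finite, ('k, 'n) schur_elem) gr_hom) module list" where
  "step_homs lam mu =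
     map (\<lambda>k. Hom (SW (tau lam mu (k - 1))) (SW (tau lam mu k))) [1..<Suc (m1 lam mu + m2 lam mu)]"

text \<open>
  The composition map out of the tensor product. It is evaluated on representatives in the free
  vector space on tuples of homomorphisms; the value does not depend on the representative.
\<close>

definition Theta :: "int \<times> int \<Rightarrow> int \<times> int
    \<Rightarrow> (('k::field, 'n::finite, ('k, 'n) schur_elem) gr_hom list \<Rightarrow>\<^sub>0 'k) set
    \<Rightarrow> ('k, 'n, ('k, 'n) schur_elem) gr_hom" where
  "Theta lam mu T = the_elem ((\<lambda>p. \<Oplus>\<^bsub>Hom (SW lam) (SW mu)\<^esub>\<phi>s\<in>Poly_Mapping.keys p.
     Poly_Mapping.lookup p \<phi>s \<odot>\<^bsub>Hom (SW lam) (SW mu)\<^esub> hom_comp_list (SW lam) \<phi>s) ` T)"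

text \<open>The path of basis homomorphisms attached to vectors $v_1, v_2, \ldots$\<close>

definition basis_path :: "int \<times> int \<Rightarrow> int \<times> int \<Rightarrow> (nat \<Rightarrow> 'k::field^'n)
    \<Rightarrow> ('k, 'n, ('k, 'n) schur_elem) gr_hom list" where
  "basis_path lam mu v =
     map (\<lambda>k. if k \<le> m1 lam mu then f_map (tau lam mu (k - 1)) (v k)
              else g_map (tau lam mu (k - 1)) (v k)) [1..<Suc (m1 lam mu + m2 lam mu)]"

end

theory Submission imports Defs
begin

text \<open>
  A frame of a point of the Grassmannian, i.e. a pair of linear forms with columns \<open>z\<^sub>1, \<dots>, z\<^sub>n\<close>
  in the plane, identifies the fibre of the Schur power \<open>\<lambda>\<close> with binary forms of degree
  \<open>N = \<lambda>\<^sub>1 - \<lambda>\<^sub>2\<close>. There \<open>f\<close> is multiplication by the linear form \<open>z\<^sub>v\<close> and \<open>g\<close> is the derivation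
  \<open>y \<mapsto> y \<wedge> z\<^sub>v\<close>. A homomorphism \<open>\<phi>\<close> from \<open>\<lambda>\<close> to \<open>\<mu>\<close> thus becomes a function of the frame, of
  a vector \<open>y\<close> (the argument being \<open>y^N\<close>) and of a vector \<open>x\<close> (at which the image is evaluated).
  Regularity on the charts makes it polynomial, of bounded degree, along every line of frames that
  misses the dependent pairs of rows; as \<open>n \<ge> 4\<close>, there are enough such lines to extend it by
  interpolation to a polynomial in all pairs of rows. Being semi-invariant under \<open>GL(2)\<close>, the
  function is a combination of products of brackets, by the first fundamental theorem of invariant
  theory. In such a product the
  brackets \<open>(y, z\<^sub>i)\<close> are steps \<open>g\<close>, the brackets \<open>(z\<^sub>i, x)\<close> are steps \<open>f\<close>, and each
  bracket \<open>(z\<^sub>i, z\<^sub>j)\<close> is, up to the invertible factor \<open>N + 2\<close>, the difference of the two compositions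
  of a step \<open>f\<close> and a step \<open>g\<close>. The commutation relation of \<open>f\<close> and \<open>g\<close> reorders the
  steps so that the \<open>f\<close> come first, which exhibits \<open>\<phi>\<close> as a combination of paths.
\<close>

text \<open>Dependent pairs of rows have codimension \<open>n - 1\<close> among all pairs, so
  extending across them is a Hartogs phenomenon. It is done by hand, by extrapolating values at the
  points 1, ..., D + 1 of a line to its point 0. This needs one degree bound D for all lines, which
  comes from the torus: reversing a line exchanges its origin with the point at infinity at the cost
  of a known power of the parameter. The vectors y and x turn a map between two representations into
  one scalar semi-invariant, to which the theorem on brackets applies. The degrees N in y and N' in
  x fix how many brackets of each kind occur, and this count makes the numbers of steps f and g come
  out as \<open>m1\<close> and \<open>m2\<close>. A bracket (y, x) is no step: it records a factor y
  of the argument that survives to the value. Algebraic closure is used where a rational function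
  without poles is shown to be a polynomial. Characteristic zero supplies the nodes, the inverses of
  N + 2, of factorials and of the constant in the Capelli identity, and it makes the powers y^N span
  all forms.\<close>

abbreviation psmult :: "'a::comm_semiring_0 \<Rightarrow> 'a poly \<Rightarrow> 'a poly" where
  "psmult \<equiv> Polynomial.smult"

section \<open>Regular functions of one variable\<close>

definition lagr :: "'k::field set \<Rightarrow> 'k \<Rightarrow> 'k \<Rightarrow> 'k" where
  "lagr A s x = (\<Prod>r\<in>A-{s}. (x - r) / (s - r))"

definition lagr_poly :: "'k::field set \<Rightarrow> 'k \<Rightarrow> 'k poly" where
  "lagr_poly A s = (\<Prod>r\<in>A-{s}. psmult (inverse (s - r)) [:- r, 1:])"

lemma poly_lagr_poly: "poly (lagr_poly A s) x = lagr A s x"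
  by (simp add: lagr_poly_def lagr_def poly_prod divide_inverse algebra_simps)

lemma degree_lagr_poly:
  assumes "finite A" "s \<in> A" shows "degree (lagr_poly A s) < card A"
proof -
  have "degree (lagr_poly A s) \<le> sum (degree \<circ> (\<lambda>r. psmult (inverse (s - r)) [:- r, 1:])) (A - {s})"
    unfolding lagr_poly_def using assms by (intro degree_prod_sum_le) auto
  also have "\<dots> \<le> (\<Sum>r\<in>A-{s}. 1)"
    by (intro sum_mono) simp
  also have "\<dots> < card A"
  proof -
    have "card A > 0" using assms by (auto simp: card_gt_0_iff)
    then show ?thesis using assms by simp
  qed
  finally show ?thesis .
qed

lemma lagr_node:
  assumes "finite A" "s \<in> A" "r \<in> A"
  shows "lagr A s r = (if r = s then 1 else 0)"
proof (cases "r = s")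
  case False
  then have "\<exists>z\<in>A - {s}. (r - z) / (s - z) = 0" using assms by auto
  then show ?thesis using False assms by (auto simp: lagr_def intro!: prod_zero)
qed (auto simp: lagr_def intro!: prod.neutral split: if_splits)

lemma lagr_interp:
  fixes q :: "'k::field_char_0 poly"
  assumes "finite A" "degree q < card A"
  shows "poly q x = (\<Sum>s\<in>A. lagr A s x * poly q s)"
proof -
  define h where "h = (\<Sum>s\<in>A. psmult (poly q s) (lagr_poly A s))"
  have "degree h < card A"
  proof -
    have "degree h \<le> card A - 1"
      unfolding h_def using assms(1) degree_lagr_poly[OF assms(1)]
      by (intro degree_sum_le) (fastforce simp: le_diff_conv intro: order.trans[OF degree_smult_le])+
    then show ?thesis using assms(2) by linarith
  qed
  moreover have "poly h r = poly q r" if "r \<in> A" for r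
    using that assms(1) by (simp add: h_def poly_sum poly_lagr_poly lagr_node if_distrib cong: if_cong)
  ultimately have "q = h" using assms by (intro poly_eqI_degree[of A]) auto
  then have "poly q x = poly h x" by simp
  then show ?thesis by (simp add: h_def poly_sum poly_lagr_poly mult.commute)
qed

text \<open>The bound D is explicit because a single set of interpolation nodes has to serve all
  lines at once.\<close>

definition poly_le :: "nat \<Rightarrow> ('k::field \<Rightarrow> 'k) \<Rightarrow> bool" where
  "poly_le D f \<longleftrightarrow> (\<exists>q. degree q \<le> D \<and> (\<forall>x. f x = poly q x))"

lemma poly_le_const: "poly_le D (\<lambda>x. c)"
  unfolding poly_le_def by (intro exI[of _ "[:c:]"]) auto

lemma poly_le_cmult: "poly_le D f \<Longrightarrow> poly_le D (\<lambda>x. c * f x)"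
  unfolding poly_le_def by (metis degree_smult_le order.trans poly_smult)

lemma poly_le_add: "poly_le D f \<Longrightarrow> poly_le D g \<Longrightarrow> poly_le D (\<lambda>x. f x + g x)"
  unfolding poly_le_def by (metis degree_add_le poly_add)

lemma poly_le_sum:
  "(\<And>u. u \<in> A \<Longrightarrow> poly_le D (f u)) \<Longrightarrow> poly_le D (\<lambda>x. \<Sum>u\<in>A. c u * f u x)"
  by (induction A rule: infinite_finite_induct)
    (auto intro!: poly_le_const poly_le_add poly_le_cmult)

text \<open>These D + 1 points are distinct in characteristic zero. The point 0 is avoided, since
  the value there is to be recovered from the others.\<close>

definition nodes :: "nat \<Rightarrow> 'k::field_char_0 set" where
  "nodes D = of_nat ` {1..Suc D}"

text \<open>The weights of extrapolation to 0. They do not depend on the function, which later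
  allows sums over two directions to be interchanged.\<close>

definition kap :: "nat \<Rightarrow> 'k::field_char_0 \<Rightarrow> 'k" where
  "kap D u = lagr (nodes D) u 0"

lemma finite_nodes [simp]: "finite (nodes D)" by (simp add: nodes_def)

lemma card_nodes: "card (nodes D :: 'k::field_char_0 set) = Suc D"
  unfolding nodes_def by (subst card_image) (auto simp: inj_on_def)

lemma nodes_nonzero: "u \<in> nodes D \<Longrightarrow> u \<noteq> 0"
  by (auto simp: nodes_def)

lemma poly_le_extrapolate:
  fixes f :: "'k::field_char_0 \<Rightarrow> 'k"
  assumes "poly_le D f" shows "f 0 = (\<Sum>u\<in>nodes D. kap D u * f u)"
  using assms lagr_interp[of "nodes D" _ 0] by (auto simp: poly_le_def kap_def card_nodes less_Suc_eq_le)

text \<open>Rational functions without a pole at \<open>x0\<close>; nothing is said at the other zeros of the denominator.\<close>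

definition rr :: "'k::field \<Rightarrow> ('k \<Rightarrow> 'k) \<Rightarrow> bool" where
  "rr x0 f \<longleftrightarrow> (\<exists>P Q. poly Q x0 \<noteq> 0 \<and> (\<forall>x. poly Q x \<noteq> 0 \<longrightarrow> f x * poly Q x = poly P x))"

lemma rr_poly: "(\<And>x. f x = poly p x) \<Longrightarrow> rr x0 f"
  unfolding rr_def by (intro exI[of _ p] exI[of _ 1]) auto

lemma rr_const: "rr x0 (\<lambda>x. c)"
  by (rule rr_poly[of _ "[:c:]"]) simp

lemma rr_add: assumes "rr x0 f" "rr x0 g" shows "rr x0 (\<lambda>x. f x + g x)"
proof -
  obtain P Q P' Q' where *: "poly Q x0 \<noteq> 0" "\<And>x. poly Q x \<noteq> 0 \<Longrightarrow> f x * poly Q x = poly P x"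
    "poly Q' x0 \<noteq> 0" "\<And>x. poly Q' x \<noteq> 0 \<Longrightarrow> g x * poly Q' x = poly P' x"
    using assms unfolding rr_def by metis
  show ?thesis unfolding rr_def
  proof (rule exI[of _ "P * Q' + P' * Q"], rule exI[of _ "Q * Q'"], intro conjI allI impI)
    fix x assume "poly (Q * Q') x \<noteq> 0"
    then show "(f x + g x) * poly (Q * Q') x = poly (P * Q' + P' * Q) x"
      using *(2)[of x] *(4)[of x] by (simp add: algebra_simps)
  qed (use * in auto)
qed

lemma rr_mult: assumes "rr x0 f" "rr x0 g" shows "rr x0 (\<lambda>x. f x * g x)"
proof -
  obtain P Q P' Q' where *: "poly Q x0 \<noteq> 0" "\<And>x. poly Q x \<noteq> 0 \<Longrightarrow> f x * poly Q x = poly P x"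
    "poly Q' x0 \<noteq> 0" "\<And>x. poly Q' x \<noteq> 0 \<Longrightarrow> g x * poly Q' x = poly P' x"
    using assms unfolding rr_def by metis
  show ?thesis unfolding rr_def
  proof (rule exI[of _ "P * P'"], rule exI[of _ "Q * Q'"], intro conjI allI impI)
    fix x assume "poly (Q * Q') x \<noteq> 0"
    moreover have "(f x * g x) * poly (Q * Q') x = (f x * poly Q x) * (g x * poly Q' x)" by simp
    ultimately show "(f x * g x) * poly (Q * Q') x = poly (P * P') x"
      using *(2)[of x] *(4)[of x] by simp
  qed (use * in auto)
qed

lemma rr_sum: "(\<And>i. i \<in> A \<Longrightarrow> rr x0 (f i)) \<Longrightarrow> rr x0 (\<lambda>x. \<Sum>i\<in>A. f i x)"
  by (induction A rule: infinite_finite_induct) (auto intro: rr_const rr_add)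

lemma rr_power: "rr x0 f \<Longrightarrow> rr x0 (\<lambda>x. f x ^ n)"
  by (induction n) (auto intro: rr_const rr_mult)

lemma rr_divide: assumes "rr x0 f" "rr x0 g" "g x0 \<noteq> 0" shows "rr x0 (\<lambda>x. f x / g x)"
proof -
  obtain P Q P' Q' where *: "poly Q x0 \<noteq> 0" "\<And>x. poly Q x \<noteq> 0 \<Longrightarrow> f x * poly Q x = poly P x"
    "poly Q' x0 \<noteq> 0" "\<And>x. poly Q' x \<noteq> 0 \<Longrightarrow> g x * poly Q' x = poly P' x"
    using assms(1,2) unfolding rr_def by metis
  show ?thesis unfolding rr_def
  \<comment> \<open>With \<open>Q'\<close> in the denominator as well, both given formulas are
    available wherever it does not vanish; \<open>P'\<close> is nonzero at \<open>x0\<close> because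
    \<open>g x0\<close> is.\<close>
  proof (rule exI[of _ "P * Q' * Q'"], rule exI[of _ "Q * P' * Q'"], intro conjI allI impI)
    fix x assume a: "poly (Q * P' * Q') x \<noteq> 0"
    have g: "g x * poly Q' x = poly P' x" and f: "f x * poly Q x = poly P x" using a *(2,4) by auto
    then have "g x \<noteq> 0" using a by auto
    have "f x / g x * poly (Q * P' * Q') x = f x / g x * (poly Q x * (g x * poly Q' x) * poly Q' x)"
      by (simp add: g)
    also have "\<dots> = (f x * poly Q x) * poly Q' x * poly Q' x" using \<open>g x \<noteq> 0\<close> by (simp add: field_simps)
    finally show "f x / g x * poly (Q * P' * Q') x = poly (P * Q' * Q') x" by (simp add: f)
  next
    show "poly (Q * P' * Q') x0 \<noteq> 0" using *(1,3) assms(3) by (simp flip: *(4)[OF *(3)])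
  qed
qed

text \<open>Equality is required only off the zeros of \<open>R\<close>: a function on a line agrees
  with its expression in a chart only where the line lies in that chart.\<close>

lemma rr_cong:
  assumes "rr x0 g" "poly R x0 \<noteq> 0" "\<And>x. poly R x \<noteq> 0 \<Longrightarrow> f x = g x"
  shows "rr x0 f"
proof -
  obtain P Q where *: "poly Q x0 \<noteq> 0" "\<And>x. poly Q x \<noteq> 0 \<Longrightarrow> g x * poly Q x = poly P x"
    using assms(1) unfolding rr_def by metis
  show ?thesis unfolding rr_def
  proof (rule exI[of _ "P * R"], rule exI[of _ "Q * R"], intro conjI allI impI)
    fix x assume "poly (Q * R) x \<noteq> 0"
    then show "f x * poly (Q * R) x = poly (P * R) x"
      using *(2)[of x] assms(3)[of x] by (simp add: algebra_simps)
  qed (use * assms in auto)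
qed

text \<open>Induction on the degree of a denominator \<open>Q\<close>. A root of \<open>Q\<close>,
  which exists by algebraic closure, is not a pole, so the numerator vanishes there too and the
  common linear factor can be cancelled. Once \<open>Q\<close> is a nonzero constant, the formula
  holds at every point.\<close>

lemma rr_everywhere_imp_poly:
  fixes f :: "'k::{alg_closed_field, field_char_0} \<Rightarrow> 'k"
  assumes rr: "\<And>x0. rr x0 f" shows "\<exists>p. \<forall>x. f x = poly p x"
proof -
  have "\<exists>p. \<forall>x. f x = poly p x"
    if "Q \<noteq> 0" "\<And>x. poly Q x \<noteq> 0 \<Longrightarrow> f x * poly Q x = poly P x" for P Q
    using that
  proof (induction "degree Q" arbitrary: P Q)
    case 0
    then obtain c where "Q = [:c:]" by (metis degree_eq_zeroE)
    with 0 show ?case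
      by (intro exI[of _ "psmult (inverse c) P"]) (auto simp: field_simps)
  next
    case (Suc d)
    then obtain x0 where x0: "poly Q x0 = 0" using alg_closed_imp_poly_has_root[of Q] by auto
    obtain P0 Q0 where *: "poly Q0 x0 \<noteq> 0" "\<And>x. poly Q0 x \<noteq> 0 \<Longrightarrow> f x * poly Q0 x = poly P0 x"
      using rr[of x0] unfolding rr_def by metis
    \<comment> \<open>Both fractions equal \<open>f\<close> off the zeros of \<open>Q * Q0\<close>,
      so the difference times \<open>Q * Q0\<close> vanishes everywhere.\<close>
    have eq: "P * Q0 = P0 * Q"
    proof -
      have "Q * Q0 * (P * Q0 - P0 * Q) = 0"
      proof (rule poly_all_0_iff_0[THEN iffD1], intro allI)
        fix x
        show "poly (Q * Q0 * (P * Q0 - P0 * Q)) x = 0"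
        proof (cases "poly Q x = 0 \<or> poly Q0 x = 0")
          case False
          then have "poly P0 x = f x * poly Q0 x" "poly P x = f x * poly Q x"
            by (simp_all add: *(2) Suc.prems(2))
          then show ?thesis by simp
        qed auto
      qed
      moreover have "Q0 \<noteq> 0" using * by auto
      ultimately show ?thesis using Suc.prems(1) by auto
    qed
    then have "poly P x0 * poly Q0 x0 = 0" using x0 by (metis mult_zero_right poly_mult)
    then have "poly P x0 = 0" using * by simp
    then obtain P1 Q1 where P1: "P = [:-x0, 1:] * P1" and Q1: "Q = [:-x0, 1:] * Q1"
      using x0 by (metis dvdE poly_eq_0_iff_dvd)
    have "[:-x0, 1:] * (P1 * Q0 - P0 * Q1) = 0" using eq unfolding P1 Q1 by (simp add: algebra_simps)
    then have eq1: "P1 * Q0 = P0 * Q1" by (metis eq_iff_diff_eq_0 mult_eq_0_iff one_neq_zero pCons_eq_0_iff)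
    have "Q1 \<noteq> 0" using Suc.prems(1) Q1 by auto
    have "degree Q = Suc (degree Q1)" unfolding Q1 using \<open>Q1 \<noteq> 0\<close> by (subst degree_mult_eq) auto
    then have "d = degree Q1" using Suc.hyps by simp
    then show ?case
    proof (rule Suc.hyps(1))
      fix x assume x: "poly Q1 x \<noteq> 0"
      show "f x * poly Q1 x = poly P1 x"
      proof (cases "x = x0")
        \<comment> \<open>At the root itself the old formula says nothing; the value of
          \<open>f\<close> comes from the local fraction.\<close>
        case True
        have "poly P1 x0 * poly Q0 x0 = poly P0 x0 * poly Q1 x0" using eq1 by (metis poly_mult)
        then have "poly P1 x0 * poly Q0 x0 = f x0 * poly Q1 x0 * poly Q0 x0"
          by (simp flip: *(2)[OF *(1)] add: mult_ac)
        then show ?thesis using * True by simp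
      next
        case False
        then have "f x * poly Q x = poly P x" using x Suc.prems(2) by (simp add: Q1)
        then have "(x - x0) * (f x * poly Q1 x) = (x - x0) * poly P1 x"
          unfolding P1 Q1 by (simp add: algebra_simps)
        then show ?thesis using False by simp
      qed
    qed (use \<open>Q1 \<noteq> 0\<close> in auto)
  qed
  moreover obtain P Q where "poly Q 0 \<noteq> 0" "\<And>x. poly Q x \<noteq> 0 \<Longrightarrow> f x * poly Q x = poly P x"
    using rr[of 0] unfolding rr_def by metis
  ultimately show ?thesis by (metis poly_0)
qed

text \<open>The point at infinity bounds the degree.\<close>

lemma poly_le_of_inversion:
  fixes p g :: "'k::field_char_0 poly" and e :: int
  assumes "\<And>x. x \<noteq> 0 \<Longrightarrow> poly p x = x powi e * poly g (inverse x)"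
  shows "degree p \<le> nat e"
proof (cases "p = 0")
  case False
  define n where "n = degree g"
  \<comment> \<open>Reversing the coefficients of \<open>g\<close> clears the denominators.\<close>
  have g: "x ^ n * poly g (inverse x) = poly (reflect_poly g) x" if "x \<noteq> 0" for x
    using that poly_reflect_poly_nz[of x g] by (simp add: n_def)
  have key: "x ^ n * poly p x = x powi e * poly (reflect_poly g) x" if "x \<noteq> 0" for x
    using assms[OF that] g[OF that] by (simp add: algebra_simps flip: g[OF that])
  have dr: "degree (reflect_poly g) \<le> n" unfolding n_def by (rule degree_reflect_poly_le)
  show ?thesis
  proof (cases "e \<ge> 0")
    case True
    have "monom 1 n * p = monom 1 (nat e) * reflect_poly g"
    proof -
      \<comment> \<open>The hypothesis excludes 0, so the identity is proved after multiplication by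
        the variable, which is then cancelled.\<close>
      have "[:0,1:] * (monom 1 n * p - monom 1 (nat e) * reflect_poly g) = 0"
      proof (rule poly_all_0_iff_0[THEN iffD1], intro allI)
        fix x show "poly ([:0,1:] * (monom 1 n * p - monom 1 (nat e) * reflect_poly g)) x = 0"
          using key[of x] True by (cases "x = 0") (auto simp: poly_monom power_int_def)
      qed
      then show ?thesis by (metis eq_iff_diff_eq_0 mult_eq_0_iff one_neq_zero pCons_eq_0_iff)
    qed
    moreover have "degree (monom 1 n * p) = n + degree p"
      using False by (subst degree_mult_eq) (auto simp: degree_monom_eq monom_eq_0_iff)
    moreover have "degree (monom 1 (nat e) * reflect_poly g) \<le> nat e + n"
      using dr degree_mult_le[of "monom 1 (nat e)" "reflect_poly g"] by (auto simp: degree_monom_eq)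
    ultimately show ?thesis by simp
  next
    case neg: False
    have "monom 1 (n + nat (-e)) * p = reflect_poly g"
    proof -
      have "[:0,1:] * (monom 1 (n + nat (-e)) * p - reflect_poly g) = 0"
      proof (rule poly_all_0_iff_0[THEN iffD1], intro allI)
        fix x :: 'k
        have "x ^ nat (-e) * (x ^ n * poly p x) = poly (reflect_poly g) x" if "x \<noteq> 0"
          using key[OF that] that neg by (simp add: power_int_def field_simps)
        then show "poly ([:0,1:] * (monom 1 (n + nat (-e)) * p - reflect_poly g)) x = 0"
          by (cases "x = 0") (auto simp: poly_monom power_add algebra_simps)
      qed
      then show ?thesis by (metis eq_iff_diff_eq_0 mult_eq_0_iff one_neq_zero pCons_eq_0_iff)
    qed
    then have "n + nat (-e) + degree p \<le> n"
      using dr False degree_mult_eq[of "monom 1 (n + nat (-e)) :: 'k poly" p]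
      by (auto simp: degree_monom_eq monom_eq_0_iff)
    then show ?thesis by simp
  qed
qed auto

section \<open>The first fundamental theorem for two-rowed matrices\<close>

inductive polyfun :: "(('i \<Rightarrow> 'k::field_char_0) \<Rightarrow> 'k) \<Rightarrow> bool" where
  polyfun_const: "polyfun (\<lambda>p. c)"
| polyfun_var: "polyfun (\<lambda>p. p i)"
| polyfun_add: "polyfun f \<Longrightarrow> polyfun g \<Longrightarrow> polyfun (\<lambda>p. f p + g p)"
| polyfun_mult: "polyfun f \<Longrightarrow> polyfun g \<Longrightarrow> polyfun (\<lambda>p. f p * g p)"

lemma polyfun_sum: "(\<And>i. i \<in> A \<Longrightarrow> polyfun (f i)) \<Longrightarrow> polyfun (\<lambda>p. \<Sum>i\<in>A. f i p)"
  by (induction A rule: infinite_finite_induct) (auto intro: polyfun_const polyfun_add)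

lemma polyfun_uminus: "polyfun f \<Longrightarrow> polyfun (\<lambda>p. - f p)"
  using polyfun_mult[OF polyfun_const[of "-1"]] by fastforce

lemma polyfun_diff: "polyfun f \<Longrightarrow> polyfun g \<Longrightarrow> polyfun (\<lambda>p. f p - g p)"
  using polyfun_add[OF _ polyfun_uminus] by fastforce

lemma polyfun_power: "polyfun f \<Longrightarrow> polyfun (\<lambda>p. f p ^ n)"
  by (induction n) (auto intro: polyfun_const polyfun_mult)

lemma polyfun_poly: "polyfun f \<Longrightarrow> polyfun (\<lambda>p. poly q (f p))"
  by (induction q) (auto intro: polyfun_const polyfun_mult polyfun_add)

lemma polyfun_subst:
  assumes "polyfun f" "\<And>i. polyfun (\<lambda>p. h p i)"
  shows "polyfun (\<lambda>p. f (h p))"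
  using assms by (induction) (auto intro: polyfun.intros)

lemma polyfun_line_exists:
  assumes "polyfun f" shows "\<exists>g. \<forall>x. poly g x = f (\<lambda>i. p i + x * q i)"
  using assms
proof induction
  case (polyfun_const c)
  show ?case by (intro exI[of _ "[:c:]"]) auto
next
  case (polyfun_var i)
  show ?case by (intro exI[of _ "[:p i, q i:]"]) auto
qed (metis poly_add, metis poly_mult)

text \<open>Unique because polynomials that agree as functions on an infinite field are equal; so
  polynomial functions have derivatives without any choice of coefficients.\<close>

definition line_poly :: "(('i \<Rightarrow> 'k::field_char_0) \<Rightarrow> 'k) \<Rightarrow> ('i \<Rightarrow> 'k) \<Rightarrow> ('i \<Rightarrow> 'k) \<Rightarrow> 'k poly" where
  "line_poly f p q = (THE g. \<forall>x. poly g x = f (\<lambda>i. p i + x * q i))"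

lemma line_poly_eqI: "(\<And>x. poly g x = f (\<lambda>i. p i + x * q i)) \<Longrightarrow> line_poly f p q = g"
  unfolding line_poly_def by (rule the_equality) (auto simp flip: poly_eq_poly_eq_iff)

lemma poly_line_poly: "polyfun f \<Longrightarrow> poly (line_poly f p q) x = f (\<lambda>i. p i + x * q i)"
  using polyfun_line_exists[of f p q] line_poly_eqI[of _ f p q] by metis

text \<open>The derivative of f at p in the direction q: the linear coefficient of f on the line
  through p.\<close>

definition dd :: "(('i \<Rightarrow> 'k::field_char_0) \<Rightarrow> 'k) \<Rightarrow> ('i \<Rightarrow> 'k) \<Rightarrow> ('i \<Rightarrow> 'k) \<Rightarrow> 'k" where
  "dd f p q = coeff (line_poly f p q) 1"

lemma dd_const: "dd (\<lambda>p. c) p q = 0"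
  unfolding dd_def by (subst line_poly_eqI[of "[:c:]"]) auto

lemma dd_var: "dd (\<lambda>p. p i) p q = q i"
  unfolding dd_def by (subst line_poly_eqI[of "[:p i, q i:]"]) auto

lemma dd_add: "polyfun f \<Longrightarrow> polyfun g \<Longrightarrow> dd (\<lambda>p. f p + g p) p q = dd f p q + dd g p q"
  unfolding dd_def by (subst line_poly_eqI[of "line_poly f p q + line_poly g p q"]) (auto simp: poly_line_poly)

lemma dd_mult: 
  assumes "polyfun f" "polyfun g"
  shows "dd (\<lambda>p. f p * g p) p q = f p * dd g p q + dd f p q * g p"
proof -
  have 0: "coeff (line_poly h p q) 0 = h p" if "polyfun h" for h :: "('a \<Rightarrow> 'b) \<Rightarrow> 'b"
    using poly_line_poly[OF that, of p q 0] by (simp add: poly_0_coeff_0)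
  show ?thesis
    unfolding dd_def using assms
    by (subst line_poly_eqI[of "line_poly f p q * line_poly g p q"])
      (auto simp: poly_line_poly coeff_mult 0)
qed

definition pd :: "'i \<Rightarrow> (('i \<Rightarrow> 'k::field_char_0) \<Rightarrow> 'k) \<Rightarrow> ('i \<Rightarrow> 'k) \<Rightarrow> 'k" where
  "pd i f p = dd f p (\<lambda>j. if j = i then 1 else 0)"

lemma pd_const: "pd i (\<lambda>p. c) = (\<lambda>p. 0)"
  by (simp add: pd_def[abs_def] dd_const)

lemma pd_var: "pd i (\<lambda>p. p j) = (\<lambda>p. if j = i then 1 else 0)"
  by (simp add: pd_def[abs_def] dd_var)

lemma pd_add: "polyfun f \<Longrightarrow> polyfun g \<Longrightarrow> pd i (\<lambda>p. f p + g p) = (\<lambda>p. pd i f p + pd i g p)"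
  by (simp add: pd_def[abs_def] dd_add)

lemma pd_mult:
  "polyfun f \<Longrightarrow> polyfun g \<Longrightarrow> pd i (\<lambda>p. f p * g p) = (\<lambda>p. f p * pd i g p + pd i f p * g p)"
  by (simp add: pd_def[abs_def] dd_mult)

lemma pd_cmult: "polyfun f \<Longrightarrow> pd i (\<lambda>p. c * f p) = (\<lambda>p. c * pd i f p)"
  by (simp add: pd_mult polyfun_const pd_const)

lemma pd_diff: "polyfun f \<Longrightarrow> polyfun g \<Longrightarrow> pd i (\<lambda>p. f p - g p) = (\<lambda>p. pd i f p - pd i g p)"
  using pd_add[OF _ polyfun_mult[OF polyfun_const[of "-1"]], of f g i] pd_cmult[of g i "-1"] by simp

lemma polyfun_pd: "polyfun f \<Longrightarrow> polyfun (pd i f)"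
proof (induction rule: polyfun.induct)
  case (polyfun_var j)
  show ?case by (cases "j = i") (auto simp: pd_var intro: polyfun.intros)
qed (auto simp: pd_const pd_add pd_mult intro: polyfun.intros)

lemma pd_sum:
  "(\<And>k. k \<in> A \<Longrightarrow> polyfun (f k)) \<Longrightarrow> pd i (\<lambda>p. \<Sum>k\<in>A. f k p) = (\<lambda>p. \<Sum>k\<in>A. pd i (f k) p)"
  by (induction A rule: infinite_finite_induct) (auto simp: pd_const pd_add polyfun_sum)

lemma pd_commute: "polyfun f \<Longrightarrow> pd i (pd j f) = pd j (pd i f)"
proof (induction rule: polyfun.induct)
  case (polyfun_var k)
  show ?case by (cases "k = i"; cases "k = j") (auto simp: pd_var pd_const)
qed (simp_all add: pd_const pd_add pd_mult polyfun_pd polyfun_add polyfun_mult fun_eq_iff algebra_simps)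

lemma dd_eq_sum_pd:
  fixes f :: "('i::finite \<Rightarrow> 'k::field_char_0) \<Rightarrow> 'k"
  shows "polyfun f \<Longrightarrow> dd f p q = (\<Sum>i\<in>UNIV. q i * pd i f p)"
proof (induction rule: polyfun.induct)
  case (polyfun_mult f g)
  then show ?case
    by (simp add: dd_mult pd_mult distrib_left sum.distrib sum_distrib_left sum_distrib_right mult_ac)
qed (simp_all add: dd_const pd_const dd_var pd_var dd_add pd_add sum.distrib distrib_left if_distrib[of "(*) _"] cong: if_cong)

section \<open>Cayley's Omega operator and the Capelli identity\<close>

type_synonym ('j, 'k) mat2 = "'j \<times> bool \<Rightarrow> 'k"

definition br :: "'j \<Rightarrow> 'j \<Rightarrow> ('j, 'k::field_char_0) mat2 \<Rightarrow> 'k" where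
  "br i j p = p (i, True) * p (j, False) - p (i, False) * p (j, True)"

text \<open>The polarisation operator, the infinitesimal generator of adding a multiple of row
  \<open>True\<close> to row \<open>False\<close>.\<close>

definition pol12 :: "(('j::finite, 'k::field_char_0) mat2 \<Rightarrow> 'k) \<Rightarrow> ('j, 'k) mat2 \<Rightarrow> 'k" where
  "pol12 f p = (\<Sum>j\<in>UNIV. p (j, True) * pd (j, False) f p)"

definition euler :: "bool \<Rightarrow> (('j::finite, 'k::field_char_0) mat2 \<Rightarrow> 'k) \<Rightarrow> ('j, 'k) mat2 \<Rightarrow> 'k" where
  "euler r f p = (\<Sum>j\<in>UNIV. p (j, r) * pd (j, r) f p)"

text \<open>Cayley's Omega operator for the columns i and j: the bracket with its entries replaced
  by partial derivatives.\<close>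

definition omega :: "'j \<Rightarrow> 'j \<Rightarrow> (('j::finite, 'k::field_char_0) mat2 \<Rightarrow> 'k) \<Rightarrow> ('j, 'k) mat2 \<Rightarrow> 'k" where
  "omega i j f p = pd (i, True) (pd (j, False) f) p - pd (j, True) (pd (i, False) f) p"

text \<open>The Lie algebra version of semi-invariance of weight \<open>det^h\<close>: a nilpotent
  element annihilates f, and both torus directions act by the same scalar h.\<close>

definition sl2_inv :: "nat \<Rightarrow> (('j::finite, 'k::field_char_0) mat2 \<Rightarrow> 'k) \<Rightarrow> bool" where
  "sl2_inv h f \<longleftrightarrow> polyfun f \<and> (\<forall>p. pol12 f p = 0) \<and> (\<forall>r p. euler r f p = of_nat h * f p)"

text \<open>The Leibniz rule for an operator that is linear in one row; the first summand is the
  commutator. The commutations of derivatives with \<open>pol12\<close> and \<open>euler\<close>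
  rest on it.\<close>

lemma pd_row_sum:
  fixes g :: "'j::finite \<Rightarrow> ('j, 'k::field_char_0) mat2 \<Rightarrow> 'k"
  assumes "\<And>k. polyfun (g k)"
  shows "pd (i, s) (\<lambda>p. \<Sum>k\<in>UNIV. p (k, r) * g k p) p
    = (if s = r then g i p else 0) + (\<Sum>k\<in>UNIV. p (k, r) * pd (i, s) (g k) p)"
proof -
  have "pd (i, s) (\<lambda>p. p (k, r) * g k p) p
      = p (k, r) * pd (i, s) (g k) p + (if k = i \<and> r = s then 1 else 0) * g k p" for k
    using pd_mult[OF polyfun_var assms, of "(i, s)" "(k, r)" k] by (simp add: pd_var)
  then have "pd (i, s) (\<lambda>p. \<Sum>k\<in>UNIV. p (k, r) * g k p) p
      = (\<Sum>k\<in>UNIV. p (k, r) * pd (i, s) (g k) p + (if k = i \<and> r = s then 1 else 0) * g k p)"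
    using assms by (subst pd_sum) (auto intro: polyfun_mult polyfun_var)
  also have "(\<Sum>k\<in>UNIV. (if k = i \<and> r = s then 1 else 0) * g k p) = (if s = r then g i p else 0)"
    by (auto simp: if_distrib[of "\<lambda>x. x * _"] cong: if_cong)
  ultimately show ?thesis by (simp add: sum.distrib)
qed

lemma pol12_fun: "sl2_inv h f \<Longrightarrow> (\<lambda>p. \<Sum>k\<in>UNIV. p (k, True) * pd (k, False) f p) = (\<lambda>p. 0)"
  by (auto simp: sl2_inv_def pol12_def fun_eq_iff)

lemma euler_fun: "sl2_inv h f \<Longrightarrow> (\<lambda>p. \<Sum>k\<in>UNIV. p (k, r) * pd (k, r) f p) = (\<lambda>p. of_nat h * f p)"
  by (auto simp: sl2_inv_def euler_def fun_eq_iff)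

text \<open>Once the bracket is expanded, the inner sum over j is an Euler or a polarisation
  operator, up to the order of factors. Commuting it past the remaining derivative leaves
  \<open>h\<close> times one derivative and minus the other, so the sum with plain second
  derivatives is \<open>h * h + h\<close> times f; antisymmetry of the bracket doubles it.\<close>

lemma capelli:
  fixes f :: "('j::finite, 'k::field_char_0) mat2 \<Rightarrow> 'k"
  assumes inv: "sl2_inv h f"
  shows "2 * of_nat h * (of_nat h + 1) * f p = (\<Sum>i\<in>UNIV. \<Sum>j\<in>UNIV. br i j p * omega i j f p)"
proof -
  have f: "polyfun f" and pf: "\<And>i. polyfun (pd i f)" using inv by (auto simp: sl2_inv_def polyfun_pd)
  define A where "A i j = pd (i, True) (pd (j, False) f) p" for i j
  have 1: "(\<Sum>j\<in>UNIV. p (j, False) * A i j) = of_nat h * pd (i, True) f p" for i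
    using pd_row_sum[of "\<lambda>k. pd (k, False) f" i True False p] pf f
    by (simp add: euler_fun[OF inv] pd_cmult A_def)
  have 2: "(\<Sum>j\<in>UNIV. p (j, True) * A i j) = - pd (i, False) f p" for i
    using pd_row_sum[of "\<lambda>k. pd (k, False) f" i True True p] pf f
    by (simp add: pol12_fun[OF inv] pd_const A_def eq_neg_iff_add_eq_0 add.commute)
  have "(\<Sum>i\<in>UNIV. \<Sum>j\<in>UNIV. br i j p * A i j) =
      (\<Sum>i\<in>UNIV. p (i, True) * (\<Sum>j\<in>UNIV. p (j, False) * A i j)) -
      (\<Sum>i\<in>UNIV. p (i, False) * (\<Sum>j\<in>UNIV. p (j, True) * A i j))"
    by (simp add: br_def sum_subtractf sum_distrib_left algebra_simps)
  also have "\<dots> = of_nat h * euler True f p + euler False f p"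
    unfolding 1 2 by (simp add: euler_def sum_distrib_left sum_negf mult_ac)
  also have "\<dots> = of_nat h * (of_nat h + 1) * f p"
    using inv by (simp add: sl2_inv_def algebra_simps)
  finally have S: "(\<Sum>i\<in>UNIV. \<Sum>j\<in>UNIV. br i j p * A i j) = of_nat h * (of_nat h + 1) * f p" .
  have "(\<Sum>i\<in>UNIV. \<Sum>j\<in>UNIV. br i j p * A j i) = (\<Sum>i\<in>UNIV. \<Sum>j\<in>UNIV. - (br i j p * A i j))"
    by (subst sum.swap) (auto simp: br_def algebra_simps intro!: sum.cong)
  then have "(\<Sum>i\<in>UNIV. \<Sum>j\<in>UNIV. br i j p * omega i j f p) = 2 * (\<Sum>i\<in>UNIV. \<Sum>j\<in>UNIV. br i j p * A i j)"
    by (simp add: omega_def A_def right_diff_distrib sum_subtractf sum_negf)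
  then show ?thesis unfolding S by simp
qed

text \<open>Each term of \<open>omega\<close> takes one derivative in each row, which lowers both
  degrees by one. Polarising a term leaves a second derivative in row \<open>False\<close> that is
  symmetric in i and j, so it cancels in the difference.\<close>

lemma sl2_inv_omega:
  fixes f :: "('j::finite, 'k::field_char_0) mat2 \<Rightarrow> 'k"
  assumes inv: "sl2_inv (Suc h) f"
  shows "sl2_inv h (omega i j f)"
proof -
  have f: "polyfun f" and pf: "\<And>i. polyfun (pd i f)" and ppf: "\<And>i j. polyfun (pd i (pd j f))"
    using inv by (auto simp: sl2_inv_def polyfun_pd)
  define A where "A i j = pd (i, True) (pd (j, False) f)" for i j
  have om: "omega i j f = (\<lambda>p. A i j p - A j i p)" by (simp add: omega_def A_def fun_eq_iff)
  have A: "polyfun (A i j)" for i j by (simp add: A_def ppf)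
  have c3: "pd k (A i j) = pd (i, True) (pd (j, False) (pd k f))" for k i j
    unfolding A_def using pd_commute[OF pf[of "(j, False)"], of k "(i, True)"] pd_commute[OF f, of k "(j, False)"]
    by simp
  have pol: "pol12 (A i j) p = - pd (j, False) (pd (i, False) f) p" for i j p
  proof -
    have "(\<lambda>p. \<Sum>k\<in>UNIV. p (k, True) * pd (j, False) (pd (k, False) f) p) = (\<lambda>p. 0)"
      using pd_row_sum[of "\<lambda>k. pd (k, False) f" j False True] pf
      by (simp add: pol12_fun[OF inv] pd_const fun_eq_iff)
    then have "pd (j, False) (pd (i, False) f) p + pol12 (A i j) p = 0"
      using pd_row_sum[of "\<lambda>k. pd (j, False) (pd (k, False) f)" i True True p] ppf f
      by (simp add: pd_const pol12_def c3)
    then show ?thesis by (simp add: eq_neg_iff_add_eq_0 add.commute)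
  qed
  have eu: "euler r (A i j) p = of_nat h * A i j p" for r i j p
  proof (cases r)
    case True
    have "(\<lambda>p. \<Sum>k\<in>UNIV. p (k, True) * pd (j, False) (pd (k, True) f) p) = (\<lambda>p. of_nat (Suc h) * pd (j, False) f p)"
      using pd_row_sum[of "\<lambda>k. pd (k, True) f" j False True] pf f
      by (simp add: euler_fun[OF inv] pd_cmult fun_eq_iff del: of_nat_Suc)
    then have "A i j p + euler True (A i j) p = of_nat (Suc h) * A i j p"
      using pd_row_sum[of "\<lambda>k. pd (j, False) (pd (k, True) f)" i True True p] ppf f pf
        pd_commute[OF f, of "(j, False)" "(i, True)"]
      by (simp add: pd_cmult euler_def c3[unfolded A_def] A_def del: of_nat_Suc)
    then show ?thesis using True by (simp add: algebra_simps)
  next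
    case False
    have "(\<lambda>p. pd (j, False) f p + (\<Sum>k\<in>UNIV. p (k, False) * pd (j, False) (pd (k, False) f) p))
        = (\<lambda>p. of_nat (Suc h) * pd (j, False) f p)"
      using pd_row_sum[of "\<lambda>k. pd (k, False) f" j False False] pf f
      by (simp add: euler_fun[OF inv] pd_cmult fun_eq_iff del: of_nat_Suc)
    then have "(\<lambda>p. \<Sum>k\<in>UNIV. p (k, False) * pd (j, False) (pd (k, False) f) p) = (\<lambda>p. of_nat h * pd (j, False) f p)"
      by (simp add: fun_eq_iff algebra_simps)
    then have "euler False (A i j) p = of_nat h * A i j p"
      using pd_row_sum[of "\<lambda>k. pd (j, False) (pd (k, False) f)" i True False p] ppf f pf
      by (simp add: pd_cmult euler_def c3[unfolded A_def] A_def)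
    then show ?thesis using False by simp
  qed
  have "pol12 (omega i j f) p = pol12 (A i j) p - pol12 (A j i) p" for p
    by (simp add: om pol12_def pd_diff A right_diff_distrib sum_subtractf)
  then have "pol12 (omega i j f) p = 0" for p
    using pd_commute[OF f, of "(i, False)" "(j, False)"] by (simp add: pol)
  moreover have "euler r (omega i j f) p = euler r (A i j) p - euler r (A j i) p" for r p
    by (simp add: om euler_def pd_diff A right_diff_distrib sum_subtractf)
  then have "euler r (omega i j f) p = of_nat h * omega i j f p" for r p
    by (simp add: eu om algebra_simps)
  ultimately show ?thesis using A by (simp add: sl2_inv_def om polyfun_diff)
qed

section \<open>Spans of bracket products\<close>

definition br_span :: "nat \<Rightarrow> (('j, 'k::field_char_0) mat2 \<Rightarrow> 'k) \<Rightarrow> bool" where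
  "br_span h f \<longleftrightarrow> (\<exists>L. (\<forall>(c, M)\<in>set L. length M = h) \<and>
     (\<forall>p. f p = (\<Sum>(c, M)\<leftarrow>L. c * (\<Prod>(i, j)\<leftarrow>M. br i j p))))"

lemma br_span_0: "br_span h (\<lambda>p. 0)"
  unfolding br_span_def by (intro exI[of _ "[]"]) auto

lemma br_span_add: assumes "br_span h f" "br_span h g" shows "br_span h (\<lambda>p. f p + g p)"
proof -
  obtain L L' where "\<forall>(c, M)\<in>set L. length M = h" "\<forall>p. f p = (\<Sum>(c, M)\<leftarrow>L. c * (\<Prod>(i, j)\<leftarrow>M. br i j p))"
    "\<forall>(c, M)\<in>set L'. length M = h" "\<forall>p. g p = (\<Sum>(c, M)\<leftarrow>L'. c * (\<Prod>(i, j)\<leftarrow>M. br i j p))"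
    using assms unfolding br_span_def by metis
  then show ?thesis unfolding br_span_def by (intro exI[of _ "L @ L'"]) auto
qed

lemma br_span_br_mult: assumes "br_span h f" shows "br_span (Suc h) (\<lambda>p. c * (br i j p * f p))"
proof -
  obtain L where L: "\<forall>(c, M)\<in>set L. length M = h" "\<And>p. f p = (\<Sum>(c, M)\<leftarrow>L. c * (\<Prod>(i, j)\<leftarrow>M. br i j p))"
    using assms unfolding br_span_def by metis
  have "c * (br i j p * f p) = (\<Sum>(c', M)\<leftarrow>map (\<lambda>(c', M). (c * c', (i, j) # M)) L. c' * (\<Prod>(i, j)\<leftarrow>M. br i j p))" for p
    unfolding L(2) by (simp add: sum_list_const_mult[symmetric] o_def case_prod_unfold mult_ac)
  then show ?thesis using L(1) unfolding br_span_def
    by (intro exI[of _ "map (\<lambda>(c', M). (c * c', (i, j) # M)) L"]) auto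
qed

lemma br_span_sum: "(\<And>i. i \<in> A \<Longrightarrow> br_span h (f i)) \<Longrightarrow> br_span h (\<lambda>p. \<Sum>i\<in>A. f i p)"
  by (induction A rule: infinite_finite_induct) (auto intro: br_span_0 br_span_add)

text \<open>By induction on \<open>h\<close>, the Capelli identity writes f as a combination of
  brackets times functions of weight one less, its constant being invertible in characteristic zero.
  In weight 0 both Euler operators vanish, so f is constant on every line through the
  origin.\<close>

lemma sl2_inv_imp_br_span:
  fixes f :: "('j::finite, 'k::field_char_0) mat2 \<Rightarrow> 'k"
  assumes "sl2_inv h f" shows "br_span h f"
  using assms
proof (induction h arbitrary: f)
  case 0
  have f: "polyfun f" and eu: "\<And>r p. euler r f p = 0" using 0 by (auto simp: sl2_inv_def)
  have "f p = f (\<lambda>_. 0)" for p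
  proof -
    define g where "g = line_poly f (\<lambda>_. 0) p"
    have g: "poly g x = f (\<lambda>i. x * p i)" for x by (simp add: g_def poly_line_poly[OF f])
    \<comment> \<open>The value \<open>x * g'(x)\<close> is the sum of the two Euler operators at
      the point \<open>x p\<close>.\<close>
    have "poly ([:0, 1:] * pderiv g) x = 0" for x
    proof -
      have "line_poly f (\<lambda>i. x * p i) p = pcompose g [:x, 1:]"
        by (rule line_poly_eqI) (simp add: poly_pcompose g algebra_simps)
      then have "dd f (\<lambda>i. x * p i) p = poly (pderiv (pcompose g [:x, 1:])) 0"
        by (simp add: dd_def poly_0_coeff_0 coeff_pderiv)
      also have "\<dots> = poly (pderiv g) x"
        by (simp add: pderiv_pcompose poly_pcompose pderiv_pCons)
      finally have "poly (pderiv g) x = (\<Sum>i\<in>UNIV. p i * pd i f (\<lambda>i. x * p i))"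
        by (simp add: dd_eq_sum_pd[OF f])
      then have "x * poly (pderiv g) x = (\<Sum>i\<in>UNIV. (x * p i) * pd i f (\<lambda>i. x * p i))"
        by (simp add: sum_distrib_left mult_ac)
      also have "\<dots> = euler True f (\<lambda>i. x * p i) + euler False f (\<lambda>i. x * p i)"
        unfolding euler_def UNIV_Times_UNIV[symmetric] UNIV_bool
        by (simp add: sum.cartesian_product' sum.distrib add.commute)
      finally show ?thesis by (simp add: eu)
    qed
    then have "[:0, 1:] * pderiv g = 0" using poly_all_0_iff_0 by blast
    then have "pderiv g = 0" by (metis mult_eq_0_iff one_neq_zero pCons_eq_0_iff)
    then obtain c where "g = [:c:]" by (metis pderiv_eq_0_iff degree_eq_zeroE)
    then show ?thesis using g[of 1] g[of 0] by simp
  qed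
  then show ?case unfolding br_span_def by (intro exI[of _ "[(f (\<lambda>_. 0), [])]"]) auto
next
  case (Suc h)
  define d where "d = inverse (2 * of_nat (Suc h) * (of_nat (Suc h) + 1) :: 'k)"
  have nz: "(2 * of_nat (Suc h) * (of_nat (Suc h) + 1) :: 'k) \<noteq> 0"
  proof -
    have "(of_nat (Suc h) + 1 :: 'k) = of_nat (Suc (Suc h))" by simp
    then show ?thesis by (simp only: mult_eq_0_iff of_nat_eq_0_iff) simp
  qed
  have "f p = (\<Sum>i\<in>UNIV. \<Sum>j\<in>UNIV. d * (br i j p * omega i j f p))" for p
  proof -
    have "f p = d * (2 * of_nat (Suc h) * (of_nat (Suc h) + 1) * f p)"
      using left_inverse[OF nz] unfolding d_def[symmetric] by (metis mult.assoc mult_1)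
    then show ?thesis unfolding capelli[OF Suc.prems] by (simp only: sum_distrib_left)
  qed
  moreover have "br_span (Suc h) (\<lambda>p. \<Sum>i\<in>UNIV. \<Sum>j\<in>UNIV. d * (br i j p * omega i j f p))"
    by (intro br_span_sum br_span_br_mult Suc.IH sl2_inv_omega Suc.prems)
  ultimately show ?case by (simp add: br_span_def)
qed

text \<open>Differentiating the one-parameter groups at the identity gives the infinitesimal
  conditions. The torus produces the polynomial \<open>(1 + x)^h\<close>, whose linear coefficient
  is the weight.\<close>

theorem gl2_semi_invariant_imp_br_span:
  fixes F :: "('j::finite, 'k::field_char_0) mat2 \<Rightarrow> 'k"
  assumes F: "polyfun F"
    and unip: "\<And>x p. F (\<lambda>(j, r). if r then p (j, True) else p (j, False) + x * p (j, True)) = F p"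
    and torus: "\<And>x s p. x \<noteq> 0 \<Longrightarrow> F (\<lambda>(j, r). if r = s then x * p (j, r) else p (j, r)) = x ^ h * F p"
  shows "br_span h F"
proof (rule sl2_inv_imp_br_span, unfold sl2_inv_def, intro conjI allI F)
  fix p
  define q :: "('j, 'k) mat2" where "q = (\<lambda>(j, r). if r then 0 else p (j, True))"
  have *: "(\<lambda>i. p i + x * q i) = (\<lambda>(j, r). if r then p (j, True) else p (j, False) + x * p (j, True))" for x
    by (auto simp: q_def fun_eq_iff)
  have "line_poly F p q = [:F p:]" by (rule line_poly_eqI) (unfold *, simp add: unip)
  then have "dd F p q = 0" by (simp add: dd_def)
  then show "pol12 F p = 0"
    unfolding dd_eq_sum_pd[OF F] pol12_def UNIV_Times_UNIV[symmetric] UNIV_bool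
    by (simp add: sum.cartesian_product' sum.distrib q_def)
next
  fix s p
  define q :: "('j, 'k) mat2" where "q = (\<lambda>(j, r). if r = s then p (j, r) else 0)"
  have *: "(\<lambda>i. p i + x * q i) = (\<lambda>(j, r). if r = s then (1 + x) * p (j, r) else p (j, r))" for x
    by (auto simp: q_def fun_eq_iff algebra_simps)
  \<comment> \<open>At \<open>x = -1\<close> the torus element degenerates and the hypothesis is
    silent; the factor \<open>1 + x\<close> covers this point and is cancelled afterwards.\<close>
  have "[:1, 1:] * (line_poly F p q - psmult (F p) ([:1, 1:] ^ h)) = 0"
  proof (rule poly_all_0_iff_0[THEN iffD1], intro allI)
    fix x show "poly ([:1, 1:] * (line_poly F p q - psmult (F p) ([:1, 1:] ^ h))) x = 0"
    proof (cases "1 + x = 0")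
      case False
      then have "poly (line_poly F p q) x = (1 + x) ^ h * F p"
        unfolding poly_line_poly[OF F] * by (rule torus)
      then show ?thesis by (simp add: mult.commute)
    next
      case True
      then have "poly [:1, 1:] x = 0" by simp
      then show ?thesis by (simp only: poly_mult mult_zero_left)
    qed
  qed
  then have "line_poly F p q = psmult (F p) ([:1, 1:] ^ h)"
    by (metis eq_iff_diff_eq_0 mult_eq_0_iff one_neq_zero pCons_eq_0_iff)
  moreover have "coeff ([:1, 1:] ^ h :: 'k poly) 1 = of_nat h"
  proof -
    have 0: "coeff ([:1, 1:] ^ m :: 'k poly) 0 = 1" for m by (induction m) auto
    show ?thesis by (induction h) (auto simp: coeff_pCons 0)
  qed
  ultimately have "dd F p q = of_nat h * F p" by (simp add: dd_def)
  moreover have "dd F p q = euler s F p"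
    unfolding dd_eq_sum_pd[OF F] euler_def UNIV_Times_UNIV[symmetric] UNIV_bool
    by (cases s) (simp_all add: sum.cartesian_product' sum.distrib q_def)
  ultimately show "euler s F p = of_nat h * F p" by simp
qed

section \<open>Extension of functions of a pair of independent rows\<close>

definition ind2 :: "'k::field^'n \<Rightarrow> 'k^'n \<Rightarrow> bool" where
  "ind2 a b \<longleftrightarrow> (\<forall>x y. x *s a + y *s b = 0 \<longrightarrow> x = 0 \<and> y = 0)"

definition ind3 :: "'k::field^'n \<Rightarrow> 'k^'n \<Rightarrow> 'k^'n \<Rightarrow> bool" where
  "ind3 a b c \<longleftrightarrow> (\<forall>x y z. x *s a + y *s b + z *s c = 0 \<longrightarrow> x = 0 \<and> y = 0 \<and> z = 0)"

text \<open>The vector w avoids the span of a, b, c, which may themselves be dependent; shorter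
  lists are padded with 0.\<close>

definition outside :: "'k::field^'n \<Rightarrow> 'k^'n \<Rightarrow> 'k^'n \<Rightarrow> 'k^'n \<Rightarrow> bool" where
  "outside w a b c \<longleftrightarrow> (\<forall>x y z r. r *s w = x *s a + y *s b + z *s c \<longrightarrow> r = 0)"

lemma outsideD: "outside w a b c \<Longrightarrow> r *s w = x *s a + y *s b + z *s c \<Longrightarrow> r = 0"
  by (simp add: outside_def)

text \<open>Three vectors span a proper subspace as soon as \<open>n \<ge> 4\<close>. This is the
  source of all auxiliary directions below.\<close>

lemma outside_exists:
  fixes a b c :: "'k::field^'n::finite"
  assumes "CARD('n) \<ge> 4" shows "\<exists>w. outside w a b c"
proof -
  have "vec.dim {a, b, c} \<le> card {a, b, c}"
    by (intro vec.dim_le_card vec.span_superset) auto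
  also have "\<dots> \<le> 3" by (simp add: card_insert_if)
  finally have "vec.dim {a, b, c} < CARD('n)" using assms by simp
  then have "vec.span {a, b, c} \<noteq> UNIV" by (metis vec_dim_card vec.dim_span less_irrefl)
  then obtain w where w: "w \<notin> vec.span {a, b, c}" by auto
  have "outside w a b c" unfolding outside_def
  proof (intro allI impI)
    fix x y z r assume *: "r *s w = x *s a + y *s b + z *s c"
    have "r *s w \<in> vec.span {a, b, c}"
      unfolding * by (intro vec.span_add vec.span_scale vec.span_base) auto
    then have "r \<noteq> 0 \<Longrightarrow> inverse r *s (r *s w) \<in> vec.span {a, b, c}" by (rule vec.span_scale)
    then show "r = 0" using w by (cases "r = 0") auto
  qed
  then show ?thesis ..
qed

lemma ind2_nonzero: "ind2 a b \<Longrightarrow> a + x *s b \<noteq> 0"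
  unfolding ind2_def by (metis one_neq_zero vector_smult_lid)

lemma not_ind2_imp: assumes "a \<noteq> 0" "\<not> ind2 a b" obtains c where "b = c *s a"
proof -
  obtain x y where *: "x *s a + y *s b = 0" "x \<noteq> 0 \<or> y \<noteq> 0"
    using assms(2) unfolding ind2_def by auto
  have "y \<noteq> 0"
  proof
    assume "y = 0"
    then have "x *s a = 0" "x \<noteq> 0" using * by auto
    then show False using assms(1) by (simp add: vec.scale_eq_0_iff)
  qed
  have "b = (- x / y) *s a"
  proof -
    have "y *s b = - (x *s a)" using *(1) by (simp add: eq_neg_iff_add_eq_0 add.commute)
    then have "inverse y *s (y *s b) = inverse y *s (- (x *s a))" by simp
    then show ?thesis using \<open>y \<noteq> 0\<close> by (simp add: divide_inverse mult.commute)
  qed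
  then show ?thesis by (rule that)
qed

lemma ind3_outside:
  assumes "ind2 a b" "outside w a b c" shows "ind3 a b w"
  unfolding ind3_def
proof (intro allI impI)
  fix x y z assume *: "x *s a + y *s b + z *s w = 0"
  then have "z *s w = (- x) *s a + (- y) *s b + 0 *s c"
    by (simp add: add_eq_0_iff)
  then have "z = 0" by (rule outsideD[OF assms(2)])
  then show "x = 0 \<and> y = 0 \<and> z = 0" using * assms(1) by (auto simp: ind2_def)
qed

lemma ind2_outside:
  assumes "a \<noteq> 0" "outside w a b c" shows "ind2 a w"
  unfolding ind2_def
proof (intro allI impI)
  fix x y assume *: "x *s a + y *s w = 0"
  then have "y *s w = (- x) *s a + 0 *s b + 0 *s c" by (simp add: add_eq_0_iff)
  then have "y = 0" by (rule outsideD[OF assms(2)])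
  then show "x = 0 \<and> y = 0" using * assms(1) by (auto simp: vec.scale_eq_0_iff)
qed

lemma outside_nonzero: "outside w a b c \<Longrightarrow> w \<noteq> 0"
  using outsideD[of w a b c 1 0 0 0] by auto

lemma outside_perm:
  "outside w a b c \<Longrightarrow> outside w b a c" "outside w a b c \<Longrightarrow> outside w a c b"
  unfolding outside_def by (metis add.commute, metis add.commute add.left_commute)

text \<open>Only values of f at independent pairs carry meaning. Under \<open>ind3\<close> the whole
  line stays among such pairs, and polynomiality is asked for on these lines only.\<close>

locale row_extension =
  fixes f :: "'k::field_char_0^'n::finite \<Rightarrow> 'k^'n \<Rightarrow> 'k" and D :: nat
  assumes four: "CARD('n) \<ge> 4"
    and snd_line: "ind3 a b b' \<Longrightarrow> poly_le D (\<lambda>x. f a (b + x *s b'))"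
    and fst_line: "ind3 a a' b \<Longrightarrow> poly_le D (\<lambda>x. f (a + x *s a') b)"
begin

lemma ext_snd: "ind3 a b w \<Longrightarrow> f a b = (\<Sum>u\<in>nodes D. kap D u * f a (b + u *s w))"
  using poly_le_extrapolate[OF snd_line[of a b w]] by simp

text \<open>First extension: the second row may depend on a nonzero first row. The value is
  extrapolated from a line that leaves the span of both rows; by \<open>f2_eq\<close> any such
  direction gives the same result.\<close>

definition f2 :: "'k^'n \<Rightarrow> 'k^'n \<Rightarrow> 'k" where
  "f2 a b = (\<Sum>u\<in>nodes D. kap D u * f a (b + u *s (SOME w. outside w a b 0)))"

text \<open>Extrapolating in both directions gives a double sum over the points
  \<open>b + u w + v w'\<close>, each independent of a. Depending on the order of summation it
  collapses to one side or the other.\<close>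

lemma ext_well_defined_ind3:
  assumes "ind3 a w w'" and b: "b = c *s a"
  shows "(\<Sum>u\<in>nodes D. kap D u * f a (b + u *s w)) = (\<Sum>u\<in>nodes D. kap D u * f a (b + u *s w'))"
proof -
  have I: "x = 0 \<and> y = 0 \<and> z = 0" if "x *s a + y *s w + z *s w' = 0" for x y z
    using assms(1) that unfolding ind3_def by blast
  have 1: "f a (b + u *s w) = (\<Sum>v\<in>nodes D. kap D v * f a (b + u *s w + v *s w'))" if "u \<noteq> 0" for u
  proof (rule ext_snd, unfold ind3_def, intro allI impI)
    fix x y z assume "x *s a + y *s (b + u *s w) + z *s w' = 0"
    then have "(x + y * c) *s a + (y * u) *s w + z *s w' = 0" by (simp add: b algebra_simps)
    from I[OF this] that show "x = 0 \<and> y = 0 \<and> z = 0" by auto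
  qed
  have 2: "f a (b + v *s w') = (\<Sum>u\<in>nodes D. kap D u * f a (b + v *s w' + u *s w))" if "v \<noteq> 0" for v
  proof (rule ext_snd, unfold ind3_def, intro allI impI)
    fix x y z assume "x *s a + y *s (b + v *s w') + z *s w = 0"
    then have "(x + y * c) *s a + z *s w + (y * v) *s w' = 0" by (simp add: b algebra_simps)
    from I[OF this] that show "x = 0 \<and> y = 0 \<and> z = 0" by auto
  qed
  have "(\<Sum>u\<in>nodes D. kap D u * f a (b + u *s w)) =
      (\<Sum>u\<in>nodes D. \<Sum>v\<in>nodes D. kap D u * kap D v * f a (b + u *s w + v *s w'))"
  proof (intro sum.cong refl)
    fix u :: 'k assume "u \<in> nodes D"
    from 1[OF nodes_nonzero[OF this]]
    show "kap D u * f a (b + u *s w) = (\<Sum>v\<in>nodes D. kap D u * kap D v * f a (b + u *s w + v *s w'))"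
      by (simp only: sum_distrib_left mult.assoc)
  qed
  also have "\<dots> = (\<Sum>v\<in>nodes D. \<Sum>u\<in>nodes D. kap D u * kap D v * f a (b + u *s w + v *s w'))"
    by (rule sum.swap)
  also have "\<dots> = (\<Sum>v\<in>nodes D. kap D v * f a (b + v *s w'))"
  proof (intro sum.cong refl)
    fix v :: 'k assume "v \<in> nodes D"
    from 2[OF nodes_nonzero[OF this]]
    have "kap D v * f a (b + v *s w') = (\<Sum>u\<in>nodes D. kap D v * (kap D u * f a (b + v *s w' + u *s w)))"
      by (simp only: sum_distrib_left)
    then show "(\<Sum>u\<in>nodes D. kap D u * kap D v * f a (b + u *s w + v *s w')) = kap D v * f a (b + v *s w')"
      by (simp add: mult_ac add_ac)
  qed
  finally show ?thesis .
qed

lemma ext_well_defined: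
  assumes a: "a \<noteq> 0" and w: "outside w a b c" and w': "outside w' a b c'"
  shows "(\<Sum>u\<in>nodes D. kap D u * f a (b + u *s w)) = (\<Sum>u\<in>nodes D. kap D u * f a (b + u *s w'))"
proof (cases "ind2 a b")
  case True
  from ext_snd[OF ind3_outside[OF this w]] ext_snd[OF ind3_outside[OF this w']]
  show ?thesis by (rule trans[OF sym])
next
  case False
  then obtain r where r: "b = r *s a" using not_ind2_imp[OF a] by auto
  \<comment> \<open>The directions w and w' may be dependent modulo a, so both are compared with a
    third one that is independent of each.\<close>
  obtain w'' where w'': "outside w'' a w w'" using outside_exists[OF four] by blast
  have "ind3 a w w''" "ind3 a w' w''"
    using ind3_outside[OF ind2_outside[OF a w] w''] ind3_outside[OF ind2_outside[OF a w'] outside_perm(2)[OF w'']]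
    by auto
  then show ?thesis using ext_well_defined_ind3[OF _ r, of w w''] ext_well_defined_ind3[OF _ r, of w' w''] by argo
qed

lemma f2_eq:
  assumes "a \<noteq> 0" "outside w a b c"
  shows "f2 a b = (\<Sum>u\<in>nodes D. kap D u * f a (b + u *s w))"
proof -
  have "outside (SOME w. outside w a b 0) a b 0"
    by (rule someI_ex) (rule outside_exists[OF four])
  then show ?thesis unfolding f2_def by (rule ext_well_defined[OF assms(1) _ assms(2)])
qed

lemma f2_ind2: assumes "ind2 a b" shows "f2 a b = f a b"
proof -
  obtain w where w: "outside w a b 0" using outside_exists[OF four] by blast
  have "a \<noteq> 0" using ind2_nonzero[OF assms, of 0] by simp
  from f2_eq[OF this w] show ?thesis unfolding ext_snd[OF ind3_outside[OF assms w], symmetric] .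
qed

text \<open>One direction w outside the span of a, a', b serves all points of the line, so
  \<open>f2\<close> is there a combination, with fixed weights, of values of f along lines that
  satisfy \<open>ind3\<close>.\<close>

lemma f2_fst_line: assumes "ind2 a a'" shows "poly_le D (\<lambda>x. f2 (a + x *s a') b)"
proof -
  obtain w where w: "outside w a a' b" using outside_exists[OF four] by blast
  have "f2 (a + x *s a') b = (\<Sum>u\<in>nodes D. kap D u * f (a + x *s a') (b + u *s w))" for x
  proof (rule f2_eq)
    show "a + x *s a' \<noteq> 0" using assms by (rule ind2_nonzero)
    show "outside w (a + x *s a') b 0" unfolding outside_def
    proof (intro allI impI)
      fix y z t r assume "r *s w = y *s (a + x *s a') + z *s b + t *s 0"
      then have "r *s w = y *s a + (y * x) *s a' + z *s b" by (simp add: algebra_simps)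
      then show "r = 0" by (rule outsideD[OF w])
    qed
  qed
  moreover have "poly_le D (\<lambda>x. f (a + x *s a') (b + u *s w))" if "u \<in> nodes D" for u
  proof (rule fst_line, unfold ind3_def, intro allI impI)
    fix x y z assume *: "x *s a + y *s a' + z *s (b + u *s w) = 0"
    then have "(z * u) *s w = (- x) *s a + (- y) *s a' + (- z) *s b"
      by (simp add: algebra_simps add_eq_0_iff)
    then have "z = 0" using outsideD[OF w] nodes_nonzero[OF that] by fastforce
    then show "x = 0 \<and> y = 0 \<and> z = 0" using * assms by (auto simp: ind2_def)
  qed
  ultimately show ?thesis by (simp add: poly_le_sum)
qed

lemma f2_snd_line: assumes "ind2 a b'" shows "poly_le D (\<lambda>x. f2 a (b + x *s b'))"
proof -
  obtain w where w: "outside w a b b'" using outside_exists[OF four] by blast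
  have "f2 a (b + x *s b') = (\<Sum>u\<in>nodes D. kap D u * f a (b + u *s w + x *s b'))" for x
  proof -
    have "f2 a (b + x *s b') = (\<Sum>u\<in>nodes D. kap D u * f a (b + x *s b' + u *s w))"
    proof (rule f2_eq)
      show "a \<noteq> 0" using ind2_nonzero[OF assms, of 0] by simp
      show "outside w a (b + x *s b') 0" unfolding outside_def
      proof (intro allI impI)
        fix y z t r assume "r *s w = y *s a + z *s (b + x *s b') + t *s 0"
        then have "r *s w = y *s a + z *s b + (z * x) *s b'" by (simp add: algebra_simps)
        then show "r = 0" by (rule outsideD[OF w])
      qed
    qed
    then show ?thesis by (simp add: add_ac)
  qed
  moreover have "poly_le D (\<lambda>x. f a (b + u *s w + x *s b'))" if "u \<in> nodes D" for u
  proof (rule snd_line, unfold ind3_def, intro allI impI)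
    fix x y z assume *: "x *s a + y *s (b + u *s w) + z *s b' = 0"
    then have "(y * u) *s w = (- x) *s a + (- y) *s b + (- z) *s b'"
      by (simp add: algebra_simps add_eq_0_iff)
    then have "y = 0" using outsideD[OF w] nodes_nonzero[OF that] by fastforce
    then show "x = 0 \<and> y = 0 \<and> z = 0" using * assms by (auto simp: ind2_def)
  qed
  ultimately show ?thesis by (simp add: poly_le_sum)
qed

text \<open>Second extension, to a vanishing first row. The direction \<open>1\<close> is an
  arbitrary nonzero vector; by \<open>f3_0\<close> any other one gives the same value.\<close>

definition f3 :: "'k^'n \<Rightarrow> 'k^'n \<Rightarrow> 'k" where
  "f3 a b = (if a = 0 then \<Sum>u\<in>nodes D. kap D u * f2 (u *s 1) b else f2 a b)"

lemma f2_extrapolate: "ind2 a w \<Longrightarrow> f2 a b = (\<Sum>u\<in>nodes D. kap D u * f2 (a + u *s w) b)"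
  using poly_le_extrapolate[OF f2_fst_line[of a w b]] by simp

text \<open>The double extrapolation of \<open>ext_well_defined_ind3\<close>, now in the first
  row.\<close>

lemma f2_origin_ind2:
  assumes I: "ind2 w w'"
  shows "(\<Sum>u\<in>nodes D. kap D u * f2 (u *s w) b) = (\<Sum>u\<in>nodes D. kap D u * f2 (u *s w') b)"
proof -
  have I': "ind2 (u *s w) w'" "ind2 (u *s w') w" if "u \<noteq> 0" for u
    using I that unfolding ind2_def by (fastforce simp: add.commute)+
  have "(\<Sum>u\<in>nodes D. kap D u * f2 (u *s w) b) =
      (\<Sum>u\<in>nodes D. \<Sum>v\<in>nodes D. kap D u * kap D v * f2 (u *s w + v *s w') b)"
  proof (intro sum.cong refl)
    fix u :: 'k assume "u \<in> nodes D"
    from f2_extrapolate[OF I'(1)[OF nodes_nonzero[OF this]], of b]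
    show "kap D u * f2 (u *s w) b = (\<Sum>v\<in>nodes D. kap D u * kap D v * f2 (u *s w + v *s w') b)"
      by (simp only: sum_distrib_left mult.assoc)
  qed
  also have "\<dots> = (\<Sum>v\<in>nodes D. \<Sum>u\<in>nodes D. kap D u * kap D v * f2 (u *s w + v *s w') b)"
    by (rule sum.swap)
  also have "\<dots> = (\<Sum>v\<in>nodes D. kap D v * f2 (v *s w') b)"
  proof (intro sum.cong refl)
    fix v :: 'k assume "v \<in> nodes D"
    from f2_extrapolate[OF I'(2)[OF nodes_nonzero[OF this]], of b]
    have "kap D v * f2 (v *s w') b = (\<Sum>u\<in>nodes D. kap D v * (kap D u * f2 (v *s w' + u *s w) b))"
      by (simp only: sum_distrib_left)
    then show "(\<Sum>u\<in>nodes D. kap D u * kap D v * f2 (u *s w + v *s w') b) = kap D v * f2 (v *s w') b"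
      by (simp add: mult_ac add.commute)
  qed
  finally show ?thesis .
qed

lemma f3_0: assumes "w \<noteq> 0" shows "f3 0 b = (\<Sum>u\<in>nodes D. kap D u * f2 (u *s w) b)"
proof -
  obtain w' where w': "outside w' w 1 0" using outside_exists[OF four] by blast
  have one: "(1 :: 'k^'n) \<noteq> 0" by (simp add: vec_eq_iff)
  have "ind2 w w'" "ind2 1 w'"
    using ind2_outside[OF assms w'] ind2_outside[OF one outside_perm(1)[OF w']] by auto
  then show ?thesis using f2_origin_ind2[of w w' b] f2_origin_ind2[of 1 w' b] unfolding f3_def by argo
qed

text \<open>A line of first rows may pass through 0. Shifting it by multiples of a vector w outside
  its span gives lines to which \<open>f2_fst_line\<close> applies, and the original values are
  extrapolated from these with fixed weights.\<close>

lemma f3_fst_line: "poly_le D (\<lambda>x. f3 (a + x *s a') b)"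
proof (cases "a' = 0")
  case True
  then show ?thesis by (simp add: poly_le_const)
next
  case a': False
  obtain w where w: "outside w a a' 0" using outside_exists[OF four] by blast
  have "f3 (a + x *s a') b = (\<Sum>u\<in>nodes D. kap D u * f2 (a + u *s w + x *s a') b)" for x
  proof (cases "a + x *s a' = 0")
    case True
    then have "a + u *s w + x *s a' = u *s w" for u by (simp add: algebra_simps)
    then show ?thesis unfolding True by (simp only: f3_0[OF outside_nonzero[OF w]])
  next
    case False
    have "outside w (a + x *s a') 0 0" unfolding outside_def
    proof (intro allI impI)
      fix y z t r assume "r *s w = y *s (a + x *s a') + z *s 0 + t *s 0"
      then have "r *s w = y *s a + (y * x) *s a' + 0 *s 0" by (simp add: algebra_simps)
      then show "r = 0" by (rule outsideD[OF w])
    qed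
    then have "ind2 (a + x *s a') w" using ind2_outside[OF False] by blast
    then have "f2 (a + x *s a') b = (\<Sum>u\<in>nodes D. kap D u * f2 (a + x *s a' + u *s w) b)"
      by (rule f2_extrapolate)
    moreover have "a + x *s a' + u *s w = a + u *s w + x *s a'" for u by (simp add: add_ac)
    ultimately show ?thesis using False by (simp only: f3_def if_False)
  qed
  moreover have "poly_le D (\<lambda>x. f2 (a + u *s w + x *s a') b)" if "u \<in> nodes D" for u
  proof (rule f2_fst_line, unfold ind2_def, intro allI impI)
    fix x y assume *: "x *s (a + u *s w) + y *s a' = 0"
    then have "(x * u) *s w = (- x) *s a + (- y) *s a' + 0 *s 0"
      by (simp add: algebra_simps add_eq_0_iff)
    then have "x = 0" using outsideD[OF w] nodes_nonzero[OF that] by fastforce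
    then show "x = 0 \<and> y = 0" using * a' by (auto simp: vec.scale_eq_0_iff)
  qed
  ultimately show ?thesis by (simp add: poly_le_sum)
qed

lemma f3_snd_line: "poly_le D (\<lambda>x. f3 a (b + x *s b'))"
proof (cases "b' = 0")
  case True
  then show ?thesis by (simp add: poly_le_const)
next
  case b': False
  obtain w where w: "outside w a b' 0" using outside_exists[OF four] by blast
  have "f3 a c = (\<Sum>u\<in>nodes D. kap D u * f2 (a + u *s w) c)" for c
  proof (cases "a = 0")
    case True
    then show ?thesis using f3_0[OF outside_nonzero[OF w]] by simp
  next
    case False
    from f2_extrapolate[OF ind2_outside[OF this w]] show ?thesis using False by (simp only: f3_def if_False)
  qed
  moreover have "poly_le D (\<lambda>x. f2 (a + u *s w) (b + x *s b'))" if "u \<in> nodes D" for u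
  proof (rule f2_snd_line, unfold ind2_def, intro allI impI)
    fix x y assume *: "x *s (a + u *s w) + y *s b' = 0"
    then have "(x * u) *s w = (- x) *s a + (- y) *s b' + 0 *s 0"
      by (simp add: algebra_simps add_eq_0_iff)
    then have "x = 0" using outsideD[OF w] nodes_nonzero[OF that] by fastforce
    then show "x = 0 \<and> y = 0" using * b' by (auto simp: vec.scale_eq_0_iff)
  qed
  ultimately show ?thesis by (simp add: poly_le_sum)
qed

lemma f3_ind2: "ind2 a b \<Longrightarrow> f3 a b = f a b"
  using f2_ind2[of a b] ind2_nonzero[of a b 0] by (simp add: f3_def)

end

text \<open>The variables are released one at a time, each by Lagrange interpolation; the common
  degree bound is what allows fixed nodes.\<close>

lemma polyfun_of_coordinate_lines:
  fixes f :: "('i::finite \<Rightarrow> 'k::field_char_0) \<Rightarrow> 'k"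
  assumes "\<And>p i. poly_le D (\<lambda>x. f (p(i := x)))"
  shows "polyfun f"
proof -
  have "polyfun (\<lambda>p. f (\<lambda>i. if i \<in> A then p i else p0 i))" if "finite A" for A p0
    using that
  proof (induction A arbitrary: p0 rule: finite_induct)
    case empty
    then show ?case by (simp add: polyfun_const)
  next
    case (insert i A)
    have "f (\<lambda>j. if j \<in> insert i A then p j else p0 j)
        = (\<Sum>s\<in>nodes D. lagr (nodes D) s (p i) * f (\<lambda>j. if j \<in> A then p j else (p0(i := s)) j))" for p
    proof -
      let ?p = "\<lambda>j. if j \<in> A then p j else p0 j"
      obtain q where q: "degree q \<le> D" "\<And>x. f (?p(i := x)) = poly q x"
        using assms[of ?p i] unfolding poly_le_def by blast
      have "(\<lambda>j. if j \<in> insert i A then p j else p0 j) = ?p(i := p i)" by auto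
      moreover have "(\<lambda>j. if j \<in> A then p j else (p0(i := s)) j) = ?p(i := s)" for s
        using insert.hyps by auto
      ultimately show ?thesis
        using q(1) by (simp add: q(2) card_nodes less_Suc_eq_le flip: lagr_interp)
    qed
    moreover have "polyfun (\<lambda>p. \<Sum>s\<in>nodes D. lagr (nodes D) s (p i) * f (\<lambda>j. if j \<in> A then p j else (p0(i := s)) j))"
      by (intro polyfun_sum polyfun_mult insert.IH) (auto intro: polyfun_poly[OF polyfun_var] simp flip: poly_lagr_poly)
    ultimately show ?case by simp
  qed
  from this[of UNIV] show ?thesis by simp
qed

definition row :: "bool \<Rightarrow> ('n \<times> bool \<Rightarrow> 'k) \<Rightarrow> 'k^'n" where
  "row r p = (\<chi> i. p (i, r))"

definition mat_of :: "'k^'n \<Rightarrow> 'k^'n \<Rightarrow> 'n \<times> bool \<Rightarrow> 'k" where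
  "mat_of a b = (\<lambda>(i, r). if r then a $ i else b $ i)"

lemma row_mat_of [simp]: "row True (mat_of a b) = a" "row False (mat_of a b) = b"
  by (auto simp: row_def mat_of_def vec_eq_iff)

lemma mat_of_row [simp]: "mat_of (row True p) (row False p) = p"
  by (auto simp: row_def mat_of_def)

theorem row_extension_polyfun:
  fixes f :: "'k::field_char_0^'n::finite \<Rightarrow> 'k^'n \<Rightarrow> 'k"
  assumes "CARD('n) \<ge> 4"
    and "\<And>a b b'. ind3 a b b' \<Longrightarrow> poly_le D (\<lambda>x. f a (b + x *s b'))"
    and "\<And>a a' b. ind3 a a' b \<Longrightarrow> poly_le D (\<lambda>x. f (a + x *s a') b)"
  obtains F where "polyfun F" "\<And>a b. ind2 a b \<Longrightarrow> F (mat_of a b) = f a b"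
proof -
  interpret row_extension f D using assms by unfold_locales auto
  \<comment> \<open>Changing one coordinate of the matrix moves a single row along a line in an axis
    direction.\<close>
  have upd: "row r (p((i, s) := x)) = (if r = s then (row r p - p (i, r) *s axis i 1) + x *s axis i 1 else row r p)"
    for r s i p and x :: 'k
    by (auto simp: row_def vec_eq_iff axis_def)
  have "polyfun (\<lambda>p. f3 (row True p) (row False p))"
  proof (rule polyfun_of_coordinate_lines)
    fix p :: "'n \<times> bool \<Rightarrow> 'k" and c :: "'n \<times> bool"
    obtain i s where "c = (i, s)" by (cases c)
    then show "poly_le D (\<lambda>x. f3 (row True (p(c := x))) (row False (p(c := x))))"
      by (cases s) (simp_all add: upd f3_fst_line f3_snd_line)
  qed
  then show ?thesis by (rule that) (simp add: f3_ind2)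
qed

section \<open>Binary forms\<close>

text \<open>Binary forms of degree \<open>N\<close> are dehomogenised to polynomials of degree at most \<open>N\<close>;
  \<open>hsub N P A B\<close> substitutes \<open>A\<close> and \<open>B\<close> for the two variables, and
  \<open>Dz N z\<close> is the derivation that sends a vector \<open>y\<close> to the scalar \<open>y \<wedge> z\<close>.\<close>

definition lin :: "'k::field \<times> 'k \<Rightarrow> 'k poly" where
  "lin z = [:fst z, snd z:]"

definition det2 :: "'k::field \<times> 'k \<Rightarrow> 'k \<times> 'k \<Rightarrow> 'k" where
  "det2 y z = fst y * snd z - snd y * fst z"

definition hsub :: "nat \<Rightarrow> 'k::field poly \<Rightarrow> 'k poly \<Rightarrow> 'k poly \<Rightarrow> 'k poly" where
  "hsub N P A B = (\<Sum>i\<le>N. psmult (coeff P i) (A ^ (N - i) * B ^ i))"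

definition Dz :: "nat \<Rightarrow> 'k::field \<times> 'k \<Rightarrow> 'k poly \<Rightarrow> 'k poly" where
  "Dz N z P = psmult (of_nat N * snd z) P - lin z * pderiv P"

lemma degree_lin: "degree (lin z) \<le> 1"
  by (simp add: lin_def)

lemma degree_prod_lin: "degree (\<Prod>y\<leftarrow>ys. lin (z y)) \<le> length ys"
proof (induction ys)
  case (Cons y ys)
  then show ?case using degree_mult_le[of "lin (z y)" "\<Prod>y\<leftarrow>ys. lin (z y)"] degree_lin[of "z y"] by simp
qed simp

lemma psmult_sum: "psmult c (\<Sum>i\<in>I. f i) = (\<Sum>i\<in>I. psmult c (f i))"
  by (induction I rule: infinite_finite_induct) (simp_all add: smult_add_right)

lemma hsub_add: "hsub N (P + Q) A B = hsub N P A B + hsub N Q A B"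
  by (simp add: hsub_def smult_add_left sum.distrib)

lemma hsub_smult: "hsub N (psmult c P) A B = psmult c (hsub N P A B)"
  by (simp add: hsub_def psmult_sum)

lemma hsub_0: "hsub N 0 A B = 0"
  by (simp add: hsub_def)

lemma hsub_sum: "hsub N (\<Sum>i\<in>I. P i) A B = (\<Sum>i\<in>I. hsub N (P i) A B)"
  by (induction I rule: infinite_finite_induct) (simp_all add: hsub_add hsub_0)

lemma hsub_monom: "i \<le> N \<Longrightarrow> hsub N (monom c i) A B = psmult c (A ^ (N - i) * B ^ i)"
  by (simp add: hsub_def if_distrib[of "\<lambda>c. psmult c _"] cong: if_cong)

lemma poly_sum_monoms: "degree P \<le> N \<Longrightarrow> P = (\<Sum>i\<le>N. monom (coeff P i) i)"
  by (simp add: poly_as_sum_of_monoms')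

lemma hsub_mult:
  assumes "degree P \<le> N" "degree Q \<le> M"
  shows "hsub (N + M) (P * Q) A B = hsub N P A B * hsub M Q A B"
proof -
  have "P * Q = (\<Sum>i\<le>N. \<Sum>j\<le>M. monom (coeff P i * coeff Q j) (i + j))"
    by (subst poly_sum_monoms[OF assms(1)], subst poly_sum_monoms[OF assms(2)])
      (simp add: sum_product mult_monom)
  then have "hsub (N + M) (P * Q) A B
      = (\<Sum>i\<le>N. \<Sum>j\<le>M. psmult (coeff P i * coeff Q j) (A ^ (N + M - (i + j)) * B ^ (i + j)))"
    by (simp add: hsub_sum hsub_monom)
  also have "\<dots> = (\<Sum>i\<le>N. \<Sum>j\<le>M. psmult (coeff P i) (A ^ (N - i) * B ^ i) * psmult (coeff Q j) (A ^ (M - j) * B ^ j))"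
  proof (intro sum.cong refl)
    fix i j assume "i \<in> {..N}" "j \<in> {..M}"
    then have "N + M - (i + j) = (N - i) + (M - j)" by auto
    then show "psmult (coeff P i * coeff Q j) (A ^ (N + M - (i + j)) * B ^ (i + j))
      = psmult (coeff P i) (A ^ (N - i) * B ^ i) * psmult (coeff Q j) (A ^ (M - j) * B ^ j)"
      by (simp only: power_add) (simp add: mult_ac)
  qed
  also have "\<dots> = hsub N P A B * hsub M Q A B"
    by (simp add: hsub_def sum_product)
  finally show ?thesis .
qed

lemma hsub_power:
  assumes "degree P \<le> 1" shows "hsub n (P ^ n) A B = hsub 1 P A B ^ n"
proof (induction n)
  case 0
  show ?case by (simp add: hsub_def)
next
  case (Suc n)
  have "degree (P ^ n) \<le> n" using degree_power_le[of P n] assms by (metis le_trans mult_le_mono1 mult_1)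
  then show ?case using hsub_mult[OF assms, of "P ^ n" n] Suc by simp
qed

lemma degree_hsub_le:
  assumes "degree A \<le> 1" "degree B \<le> 1" shows "degree (hsub N P A B) \<le> N"
  unfolding hsub_def
proof (rule degree_sum_le)
  fix i assume i: "i \<in> {..N}"
  have "degree (A ^ (N - i) * B ^ i) \<le> degree A * (N - i) + degree B * i"
    using degree_mult_le degree_power_le add_mono order.trans by meson
  also have "\<dots> \<le> 1 * (N - i) + 1 * i" using assms by (intro add_mono mult_mono) auto
  also have "\<dots> = N" using i by simp
  finally show "degree (psmult (coeff P i) (A ^ (N - i) * B ^ i)) \<le> N"
    using degree_smult_le order.trans by blast
qed simp

lemma hsub_hsub:
  assumes "degree A \<le> 1" "degree B \<le> 1"
  shows "hsub N (hsub N P A B) C D = hsub N P (hsub 1 A C D) (hsub 1 B C D)"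
proof -
  have d: "degree (X ^ n) \<le> n" if "degree X \<le> 1" for X :: "'a poly" and n
    using degree_power_le[of X n] that by (metis le_trans mult_le_mono1 mult_1)
  have "hsub N (A ^ (N - i) * B ^ i) C D = hsub 1 A C D ^ (N - i) * hsub 1 B C D ^ i" if "i \<le> N" for i
    using hsub_mult[OF d[OF assms(1), of "N - i"] d[OF assms(2), of i]] that
    by (simp add: hsub_power[OF assms(1)] hsub_power[OF assms(2)] del: One_nat_def)
  then show ?thesis
    unfolding hsub_def[of N P] by (simp add: hsub_sum hsub_smult)
qed

definition heval :: "nat \<Rightarrow> 'k::field poly \<Rightarrow> 'k \<Rightarrow> 'k \<Rightarrow> 'k" where
  "heval N P x y = (\<Sum>i\<le>N. coeff P i * (x ^ (N - i) * y ^ i))"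

text \<open>Evaluation is the substitution of constants, so the product and composition rules of
  \<open>hsub\<close> carry over to \<open>heval\<close>.\<close>

lemma hsub_heval: "hsub N P [:x:] [:y:] = [:heval N P x y:]"
proof -
  have "(\<Sum>i\<le>M. [:g i:]) = [:\<Sum>i\<le>M. g i:]" for M and g :: "nat \<Rightarrow> 'a" by (induction M) auto
  then show ?thesis by (simp add: hsub_def heval_def poly_const_pow mult_ac)
qed

lemma heval_add: "heval N (P + Q) x y = heval N P x y + heval N Q x y"
  by (simp add: heval_def distrib_right sum.distrib)

lemma heval_smult: "heval N (psmult c P) x y = c * heval N P x y"
  by (simp add: heval_def sum_distrib_left mult_ac)

lemma heval_sum: "heval N (\<Sum>i\<in>I. P i) x y = (\<Sum>i\<in>I. heval N (P i) x y)"
  by (induction I rule: infinite_finite_induct) (auto simp: heval_add, auto simp: heval_def)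

lemma heval_mult:
  "degree P \<le> N \<Longrightarrow> degree Q \<le> M \<Longrightarrow> heval (N + M) (P * Q) x y = heval N P x y * heval M Q x y"
  using hsub_mult[of P N Q M "[:x:]" "[:y:]"] by (simp add: hsub_heval)

lemma heval_lin: "heval 1 (lin z) x y = fst z * x + snd z * y"
  by (simp add: heval_def lin_def)

lemma heval_power: "degree P \<le> 1 \<Longrightarrow> heval n (P ^ n) x y = heval 1 P x y ^ n"
  using hsub_power[of P n "[:x:]" "[:y:]"] by (simp add: hsub_heval poly_const_pow)

lemma heval_hsub:
  assumes "degree A \<le> 1" "degree B \<le> 1"
  shows "heval N (hsub N P A B) x y = heval N P (heval 1 A x y) (heval 1 B x y)"
  using hsub_hsub[OF assms, of N P "[:x:]" "[:y:]"] by (simp add: hsub_heval)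

lemma heval_1: "degree P \<le> N \<Longrightarrow> heval N P 1 y = poly P y"
  by (subst (2) poly_sum_monoms[of P N]) (auto simp: poly_sum poly_monom heval_def)

lemma heval_eqI:
  fixes P Q :: "'k::field_char_0 poly"
  assumes "degree P \<le> N" "degree Q \<le> N" "\<And>x y. heval N P x y = heval N Q x y"
  shows "P = Q"
  using assms(3)[of 1] by (auto simp: heval_1 assms(1,2) simp flip: poly_eq_poly_eq_iff)

lemma heval_prod_lin:
  "heval (length vs) (\<Prod>v\<leftarrow>vs. lin (z v)) x y = (\<Prod>v\<leftarrow>vs. fst (z v) * x + snd (z v) * y)"
proof (induction vs)
  case Nil
  show ?case by (simp add: heval_def)
next
  case (Cons v vs)
  then show ?case
    using heval_mult[OF degree_lin[of "z v"] degree_prod_lin[where z = z and ys = vs], of x y]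
    by (simp add: heval_lin[simplified])
qed

section \<open>The derivation \<open>Dz\<close> and its commutation with multiplication\<close>

lemma Dz_add: "Dz N z (P + Q) = Dz N z P + Dz N z Q"
  by (simp add: Dz_def smult_add_right pderiv_add algebra_simps)

lemma Dz_smult: "Dz N z (psmult c P) = psmult c (Dz N z P)"
  by (simp add: Dz_def pderiv_smult smult_diff_right mult.commute)

lemma Dz_0: "Dz N z 0 = 0"
  by (simp add: Dz_def)

lemma Dz_sum: "Dz N z (\<Sum>i\<in>I. P i) = (\<Sum>i\<in>I. Dz N z (P i))"
  by (induction I rule: infinite_finite_induct) (auto simp: Dz_add Dz_0)

lemma Dz_mult: "Dz (N + M) z (P * Q) = Dz N z P * Q + P * Dz M z Q"
  by (simp add: Dz_def pderiv_mult smult_add_left algebra_simps)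

lemma Dz_lin: "Dz 1 z (lin y) = [:det2 y z:]"
  by (simp add: Dz_def lin_def det2_def pderiv_pCons algebra_simps)

text \<open>The commutation relation of g and f: meeting the new factor y, the derivation produces
  the scalar \<open>det2 y z\<close>.\<close>

lemma Dz_Suc_lin: "Dz (Suc N) z (lin y * P) = psmult (det2 y z) P + lin y * Dz N z P"
  using Dz_mult[of 1 N z "lin y" P] by (simp add: Dz_lin[simplified])

lemma Dz_power_lin: "Dz (Suc N) z (lin y ^ Suc N) = psmult (of_nat (Suc N) * det2 y z) (lin y ^ N)"
proof (induction N)
  case 0
  show ?case using Dz_Suc_lin[of 0 z y 1] by (simp add: Dz_def)
next
  case (Suc N)
  have "Dz (Suc (Suc N)) z (lin y * lin y ^ Suc N)
      = psmult (det2 y z) (lin y ^ Suc N) + lin y * psmult (of_nat (Suc N) * det2 y z) (lin y ^ N)"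
    unfolding Dz_Suc_lin Suc ..
  also have "\<dots> = psmult (of_nat (Suc (Suc N)) * det2 y z) (lin y ^ Suc N)"
    by (simp only: of_nat_Suc[of "Suc N"] distrib_right mult_1 smult_add_left mult_smult_right power_Suc)
  finally show ?case by (simp only: power_Suc)
qed

text \<open>The terms with \<open>pderiv P\<close> are equal and cancel; in the rest, eliminating
  the variable from \<open>lin v\<close> and \<open>lin w\<close> leaves the constant
  \<open>det2 v w\<close>.\<close>

lemma lin_Dz_exchange: "lin v * Dz N w P - lin w * Dz N v P = psmult (of_nat N * det2 v w) P"
proof -
  have "psmult (snd w) (lin v) - psmult (snd v) (lin w) = [:det2 v w:]"
    by (simp add: lin_def det2_def algebra_simps)
  then have "(psmult (snd w) (lin v) - psmult (snd v) (lin w)) * psmult (of_nat N) P = psmult (of_nat N * det2 v w) P"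
    by (simp add: mult.commute)
  then show ?thesis by (simp add: Dz_def algebra_simps)
qed

text \<open>This replaces the scalar \<open>v \<wedge> w\<close>, which is not itself a step, by a combination of paths.\<close>

lemma det2_as_paths:
  "psmult (of_nat (N + 2) * det2 v w) P = Dz (Suc N) w (lin v * P) - Dz (Suc N) v (lin w * P)"
proof -
  have "det2 w v = - det2 v w" by (simp add: det2_def algebra_simps)
  \<comment> \<open>Each of the two commutators contributes one copy of the scalar and the exchange
    contributes N copies, hence the factor \<open>N + 2\<close>.\<close>
  then have "Dz (Suc N) w (lin v * P) - Dz (Suc N) v (lin w * P)
      = psmult (det2 v w) P + psmult (det2 v w) P + (lin v * Dz N w P - lin w * Dz N v P)"
    by (simp only: Dz_Suc_lin smult_minus_left) (simp add: add_ac)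
  also have "\<dots> = psmult (det2 v w + det2 v w + of_nat N * det2 v w) P"
    by (simp only: lin_Dz_exchange smult_add_left)
  finally show ?thesis by (simp add: algebra_simps)
qed

text \<open>The coefficient of degree \<open>N + 1\<close> cancels because the scalar in
  \<open>Dz\<close> is exactly that degree times \<open>snd z\<close>.\<close>

lemma degree_Dz:
  assumes "degree P \<le> Suc N" shows "degree (Dz (Suc N) z P) \<le> N"
proof (rule degree_le, intro allI impI)
  fix i assume "N < i"
  then obtain m where m: "i = Suc m" "N \<le> m" by (cases i) auto
  have 0: "coeff P (Suc (Suc m)) = 0" using assms m by (intro coeff_eq_0) simp
  show "coeff (Dz (Suc N) z P) i = 0"
  proof (cases "m = N")
    case True
    then show ?thesis using 0 by (simp add: Dz_def lin_def m(1) coeff_pderiv del: of_nat_Suc)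
  next
    case False
    then have "coeff P (Suc m) = 0" using assms m by (intro coeff_eq_0) simp
    then show ?thesis using 0 by (simp add: Dz_def lin_def m(1) coeff_pderiv del: of_nat_Suc)
  qed
qed

section \<open>Paths and their span\<close>

primrec gops :: "nat \<Rightarrow> 'v list \<Rightarrow> ('v \<Rightarrow> 'k::field \<times> 'k) \<Rightarrow> 'k poly \<Rightarrow> 'k poly" where
  "gops N [] z P = P"
| "gops N (w # ws) z P = gops (N - 1) ws z (Dz N (z w) P)"

lemma gops_append: "gops N (ws @ ws') z P = gops (N - length ws) ws' z (gops N ws z P)"
  by (induction ws arbitrary: N P) (auto simp: diff_diff_eq)

lemma gops_add: "gops N ws z (P + Q) = gops N ws z P + gops N ws z Q"
  by (induction ws arbitrary: N P Q) (auto simp: Dz_add)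

lemma gops_smult: "gops N ws z (psmult c P) = psmult c (gops N ws z P)"
  by (induction ws arbitrary: N P) (auto simp: Dz_smult)

lemma gops_diff: "gops N ws z (P - Q) = gops N ws z P - gops N ws z Q"
  using gops_add[of N ws z P "psmult (-1) Q"] gops_smult[of N ws z "-1" Q] by simp

definition pth :: "nat \<Rightarrow> 'v list \<Rightarrow> 'v list \<Rightarrow> ('v \<Rightarrow> 'k::field \<times> 'k) \<Rightarrow> 'k poly \<Rightarrow> 'k poly" where
  "pth \<alpha> vs ws z P = gops (\<alpha> + length vs) ws z ((\<Prod>v\<leftarrow>vs. lin (z v)) * P)"

text \<open>The list L is chosen before the frame z and the form P. This uniformity is essential:
  the coefficients must be constants of the base field, not functions on the Grassmannian.\<close>

definition path_span :: "nat \<Rightarrow> nat \<Rightarrow> nat \<Rightarrow> (('v \<Rightarrow> 'k::field_char_0 \<times> 'k) \<Rightarrow> 'k poly \<Rightarrow> 'k poly) \<Rightarrow> bool" where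
  "path_span \<alpha> k l Op \<longleftrightarrow> (\<exists>L. (\<forall>(c, vs, ws)\<in>set L. length vs = k \<and> length ws = l) \<and>
     (\<forall>z P. Op z P = (\<Sum>(c, vs, ws)\<leftarrow>L. psmult c (pth \<alpha> vs ws z P))))"

lemma path_span_0: "path_span \<alpha> k l (\<lambda>z P. 0)"
  unfolding path_span_def by (intro exI[of _ "[]"]) auto

lemma path_span_pth:
  assumes "length vs = k" "length ws = l"
  shows "path_span \<alpha> k l (\<lambda>z P. psmult c (pth \<alpha> vs ws z P))"
  unfolding path_span_def by (intro exI[of _ "[(c, vs, ws)]"]) (auto simp: assms)

lemma path_span_add:
  assumes "path_span \<alpha> k l O1" "path_span \<alpha> k l O2"
  shows "path_span \<alpha> k l (\<lambda>z P. O1 z P + O2 z P)"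
proof -
  obtain L1 L2 where "\<forall>(c, vs, ws)\<in>set L1. length vs = k \<and> length ws = l"
    "\<forall>z P. O1 z P = (\<Sum>(c, vs, ws)\<leftarrow>L1. psmult c (pth \<alpha> vs ws z P))"
    "\<forall>(c, vs, ws)\<in>set L2. length vs = k \<and> length ws = l"
    "\<forall>z P. O2 z P = (\<Sum>(c, vs, ws)\<leftarrow>L2. psmult c (pth \<alpha> vs ws z P))"
    using assms unfolding path_span_def by metis
  then show ?thesis unfolding path_span_def by (intro exI[of _ "L1 @ L2"]) auto
qed

lemma path_span_linear:
  fixes T :: "('v \<Rightarrow> 'k::field_char_0 \<times> 'k) \<Rightarrow> 'k poly \<Rightarrow> 'k poly"
  assumes Op: "path_span \<alpha> k l Op"
    and add: "\<And>z P Q. T z (P + Q) = T z P + T z Q"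
    and smult: "\<And>z c P. T z (psmult c P) = psmult c (T z P)"
    and pth: "\<And>c vs ws. length vs = k \<Longrightarrow> length ws = l
      \<Longrightarrow> path_span \<alpha> k' l' (\<lambda>z P. psmult c (T z (pth \<alpha> vs ws z P)))"
  shows "path_span \<alpha> k' l' (\<lambda>z P. T z (Op z P))"
proof -
  obtain L where L: "\<forall>(c, vs, ws)\<in>set L. length vs = k \<and> length ws = l"
    "\<And>z P. Op z P = (\<Sum>(c, vs, ws)\<leftarrow>L. psmult c (pth \<alpha> vs ws z P))"
    using Op unfolding path_span_def by metis
  have zero: "T z 0 = 0" for z using smult[of z 0 0] by simp
  have "path_span \<alpha> k' l' (\<lambda>z P. T z (\<Sum>(c, vs, ws)\<leftarrow>L. psmult c (pth \<alpha> vs ws z P)))"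
    using L(1)
  proof (induction L)
    case Nil
    show ?case by (simp add: zero path_span_0)
  next
    case (Cons x L)
    obtain c vs ws where x: "x = (c, vs, ws)" by (cases x)
    show ?case using Cons by (simp add: x add smult path_span_add pth)
  qed
  then show ?thesis by (simp add: L(2))
qed

lemma path_span_smult:
  assumes "path_span \<alpha> k l Op" shows "path_span \<alpha> k l (\<lambda>z P. psmult c (Op z P))"
  using assms by (rule path_span_linear) (auto simp: smult_add_right mult.commute path_span_pth)

lemma path_span_Dz:
  fixes Op :: "('v \<Rightarrow> 'k::field_char_0 \<times> 'k) \<Rightarrow> 'k poly \<Rightarrow> 'k poly"
  assumes "path_span \<alpha> k l Op"
  shows "path_span \<alpha> k (Suc l) (\<lambda>z P. Dz (\<alpha> + k - l) (z w) (Op z P))"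
  using assms
proof (rule path_span_linear)
  fix c :: 'k and vs ws :: "'v list" assume *: "length vs = k" "length ws = l"
  then have "Dz (\<alpha> + k - l) (z w) (pth \<alpha> vs ws z P) = pth \<alpha> vs (ws @ [w]) z P" for z :: "'v \<Rightarrow> 'k \<times> 'k" and P
    by (simp add: pth_def gops_append)
  then show "path_span \<alpha> k (Suc l) (\<lambda>z P. psmult c (Dz (\<alpha> + k - l) (z w) (pth \<alpha> vs ws z P)))"
    using * by (simp add: path_span_pth)
qed (auto simp: Dz_add Dz_smult)

text \<open>A scalar commutes with all steps g, so it can be placed between the steps f and the
  steps g. There the degree is \<open>\<alpha> + k\<close>, and \<open>det2_as_paths\<close> splits
  the scalar into two paths longer by one step of each kind.\<close>

lemma path_span_det2:
  fixes Op :: "('v \<Rightarrow> 'k::field_char_0 \<times> 'k) \<Rightarrow> 'k poly \<Rightarrow> 'k poly"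
  assumes "path_span \<alpha> k l Op"
  shows "path_span \<alpha> (Suc k) (Suc l) (\<lambda>z P. psmult (det2 (z v) (z w)) (Op z P))"
  using assms
proof (rule path_span_linear)
  fix c :: 'k and vs ws :: "'v list" assume *: "length vs = k" "length ws = l"
  define N where "N = \<alpha> + k"
  define d :: 'k where "d = inverse (of_nat (N + 2))"
  have d: "d * of_nat (N + 2) = 1" unfolding d_def by (rule left_inverse) (unfold of_nat_eq_0_iff, simp)
  have "psmult (det2 (z v) (z w)) (pth \<alpha> vs ws z P)
      = psmult d (pth \<alpha> (v # vs) (w # ws) z P) + psmult (- d) (pth \<alpha> (w # vs) (v # ws) z P)" for z P
  proof -
    define F where "F = (\<Prod>v\<leftarrow>vs. lin (z v)) * P"
    have "psmult (det2 (z v) (z w)) (pth \<alpha> vs ws z P)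
        = psmult d (gops N ws z (psmult (of_nat (N + 2) * det2 (z v) (z w)) F))"
      by (simp only: pth_def * N_def[symmetric] F_def[symmetric] gops_smult smult_smult mult.assoc[symmetric] d mult_1)
    also have "\<dots> = psmult d (gops N ws z (Dz (Suc N) (z w) (lin (z v) * F))
        - gops N ws z (Dz (Suc N) (z v) (lin (z w) * F)))"
      by (simp only: det2_as_paths gops_diff)
    finally show ?thesis
      by (simp add: pth_def * N_def F_def smult_diff_right mult.assoc)
  qed
  then show "path_span \<alpha> (Suc k) (Suc l) (\<lambda>z P. psmult c (psmult (det2 (z v) (z w)) (pth \<alpha> vs ws z P)))"
    using * by (simp add: smult_add_right del: smult_minus_left)
      (intro path_span_add path_span_pth; simp)
qed (auto simp: smult_add_right mult.commute)

text \<open>A step f applied last is moved past the steps g one at a time from the end: commuting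
  with the last g leaves a multiple of \<open>det2\<close>, which is again a combination of paths.
  The bound on l keeps the truncated subtraction of degrees exact.\<close>

lemma path_span_lin:
  fixes Op :: "('v \<Rightarrow> 'k::field_char_0 \<times> 'k) \<Rightarrow> 'k poly \<Rightarrow> 'k poly"
  assumes "path_span \<alpha> k l Op" "l \<le> \<alpha> + k"
  shows "path_span \<alpha> (Suc k) l (\<lambda>(z :: 'v \<Rightarrow> 'k \<times> 'k) P. lin (z v) * Op z P)"
  using assms(1)
proof (rule path_span_linear)
  fix c :: 'k and vs ws :: "'v list" assume *: "length vs = k" "length ws = l"
  have "path_span \<alpha> (Suc k) (length ws) (\<lambda>(z :: 'v \<Rightarrow> 'k \<times> 'k) P. lin (z v) * pth \<alpha> vs ws z P)" if "length ws \<le> \<alpha> + k" for ws :: "'v list"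
    using that
  proof (induction ws rule: rev_induct)
    case Nil
    have "path_span \<alpha> (Suc k) 0 (\<lambda>(z :: 'v \<Rightarrow> 'k \<times> 'k) P. psmult 1 (pth \<alpha> (v # vs) [] z P))"
      by (rule path_span_pth) (auto simp: *)
    then show ?case by (simp add: pth_def mult.assoc)
  next
    case (snoc w ws)
    define M where "M = \<alpha> + k - length (ws @ [w])"
    have M: "\<alpha> + k - length ws = Suc M" "\<alpha> + Suc k - length ws = Suc (Suc M)" using snoc.prems by (auto simp: M_def)
    have eq: "lin (z v) * pth \<alpha> vs (ws @ [w]) z P =
        Dz (\<alpha> + Suc k - length ws) (z w) (lin (z v) * pth \<alpha> vs ws z P) + psmult (-1) (psmult (det2 (z v) (z w)) (pth \<alpha> vs ws z P))" for z P
      unfolding M by (simp add: pth_def gops_append * M Dz_Suc_lin)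
    have A: "path_span \<alpha> (Suc k) (Suc (length ws)) (\<lambda>(z :: 'v \<Rightarrow> 'k \<times> 'k) P. Dz (\<alpha> + Suc k - length ws) (z w) (lin (z v) * pth \<alpha> vs ws z P))"
      by (rule path_span_Dz) (use snoc in simp)
    have "path_span \<alpha> k (length ws) (\<lambda>(z :: 'v \<Rightarrow> 'k \<times> 'k) P. pth \<alpha> vs ws z P)"
      using path_span_pth[OF *(1) refl, where \<alpha> = \<alpha> and ws = ws and c = 1] by simp
    then have B: "path_span \<alpha> (Suc k) (Suc (length ws)) (\<lambda>(z :: 'v \<Rightarrow> 'k \<times> 'k) P. psmult (-1) (psmult (det2 (z v) (z w)) (pth \<alpha> vs ws z P)))"
      by (intro path_span_smult path_span_det2)
    show ?case unfolding eq using path_span_add[OF A B] by simp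
  qed
  from path_span_smult[OF this[of ws]] show "path_span \<alpha> (Suc k) l (\<lambda>(z :: 'v \<Rightarrow> 'k \<times> 'k) P. psmult c (lin (z v) * pth \<alpha> vs ws z P))"
    using * assms(2) by simp
qed (auto simp: algebra_simps)

lemma path_span_prod_lin:
  assumes "path_span \<alpha> k l Op" "l \<le> \<alpha> + k"
  shows "path_span \<alpha> (k + length vs) l (\<lambda>z P. (\<Prod>v\<leftarrow>vs. lin (z v)) * Op z P)"
proof (induction vs)
  case (Cons v vs)
  have "path_span \<alpha> (Suc (k + length vs)) l (\<lambda>z P. lin (z v) * ((\<Prod>v\<leftarrow>vs. lin (z v)) * Op z P))"
    using Cons assms(2) by (intro path_span_lin) auto
  then show ?case by (simp add: mult.assoc)
qed (simp add: assms)

lemma path_span_prod_det2: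
  assumes "path_span \<alpha> k l Op"
  shows "path_span \<alpha> (k + length Z) (l + length Z) (\<lambda>z P. psmult (\<Prod>(v, w)\<leftarrow>Z. det2 (z v) (z w)) (Op z P))"
proof (induction Z)
  case (Cons x Z)
  obtain v w where x: "x = (v, w)" by (cases x)
  have "path_span \<alpha> (Suc (k + length Z)) (Suc (l + length Z)) (\<lambda>z P. psmult (det2 (z v) (z w)) (psmult (\<Prod>(v, w)\<leftarrow>Z. det2 (z v) (z w)) (Op z P)))"
    by (intro path_span_det2 Cons)
  then show ?case by (simp add: x)
qed (simp add: assms)

lemma path_span_gops: "path_span \<alpha> 0 (length ws) (\<lambda>z P. gops \<alpha> ws z P)"
  using path_span_pth[where vs = "[]" and ws = ws and \<alpha> = \<alpha> and c = 1, OF refl refl] by (simp add: pth_def)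

section \<open>Quotient modules\<close>

definition cls :: "'a::ab_group_add set \<Rightarrow> 'a \<Rightarrow> 'a set" where
  "cls N x = {q. q - x \<in> N}"

context vector_space
begin

lemma cls_eq_iff:
  assumes "subspace N" shows "cls N x = cls N y \<longleftrightarrow> x - y \<in> N"
proof
  assume "cls N x = cls N y"
  moreover have "x \<in> cls N x" using assms by (simp add: cls_def subspace_0)
  ultimately show "x - y \<in> N" by (simp add: cls_def)
next
  assume *: "x - y \<in> N"
  have "q - x \<in> N \<longleftrightarrow> q - y \<in> N" for q
    using subspace_add[OF assms *, of "q - x"] subspace_diff[OF assms _ *, of "q - y"] by auto
  then show "cls N x = cls N y" by (auto simp: cls_def)
qed

text \<open>The record is kept general because the facts serve three times: for the fibres of the
  tautological bundle, for their Schur powers and for the tensor product of Hom spaces.\<close>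

lemma quot_module_facts:
  fixes C N :: "'b set"
  defines "M \<equiv> \<lparr>carrier = C, mult = undefined, one = undefined, zero = 0, add = (+), smult = scale\<rparr>"
  assumes C: "subspace C" and N: "subspace N" and NC: "N \<subseteq> C"
  shows quot_coset: "N +>\<^bsub>M\<^esub> x = cls N x"
    and quot_carrier: "carrier (quot_module M N) = cls N ` C"
    and quot_zero: "\<zero>\<^bsub>quot_module M N\<^esub> = cls N 0"
    and quot_add: "cls N x \<oplus>\<^bsub>quot_module M N\<^esub> cls N y = cls N (x + y)"
    and quot_smult: "c \<odot>\<^bsub>quot_module M N\<^esub> cls N x = cls N (scale c x)"
proof -
  have coset: "N +>\<^bsub>M\<^esub> x = cls N x" for x
  proof -
    have "(\<exists>h\<in>N. q = h + x) \<longleftrightarrow> q - x \<in> N" for q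
      by (auto intro!: bexI[of _ "q - x"])
    moreover have "N +>\<^bsub>M\<^esub> x = {q. \<exists>h\<in>N. q = h + x}" by (auto simp: a_r_coset_def' M_def)
    ultimately show ?thesis by (simp add: cls_def)
  qed
  show "N +>\<^bsub>M\<^esub> x = cls N x" by (rule coset)
  show "carrier (quot_module M N) = cls N ` C"
  proof -
    have "carrier (quot_module M N) = (\<Union>x\<in>C. {N +>\<^bsub>M\<^esub> x})"
      by (simp add: quot_module_def A_RCOSETS_def' M_def)
    then show ?thesis unfolding coset by blast
  qed
  show "\<zero>\<^bsub>quot_module M N\<^esub> = cls N 0" by (simp add: quot_module_def cls_def)
  show "cls N x \<oplus>\<^bsub>quot_module M N\<^esub> cls N y = cls N (x + y)"
  proof -
    have "(\<exists>h\<in>cls N x. \<exists>k\<in>cls N y. q = h + k) \<longleftrightarrow> q - (x + y) \<in> N" for q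
    proof
      assume "\<exists>h\<in>cls N x. \<exists>k\<in>cls N y. q = h + k"
      then obtain h k where "h - x \<in> N" "k - y \<in> N" "q = h + k" by (auto simp: cls_def)
      then show "q - (x + y) \<in> N" using subspace_add[OF N, of "h - x" "k - y"] by (simp add: algebra_simps)
    next
      assume "q - (x + y) \<in> N"
      then have "q - y \<in> cls N x" "y \<in> cls N y" using subspace_0[OF N] by (simp_all add: cls_def algebra_simps)
      moreover have "q = (q - y) + y" by simp
      ultimately show "\<exists>h\<in>cls N x. \<exists>k\<in>cls N y. q = h + k" by blast
    qed
    moreover have "cls N x \<oplus>\<^bsub>quot_module M N\<^esub> cls N y = {q. \<exists>h\<in>cls N x. \<exists>k\<in>cls N y. q = h + k}"
      unfolding quot_module_def by (simp add: set_add_def') (auto simp: M_def)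
    ultimately show ?thesis unfolding cls_def[of N "x + y"] by simp
  qed
  show "c \<odot>\<^bsub>quot_module M N\<^esub> cls N x = cls N (scale c x)"
  proof -
    have eq: "cls N (scale c q) = cls N (scale c x)" if "q \<in> cls N x" for q
    proof -
      have "scale c q - scale c x \<in> N"
        using that subspace_scale[OF N, of "q - x" c] by (simp add: cls_def scale_right_diff_distrib)
      then show ?thesis by (simp add: cls_eq_iff[OF N])
    qed
    have "x \<in> cls N x" using subspace_0[OF N] by (simp add: cls_def)
    then have "(\<Union>q\<in>cls N x. cls N (scale c x)) = cls N (scale c x)" by blast
    moreover have "(\<Union>q\<in>cls N x. cls N (scale c q)) = (\<Union>q\<in>cls N x. cls N (scale c x))"
      using eq by (intro SUP_cong) simp_all
    ultimately have "(\<Union>q\<in>cls N x. cls N (scale c q)) = cls N (scale c x)" by simp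
    moreover have "c \<odot>\<^bsub>quot_module M N\<^esub> cls N x = (\<Union>q\<in>cls N x. N +>\<^bsub>M\<^esub> (scale c q))"
      by (simp add: quot_module_def) (simp add: M_def)
    ultimately show ?thesis unfolding coset by simp
  qed
qed

end

section \<open>Schur powers of a plane\<close>

lemma keys_fscale: "Poly_Mapping.keys (fscale c p) \<subseteq> Poly_Mapping.keys p"
  by (auto simp: in_keys_iff lookup_fscale)

lemma keys_subspace: "free.subspace {p. Poly_Mapping.keys p \<subseteq> G}"
  unfolding free.subspace_def mem_Collect_eq
  by (auto dest!: subsetD[OF Poly_Mapping.keys_add] subsetD[OF keys_fscale])

lemma poly_mapping_sum_gen: "(\<Sum>w\<in>Poly_Mapping.keys p. fscale (Poly_Mapping.lookup p w) (gen w)) = p"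
proof (rule poly_mapping_eqI)
  fix v
  have "(\<Sum>w\<in>Poly_Mapping.keys p. Poly_Mapping.lookup p w * (if w = v then 1 else 0)) = Poly_Mapping.lookup p v"
    by (simp add: if_distrib[of "(*) _"] in_keys_iff cong: if_cong)
  then show "Poly_Mapping.lookup (\<Sum>w\<in>Poly_Mapping.keys p. fscale (Poly_Mapping.lookup p w) (gen w)) v = Poly_Mapping.lookup p v"
    by (simp add: lookup_sum lookup_fscale lookup_single when_def)
qed

definition ext :: "('w \<Rightarrow> 'k::field poly) \<Rightarrow> ('w \<Rightarrow>\<^sub>0 'k) \<Rightarrow> 'k poly" where
  "ext e p = (\<Sum>w\<in>Poly_Mapping.keys p. psmult (Poly_Mapping.lookup p w) (e w))"

lemma ext_superset:
  "finite S \<Longrightarrow> Poly_Mapping.keys p \<subseteq> S \<Longrightarrow> ext e p = (\<Sum>w\<in>S. psmult (Poly_Mapping.lookup p w) (e w))"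
  unfolding ext_def by (rule sum.mono_neutral_left) (auto simp: in_keys_iff)

lemma ext_add: "ext e (p + q) = ext e p + ext e q"
  using Poly_Mapping.keys_add[of p q]
    ext_superset[of "Poly_Mapping.keys p \<union> Poly_Mapping.keys q" p e]
    ext_superset[of "Poly_Mapping.keys p \<union> Poly_Mapping.keys q" q e]
    ext_superset[of "Poly_Mapping.keys p \<union> Poly_Mapping.keys q" "p + q" e]
  by (simp add: lookup_add smult_add_left sum.distrib)

lemma ext_fscale: "ext e (fscale c p) = psmult c (ext e p)"
proof -
  show ?thesis
    using keys_fscale[of c p] ext_superset[of "Poly_Mapping.keys p" "fscale c p" e]
    by (simp add: ext_def lookup_fscale psmult_sum)
qed

lemma ext_gen [simp]: "ext e (gen w) = e w"
  by (simp add: ext_def)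

lemma ext_0 [simp]: "ext e 0 = 0"
  by (simp add: ext_def)

lemma ext_diff: "ext e (p - q) = ext e p - ext e q"
  using ext_add[of e "p - q" q] by simp

lemma ext_sum: "ext e (\<Sum>i\<in>I. p i) = (\<Sum>i\<in>I. ext e (p i))"
  by (induction I rule: infinite_finite_induct) (auto simp: ext_add)

lemma ext_lin_ext: "ext e (lin_ext h p) = ext (\<lambda>w. ext e (h w)) p"
  unfolding lin_ext_def by (simp add: ext_sum ext_fscale ext_def[of _ p])

lemma ext_subspace: "free.subspace {p. ext e p = 0}"
  by (rule free.subspaceI) (auto simp: ext_add ext_fscale)

lemma keys_lin_ext:
  assumes "\<And>w. w \<in> Poly_Mapping.keys p \<Longrightarrow> Poly_Mapping.keys (h w) \<subseteq> G"
  shows "Poly_Mapping.keys (lin_ext h p) \<subseteq> G"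
proof -
  have "lin_ext h p \<in> {p. Poly_Mapping.keys p \<subseteq> G}"
    unfolding lin_ext_def using assms
    by (intro free.subspace_sum[OF keys_subspace] free.subspace_scale[OF keys_subspace]) simp
  then show ?thesis by simp
qed

section \<open>Words of a Schur power as binary forms\<close>

definition sdeg :: "int \<times> int \<Rightarrow> nat" where
  "sdeg l = nat (fst l - snd l)"

definition is_part :: "int \<times> int \<Rightarrow> bool" where
  "is_part l \<longleftrightarrow> snd l \<le> fst l \<and> 0 \<le> snd l"

lemma deg_eq: "deg l = 2 * wedges l + sdeg l"
  by (simp add: deg_def sdeg_def)

lemma part_e1:
  assumes "is_part l"
  shows "is_part (l + e1)" "wedges (l + e1) = wedges l" "sdeg (l + e1) = Suc (sdeg l)"
    "deg (l + e1) = Suc (deg l)"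
  using assms by (auto simp: is_part_def wedges_def sdeg_def e1_def deg_def plus_prod_def)

lemma part_e2:
  assumes "is_part l" "is_part (l + e2)"
  shows "wedges (l + e2) = Suc (wedges l)" "sdeg l = Suc (sdeg (l + e2))" "deg (l + e2) = Suc (deg l)"
  using assms by (auto simp: is_part_def wedges_def sdeg_def e2_def deg_def plus_prod_def)

definition wdet :: "('a \<Rightarrow> 'k::field \<times> 'k) \<Rightarrow> 'a list \<Rightarrow> nat \<Rightarrow> 'k" where
  "wdet \<theta> w a = det2 (\<theta> (w ! (2 * a))) (\<theta> (w ! (2 * a + 1)))"

text \<open>The exterior square of a plane is a line, so wedge factors become scalars and only the
  symmetric part contributes linear forms.\<close>

definition evw :: "int \<times> int \<Rightarrow> ('a \<Rightarrow> 'k::field \<times> 'k) \<Rightarrow> 'a list \<Rightarrow> 'k poly" where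
  "evw l \<theta> w = psmult (\<Prod>a<wedges l. wdet \<theta> w a) (\<Prod>y\<leftarrow>drop (2 * wedges l) w. lin (\<theta> y))"

lemma prod_list_update_map:
  fixes f :: "'a \<Rightarrow> 'b::comm_monoid_mult"
  assumes "i < length ys"
  shows "(\<Prod>y\<leftarrow>ys[i := x]. f y) = f x * (\<Prod>y\<leftarrow>take i ys @ drop (Suc i) ys. f y)"
  using assms by (simp add: upd_conv_take_nth_drop mult_ac)

text \<open>Like its companions for wedge factors below, this isolates the entries that a relation
  touches; the relation then becomes an identity between linear forms and determinants.\<close>

lemma evw_update_sym:
  assumes "length w = deg l" "2 * wedges l \<le> i" "i < deg l"
  obtains c R where "\<And>x. evw l \<theta> (w[i := x]) = psmult c (lin (\<theta> x) * R)"
proof -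
  let ?j = "i - 2 * wedges l" and ?ys = "drop (2 * wedges l) w"
  have "wdet \<theta> (w[i := x]) a = wdet \<theta> w a" if "a < wedges l" for a x
    using that assms by (simp add: wdet_def)
  then have "evw l \<theta> (w[i := x]) = psmult (\<Prod>a<wedges l. wdet \<theta> w a)
      (lin (\<theta> x) * (\<Prod>y\<leftarrow>take ?j ?ys @ drop (Suc ?j) ?ys. lin (\<theta> y)))" for x
    using assms prod_list_update_map[of ?j ?ys "\<lambda>y. lin (\<theta> y)" x] by (simp add: evw_def drop_update_swap)
  then show ?thesis by (rule that)
qed

lemma evw_update_wedge:
  assumes "length w = deg l" "a < wedges l"
  obtains R where "\<And>x y. evw l \<theta> (w[2 * a := x, 2 * a + 1 := y]) = psmult (det2 (\<theta> x) (\<theta> y)) R"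
proof -
  have "wdet \<theta> (w[2 * a := x, 2 * a + 1 := y]) b = (if b = a then det2 (\<theta> x) (\<theta> y) else wdet \<theta> w b)"
    if "b < wedges l" for b x y
  proof (cases "b = a")
    case False
    then have "2 * b \<noteq> 2 * a" "2 * b \<noteq> 2 * a + 1" "2 * b + 1 \<noteq> 2 * a" "2 * b + 1 \<noteq> 2 * a + 1" by presburger+
    then show ?thesis using False by (simp add: wdet_def)
  qed (use assms in \<open>simp add: wdet_def deg_eq\<close>)
  then have "(\<Prod>b<wedges l. wdet \<theta> (w[2 * a := x, 2 * a + 1 := y]) b)
      = (\<Prod>b<wedges l. if b = a then det2 (\<theta> x) (\<theta> y) else wdet \<theta> w b)" for x y by (intro prod.cong) auto
  also have "(\<Prod>b<wedges l. if b = a then det2 (\<theta> x) (\<theta> y) else wdet \<theta> w b)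
      = det2 (\<theta> x) (\<theta> y) * (\<Prod>b\<in>{..<wedges l} - {a}. wdet \<theta> w b)" for x y
    using assms(2) by (subst prod.remove[of _ a]) auto
  finally have "evw l \<theta> (w[2 * a := x, 2 * a + 1 := y]) = psmult (det2 (\<theta> x) (\<theta> y))
      (psmult (\<Prod>b\<in>{..<wedges l} - {a}. wdet \<theta> w b) (\<Prod>y\<leftarrow>drop (2 * wedges l) w. lin (\<theta> y)))" for x y
    using assms(2) by (simp add: evw_def)
  then show ?thesis by (rule that)
qed

lemma sym_perm:
  assumes "mset ys = mset ys'" "length pre \<ge> 2 * wedges l"
  shows "evw l \<theta> (pre @ ys) = evw l \<theta> (pre @ ys')"
proof -
  have "wdet \<theta> (pre @ ys) a = wdet \<theta> (pre @ ys') a" if "a < wedges l" for a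
    using that assms(2) by (simp add: wdet_def nth_append)
  moreover have "(\<Prod>y\<leftarrow>ys. lin (\<theta> y)) = (\<Prod>y\<leftarrow>ys'. lin (\<theta> y))"
    using assms(1) by (metis mset_map prod_mset_prod_list)
  ultimately show ?thesis using assms(2) by (simp add: evw_def)
qed

text \<open>Coordinates are a bijection compatible with the operations, so a fibre of the bundle is
  an instance for each of its frames.\<close>

locale plane =
  fixes M :: "('k::field_char_0, 'a) module" and \<theta> :: "'a \<Rightarrow> 'k \<times> 'k"
  assumes bij: "bij_betw \<theta> (carrier M) UNIV"
    and theta_add: "x \<in> carrier M \<Longrightarrow> y \<in> carrier M \<Longrightarrow> \<theta> (x \<oplus>\<^bsub>M\<^esub> y) = \<theta> x + \<theta> y"
    and theta_smult: "x \<in> carrier M \<Longrightarrow> \<theta> (c \<odot>\<^bsub>M\<^esub> x) = (c * fst (\<theta> x), c * snd (\<theta> x))"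
    and add_closed: "x \<in> carrier M \<Longrightarrow> y \<in> carrier M \<Longrightarrow> x \<oplus>\<^bsub>M\<^esub> y \<in> carrier M"
    and smult_closed: "x \<in> carrier M \<Longrightarrow> c \<odot>\<^bsub>M\<^esub> x \<in> carrier M"
begin

lemma schur_words_iff: "w \<in> schur_words l M \<longleftrightarrow> length w = deg l \<and> set w \<subseteq> carrier M"
proof -
  have "w \<in> schur_words l M \<longleftrightarrow> length w = deg l \<and> (\<forall>i<length w. w ! i \<in> carrier M)"
    by (auto simp: schur_words_def words_def list_all2_conv_all_nth)
  then show ?thesis by (simp add: subset_code(1) all_set_conv_all_nth)
qed

lemma comb_closed: "x \<in> carrier M \<Longrightarrow> y \<in> carrier M \<Longrightarrow> c \<odot>\<^bsub>M\<^esub> x \<oplus>\<^bsub>M\<^esub> d \<odot>\<^bsub>M\<^esub> y \<in> carrier M"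
  by (simp add: add_closed smult_closed)

lemma theta_comb:
  "x \<in> carrier M \<Longrightarrow> y \<in> carrier M \<Longrightarrow> \<theta> (c \<odot>\<^bsub>M\<^esub> x \<oplus>\<^bsub>M\<^esub> d \<odot>\<^bsub>M\<^esub> y)
    = (c * fst (\<theta> x) + d * fst (\<theta> y), c * snd (\<theta> x) + d * snd (\<theta> y))"
  by (simp add: theta_add theta_smult smult_closed plus_prod_def)

lemma schur_words_update: "w \<in> schur_words l M \<Longrightarrow> x \<in> carrier M \<Longrightarrow> w[i := x] \<in> schur_words l M"
  using set_update_subset_insert[of w i x] by (auto simp: schur_words_iff)

lemma schur_words_nth: "w \<in> schur_words l M \<Longrightarrow> i < deg l \<Longrightarrow> w ! i \<in> carrier M"
  by (auto simp: schur_words_iff)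

lemma schur_words_swap: "w \<in> schur_words l M \<Longrightarrow> i < deg l \<Longrightarrow> j < deg l \<Longrightarrow> swap i j w \<in> schur_words l M"
  by (simp add: swap_def schur_words_update schur_words_nth)

lemma gen_words: "w \<in> schur_words l M \<Longrightarrow> gen w \<in> {p. Poly_Mapping.keys p \<subseteq> schur_words l M}"
  by simp

lemma schur_rels_cases:
  assumes "R \<in> schur_rels l M"
  obtains
      (multi) w i c d x y where "R = gen (w[i := c \<odot>\<^bsub>M\<^esub> x \<oplus>\<^bsub>M\<^esub> d \<odot>\<^bsub>M\<^esub> y]) - fscale c (gen (w[i := x])) - fscale d (gen (w[i := y]))"
        "w \<in> schur_words l M" "i < deg l" "x \<in> carrier M" "y \<in> carrier M"
    | (wedge) w a where "R = gen w" "w \<in> schur_words l M" "a < wedges l" "w ! (2 * a) = w ! (2 * a + 1)"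
    | (sym) w i j where "R = gen w - gen (swap i j w)" "w \<in> schur_words l M" "2 * wedges l \<le> i" "i < j" "j < deg l"
    | (ex1) w a j where "R = gen w - (gen (swap (2 * a) j w) + gen (swap (2 * a + 1) j w))"
        "w \<in> schur_words l M" "a < wedges l" "2 * a + 2 \<le> j" "j < deg l"
    | (ex2) w a b where "R = gen w - gen (swap (2 * a) (2 * b) (swap (2 * a + 1) (2 * b + 1) w))"
        "w \<in> schur_words l M" "a < b" "b < wedges l"
proof -
  from assms consider "R \<in> multilinear_rels (replicate (deg l) M)" | "R \<in> wedge_sym_rels l M"
    | "R \<in> exchange_rels1 l M" | "R \<in> exchange_rels2 l M"
    unfolding schur_rels_def by blast
  then show thesis
  proof cases
    case 1
    then obtain w i c d x y where *: "R = gen (w[i := c \<odot>\<^bsub>replicate (deg l) M ! i\<^esub> x \<oplus>\<^bsub>replicate (deg l) M ! i\<^esub> d \<odot>\<^bsub>replicate (deg l) M ! i\<^esub> y])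
        - fscale c (gen (w[i := x])) - fscale d (gen (w[i := y]))"
      "w \<in> schur_words l M" "i < length (replicate (deg l) M)" "x \<in> carrier (replicate (deg l) M ! i)" "y \<in> carrier (replicate (deg l) M ! i)"
      unfolding multilinear_rels_def schur_words_def by blast
    show thesis by (rule multi[where w = w and i = i and c = c and d = d and x = x and y = y]) (use * in simp_all)
  next
    case 2
    then show thesis using wedge sym unfolding wedge_sym_rels_def by blast
  next
    case 3
    then show thesis using ex1 unfolding exchange_rels1_def by blast
  next
    case 4
    then show thesis using ex2 unfolding exchange_rels2_def by blast
  qed
qed

lemma schur_rels_keys:
  assumes "R \<in> schur_rels l M" shows "Poly_Mapping.keys R \<subseteq> schur_words l M"
proof -
  note S = keys_subspace[of "schur_words l M"]
  note I = free.subspace_diff[OF S] free.subspace_add[OF S] free.subspace_scale[OF S] gen_words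
    schur_words_swap schur_words_update comb_closed
  have d: "2 * a < deg l" "2 * a + 1 < deg l" if "a < wedges l" for a using that by (auto simp: deg_eq)
  from assms have "R \<in> {p. Poly_Mapping.keys p \<subseteq> schur_words l M}"
  proof (cases rule: schur_rels_cases)
    case multi
    show ?thesis unfolding multi(1) by (intro I multi)
  next
    case wedge
    show ?thesis unfolding wedge(1) by (intro I wedge)
  next
    case sym
    then show ?thesis unfolding sym(1) by (intro I sym(2,5)) auto
  next
    case ex1
    show ?thesis unfolding ex1(1) by (intro I ex1 d)
  next
    case ex2
    then show ?thesis unfolding ex2(1) by (intro I ex2(2,4) d) auto
  qed
  then show ?thesis by simp
qed

lemma theta_inj: "x \<in> carrier M \<Longrightarrow> y \<in> carrier M \<Longrightarrow> \<theta> x = \<theta> y \<Longrightarrow> x = y"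
  using bij by (auto simp: bij_betw_def inj_on_def)

lemma evw_multi:
  assumes w: "length w = deg l" "i < deg l" and xy: "x \<in> carrier M" "y \<in> carrier M"
  shows "evw l \<theta> (w[i := c \<odot>\<^bsub>M\<^esub> x \<oplus>\<^bsub>M\<^esub> d \<odot>\<^bsub>M\<^esub> y])
    = psmult c (evw l \<theta> (w[i := x])) + psmult d (evw l \<theta> (w[i := y]))"
proof (cases "2 * wedges l \<le> i")
  case True
  obtain e R where R: "\<And>x. evw l \<theta> (w[i := x]) = psmult e (lin (\<theta> x) * R)"
    using evw_update_sym[OF w(1) True w(2)] by blast
  have "lin (\<theta> (c \<odot>\<^bsub>M\<^esub> x \<oplus>\<^bsub>M\<^esub> d \<odot>\<^bsub>M\<^esub> y)) = psmult c (lin (\<theta> x)) + psmult d (lin (\<theta> y))"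
    by (simp add: lin_def theta_comb xy)
  then show ?thesis unfolding R by (simp add: algebra_simps smult_add_right)
next
  case False
  define a where "a = i div 2"
  have a: "a < wedges l" using False by (auto simp: a_def)
  obtain R where R: "\<And>x y. evw l \<theta> (w[2 * a := x, 2 * a + 1 := y]) = psmult (det2 (\<theta> x) (\<theta> y)) R"
    using evw_update_wedge[OF w(1) a] by blast
  have len: "2 * a < length w" "2 * a + 1 < length w" using a w by (auto simp: deg_eq)
  have "i = 2 * a \<or> i = 2 * a + 1" unfolding a_def by presburger
  then consider "i = 2 * a" | "i = 2 * a + 1" by blast
  then show ?thesis
  proof cases
    case 1
    have "w[i := z] = w[2 * a := z, 2 * a + 1 := w ! (2 * a + 1)]" for z
      by (subst list_update_swap) (simp_all add: 1)
    then show ?thesis by (simp only: R)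
       (simp add: det2_def theta_comb xy algebra_simps flip: smult_add_left)
  next
    case 2
    have "w[i := z] = w[2 * a := w ! (2 * a), 2 * a + 1 := z]" for z
      using len 2 by simp
    then show ?thesis by (simp only: R)
       (simp add: det2_def theta_comb xy algebra_simps flip: smult_add_left)
  qed
qed

lemma mset_swap_drop:
  assumes "m \<le> i" "m \<le> j" "i < length w" "j < length w"
  shows "mset (drop m (swap i j w)) = mset (drop m w)"
proof -
  have "drop m (swap i j w) = (drop m w)[i - m := drop m w ! (j - m), j - m := drop m w ! (i - m)]"
    using assms by (simp add: swap_def drop_update_swap)
  then show ?thesis using assms by (simp only:) (rule mset_swap, auto)
qed

lemma evw_swap_sym:
  assumes "length w = deg l" "2 * wedges l \<le> i" "2 * wedges l \<le> j" "i < deg l" "j < deg l"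
  shows "evw l \<theta> (swap i j w) = evw l \<theta> w"
proof -
  let ?m = "2 * wedges l"
  have "take ?m (swap i j w) = take ?m w" using assms by (simp add: swap_def)
  then have "swap i j w = take ?m w @ drop ?m (swap i j w)" by (metis append_take_drop_id)
  then show ?thesis
    using sym_perm[where \<theta> = \<theta> and l = l and pre = "take ?m w", OF mset_swap_drop[of ?m i j w]] assms by (simp add: deg_eq)
qed

text \<open>The Pluecker relation, once between scalars and once with the last vector left as a
  linear form; this is what the exchange relation (E1) amounts to on forms.\<close>

lemma det2_exchange:
  "det2 x y * det2 z v = det2 z y * det2 x v + det2 x z * det2 y v" (is ?A)
  "psmult (det2 x y) (lin z) = psmult (det2 z y) (lin x) + psmult (det2 x z) (lin y)" (is ?B)
  by (simp_all add: det2_def lin_def algebra_simps)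

lemma evw_update_wedge_sym:
  assumes "length w = deg l" "a < wedges l" "2 * wedges l \<le> j" "j < deg l"
  obtains R where "\<And>x y z. evw l \<theta> (w[2 * a := x, 2 * a + 1 := y, j := z]) = psmult (det2 (\<theta> x) (\<theta> y)) (lin (\<theta> z) * R)"
proof -
  let ?j = "j - 2 * wedges l" and ?ys = "drop (2 * wedges l) w"
  have "wdet \<theta> (w[2 * a := x, 2 * a + 1 := y, j := z]) b = (if b = a then det2 (\<theta> x) (\<theta> y) else wdet \<theta> w b)"
    if "b < wedges l" for b x y z
  proof (cases "b = a")
    case False
    then have "2 * b \<noteq> 2 * a" "2 * b \<noteq> 2 * a + 1" "2 * b + 1 \<noteq> 2 * a" "2 * b + 1 \<noteq> 2 * a + 1" by presburger+
    then show ?thesis using False that assms by (simp add: wdet_def)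
  qed (use assms in \<open>simp add: wdet_def deg_eq\<close>)
  then have "(\<Prod>b<wedges l. wdet \<theta> (w[2 * a := x, 2 * a + 1 := y, j := z]) b)
      = (\<Prod>b<wedges l. if b = a then det2 (\<theta> x) (\<theta> y) else wdet \<theta> w b)" for x y z by (intro prod.cong) auto
  also have "(\<Prod>b<wedges l. if b = a then det2 (\<theta> x) (\<theta> y) else wdet \<theta> w b)
      = det2 (\<theta> x) (\<theta> y) * (\<Prod>b\<in>{..<wedges l} - {a}. wdet \<theta> w b)" for x y
    using assms(2) by (subst prod.remove[of _ a]) auto
  finally have "evw l \<theta> (w[2 * a := x, 2 * a + 1 := y, j := z]) = psmult (det2 (\<theta> x) (\<theta> y))
      (lin (\<theta> z) * psmult (\<Prod>b\<in>{..<wedges l} - {a}. wdet \<theta> w b) (\<Prod>y\<leftarrow>take ?j ?ys @ drop (Suc ?j) ?ys. lin (\<theta> y)))" for x y z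
    using assms prod_list_update_map[of ?j ?ys "\<lambda>y. lin (\<theta> y)" z] by (simp add: evw_def drop_update_swap)
  then show ?thesis by (rule that)
qed

lemma evw_update_wedge_wedge:
  assumes "length w = deg l" "a < wedges l" "b < wedges l" "a \<noteq> b"
  obtains R where "\<And>x y z v. evw l \<theta> (w[2 * a := x, 2 * a + 1 := y, 2 * b := z, 2 * b + 1 := v])
    = psmult (det2 (\<theta> x) (\<theta> y) * det2 (\<theta> z) (\<theta> v)) R"
proof -
  have "wdet \<theta> (w[2 * a := x, 2 * a + 1 := y, 2 * b := z, 2 * b + 1 := v]) c
      = (if c = a then det2 (\<theta> x) (\<theta> y) else if c = b then det2 (\<theta> z) (\<theta> v) else wdet \<theta> w c)"
    if "c < wedges l" for c x y z v
  proof -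
    have *: "2 * a' \<noteq> 2 * a'' + 1" "2 * a' + 1 \<noteq> 2 * a''" for a' a'' :: nat by presburger+
    show ?thesis using assms that by (auto simp: wdet_def deg_eq nth_list_update *)
  qed
  then have "(\<Prod>c<wedges l. wdet \<theta> (w[2 * a := x, 2 * a + 1 := y, 2 * b := z, 2 * b + 1 := v]) c)
      = (\<Prod>c<wedges l. if c = a then det2 (\<theta> x) (\<theta> y) else if c = b then det2 (\<theta> z) (\<theta> v) else wdet \<theta> w c)"
    for x y z v by (intro prod.cong) auto
  also have "(\<Prod>c<wedges l. if c = a then det2 (\<theta> x) (\<theta> y) else if c = b then det2 (\<theta> z) (\<theta> v) else wdet \<theta> w c)
      = det2 (\<theta> x) (\<theta> y) * (det2 (\<theta> z) (\<theta> v) * (\<Prod>c\<in>{..<wedges l} - {a} - {b}. wdet \<theta> w c))" for x y z v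
    using assms by (subst prod.remove[of _ a], simp, simp, subst prod.remove[of _ b]) auto
  finally have "evw l \<theta> (w[2 * a := x, 2 * a + 1 := y, 2 * b := z, 2 * b + 1 := v])
      = psmult (det2 (\<theta> x) (\<theta> y) * det2 (\<theta> z) (\<theta> v))
        (psmult (\<Prod>c\<in>{..<wedges l} - {a} - {b}. wdet \<theta> w c) (\<Prod>y\<leftarrow>drop (2 * wedges l) w. lin (\<theta> y)))" for x y z v
    using assms by (simp add: evw_def mult.assoc)
  then show ?thesis by (rule that)
qed

lemma evw_exchange1:
  assumes w: "length w = deg l" and a: "a < wedges l" and j: "2 * a + 2 \<le> j" "j < deg l"
  shows "evw l \<theta> w = evw l \<theta> (swap (2 * a) j w) + evw l \<theta> (swap (2 * a + 1) j w)"
proof -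
  let ?x = "w ! (2 * a)" and ?y = "w ! (2 * a + 1)" and ?z = "w ! j"
  have len: "2 * a < length w" "2 * a + 1 < length w" using a w by (auto simp: deg_eq)
  show ?thesis
  proof (cases "2 * wedges l \<le> j")
    case True
    obtain R where R: "\<And>x y z. evw l \<theta> (w[2 * a := x, 2 * a + 1 := y, j := z]) = psmult (det2 (\<theta> x) (\<theta> y)) (lin (\<theta> z) * R)"
      using evw_update_wedge_sym[OF w a True j(2)] by blast
    have 0: "w = w[2 * a := ?x, 2 * a + 1 := ?y, j := ?z]" by simp
    have 1: "swap (2 * a) j w = w[2 * a := ?z, 2 * a + 1 := ?y, j := ?x]"
      using j len w by (intro nth_equalityI) (auto simp: swap_def nth_list_update)
    have 2: "swap (2 * a + 1) j w = w[2 * a := ?x, 2 * a + 1 := ?z, j := ?y]"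
      by (simp add: swap_def)
    have "psmult (det2 (\<theta> ?x) (\<theta> ?y)) (lin (\<theta> ?z) * R)
        = psmult (det2 (\<theta> ?z) (\<theta> ?y)) (lin (\<theta> ?x) * R) + psmult (det2 (\<theta> ?x) (\<theta> ?z)) (lin (\<theta> ?y) * R)"
      by (simp only: det2_exchange(2)[of "\<theta> ?x" "\<theta> ?y" "\<theta> ?z"] distrib_right flip: mult_smult_left)
    then show ?thesis unfolding 1 2 R using R[of ?x ?y ?z] unfolding 0[symmetric] by (simp only:)
  next
    case False
    define b where "b = j div 2"
    have b: "b < wedges l" "a \<noteq> b" using False j by (auto simp: b_def)
    obtain R where R: "\<And>x y z v. evw l \<theta> (w[2 * a := x, 2 * a + 1 := y, 2 * b := z, 2 * b + 1 := v])
        = psmult (det2 (\<theta> x) (\<theta> y) * det2 (\<theta> z) (\<theta> v)) R"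
      using evw_update_wedge_wedge[OF w a b] by blast
    have lenb: "2 * b < length w" "2 * b + 1 < length w" using b w by (auto simp: deg_eq)
    let ?p = "w ! (2 * b)" and ?q = "w ! (2 * b + 1)"
    have *: "2 * a' \<noteq> Suc (2 * a'')" "Suc (2 * a') \<noteq> 2 * a''" for a' a'' :: nat by presburger+
    have 0: "w = w[2 * a := ?x, 2 * a + 1 := ?y, 2 * b := ?p, 2 * b + 1 := ?q]" by simp
    have "j = 2 * b \<or> j = 2 * b + 1" unfolding b_def by presburger
    then show ?thesis
    proof
      assume jb: "j = 2 * b"
      have 1: "swap (2 * a) j w = w[2 * a := ?p, 2 * a + 1 := ?y, 2 * b := ?x, 2 * b + 1 := ?q]"
        using len lenb b * by (intro nth_equalityI) (auto simp: swap_def jb nth_list_update)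
      have 2: "swap (2 * a + 1) j w = w[2 * a := ?x, 2 * a + 1 := ?p, 2 * b := ?y, 2 * b + 1 := ?q]"
        using len lenb b * by (intro nth_equalityI) (auto simp: swap_def jb nth_list_update)
      show ?thesis unfolding 1 2 R using R[of ?x ?y ?p ?q] unfolding 0[symmetric]
        by (simp only: det2_exchange(1)[of "\<theta> ?x" "\<theta> ?y" "\<theta> ?p" "\<theta> ?q"] smult_add_left)
    next
      assume jb: "j = 2 * b + 1"
      have 1: "swap (2 * a) j w = w[2 * a := ?q, 2 * a + 1 := ?y, 2 * b := ?p, 2 * b + 1 := ?x]"
        using len lenb b * by (intro nth_equalityI) (auto simp: swap_def jb nth_list_update)
      have 2: "swap (2 * a + 1) j w = w[2 * a := ?x, 2 * a + 1 := ?q, 2 * b := ?p, 2 * b + 1 := ?y]"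
        using len lenb b * by (intro nth_equalityI) (auto simp: swap_def jb nth_list_update)
      \<comment> \<open>The moved variable is the second entry of its wedge factor, so the Pluecker
        relation is needed in a transposed form.\<close>
      have "det2 (\<theta> ?x) (\<theta> ?y) * det2 (\<theta> ?p) (\<theta> ?q) = det2 (\<theta> ?q) (\<theta> ?y) * det2 (\<theta> ?p) (\<theta> ?x) + det2 (\<theta> ?x) (\<theta> ?q) * det2 (\<theta> ?p) (\<theta> ?y)"
        by (simp add: det2_def algebra_simps)
      then show ?thesis unfolding 1 2 R using R[of ?x ?y ?p ?q] unfolding 0[symmetric]
        by (simp only: smult_add_left)
    qed
  qed
qed

lemma evw_exchange2:
  assumes w: "length w = deg l" and ab: "a < b" "b < wedges l"
  shows "evw l \<theta> (swap (2 * a) (2 * b) (swap (2 * a + 1) (2 * b + 1) w)) = evw l \<theta> w"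
proof -
  have a: "a < wedges l" "a \<noteq> b" using ab by auto
  obtain R where R: "\<And>x y z v. evw l \<theta> (w[2 * a := x, 2 * a + 1 := y, 2 * b := z, 2 * b + 1 := v])
      = psmult (det2 (\<theta> x) (\<theta> y) * det2 (\<theta> z) (\<theta> v)) R"
    using evw_update_wedge_wedge[OF w a(1) ab(2) a(2)] by blast
  let ?x = "w ! (2 * a)" and ?y = "w ! (2 * a + 1)" and ?p = "w ! (2 * b)" and ?q = "w ! (2 * b + 1)"
  have len: "2 * a < length w" "2 * a + 1 < length w" "2 * b < length w" "2 * b + 1 < length w" using a ab w by (auto simp: deg_eq)
  have *: "2 * a' \<noteq> Suc (2 * a'')" "Suc (2 * a') \<noteq> 2 * a''" for a' a'' :: nat by presburger+
  have 0: "w = w[2 * a := ?x, 2 * a + 1 := ?y, 2 * b := ?p, 2 * b + 1 := ?q]" by simp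
  have 1: "swap (2 * a) (2 * b) (swap (2 * a + 1) (2 * b + 1) w) = w[2 * a := ?p, 2 * a + 1 := ?q, 2 * b := ?x, 2 * b + 1 := ?y]"
    using len a * by (intro nth_equalityI) (auto simp: swap_def nth_list_update)
  show ?thesis unfolding 1 R using R[of ?x ?y ?p ?q] unfolding 0[symmetric] by (simp only: mult.commute)
qed

lemma ext_rels: assumes "R \<in> schur_rels l M" shows "ext (evw l \<theta>) R = 0"
  using assms
proof (cases rule: schur_rels_cases)
  case (multi w i c d x y)
  then show ?thesis by (simp add: ext_diff ext_fscale evw_multi schur_words_iff)
next
  case (wedge w a)
  then have "wdet \<theta> w a = 0" by (simp add: wdet_def det2_def)
  then have "(\<Prod>a<wedges l. wdet \<theta> w a) = 0" using wedge(3) by (intro prod_zero) auto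
  then show ?thesis by (simp add: wedge(1) evw_def)
next
  case (sym w i j)
  then show ?thesis using evw_swap_sym[of w l i j] by (simp add: ext_diff schur_words_iff)
next
  case (ex1 w a j)
  then show ?thesis using evw_exchange1[of w l a j] by (simp add: ext_diff ext_add schur_words_iff)
next
  case (ex2 w a b)
  then show ?thesis using evw_exchange2[of w l a b] by (simp add: ext_diff schur_words_iff)
qed

end

section \<open>Straightening to standard words\<close>

definition std_word :: "int \<times> int \<Rightarrow> 'a \<Rightarrow> 'a \<Rightarrow> nat \<Rightarrow> 'a list" where
  "std_word l x y j = concat (replicate (wedges l) [x, y]) @ replicate (sdeg l - j) x @ replicate j y"

lemma nth_concat_pairs:
  "a < n \<Longrightarrow> concat (replicate n [x, y]) ! (2 * a) = x"
  "a < n \<Longrightarrow> concat (replicate n [x, y]) ! (2 * a + 1) = y"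
  by (induction n arbitrary: a) (auto simp: nth_Cons split: nat.splits, (case_tac a; force)+)

lemma length_concat_pairs: "length (concat (replicate n [x, y])) = 2 * n"
  by (induction n) auto

lemma length_std_word: "j \<le> sdeg l \<Longrightarrow> length (std_word l x y j) = deg l"
  by (simp add: std_word_def length_concat_pairs deg_eq)

text \<open>Standard words hit the monomials, a basis of all forms. They serve below as a basis of
  the Schur power of a plane and as generating sections on a chart.\<close>

lemma evw_std_word:
  assumes "j \<le> sdeg l" "\<theta> x = (1, 0)" "\<theta> y = (0, 1)"
  shows "evw l \<theta> (std_word l x y j) = monom 1 j"
proof -
  have "wdet \<theta> (std_word l x y j) a = 1" if "a < wedges l" for a
    using that assms nth_concat_pairs[of a "wedges l" x y]
    by (simp add: wdet_def std_word_def nth_append length_concat_pairs det2_def)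
  moreover have "(\<Prod>y\<leftarrow>drop (2 * wedges l) (std_word l x y j). lin (\<theta> y)) = lin (1, 0) ^ (sdeg l - j) * lin (0, 1) ^ j"
    by (simp add: std_word_def length_concat_pairs prod_list_replicate assms)
  ultimately show ?thesis by (simp add: evw_def lin_def monom_altdef flip: one_pCons)
qed

context plane
begin

definition E1 :: 'a where "E1 = the_inv_into (carrier M) \<theta> (1, 0)"
definition E2 :: 'a where "E2 = the_inv_into (carrier M) \<theta> (0, 1)"

lemma E_facts [simp]: "E1 \<in> carrier M" "E2 \<in> carrier M" "\<theta> E1 = (1, 0)" "\<theta> E2 = (0, 1)"
  using bij unfolding E1_def E2_def bij_betw_def
  by (auto intro!: the_inv_into_into f_the_inv_into_f)

lemma E1_neq_E2: "E1 \<noteq> E2"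
  using E_facts by (metis prod.inject zero_neq_one)

lemma decompose: "x \<in> carrier M \<Longrightarrow> x = fst (\<theta> x) \<odot>\<^bsub>M\<^esub> E1 \<oplus>\<^bsub>M\<^esub> snd (\<theta> x) \<odot>\<^bsub>M\<^esub> E2"
  by (rule theta_inj) (simp_all add: theta_comb comb_closed)

abbreviation std :: "int \<times> int \<Rightarrow> nat \<Rightarrow> 'a list" where
  "std l j \<equiv> std_word l E1 E2 j"

lemma evw_std: "j \<le> sdeg l \<Longrightarrow> evw l \<theta> (std l j) = monom 1 j"
  by (simp add: evw_std_word)

abbreviation Sp :: "int \<times> int \<Rightarrow> ('a list \<Rightarrow>\<^sub>0 'k) set" where
  "Sp l \<equiv> free.span (schur_rels l M)"

text \<open>The elements that straighten: modulo the relations they are combinations of standard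
  words.\<close>

definition T :: "int \<times> int \<Rightarrow> ('a list \<Rightarrow>\<^sub>0 'k) set" where
  "T l = {p. \<exists>c. p - (\<Sum>j\<le>sdeg l. fscale (c j) (gen (std l j))) \<in> Sp l}"

lemma subspace_T: "free.subspace (T l)"
proof (rule free.subspaceI)
  show "0 \<in> T l" unfolding T_def by (auto intro!: exI[of _ "\<lambda>_. 0"] free.span_zero)
next
  fix p q assume "p \<in> T l" "q \<in> T l"
  then obtain c d where "p - (\<Sum>j\<le>sdeg l. fscale (c j) (gen (std l j))) \<in> Sp l"
    "q - (\<Sum>j\<le>sdeg l. fscale (d j) (gen (std l j))) \<in> Sp l" unfolding T_def by blast
  from free.span_add[OF this] have "p + q - (\<Sum>j\<le>sdeg l. fscale (c j + d j) (gen (std l j))) \<in> Sp l"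
    by (simp add: free.scale_left_distrib sum.distrib algebra_simps)
  then show "p + q \<in> T l" unfolding T_def mem_Collect_eq by (rule exI[of _ "\<lambda>j. c j + d j"])
next
  fix e p assume "p \<in> T l"
  then obtain c where "p - (\<Sum>j\<le>sdeg l. fscale (c j) (gen (std l j))) \<in> Sp l" unfolding T_def by blast
  from free.span_scale[OF this, of e] have "fscale e p - (\<Sum>j\<le>sdeg l. fscale (e * c j) (gen (std l j))) \<in> Sp l"
    by (simp add: free.scale_right_diff_distrib free.scale_sum_right)
  then show "fscale e p \<in> T l" unfolding T_def mem_Collect_eq by (rule exI[of _ "\<lambda>j. e * c j"])
qed

lemma Sp_T: "p \<in> Sp l \<Longrightarrow> p \<in> T l"
  unfolding T_def by (auto intro!: exI[of _ "\<lambda>_. 0"])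

lemma std_T: "j \<le> sdeg l \<Longrightarrow> gen (std l j) \<in> T l"
  unfolding T_def
  by (auto intro!: exI[of _ "\<lambda>i. if i = j then 1 else 0"] simp: if_distrib[of "\<lambda>c. fscale c _"] free.span_zero cong: if_cong)

lemma rel_Sp: "R \<in> schur_rels l M \<Longrightarrow> R \<in> Sp l"
  by (rule free.span_base)

lemma multi_Sp:
  assumes "w \<in> schur_words l M" "i < deg l" "x \<in> carrier M" "y \<in> carrier M"
  shows "gen (w[i := c \<odot>\<^bsub>M\<^esub> x \<oplus>\<^bsub>M\<^esub> d \<odot>\<^bsub>M\<^esub> y]) - fscale c (gen (w[i := x])) - fscale d (gen (w[i := y])) \<in> Sp l"
proof (rule rel_Sp)
  have "gen (w[i := c \<odot>\<^bsub>replicate (deg l) M ! i\<^esub> x \<oplus>\<^bsub>replicate (deg l) M ! i\<^esub> d \<odot>\<^bsub>replicate (deg l) M ! i\<^esub> y])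
      - fscale c (gen (w[i := x])) - fscale d (gen (w[i := y])) \<in> multilinear_rels (replicate (deg l) M)"
    unfolding multilinear_rels_def using assms by (fastforce simp flip: schur_words_def)
  then show "gen (w[i := c \<odot>\<^bsub>M\<^esub> x \<oplus>\<^bsub>M\<^esub> d \<odot>\<^bsub>M\<^esub> y]) - fscale c (gen (w[i := x])) - fscale d (gen (w[i := y])) \<in> schur_rels l M"
    using assms(2) by (simp add: schur_rels_def)
qed

lemma sym_Sp:
  assumes "w \<in> schur_words l M" "2 * wedges l \<le> i" "i < j" "j < deg l"
  shows "gen w - gen (swap i j w) \<in> Sp l"
  by (rule rel_Sp) (use assms in \<open>auto simp: schur_rels_def wedge_sym_rels_def\<close>)

lemma wedge_Sp:
  assumes "w \<in> schur_words l M" "a < wedges l" "w ! (2 * a) = w ! (2 * a + 1)"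
  shows "gen w \<in> Sp l"
  by (rule rel_Sp) (use assms in \<open>auto simp: schur_rels_def wedge_sym_rels_def\<close>)

text \<open>Polarisation: expand the wedge square of the sum \<open>s\<close> of the two entries.
  The relations state only that wedge factors with equal entries vanish.\<close>

lemma antisym_Sp:
  assumes w: "w \<in> schur_words l M" and a: "a < wedges l"
  shows "gen w + gen (swap (2 * a) (2 * a + 1) w) \<in> Sp l"
proof -
  define v where "v x y = w[2 * a := x, 2 * a + 1 := y]" for x y
  have len: "2 * a < deg l" "2 * a + 1 < deg l" "length w = deg l" using a w by (auto simp: deg_eq schur_words_iff)
  have v: "v x y \<in> schur_words l M" if "x \<in> carrier M" "y \<in> carrier M" for x y
    unfolding v_def using that w by (intro schur_words_update)
  let ?x = "w ! (2 * a)" and ?y = "w ! (2 * a + 1)"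
  have xy: "?x \<in> carrier M" "?y \<in> carrier M" using schur_words_nth[OF w] len by auto
  define s where "s = 1 \<odot>\<^bsub>M\<^esub> ?x \<oplus>\<^bsub>M\<^esub> 1 \<odot>\<^bsub>M\<^esub> ?y"
  have s: "s \<in> carrier M" unfolding s_def using xy by (rule comb_closed)
  have u1: "(v p q)[2 * a := r] = v r q" for p q r
    unfolding v_def by (subst list_update_swap) auto
  have u2: "(v p q)[2 * a + 1 := r] = v p r" for p q r
    unfolding v_def by simp
  have z: "gen (v r r) \<in> Sp l" if "r \<in> carrier M" for r
    using wedge_Sp[OF v[OF that that] a] len by (simp add: v_def)
  have 1: "gen (v s s) - gen (v ?x s) - gen (v ?y s) \<in> Sp l"
    using multi_Sp[OF v[OF s s] len(1) xy, of 1 1, folded s_def] by (simp add: u1)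
  have 2: "gen (v r s) - gen (v r ?x) - gen (v r ?y) \<in> Sp l" if "r \<in> carrier M" for r
    using multi_Sp[OF v[OF that s] len(2) xy, of 1 1, folded s_def] by (simp add: u2[simplified])
  have e: "gen (v ?x ?y) + gen (v ?y ?x) = gen (v s s) - (gen (v s s) - gen (v ?x s) - gen (v ?y s))
      - (gen (v ?x s) - gen (v ?x ?x) - gen (v ?x ?y)) - (gen (v ?y s) - gen (v ?y ?x) - gen (v ?y ?y))
      - gen (v ?x ?x) - gen (v ?y ?y)"
    by simp
  have "gen (v ?x ?y) + gen (v ?y ?x) \<in> Sp l"
    unfolding e by (intro free.span_diff 1 2 z xy s)
  moreover have "v ?x ?y = w" "v ?y ?x = swap (2 * a) (2 * a + 1) w" by (auto simp: v_def swap_def)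
  ultimately show ?thesis by simp
qed

text \<open>One transposition brings the head of \<open>ys\<close> to the front of
  \<open>ys'\<close>; the recursion then works behind a longer prefix.\<close>

lemma perm_Sp:
  assumes "mset ys = mset ys'" "2 * wedges l \<le> length pre" "pre @ ys \<in> schur_words l M"
  shows "gen (pre @ ys) - gen (pre @ ys') \<in> Sp l"
  using assms
proof (induction ys arbitrary: pre ys')
  case Nil
  then show ?case by (simp add: free.span_zero)
next
  case (Cons y t)
  have w': "pre @ ys' \<in> schur_words l M"
    using Cons.prems(3) unfolding schur_words_iff set_append length_append
      mset_eq_setD[OF Cons.prems(1)] mset_eq_length[OF Cons.prems(1)] .
  have "y \<in> set ys'" using mset_eq_setD[OF Cons.prems(1)] by auto
  then obtain u v where ys': "ys' = u @ y # v" by (meson split_list)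
  show ?case
  proof (cases u)
    case Nil
    then have "mset t = mset v" using Cons.prems(1) ys' by simp
    from Cons.IH[OF this, of "pre @ [y]"] show ?thesis using Cons.prems ys' Nil by simp
  next
    case (Cons a u')
    let ?i = "length pre" and ?j = "length pre + length u"
    have sw: "swap ?i ?j (pre @ ys') = pre @ y # u' @ a # v"
      by (simp add: swap_def ys' Cons nth_append list_update_append)
    have 1: "gen (pre @ ys') - gen (pre @ y # u' @ a # v) \<in> Sp l"
      using sym_Sp[OF w', of ?i ?j] Cons.prems(2) w' unfolding sw by (simp add: Cons ys' schur_words_iff)
    have "mset t = mset (u' @ a # v)" using Cons.prems(1) ys' Cons by simp
    from Cons.IH[OF this, of "pre @ [y]"] have 2: "gen (pre @ y # t) - gen (pre @ y # u' @ a # v) \<in> Sp l"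
      using Cons.prems by simp
    from free.span_diff[OF 2 1] show ?thesis by simp
  qed
qed

text \<open>Induction on the number of wedge factors other than \<open>E1 \<wedge> E2\<close>: a
  repeated entry kills the word, a reversed factor is turned round up to sign. When none is left,
  sorting the symmetric part gives a standard word.\<close>

lemma basis_word_T:
  assumes "w \<in> schur_words l M" "set w \<subseteq> {E1, E2}"
  shows "gen w \<in> T l"
  using assms
proof (induction "card {a. a < wedges l \<and> (w ! (2 * a), w ! (2 * a + 1)) \<noteq> (E1, E2)}" arbitrary: w rule: less_induct)
  case less
  let ?B = "\<lambda>w. {a. a < wedges l \<and> (w ! (2 * a), w ! (2 * a + 1)) \<noteq> (E1, E2)}"
  have len: "length w = 2 * wedges l + sdeg l" using less.prems by (simp add: schur_words_iff deg_eq)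
  show ?case
  proof (cases "?B w = {}")
    case True
    let ?ys = "drop (2 * wedges l) w"
    have take: "take (2 * wedges l) w = concat (replicate (wedges l) [E1, E2])"
    proof (rule nth_equalityI)
      fix i assume i: "i < length (take (2 * wedges l) w)"
      define a where "a = i div 2"
      have a: "a < wedges l" using i len by (auto simp: a_def)
      have "i = 2 * a \<or> i = 2 * a + 1" unfolding a_def by presburger
      then show "take (2 * wedges l) w ! i = concat (replicate (wedges l) [E1, E2]) ! i"
        using True a nth_concat_pairs[OF a, of E1 E2] i by auto
    qed (simp add: len length_concat_pairs)
    have ys: "set ?ys \<subseteq> {E1, E2}" using less.prems(2) set_drop_subset by fast
    have "mset ?ys = replicate_mset (count (mset ?ys) E1) E1 + replicate_mset (count (mset ?ys) E2) E2"
      using ys E1_neq_E2 by (intro multiset_eqI) (auto simp: count_eq_zero_iff simp flip: count_mset)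
    then obtain i j where ij: "mset ?ys = replicate_mset i E1 + replicate_mset j E2" by blast
    from arg_cong[OF this, of size] have "i = sdeg l - j" and j: "j \<le> sdeg l" using len by simp_all
    with ij have ms: "mset ?ys = mset (replicate (sdeg l - j) E1 @ replicate j E2)" by simp
    have "gen (take (2 * wedges l) w @ ?ys) - gen (take (2 * wedges l) w @ replicate (sdeg l - j) E1 @ replicate j E2) \<in> Sp l"
      using less.prems(1) len by (intro perm_Sp ms) auto
    then have "gen w - gen (std l j) \<in> Sp l"
      unfolding append_take_drop_id[of "2 * wedges l" w] unfolding take std_word_def .
    from free.subspace_add[OF subspace_T Sp_T[OF this] std_T[OF j]] show ?thesis by simp
  next
    case False
    then obtain a where a: "a < wedges l" "(w ! (2 * a), w ! (2 * a + 1)) \<noteq> (E1, E2)" by auto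
    have la: "2 * a < length w" "2 * a + 1 < length w" using a len by auto
    have "w ! (2 * a) \<in> {E1, E2}" "w ! (2 * a + 1) \<in> {E1, E2}" using less.prems(2) la by (meson nth_mem subsetD)+
    then consider "w ! (2 * a) = w ! (2 * a + 1)" | "w ! (2 * a) = E2" "w ! (2 * a + 1) = E1" using a by auto
    then show ?thesis
    proof cases
      case 1
      then show ?thesis using wedge_Sp[OF less.prems(1) a(1)] Sp_T by blast
    next
      case 2
      let ?w = "swap (2 * a) (2 * a + 1) w"
      have *: "2 * a' \<noteq> Suc (2 * a'')" "Suc (2 * a') \<noteq> 2 * a''" for a' a'' :: nat by presburger+
      have "?B ?w \<subseteq> ?B w - {a}"
        using la 2 by (auto simp: swap_def nth_list_update * split: if_splits)
      then have "card (?B ?w) < card (?B w)"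
        using a by (intro psubset_card_mono) auto
      moreover have "?w \<in> schur_words l M" using less.prems(1) la by (intro schur_words_swap) (auto simp: schur_words_iff)
      moreover have "set ?w \<subseteq> {E1, E2}"
        using less.prems(2) la unfolding swap_def by (intro set_update_subsetI) (auto simp: subset_iff)
      ultimately have "gen ?w \<in> T l" by (rule less.hyps)
      from free.subspace_diff[OF subspace_T Sp_T[OF antisym_Sp[OF less.prems(1) a(1)]] this] show ?thesis by simp
    qed
  qed
qed

text \<open>Induction on the number of entries that are not basis vectors; each is expanded by
  multilinearity.\<close>

lemma word_T:
  assumes "w \<in> schur_words l M" shows "gen w \<in> T l"
  using assms
proof (induction "card {i. i < deg l \<and> w ! i \<notin> {E1, E2}}" arbitrary: w rule: less_induct)
  case less
  let ?B = "\<lambda>w. {i. i < deg l \<and> w ! i \<notin> {E1, E2}}"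
  have len: "length w = deg l" using less.prems by (simp add: schur_words_iff)
  show ?case
  proof (cases "?B w = {}")
    case True
    then have "set w \<subseteq> {E1, E2}" using len by (auto simp: set_conv_nth)
    then show ?thesis using basis_word_T less.prems by blast
  next
    case False
    then obtain i where i: "i < deg l" "w ! i \<notin> {E1, E2}" by auto
    have IH: "gen (w[i := e]) \<in> T l" if "e \<in> {E1, E2}" for e
    proof (rule less.hyps)
      have "?B (w[i := e]) \<subseteq> ?B w - {i}" using that i len by (auto simp: nth_list_update split: if_splits)
      then show "card (?B (w[i := e])) < card (?B w)" using i by (intro psubset_card_mono) auto
      show "w[i := e] \<in> schur_words l M" using that less.prems by (auto intro: schur_words_update)
    qed
    let ?c = "fst (\<theta> (w ! i))" and ?d = "snd (\<theta> (w ! i))"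
    have "w[i := ?c \<odot>\<^bsub>M\<^esub> E1 \<oplus>\<^bsub>M\<^esub> ?d \<odot>\<^bsub>M\<^esub> E2] = w"
      using decompose[OF schur_words_nth[OF less.prems i(1)]] by (metis list_update_id)
    then have "gen w - fscale ?c (gen (w[i := E1])) - fscale ?d (gen (w[i := E2])) \<in> Sp l"
      using multi_Sp[OF less.prems i(1) E_facts(1,2), of ?c ?d] by simp
    then have "gen w - fscale ?c (gen (w[i := E1])) - fscale ?d (gen (w[i := E2]))
        + fscale ?d (gen (w[i := E2])) + fscale ?c (gen (w[i := E1])) \<in> T l"
      by (intro free.subspace_add[OF subspace_T] free.subspace_scale[OF subspace_T] IH Sp_T) auto
    then show ?thesis by simp
  qed
qed

text \<open>Modulo the relations every element is a combination of standard words. Their values are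
  distinct monomials, so a vanishing value forces all coefficients to vanish; conversely every
  relation evaluates to 0.\<close>

theorem span_schur_rels:
  "free.span (schur_rels l M) = {p. Poly_Mapping.keys p \<subseteq> schur_words l M \<and> ext (evw l \<theta>) p = 0}"
proof (intro equalityI subsetI)
  fix p assume "p \<in> Sp l"
  moreover have "Sp l \<subseteq> {p. Poly_Mapping.keys p \<subseteq> schur_words l M} \<inter> {p. ext (evw l \<theta>) p = 0}"
    by (intro free.span_minimal free.subspace_inter keys_subspace ext_subspace)
      (use schur_rels_keys ext_rels in blast)
  ultimately show "p \<in> {p. Poly_Mapping.keys p \<subseteq> schur_words l M \<and> ext (evw l \<theta>) p = 0}" by auto
next
  fix p assume p: "p \<in> {p. Poly_Mapping.keys p \<subseteq> schur_words l M \<and> ext (evw l \<theta>) p = 0}"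
  then have "(\<Sum>w\<in>Poly_Mapping.keys p. fscale (Poly_Mapping.lookup p w) (gen w)) \<in> T l"
    by (intro free.subspace_sum[OF subspace_T] free.subspace_scale[OF subspace_T] word_T) auto
  then obtain c where c: "p - (\<Sum>j\<le>sdeg l. fscale (c j) (gen (std l j))) \<in> Sp l"
    unfolding poly_mapping_sum_gen T_def by blast
  have "ext (evw l \<theta>) q = 0" if "q \<in> Sp l" for q
  proof -
    have "Sp l \<subseteq> {p. ext (evw l \<theta>) p = 0}"
      by (intro free.span_minimal ext_subspace) (use ext_rels in blast)
    then show ?thesis using that by blast
  qed
  from this[OF c] have "(\<Sum>j\<le>sdeg l. psmult (c j) (evw l \<theta> (std l j))) = 0"
    using p by (simp add: ext_diff ext_sum ext_fscale)
  then have s: "(\<Sum>j\<le>sdeg l. monom (c j) j) = 0"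
    by (simp add: evw_std smult_monom)
  have "c i = 0" if "i \<le> sdeg l" for i
    using arg_cong[OF s, of "\<lambda>P. coeff P i"] that by (simp add: coeff_sum if_distrib cong: if_cong)
  then show "p \<in> Sp l" using c by simp
qed

section \<open>The Schur power as a space of forms\<close>

lemma schur_power_eq:
  "schur_power l M = quot_module \<lparr>carrier = {p. Poly_Mapping.keys p \<subseteq> schur_words l M}, mult = undefined, one = undefined,
     zero = 0, add = (+), smult = fscale\<rparr> (Sp l)"
  by (simp add: schur_power_def presented_def free_module_def)

lemma Sp_keys: "Sp l \<subseteq> {p. Poly_Mapping.keys p \<subseteq> schur_words l M}"
  unfolding span_schur_rels by auto

lemmas quot_facts = free.quot_module_facts[OF keys_subspace free.subspace_span Sp_keys]

lemma schur_class_eq: "schur_class l M p = cls (Sp l) p"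
  unfolding schur_class_def presented_class_def free_module_def by (rule quot_facts(1))

lemma carrier_schur_power: "carrier (schur_power l M) = schur_class l M ` {p. Poly_Mapping.keys p \<subseteq> schur_words l M}"
  unfolding schur_power_eq quot_facts(2) schur_class_eq ..

text \<open>Any representative gives the same binary form, as \<open>evw\<close> respects the relations.\<close>

definition val :: "int \<times> int \<Rightarrow> ('a list \<Rightarrow>\<^sub>0 'k) set \<Rightarrow> 'k poly" where
  "val l C = ext (evw l \<theta>) (SOME p. p \<in> C)"

lemma mem_class:
  assumes "q \<in> schur_class l M p" "Poly_Mapping.keys p \<subseteq> schur_words l M"
  shows "Poly_Mapping.keys q \<subseteq> schur_words l M" "ext (evw l \<theta>) q = ext (evw l \<theta>) p"
proof -
  have *: "q - p \<in> Sp l" using assms by (simp add: schur_class_eq cls_def)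
  then show "ext (evw l \<theta>) q = ext (evw l \<theta>) p" unfolding span_schur_rels by (simp add: ext_diff)
  have "p \<in> {p. Poly_Mapping.keys p \<subseteq> schur_words l M}" "q - p \<in> {p. Poly_Mapping.keys p \<subseteq> schur_words l M}"
    using assms(2) subsetD[OF Sp_keys *] by simp_all
  from free.subspace_add[OF keys_subspace this] show "Poly_Mapping.keys q \<subseteq> schur_words l M" by simp
qed

lemma class_self: "p \<in> schur_class l M p"
  by (simp add: schur_class_eq cls_def free.span_zero)

lemma val_class: "Poly_Mapping.keys p \<subseteq> schur_words l M \<Longrightarrow> val l (schur_class l M p) = ext (evw l \<theta>) p"
  unfolding val_def by (rule someI2[of _ p]) (auto simp: class_self mem_class)

lemma class_eqI:
  assumes "Poly_Mapping.keys p \<subseteq> schur_words l M" "Poly_Mapping.keys q \<subseteq> schur_words l M"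
    "ext (evw l \<theta>) p = ext (evw l \<theta>) q"
  shows "schur_class l M p = schur_class l M q"
proof -
  have "p - q \<in> {p. Poly_Mapping.keys p \<subseteq> schur_words l M}"
    using assms(1,2) by (intro free.subspace_diff[OF keys_subspace]) auto
  then have "p - q \<in> Sp l" unfolding span_schur_rels using assms(3) by (simp add: ext_diff)
  then show ?thesis by (simp add: schur_class_eq free.cls_eq_iff)
qed

lemma val_inj:
  assumes "C \<in> carrier (schur_power l M)" "C' \<in> carrier (schur_power l M)" "val l C = val l C'"
  shows "C = C'"
proof -
  obtain p q where *: "C = schur_class l M p" "C' = schur_class l M q"
    "Poly_Mapping.keys p \<subseteq> schur_words l M" "Poly_Mapping.keys q \<subseteq> schur_words l M"
    using assms(1,2) unfolding carrier_schur_power by blast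
  with assms(3) show ?thesis by (simp only: val_class) (rule class_eqI)
qed

lemma keys_add_words:
  "Poly_Mapping.keys p \<subseteq> schur_words l M \<Longrightarrow> Poly_Mapping.keys q \<subseteq> schur_words l M \<Longrightarrow> Poly_Mapping.keys (p + q) \<subseteq> schur_words l M"
  using Poly_Mapping.keys_add[of p q] by blast

lemma schur_power_add:
  assumes "C \<in> carrier (schur_power l M)" "C' \<in> carrier (schur_power l M)"
  shows "C \<oplus>\<^bsub>schur_power l M\<^esub> C' \<in> carrier (schur_power l M)"
    "val l (C \<oplus>\<^bsub>schur_power l M\<^esub> C') = val l C + val l C'"
proof -
  obtain p q where *: "C = schur_class l M p" "C' = schur_class l M q"
    "Poly_Mapping.keys p \<subseteq> schur_words l M" "Poly_Mapping.keys q \<subseteq> schur_words l M"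
    using assms by (auto simp: carrier_schur_power)
  have "C \<oplus>\<^bsub>schur_power l M\<^esub> C' = schur_class l M (p + q)"
    unfolding * schur_class_eq schur_power_eq by (rule quot_facts(4))
  then show "C \<oplus>\<^bsub>schur_power l M\<^esub> C' \<in> carrier (schur_power l M)"
    "val l (C \<oplus>\<^bsub>schur_power l M\<^esub> C') = val l C + val l C'"
    using * keys_add_words[of p l q] by (auto simp: carrier_schur_power val_class ext_add)
qed

lemma schur_power_smult:
  assumes "C \<in> carrier (schur_power l M)"
  shows "c \<odot>\<^bsub>schur_power l M\<^esub> C \<in> carrier (schur_power l M)"
    "val l (c \<odot>\<^bsub>schur_power l M\<^esub> C) = psmult c (val l C)"
proof -
  obtain p where *: "C = schur_class l M p" "Poly_Mapping.keys p \<subseteq> schur_words l M"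
    using assms by (auto simp: carrier_schur_power)
  have "c \<odot>\<^bsub>schur_power l M\<^esub> C = schur_class l M (fscale c p)"
    unfolding * schur_class_eq schur_power_eq by (rule quot_facts(5))
  then show "c \<odot>\<^bsub>schur_power l M\<^esub> C \<in> carrier (schur_power l M)"
    "val l (c \<odot>\<^bsub>schur_power l M\<^esub> C) = psmult c (val l C)"
    using * keys_fscale[of c p] by (auto simp: carrier_schur_power val_class ext_fscale)
qed

lemma schur_power_zero:
  "\<zero>\<^bsub>schur_power l M\<^esub> \<in> carrier (schur_power l M)" "val l \<zero>\<^bsub>schur_power l M\<^esub> = 0"
proof -
  have "\<zero>\<^bsub>schur_power l M\<^esub> = schur_class l M 0"
    unfolding schur_class_eq schur_power_eq by (rule quot_facts(3))
  then show "\<zero>\<^bsub>schur_power l M\<^esub> \<in> carrier (schur_power l M)" "val l \<zero>\<^bsub>schur_power l M\<^esub> = 0"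
    by (auto simp: carrier_schur_power val_class)
qed

lemma schur_power_abelian: "abelian_monoid (schur_power l M)"
  by (rule abelian_monoidI; (rule val_inj[of _ l])?; simp add: schur_power_add schur_power_zero add_ac)

lemma val_finsum:
  assumes "\<And>i. i \<in> I \<Longrightarrow> h i \<in> carrier (schur_power l M)"
  shows "(\<Oplus>\<^bsub>schur_power l M\<^esub>i\<in>I. h i) \<in> carrier (schur_power l M)"
    "val l (\<Oplus>\<^bsub>schur_power l M\<^esub>i\<in>I. h i) = (\<Sum>i\<in>I. val l (h i))"
proof -
  interpret abelian_monoid "schur_power l M" by (rule schur_power_abelian)
  show "(\<Oplus>\<^bsub>schur_power l M\<^esub>i\<in>I. h i) \<in> carrier (schur_power l M)"
    using assms by (intro finsum_closed) auto
  show "val l (\<Oplus>\<^bsub>schur_power l M\<^esub>i\<in>I. h i) = (\<Sum>i\<in>I. val l (h i))"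
    using assms
  proof (induction I rule: infinite_finite_induct)
    case (insert i I)
    have "finsum (schur_power l M) h (insert i I) = h i \<oplus>\<^bsub>schur_power l M\<^esub> finsum (schur_power l M) h I"
      using insert by (intro finsum_insert) auto
    moreover have "finsum (schur_power l M) h I \<in> carrier (schur_power l M)"
      using insert.prems by (intro finsum_closed) auto
    ultimately show ?case using insert by (simp add: schur_power_add)
  qed (simp_all add: schur_power_zero)
qed

lemma degree_evw: assumes "w \<in> schur_words l M" shows "degree (evw l \<theta> w) \<le> sdeg l"
proof -
  have "degree (\<Prod>y\<leftarrow>drop (2 * wedges l) w. lin (\<theta> y)) \<le> length (drop (2 * wedges l) w)"
    by (rule degree_prod_lin)
  also have "\<dots> = sdeg l" using assms by (simp add: schur_words_iff deg_eq)
  finally show ?thesis unfolding evw_def using degree_smult_le order.trans by blast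
qed

lemma degree_val: "C \<in> carrier (schur_power l M) \<Longrightarrow> degree (val l C) \<le> sdeg l"
  by (auto simp: carrier_schur_power val_class ext_def subset_iff
      intro!: degree_sum_le order.trans[OF degree_smult_le] degree_evw)

section \<open>The steps f and g on forms\<close>

lemma evw_f_word:
  assumes "is_part l" "w \<in> schur_words l M"
  shows "evw (l + e1) \<theta> (w @ [z]) = lin (\<theta> z) * evw l \<theta> w"
proof -
  have "wdet \<theta> (w @ [z]) a = wdet \<theta> w a" if "a < wedges l" for a
    using that assms(2) by (simp add: wdet_def nth_append schur_words_iff deg_eq)
  then show ?thesis using assms by (simp add: evw_def part_e1 schur_words_iff deg_eq mult.commute)
qed

text \<open>The Leibniz rule has one term for each linear factor, and these terms match the summands
  of \<open>g_word\<close>.\<close>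

lemma Dz_prod_list:
  "Dz (length ys) z (\<Prod>y\<leftarrow>ys. lin (\<theta> y))
    = (\<Sum>k<length ys. psmult (det2 (\<theta> (ys ! k)) z) (\<Prod>y\<leftarrow>take k ys @ drop (Suc k) ys. lin (\<theta> y)))"
proof (induction ys)
  case Nil
  show ?case by (simp add: Dz_def pderiv_1)
next
  case (Cons y ys)
  then show ?case
    by (simp add: Dz_Suc_lin sum.lessThan_Suc_shift sum_distrib_left mult.assoc del: sum.lessThan_Suc)
qed

lemma evw_g_word:
  assumes "is_part l" "is_part (l + e2)" "w \<in> schur_words l M"
  shows "ext (evw (l + e2) \<theta>) (g_word l z w) = Dz (sdeg l) (\<theta> z) (evw l \<theta> w)"
proof -
  let ?m = "2 * wedges l" and ?x = "take (2 * wedges l) w" and ?y = "drop (2 * wedges l) w"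
  have len: "length w = ?m + sdeg l" "length ?x = ?m" "length ?y = sdeg l" using assms(3) by (auto simp: schur_words_iff deg_eq)
  have "evw (l + e2) \<theta> (?x @ [?y ! k, z] @ take k ?y @ drop (Suc k) ?y)
      = psmult (\<Prod>a<wedges l. wdet \<theta> w a) (psmult (det2 (\<theta> (?y ! k)) (\<theta> z)) (\<Prod>y\<leftarrow>take k ?y @ drop (Suc k) ?y. lin (\<theta> y)))" for k
  proof -
    let ?w = "?x @ [?y ! k, z] @ take k ?y @ drop (Suc k) ?y"
    have "wdet \<theta> ?w a = wdet \<theta> w a" if "a < wedges l" for a
      using that len by (simp add: wdet_def nth_append)
    moreover have "wdet \<theta> ?w (wedges l) = det2 (\<theta> (?y ! k)) (\<theta> z)"
      using len(2) by (simp add: wdet_def nth_append)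
    moreover have "drop (2 * Suc (wedges l)) ?w = take k ?y @ drop (Suc k) ?y"
      using len(2) by simp
    ultimately show ?thesis
      using assms by (simp only: evw_def part_e2) (simp add: mult.commute)
  qed
  then have "ext (evw (l + e2) \<theta>) (g_word l z w)
      = psmult (\<Prod>a<wedges l. wdet \<theta> w a) (Dz (length ?y) (\<theta> z) (\<Prod>y\<leftarrow>?y. lin (\<theta> y)))"
    unfolding g_word_def Let_def by (simp only: ext_sum ext_gen Dz_prod_list psmult_sum)
  then show ?thesis by (simp add: len evw_def Dz_smult)
qed

lemma g_word_keys:
  assumes "is_part l" "is_part (l + e2)" "w \<in> schur_words l M" "z \<in> carrier M"
  shows "Poly_Mapping.keys (g_word l z w) \<subseteq> schur_words (l + e2) M"
proof -
  let ?x = "take (2 * wedges l) w" and ?y = "drop (2 * wedges l) w"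
  have "?x @ [?y ! k, z] @ take k ?y @ drop (Suc k) ?y \<in> schur_words (l + e2) M" if k: "k < length ?y" for k
  proof -
    have "set ?x \<subseteq> set w" "set (take k ?y) \<subseteq> set w" "set (drop (Suc k) ?y) \<subseteq> set w" "?y ! k \<in> set w"
      using k by (auto dest: in_set_takeD in_set_dropD)
    moreover have "length (?x @ [?y ! k, z] @ take k ?y @ drop (Suc k) ?y) = Suc (length w)" using k by simp
    ultimately show ?thesis using assms unfolding schur_words_iff by (auto simp: part_e2)
  qed
  then have "g_word l z w \<in> {p. Poly_Mapping.keys p \<subseteq> schur_words (l + e2) M}"
    unfolding g_word_def Let_def by (intro free.subspace_sum[OF keys_subspace] gen_words) auto
  then show ?thesis by simp
qed

lemma ext_cong_words:
  "Poly_Mapping.keys p \<subseteq> schur_words l M \<Longrightarrow> (\<And>w. w \<in> schur_words l M \<Longrightarrow> e w = e' w) \<Longrightarrow> ext e p = ext e' p"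
  unfolding ext_def by (intro sum.cong) auto

lemma ext_mult: "ext (\<lambda>w. Q * e w) p = Q * ext e p"
  by (simp add: ext_def sum_distrib_left)

lemma ext_Dz: "ext (\<lambda>w. Dz N z (e w)) p = Dz N z (ext e p)"
  by (simp add: ext_def Dz_sum Dz_smult)

text \<open>All representatives of C are sent to one class because their images have the same form;
  the union over C is therefore that single class.\<close>

lemma induced_map:
  assumes C: "C \<in> carrier (schur_power l M)"
    and h: "\<And>w. w \<in> schur_words l M \<Longrightarrow> Poly_Mapping.keys (h w) \<subseteq> schur_words l' M"
    and eq: "\<And>p. Poly_Mapping.keys p \<subseteq> schur_words l M \<Longrightarrow> ext (evw l' \<theta>) (lin_ext h p) = F (ext (evw l \<theta>) p)"
  shows "(\<Union>p\<in>C. schur_class l' M (lin_ext h p)) \<in> carrier (schur_power l' M)"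
    "val l' (\<Union>p\<in>C. schur_class l' M (lin_ext h p)) = F (val l C)"
proof -
  obtain p where p: "C = schur_class l M p" "Poly_Mapping.keys p \<subseteq> schur_words l M"
    using C by (auto simp: carrier_schur_power)
  have k: "Poly_Mapping.keys (lin_ext h q) \<subseteq> schur_words l' M" if "Poly_Mapping.keys q \<subseteq> schur_words l M" for q
    using that h by (intro keys_lin_ext) blast
  have "schur_class l' M (lin_ext h q) = schur_class l' M (lin_ext h p)" if "q \<in> C" for q
    using mem_class[OF that[unfolded p(1)] p(2)] p(2) by (intro class_eqI k) (simp_all add: eq)
  moreover have "p \<in> C" by (simp add: p class_self)
  ultimately have "(\<Union>q\<in>C. schur_class l' M (lin_ext h q)) = schur_class l' M (lin_ext h p)" by blast
  then show "(\<Union>p\<in>C. schur_class l' M (lin_ext h p)) \<in> carrier (schur_power l' M)"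
    "val l' (\<Union>p\<in>C. schur_class l' M (lin_ext h p)) = F (val l C)"
    using k[OF p(2)] p by (auto simp: carrier_schur_power val_class eq)
qed

lemma schur_f_facts:
  assumes "is_part l" "C \<in> carrier (schur_power l M)" "z \<in> carrier M"
  shows "schur_f l M z C \<in> carrier (schur_power (l + e1) M)" "val (l + e1) (schur_f l M z C) = lin (\<theta> z) * val l C"
proof -
  have k: "Poly_Mapping.keys (f_word z w :: 'a list \<Rightarrow>\<^sub>0 'k) \<subseteq> schur_words (l + e1) M" if "w \<in> schur_words l M" for w
    using that assms by (simp add: f_word_def schur_words_iff part_e1)
  have e: "ext (evw (l + e1) \<theta>) (lin_ext (f_word z) p) = lin (\<theta> z) * ext (evw l \<theta>) p"
    if "Poly_Mapping.keys p \<subseteq> schur_words l M" for p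
    unfolding ext_lin_ext ext_mult[symmetric]
    by (rule ext_cong_words[OF that]) (simp add: f_word_def evw_f_word assms(1))
  show "schur_f l M z C \<in> carrier (schur_power (l + e1) M)" "val (l + e1) (schur_f l M z C) = lin (\<theta> z) * val l C"
    unfolding schur_f_def
    by (rule induced_map[OF assms(2) k]; simp add: e)+
qed

lemma schur_g_facts:
  assumes "is_part l" "is_part (l + e2)" "C \<in> carrier (schur_power l M)" "z \<in> carrier M"
  shows "schur_g l M z C \<in> carrier (schur_power (l + e2) M)" "val (l + e2) (schur_g l M z C) = Dz (sdeg l) (\<theta> z) (val l C)"
proof -
  have e: "ext (evw (l + e2) \<theta>) (lin_ext (g_word l z) p) = Dz (sdeg l) (\<theta> z) (ext (evw l \<theta>) p)"
    if "Poly_Mapping.keys p \<subseteq> schur_words l M" for p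
    unfolding ext_lin_ext ext_Dz[symmetric]
    by (rule ext_cong_words[OF that]) (simp add: evw_g_word assms)
  note k = g_word_keys[OF assms(1,2) _ assms(4)]
  show "schur_g l M z C \<in> carrier (schur_power (l + e2) M)" "val (l + e2) (schur_g l M z C) = Dz (sdeg l) (\<theta> z) (val l C)"
    unfolding schur_g_def
    by (rule induced_map[OF assms(3) k]; simp add: e)+
qed

end

section \<open>Frames and points of the Grassmannian\<close>

type_synonym ('k, 'n) frame = "('k^'n) \<times> ('k^'n)"

definition zc :: "('k::field, 'n::finite) frame \<Rightarrow> 'k^'n \<Rightarrow> 'k \<times> 'k" where
  "zc t v = (\<Sum>i\<in>UNIV. fst t $ i * v $ i, \<Sum>i\<in>UNIV. snd t $ i * v $ i)"

definition kern :: "('k::field, 'n::finite) frame \<Rightarrow> ('k^'n) set" where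
  "kern t = {v. zc t v = (0, 0)}"

definition good :: "('k::field, 'n::finite) frame \<Rightarrow> bool" where
  "good t \<longleftrightarrow> (\<exists>ij. plucker t ij \<noteq> 0)"

lemma frames_iff: "t \<in> frames K \<longleftrightarrow> K = kern t"
  by (auto simp: frames_def kern_def zc_def)

lemma zc_add: "zc t (v + w) = zc t v + zc t w"
  by (simp add: zc_def plus_prod_def distrib_left sum.distrib)

lemma zc_smult: "zc t (c *s v) = (c * fst (zc t v), c * snd (zc t v))"
  by (simp add: zc_def sum_distrib_left mult_ac)

lemma zc_diff: "zc t (v - w) = (fst (zc t v) - fst (zc t w), snd (zc t v) - snd (zc t w))"
  by (simp add: zc_def right_diff_distrib sum_subtractf)

lemma zc_axis: "zc t (axis i 1) = (fst t $ i, snd t $ i)"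
  by (simp add: zc_def axis_def if_distrib[of "(*) _"] cong: if_cong)

lemma plucker_det2: "plucker t (i, j) = det2 (zc t (axis i 1)) (zc t (axis j 1))"
  by (cases t) (simp add: plucker_def det2_def zc_axis mult.commute)

lemma zc_0: "zc t 0 = (0, 0)"
  by (simp add: zc_def)

lemma subspace_kern: "vec.subspace (kern t)"
  by (rule vec.subspaceI) (auto simp: kern_def zc_add zc_smult zc_0)

lemma span_kern: "vec.span (kern t) = kern t"
  by (simp add: vec.span_eq_iff subspace_kern)

lemma cramer:
  assumes "det2 y z \<noteq> 0"
  shows "(det2 x z / det2 y z) * fst y + (det2 y x / det2 y z) * fst z = fst x"
    "(det2 x z / det2 y z) * snd y + (det2 y x / det2 y z) * snd z = snd x"
proof -
  have "det2 x z * fst y + det2 y x * fst z = det2 y z * fst x"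
    "det2 x z * snd y + det2 y x * snd z = det2 y z * snd x"
    by (simp_all add: det2_def algebra_simps)
  then show "(det2 x z / det2 y z) * fst y + (det2 y x / det2 y z) * fst z = fst x"
    "(det2 x z / det2 y z) * snd y + (det2 y x / det2 y z) * snd z = snd x"
    using assms by (simp_all add: field_simps)
qed

lemma zc_surj:
  assumes "plucker t (i, j) \<noteq> 0" shows "\<exists>c d. zc t (c *s axis i 1 + d *s axis j 1) = z"
proof -
  define y where "y = zc t (axis i 1)"
  define x where "x = zc t (axis j 1)"
  have d: "det2 y x \<noteq> 0" using assms by (simp add: plucker_det2 y_def x_def)
  show ?thesis
  proof (intro exI)
    show "zc t ((det2 z x / det2 y x) *s axis i 1 + (det2 y z / det2 y x) *s axis j 1) = z"
      unfolding zc_add zc_smult y_def[symmetric] x_def[symmetric] using cramer[OF d, of z] by (simp add: prod_eq_iff)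
  qed
qed

lemma good_surj: assumes "good t" shows "\<exists>v. zc t v = z"
proof -
  obtain i j where "plucker t (i, j) \<noteq> 0" using assms by (auto simp: good_def)
  from zc_surj[OF this, of z] show ?thesis by blast
qed

text \<open>Two axis vectors with a nonzero minor complement the kernel.\<close>

lemma dim_kern:
  fixes t :: "('k::field, 'n::finite) frame"
  assumes "good t" shows "vec.dim (kern t) + 2 = CARD('n)"
proof -
  obtain i j where ij: "plucker t (i, j) \<noteq> 0" using assms by (auto simp: good_def)
  let ?x = "axis i 1 :: 'k^'n" and ?y = "axis j 1 :: 'k^'n"
  have d: "det2 (zc t ?x) (zc t ?y) \<noteq> 0" using ij by (simp add: plucker_det2)
  have x: "?x \<notin> vec.span (kern t)"
    unfolding span_kern using d by (auto simp: kern_def det2_def)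
  have y: "?y \<notin> vec.span (insert ?x (kern t))"
  proof
    assume "?y \<in> vec.span (insert ?x (kern t))"
    then obtain c where "?y - c *s ?x \<in> vec.span (kern t)" by (auto simp: vec.span_insert)
    then have "zc t (?y - c *s ?x) = (0, 0)" unfolding span_kern by (simp add: kern_def)
    then have "fst (zc t ?y) = c * fst (zc t ?x)" "snd (zc t ?y) = c * snd (zc t ?x)"
      by (simp_all add: zc_diff zc_smult)
    then show False using d by (simp add: det2_def)
  qed
  have "vec.span (insert ?y (insert ?x (kern t))) = UNIV"
  proof (intro equalityI subset_UNIV subsetI)
    fix v
    obtain c e where ce: "zc t (c *s ?x + e *s ?y) = zc t v" using zc_surj[OF ij] by blast
    have "v - (c *s ?x + e *s ?y) \<in> kern t" by (simp add: kern_def zc_diff ce)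
    then have "(v - (c *s ?x + e *s ?y)) + (c *s ?x + e *s ?y) \<in> vec.span (insert ?y (insert ?x (kern t)))"
      by (intro vec.span_add vec.span_scale) (auto intro: vec.span_base)
    then show "v \<in> vec.span (insert ?y (insert ?x (kern t)))" by simp
  qed
  then have "vec.dim (insert ?y (insert ?x (kern t))) = CARD('n)"
    by (metis vec.dim_span vec_dim_card)
  then show ?thesis using x y by (simp add: vec.dim_insert)
qed

lemma kern_Gr: "good t \<Longrightarrow> kern t \<in> Gr"
  unfolding Gr_def using subspace_kern dim_kern by blast

text \<open>If all minors vanish, the images of all vectors are multiples of one of them, so K and a
  single vector span everything and K has codimension at most 1.\<close>

lemma frames_good:
  fixes K :: "('k::field^'n::finite) set"
  assumes K: "K \<in> Gr" and t: "t \<in> frames K" shows "good t"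
proof (rule ccontr)
  assume "\<not> good t"
  then have p: "det2 (zc t (axis i 1)) (zc t (axis j 1)) = 0" for i j by (auto simp: good_def simp flip: plucker_det2)
  have K': "K = kern t" using t by (simp add: frames_iff)
  have "\<exists>x. vec.span (insert x K) = UNIV"
  proof (cases "\<forall>i. zc t (axis i 1) = (0, 0)")
    case True
    then have "fst t $ i = 0 \<and> snd t $ i = 0" for i by (simp add: zc_axis)
    then have "zc t v = (0, 0)" for v by (simp add: zc_def)
    then show ?thesis by (simp add: K' kern_def)
  next
    case False
    then obtain i where i: "zc t (axis i 1) \<noteq> (0, 0)" by blast
    have propo: "\<exists>c. zc t v = (c * fst (zc t (axis i 1)), c * snd (zc t (axis i 1)))" for v
    proof -
      have e: "fst t $ i * snd t $ j = fst t $ j * snd t $ i" for j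
        using p[of i j] by (simp add: zc_axis det2_def algebra_simps)
      have "fst t $ i * snd (zc t v) = (\<Sum>j\<in>UNIV. (fst t $ i * snd t $ j) * v $ j)"
        by (simp add: zc_def sum_distrib_left mult.assoc)
      also have "\<dots> = snd t $ i * fst (zc t v)"
        unfolding e by (simp add: zc_def sum_distrib_left mult_ac)
      finally have e': "fst t $ i * snd (zc t v) = snd t $ i * fst (zc t v)" .
      show ?thesis
      proof (cases "fst t $ i = 0")
        case True
        then have "snd t $ i \<noteq> 0" "fst (zc t v) = 0" using i e' by (auto simp: zc_axis)
        then show ?thesis using True
          by (intro exI[of _ "snd (zc t v) / snd t $ i"]) (simp add: zc_axis prod_eq_iff)
      next
        case False
        then show ?thesis using e'
          by (intro exI[of _ "fst (zc t v) / fst t $ i"]) (simp add: zc_axis prod_eq_iff field_simps)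
      qed
    qed
    have "v \<in> vec.span (insert (axis i 1) K)" for v
    proof -
      obtain c where c: "zc t v = (c * fst (zc t (axis i 1)), c * snd (zc t (axis i 1)))" using propo by blast
      then have "v - c *s axis i 1 \<in> K" by (simp add: K' kern_def zc_diff zc_smult)
      then have "(v - c *s axis i 1) + c *s axis i 1 \<in> vec.span (insert (axis i 1) K)"
        by (intro vec.span_add vec.span_scale) (auto intro: vec.span_base)
      then show ?thesis by simp
    qed
    then show ?thesis by blast
  qed
  then obtain x where "vec.span (insert x K) = UNIV" by blast
  then have "vec.dim (insert x K) = CARD('n)" by (metis vec.dim_span vec_dim_card)
  moreover have "vec.dim (insert x K) \<le> vec.dim K + 1" by (simp add: vec.dim_insert)
  ultimately show False using K by (simp add: Gr_def)
qed

text \<open>Two vectors x, y that complement K define coordinates modulo K; these two functionals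
  form a frame.\<close>

lemma Gr_frame:
  fixes K :: "('k::field^'n::finite) set"
  assumes K: "K \<in> Gr" shows "\<exists>t. t \<in> frames K"
proof -
  have sub: "vec.subspace K" and dim: "vec.dim K + 2 = CARD('n)" using K by (auto simp: Gr_def)
  have span: "vec.span K = K" using sub by (simp add: vec.span_eq_iff)
  have "vec.dim K \<noteq> CARD('n)" using dim by simp
  then have "K \<noteq> UNIV" by (metis vec_dim_card)
  then obtain x where x: "x \<notin> K" by auto
  have dx: "vec.dim (insert x K) = vec.dim K + 1" using x by (simp add: vec.dim_insert span)
  then have "vec.span (insert x K) \<noteq> UNIV" using dim by (metis vec.dim_span vec_dim_card add_left_cancel one_eq_numeral_iff semiring_norm(85))
  then obtain y where y: "y \<notin> vec.span (insert x K)" by auto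
  have "vec.dim (insert y (insert x K)) = CARD('n)" using y dx dim by (simp add: vec.dim_insert[of y])
  then have all: "vec.span (insert y (insert x K)) = UNIV"
    by (metis vec.dim_eq_full vec_dim_card vec.dim_span vec.span_UNIV)
  have ex: "\<exists>r q. v - r *s x - q *s y \<in> K" for v
  proof -
    have "v \<in> vec.span (insert y (insert x K))" using all by simp
    then obtain q r where "v - q *s y - r *s x \<in> vec.span K" unfolding vec.span_insert by blast
    moreover have "v - q *s y - r *s x = v - r *s x - q *s y" by (simp add: algebra_simps)
    ultimately have "v - r *s x - q *s y \<in> K" unfolding span by simp
    then show ?thesis by blast
  qed
  have uniq: "r = r' \<and> q = q'" if "v - r *s x - q *s y \<in> K" "v - r' *s x - q' *s y \<in> K" for v r q r' q'
  proof -
    have "(v - r' *s x - q' *s y) - (v - r *s x - q *s y) \<in> K" using vec.subspace_diff[OF sub that(2,1)] .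
    then have d: "(r - r') *s x + (q - q') *s y \<in> K" by (simp add: algebra_simps)
    have "q - q' = 0"
    proof (rule ccontr)
      assume nz: "q - q' \<noteq> 0"
      have "inverse (q - q') *s ((r - r') *s x + (q - q') *s y) - (inverse (q - q') * (r - r')) *s x \<in> vec.span (insert x K)"
        using d by (intro vec.span_diff vec.span_scale) (auto intro: vec.span_base)
      moreover have "inverse (q - q') *s ((r - r') *s x + (q - q') *s y) - (inverse (q - q') * (r - r')) *s x = y"
        using nz by (simp add: vec.scale_right_distrib)
      ultimately show False using y by simp
    qed
    moreover have "r - r' = 0"
    proof (rule ccontr)
      assume nz: "r - r' \<noteq> 0"
      have "inverse (r - r') *s ((r - r') *s x + (q - q') *s y) \<in> K" using d by (rule vec.subspace_scale[OF sub])
      then show False using x nz \<open>q - q' = 0\<close> by simp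
    qed
    ultimately show ?thesis by simp
  qed
  obtain r q where rq: "\<And>v. v - r v *s x - q v *s y \<in> K" using ex by metis
  have add: "r (v + w) = r v + r w \<and> q (v + w) = q v + q w" for v w
  proof (rule uniq[OF rq])
    show "v + w - (r v + r w) *s x - (q v + q w) *s y \<in> K"
      using vec.subspace_add[OF sub rq[of v] rq[of w]] by (simp add: algebra_simps)
  qed
  have scale: "r (c *s v) = c * r v \<and> q (c *s v) = c * q v" for c v
  proof (rule uniq[OF rq])
    show "c *s v - (c * r v) *s x - (c * q v) *s y \<in> K"
      using vec.subspace_scale[OF sub rq[of v], of c] by (simp add: vec.scale_right_diff_distrib)
  qed
  have zero: "r 0 = 0 \<and> q 0 = 0" using scale[of 0 0] by simp
  have sums: "r (\<Sum>i\<in>I. h i) = (\<Sum>i\<in>I. r (h i)) \<and> q (\<Sum>i\<in>I. h i) = (\<Sum>i\<in>I. q (h i))" for I :: "'n set" and h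
    by (induction I rule: infinite_finite_induct) (auto simp: zero add)
  define t where "t = ((\<chi> i. r (axis i 1)) :: 'k^'n, (\<chi> i. q (axis i 1)) :: 'k^'n)"
  have zt: "zc t v = (r v, q v)" for v
  proof -
    have "v = (\<Sum>i\<in>UNIV. v $ i *s axis i 1)" by (simp add: basis_expansion)
    then have "r v = (\<Sum>i\<in>UNIV. v $ i * r (axis i 1)) \<and> q v = (\<Sum>i\<in>UNIV. v $ i * q (axis i 1))"
      using sums[of "\<lambda>i. v $ i *s axis i 1" UNIV] by (simp add: scale)
    then show ?thesis by (simp add: zc_def t_def mult.commute)
  qed
  have "K = kern t"
  proof (intro equalityI subsetI)
    fix v assume "v \<in> K"
    then show "v \<in> kern t" using uniq[OF rq[of v], of 0 0] by (simp add: kern_def zt)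
  next
    fix v assume "v \<in> kern t"
    then show "v \<in> K" using rq[of v] by (simp add: kern_def zt)
  qed
  then show ?thesis unfolding frames_iff by blast
qed

definition fr :: "('k::field^'n::finite) set \<Rightarrow> ('k, 'n) frame" where
  "fr K = (SOME t. t \<in> frames K)"

lemma fr: "K \<in> Gr \<Longrightarrow> fr K \<in> frames K"
  unfolding fr_def using Gr_frame by (rule someI_ex)

section \<open>The action of GL(2) on frames\<close>

type_synonym 'k gl2 = "('k \<times> 'k) \<times> ('k \<times> 'k)"

definition gact :: "'k::field gl2 \<Rightarrow> 'k \<times> 'k \<Rightarrow> 'k \<times> 'k" where
  "gact g z = (fst (fst g) * fst z + snd (fst g) * snd z, fst (snd g) * fst z + snd (snd g) * snd z)"

definition gdet :: "'k::field gl2 \<Rightarrow> 'k" where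
  "gdet g = det2 (fst g) (snd g)"

definition gfr :: "'k::field gl2 \<Rightarrow> ('k, 'n::finite) frame \<Rightarrow> ('k, 'n) frame" where
  "gfr g t = (fst (fst g) *s fst t + snd (fst g) *s snd t, fst (snd g) *s fst t + snd (snd g) *s snd t)"

lemma zc_gfr: "zc (gfr g t) v = gact g (zc t v)"
  by (simp add: zc_def gfr_def gact_def distrib_right sum.distrib sum_distrib_left mult.assoc)

lemma det2_gact: "det2 (gact g y) (gact g z) = gdet g * det2 y z"
  by (simp add: gact_def gdet_def det2_def algebra_simps)

lemma plucker_gfr: "plucker (gfr g t) ij = gdet g * plucker t ij"
  by (cases ij) (simp add: plucker_det2 zc_gfr det2_gact)

lemma kern_gfr: assumes "gdet g \<noteq> 0" shows "kern (gfr g t) = kern t"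
proof -
  have "gact g z = (0, 0) \<longleftrightarrow> z = (0, 0)" for z
  proof
    assume "gact g z = (0, 0)"
    then have 1: "fst (fst g) * fst z + snd (fst g) * snd z = 0" "fst (snd g) * fst z + snd (snd g) * snd z = 0"
      by (auto simp: gact_def)
    have "gdet g * fst z = snd (snd g) * (fst (fst g) * fst z + snd (fst g) * snd z) - snd (fst g) * (fst (snd g) * fst z + snd (snd g) * snd z)"
      "gdet g * snd z = fst (fst g) * (fst (snd g) * fst z + snd (snd g) * snd z) - fst (snd g) * (fst (fst g) * fst z + snd (fst g) * snd z)"
      by (simp_all add: gdet_def det2_def algebra_simps)
    then show "z = (0, 0)" using assms unfolding 1 by (simp add: prod_eq_iff)
  qed (simp add: gact_def)
  then show ?thesis by (simp add: kern_def zc_gfr)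
qed

lemma good_gfr: "gdet g \<noteq> 0 \<Longrightarrow> good t \<Longrightarrow> good (gfr g t)"
  by (auto simp: good_def plucker_gfr)

text \<open>Modulo the common kernel each axis vector is a combination of the axes i and j, with
  coefficients given by minors of t. Hence t' is determined by its columns i and j, and these
  determine the matrix g.\<close>

lemma frames_gfr:
  assumes K: "K \<in> Gr" and t: "t \<in> frames K" "t' \<in> frames K"
  obtains g where "gdet g \<noteq> 0" "t' = gfr g t"
proof -
  obtain i j where ij: "plucker t (i, j) \<noteq> 0" using frames_good[OF K t(1)] by (auto simp: good_def)
  define p where "p = plucker t (i, j)"
  have kk: "kern t = kern t'" using t by (simp add: frames_iff)
  define z where "z v = zc t (axis v 1)" for v
  have d: "det2 (z i) (z j) = p" by (simp add: p_def z_def plucker_det2)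
  have nz: "det2 (z i) (z j) \<noteq> 0" using ij by (simp add: d p_def)
  define R where "R v = det2 (z v) (z j) / p" for v
  define Q where "Q v = det2 (z i) (z v) / p" for v
  have Z: "zc t' (axis v 1) = zc t' (R v *s axis i 1 + Q v *s axis j 1)" for v
  proof -
    have "fst (z v) = R v * fst (z i) + Q v * fst (z j)" "snd (z v) = R v * snd (z i) + Q v * snd (z j)"
      using cramer[OF nz, of "z v"] by (simp_all add: R_def Q_def d)
    then have "zc t (axis v 1 - (R v *s axis i 1 + Q v *s axis j 1)) = (0, 0)"
      by (simp add: zc_diff zc_add zc_smult flip: z_def)
    then have "axis v 1 - (R v *s axis i 1 + Q v *s axis j 1) \<in> kern t'" unfolding kk[symmetric] by (simp add: kern_def)
    then show ?thesis by (simp add: kern_def zc_diff prod_eq_iff)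
  qed
  have A: "fst t' $ v = R v * fst t' $ i + Q v * fst t' $ j" "snd t' $ v = R v * snd t' $ i + Q v * snd t' $ j" for v
    using Z[of v] by (simp_all add: zc_axis zc_add zc_smult prod_eq_iff)
  \<comment> \<open>A row a of t', restricted to the columns i and j and multiplied by the inverse
    of the corresponding square submatrix of t: this is a row of g.\<close>
  define h where "h a = ((a $ i * snd t $ j - a $ j * snd t $ i) / p, (a $ j * fst t $ i - a $ i * fst t $ j) / p)" for a :: "'a^'b"
  define g where "g = (h (fst t'), h (snd t'))"
  have h: "fst (h a) * fst t $ v + snd (h a) * snd t $ v = R v * a $ i + Q v * a $ j" for a v
  proof -
    have "fst (h a) * fst t $ v + snd (h a) * snd t $ v
        = ((a $ i * snd t $ j - a $ j * snd t $ i) * fst t $ v + (a $ j * fst t $ i - a $ i * fst t $ j) * snd t $ v) / p"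
      by (simp add: h_def add_divide_distrib)
    also have "\<dots> = ((fst t $ v * snd t $ j - snd t $ v * fst t $ j) * a $ i + (fst t $ i * snd t $ v - snd t $ i * fst t $ v) * a $ j) / p"
      by (rule arg_cong[of _ _ "\<lambda>x. x / p"]) (simp add: algebra_simps)
    finally show ?thesis by (simp add: R_def Q_def z_def zc_axis det2_def add_divide_distrib)
  qed
  have "fst t' $ v = fst (gfr g t) $ v" "snd t' $ v = snd (gfr g t) $ v" for v
    using A[of v] by (simp_all add: gfr_def g_def h)
  then have "t' = gfr g t" by (simp add: prod_eq_iff vec_eq_iff)
  moreover have "gdet g \<noteq> 0"
  proof
    assume "gdet g = 0"
    then have "\<not> good (gfr g t)" by (simp add: good_def plucker_gfr)
    then show False using frames_good[OF K t(2)] \<open>t' = gfr g t\<close> by metis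
  qed
  ultimately show ?thesis using that by blast
qed

section \<open>The fibres of the Schur powers\<close>

definition th :: "('k::field, 'n::finite) frame \<Rightarrow> ('k^'n) set \<Rightarrow> 'k \<times> 'k" where
  "th t C = zc t (SOME v. v \<in> C)"

lemma coord_module_eq: "coord_module = \<lparr>carrier = UNIV, mult = undefined, one = undefined, zero = 0, add = (+), smult = (*s)\<rparr>"
  by (simp add: coord_module_def)

lemma Gr_subspace: "K \<in> Gr \<Longrightarrow> vec.subspace K"
  by (simp add: Gr_def)

lemmas coord_quot = vec.quot_module_facts[OF vec.subspace_UNIV Gr_subspace subset_UNIV, folded coord_module_eq]

lemma taut_section_eq: "K \<in> Gr \<Longrightarrow> taut_section v K = cls K v"
  unfolding taut_section_def by (rule coord_quot(1))

lemma carrier_taut_fibre: "K \<in> Gr \<Longrightarrow> carrier (taut_fibre K) = range (\<lambda>v. taut_section v K)"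
  unfolding taut_fibre_def by (subst coord_quot(2)) (auto simp: taut_section_eq)

lemma th_taut_section:
  assumes "K \<in> Gr" "t \<in> frames K" shows "th t (taut_section v K) = zc t v"
proof -
  have "zc t w = zc t v" if "w \<in> cls K v" for w
    using that assms(2) by (simp add: frames_iff cls_def kern_def zc_diff prod_eq_iff)
  moreover have "v \<in> cls K v" using Gr_subspace[OF assms(1)] by (simp add: cls_def vec.subspace_0)
  ultimately show ?thesis unfolding th_def taut_section_eq[OF assms(1)] by (metis someI)
qed

lemma taut_section_inj:
  assumes "K \<in> Gr" "t \<in> frames K" "zc t v = zc t w" shows "taut_section v K = taut_section w K"
proof -
  have "v - w \<in> K" using assms(2,3) by (simp add: frames_iff kern_def zc_diff)
  then show ?thesis using Gr_subspace[OF assms(1)] by (simp add: taut_section_eq assms(1) vec.cls_eq_iff)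
qed

lemma plane_fibre:
  fixes K :: "('k::field_char_0^'n::finite) set"
  assumes K: "K \<in> Gr" and t: "t \<in> frames K" shows "plane (taut_fibre K) (th t)"
proof
  note th = th_taut_section[OF K t]
  note C = carrier_taut_fibre[OF K]
  have add: "taut_section v K \<oplus>\<^bsub>taut_fibre K\<^esub> taut_section w K = taut_section (v + w) K" for v w
    unfolding taut_section_eq[OF K] taut_fibre_def by (rule coord_quot(4)[OF K])
  have smult: "c \<odot>\<^bsub>taut_fibre K\<^esub> taut_section v K = taut_section (c *s v) K" for v c
    unfolding taut_section_eq[OF K] taut_fibre_def by (rule coord_quot(5)[OF K])
  show "bij_betw (th t) (carrier (taut_fibre K)) UNIV"
    unfolding bij_betw_def
  proof
    show "inj_on (th t) (carrier (taut_fibre K))"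
      unfolding C by (rule inj_onI) (elim imageE, simp only: th, rule taut_section_inj[OF K t])
    have "\<exists>v. th t (taut_section v K) = z" for z unfolding th using good_surj[OF frames_good[OF K t]] .
    then show "th t ` carrier (taut_fibre K) = UNIV" unfolding C by (metis UNIV_eq_I rangeI image_eqI)
  qed
  fix x y assume x: "x \<in> carrier (taut_fibre K)"
  show "c \<odot>\<^bsub>taut_fibre K\<^esub> x \<in> carrier (taut_fibre K)" for c using x unfolding C by (auto simp: smult)
  show "th t (c \<odot>\<^bsub>taut_fibre K\<^esub> x) = (c * fst (th t x), c * snd (th t x))" for c
    using x unfolding C by (auto simp: smult th zc_smult)
  assume y: "y \<in> carrier (taut_fibre K)"
  show "x \<oplus>\<^bsub>taut_fibre K\<^esub> y \<in> carrier (taut_fibre K)" using x y unfolding C by (auto simp: add)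
  show "th t (x \<oplus>\<^bsub>taut_fibre K\<^esub> y) = th t x + th t y"
    using x y unfolding C by (auto simp: add th zc_add)
qed

abbreviation vl :: "('k::field_char_0, 'n::finite) frame \<Rightarrow> int \<times> int \<Rightarrow> ('k, 'n) schur_elem \<Rightarrow> 'k poly" where
  "vl t \<equiv> plane.val (th t)"

lemma evw_map:
  assumes "length vs = deg l" "\<And>v. v \<in> set vs \<Longrightarrow> \<theta> (h v) = \<theta>' v"
  shows "evw l \<theta> (map h vs) = evw l \<theta>' vs"
proof -
  have "wdet \<theta> (map h vs) a = wdet \<theta>' vs a" if "a < wedges l" for a
    using that assms by (simp add: wdet_def deg_eq)
  moreover have "map (\<lambda>y. lin (\<theta> y)) (drop (2 * wedges l) (map h vs)) = map (\<lambda>y. lin (\<theta>' y)) (drop (2 * wedges l) vs)"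
    unfolding drop_map map_map o_def using in_set_dropD by (intro map_cong refl) (fastforce simp: assms(2))
  ultimately show ?thesis by (simp add: evw_def)
qed

lemma section_words:
  fixes K :: "('k::field_char_0^'n::finite) set"
  assumes "K \<in> Gr" "length vs = deg l"
  shows "map (\<lambda>v. taut_section v K) vs \<in> schur_words l (taut_fibre K)"
  using plane.schur_words_iff[OF plane_fibre[OF assms(1) fr[OF assms(1)]]] assms
  by (auto simp: carrier_taut_fibre)

lemma schur_section_facts:
  assumes K: "K \<in> Gr" and t: "t \<in> frames K" and vs: "length vs = deg l"
  shows "schur_section l vs K \<in> carrier (schur_fibre l K)" "vl t l (schur_section l vs K) = evw l (zc t) vs"
proof -
  interpret plane "taut_fibre K" "th t" by (rule plane_fibre[OF K t])
  have k: "Poly_Mapping.keys (gen (map (\<lambda>v. taut_section v K) vs) :: _ \<Rightarrow>\<^sub>0 'a) \<subseteq> schur_words l (taut_fibre K)"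
    using section_words[OF K vs] by simp
  show "schur_section l vs K \<in> carrier (schur_fibre l K)"
    using k by (auto simp: schur_section_def schur_fibre_def carrier_schur_power)
  show "vl t l (schur_section l vs K) = evw l (zc t) vs"
    unfolding schur_section_def val_class[OF k] ext_gen
    by (rule evw_map[OF vs]) (simp add: th_taut_section[OF K t])
qed

text \<open>The action of g on forms: the two variables are replaced by the columns of g, so that
  \<open>lin z\<close> becomes \<open>lin (gact g z)\<close>.\<close>

definition gsub :: "nat \<Rightarrow> 'k::field gl2 \<Rightarrow> 'k poly \<Rightarrow> 'k poly" where
  "gsub N g P = hsub N P [:fst (fst g), fst (snd g):] [:snd (fst g), snd (snd g):]"

lemma lin_gact: "lin (gact g z) = hsub 1 (lin z) [:fst (fst g), fst (snd g):] [:snd (fst g), snd (snd g):]"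
  by (simp add: lin_def gact_def hsub_def mult.commute)

lemma gsub_prod_lin: "gsub (length ys) g (\<Prod>y\<leftarrow>ys. lin (z y)) = (\<Prod>y\<leftarrow>ys. lin (gact g (z y)))"
proof (induction ys)
  case Nil
  show ?case by (simp add: gsub_def hsub_def)
next
  case (Cons y ys)
  then show ?case
    using hsub_mult[OF degree_lin[of "z y"] degree_prod_lin[where z = z and ys = ys]]
    by (simp add: gsub_def lin_gact)
qed

lemma evw_gact:
  assumes "length w = deg l" "\<And>y. y \<in> set w \<Longrightarrow> \<theta>' y = gact g (\<theta> y)"
  shows "evw l \<theta>' w = psmult (gdet g ^ wedges l) (gsub (sdeg l) g (evw l \<theta> w))"
proof -
  have "wdet \<theta>' w a = gdet g * wdet \<theta> w a" if "a < wedges l" for a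
    using that assms by (simp add: wdet_def det2_gact deg_eq)
  then have "(\<Prod>a<wedges l. wdet \<theta>' w a) = gdet g ^ wedges l * (\<Prod>a<wedges l. wdet \<theta> w a)"
    by (simp add: prod.distrib)
  moreover have "(\<Prod>y\<leftarrow>drop (2 * wedges l) w. lin (\<theta>' y)) = gsub (sdeg l) g (\<Prod>y\<leftarrow>drop (2 * wedges l) w. lin (\<theta> y))"
  proof -
    have "map (\<lambda>y. lin (\<theta>' y)) (drop (2 * wedges l) w) = map (\<lambda>y. lin (gact g (\<theta> y))) (drop (2 * wedges l) w)"
      using in_set_dropD by (intro map_cong refl) (fastforce simp: assms(2))
    then have "(\<Prod>y\<leftarrow>drop (2 * wedges l) w. lin (\<theta>' y)) = (\<Prod>y\<leftarrow>drop (2 * wedges l) w. lin (gact g (\<theta> y)))"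
      by (simp only:)
    also have "\<dots> = gsub (length (drop (2 * wedges l) w)) g (\<Prod>y\<leftarrow>drop (2 * wedges l) w. lin (\<theta> y))"
      by (rule gsub_prod_lin[symmetric])
    finally show ?thesis using assms(1) by (simp add: deg_eq)
  qed
  ultimately show ?thesis by (simp add: evw_def gsub_def hsub_smult)
qed

lemma gsub_smult: "gsub N g (psmult c P) = psmult c (gsub N g P)"
  by (simp add: gsub_def hsub_smult)

lemma gsub_sum: "gsub N g (\<Sum>i\<in>I. P i) = (\<Sum>i\<in>I. gsub N g (P i))"
  by (simp add: gsub_def hsub_sum)

text \<open>Under a change of frame the fibre behaves as the representation of highest weight
  \<open>l\<close>: each wedge factor contributes a determinant and the rest is a symmetric
  power.\<close>

lemma vl_gfr:
  assumes K: "K \<in> Gr" and t: "t \<in> frames K" and g: "gdet g \<noteq> 0" and C: "C \<in> carrier (schur_fibre l K)"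
  shows "vl (gfr g t) l C = psmult (gdet g ^ wedges l) (gsub (sdeg l) g (vl t l C))"
proof -
  have t': "gfr g t \<in> frames K" using t g by (simp add: frames_iff kern_gfr)
  interpret A: plane "taut_fibre K" "th t" by (rule plane_fibre[OF K t])
  interpret B: plane "taut_fibre K" "th (gfr g t)" by (rule plane_fibre[OF K t'])
  obtain p where p: "C = schur_class l (taut_fibre K) p" "Poly_Mapping.keys p \<subseteq> schur_words l (taut_fibre K)"
    using C by (auto simp: schur_fibre_def A.carrier_schur_power)
  have "ext (evw l (th (gfr g t))) p = ext (\<lambda>w. psmult (gdet g ^ wedges l) (gsub (sdeg l) g (evw l (th t) w))) p"
  proof (rule A.ext_cong_words[OF p(2)])
    fix w assume w: "w \<in> schur_words l (taut_fibre K)"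
    show "evw l (th (gfr g t)) w = psmult (gdet g ^ wedges l) (gsub (sdeg l) g (evw l (th t) w))"
    proof (rule evw_gact)
      fix y assume "y \<in> set w"
      then obtain v where "y = taut_section v K" using w A.schur_words_iff carrier_taut_fibre[OF K] by blast
      then show "th (gfr g t) y = gact g (th t y)"
        by (simp add: th_taut_section[OF K t] th_taut_section[OF K t'] zc_gfr)
    qed (use w A.schur_words_iff in blast)
  qed
  also have "\<dots> = psmult (gdet g ^ wedges l) (gsub (sdeg l) g (ext (evw l (th t)) p))"
    by (simp only: ext_def gsub_sum gsub_smult psmult_sum smult_smult mult.commute)
  finally show ?thesis using p by (simp add: A.val_class B.val_class)
qed

section \<open>Regular functions\<close>

text \<open>The Pluecker coordinates of two frames of a point differ by a common factor, so
  homogeneity makes zeros, and quotients of equal degree, independent of the frame.\<close>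

lemma hom_poly_scale: "hom_poly d P \<Longrightarrow> P (\<lambda>i. c * p i) = c ^ d * P p"
  by (induction rule: hom_poly.induct) (auto simp: algebra_simps power_add)

lemma hom_poly_zero: "hom_poly d (\<lambda>p :: 'i \<Rightarrow> 'k::field. 0)"
proof (induction d)
  case (Suc d)
  have "hom_poly (1 + d) (\<lambda>p :: 'i \<Rightarrow> 'k. p undefined * 0)"
    by (intro hom_poly_mult hom_poly_var Suc)
  then show ?case by simp
qed (rule hom_poly_const)

lemma hom_poly_cmult: "hom_poly d P \<Longrightarrow> hom_poly d (\<lambda>p. c * P p)"
  using hom_poly_mult[OF hom_poly_const] by fastforce

lemma hom_poly_sum: "(\<And>i. i \<in> A \<Longrightarrow> hom_poly d (P i)) \<Longrightarrow> hom_poly d (\<lambda>p. \<Sum>i\<in>A. P i p)"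
  by (induction A rule: infinite_finite_induct) (auto intro: hom_poly_zero hom_poly_add)

lemma plucker_scale:
  assumes "K \<in> Gr" "t \<in> frames K" "t' \<in> frames K"
  obtains c where "c \<noteq> 0" "plucker t' = (\<lambda>ij. c * plucker t ij)"
proof -
  obtain g where "gdet g \<noteq> 0" "t' = gfr g t" using frames_gfr[OF assms] .
  then show ?thesis using that[of "gdet g"] by (simp add: fun_eq_iff plucker_gfr)
qed

lemma hom_poly_frames:
  assumes "hom_poly d P" "K \<in> Gr" "t \<in> frames K" "t' \<in> frames K"
  shows "P (plucker t) \<noteq> 0 \<longleftrightarrow> P (plucker t') \<noteq> 0"
proof -
  obtain c where "c \<noteq> 0" "plucker t' = (\<lambda>ij. c * plucker t ij)" using plucker_scale[OF assms(2-4)] .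
  then show ?thesis using hom_poly_scale[OF assms(1)] by auto
qed

lemma opens_subset_Gr: "U \<in> opens \<Longrightarrow> U \<subseteq> Gr"
  by (auto simp: opens_def)

lemma Gr_opens: "(Gr :: ('k::field^'n::finite) set set) \<in> opens"
  unfolding opens_def
proof (intro CollectI exI[of _ "{\<lambda>p :: 'n \<times> 'n \<Rightarrow> 'k. 1 :: 'k}"] conjI ballI)
  show "\<exists>d. hom_poly d P" if "P \<in> {\<lambda>p :: 'n \<times> 'n \<Rightarrow> 'k. 1 :: 'k}" for P :: "('n \<times> 'n \<Rightarrow> 'k) \<Rightarrow> 'k"
    using that by (auto intro: hom_poly_const)
  show "(Gr :: ('k^'n) set set) = {K \<in> Gr. \<exists>P\<in>{\<lambda>p :: 'n \<times> 'n \<Rightarrow> 'k. 1 :: 'k}. \<exists>t\<in>frames K. P (plucker t) \<noteq> 0}"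
    using Gr_frame by auto
qed

lemma opens_Int:
  fixes U V :: "('k::field^'n::finite) set set"
  assumes "U \<in> opens" "V \<in> opens" shows "U \<inter> V \<in> opens"
proof -
  obtain S T where S: "\<forall>P\<in>S. \<exists>d. hom_poly d P" "U = {K \<in> Gr. \<exists>P\<in>S. \<exists>t\<in>frames K. P (plucker t) \<noteq> 0}"
    and T: "\<forall>P\<in>T. \<exists>d. hom_poly d P" "V = {K \<in> Gr. \<exists>P\<in>T. \<exists>t\<in>frames K. P (plucker t) \<noteq> 0}"
    using assms unfolding opens_def by blast
  define R where "R = {\<lambda>p. P p * Q p | P Q. P \<in> S \<and> Q \<in> T}"
  have "\<forall>P\<in>R. \<exists>d. hom_poly d P" using S(1) T(1) hom_poly_mult unfolding R_def by blast
  moreover have "U \<inter> V = {K \<in> Gr. \<exists>P\<in>R. \<exists>t\<in>frames K. P (plucker t) \<noteq> 0}"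
  proof (intro equalityI subsetI)
    fix K assume "K \<in> U \<inter> V"
    then obtain P t Q t' where *: "K \<in> Gr" "P \<in> S" "t \<in> frames K" "P (plucker t) \<noteq> 0" "Q \<in> T" "t' \<in> frames K" "Q (plucker t') \<noteq> 0"
      using S(2) T(2) by blast
    then have "Q (plucker t) \<noteq> 0" using T(1) hom_poly_frames by blast
    with * have PQ: "(\<lambda>p. P p * Q p) \<in> R" "P (plucker t) * Q (plucker t) \<noteq> 0" by (auto simp: R_def)
    show "K \<in> {K \<in> Gr. \<exists>P\<in>R. \<exists>t\<in>frames K. P (plucker t) \<noteq> 0}"
      by (intro CollectI conjI *(1) bexI[OF _ PQ(1)] bexI[OF _ *(3)] PQ(2))
  next
    fix K assume "K \<in> {K \<in> Gr. \<exists>P\<in>R. \<exists>t\<in>frames K. P (plucker t) \<noteq> 0}"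
    then obtain P Q t where "K \<in> Gr" "P \<in> S" "Q \<in> T" "t \<in> frames K" "P (plucker t) * Q (plucker t) \<noteq> 0"
      by (auto simp: R_def)
    then show "K \<in> U \<inter> V" using S(2) T(2) by auto
  qed
  ultimately show ?thesis unfolding opens_def by blast
qed

section \<open>Standard charts\<close>

definition chart :: "'n \<Rightarrow> 'n \<Rightarrow> ('k::field^'n::finite) set set" where
  "chart i j = {K \<in> Gr. \<exists>t\<in>frames K. plucker t (i, j) \<noteq> 0}"

lemma chart_opens: "chart i j \<in> opens"
  unfolding opens_def chart_def
  by (rule CollectI, rule exI[of _ "{\<lambda>p. p (i, j)}"]) (auto intro: hom_poly_var)

lemma chart_iff: "K \<in> Gr \<Longrightarrow> t \<in> frames K \<Longrightarrow> K \<in> chart i j \<longleftrightarrow> plucker t (i, j) \<noteq> 0"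
  unfolding chart_def using hom_poly_frames[OF hom_poly_var[of "(i, j)"]] by blast

lemma chart_cover: "K \<in> Gr \<Longrightarrow> \<exists>i j. K \<in> chart i j"
  using frames_good[OF _ fr] chart_iff[OF _ fr] unfolding good_def by fast

lemma chart_Gr: "K \<in> chart i j \<Longrightarrow> K \<in> Gr"
  by (simp add: chart_def)

section \<open>Local fractions and the ring operations on regular functions\<close>

definition frac_on :: "('k::field^'n::finite) set set \<Rightarrow> (('k^'n) set \<Rightarrow> 'k) \<Rightarrow> bool" where
  "frac_on N s \<longleftrightarrow> (\<exists>d P Q. hom_poly d P \<and> hom_poly d Q \<and>
     (\<forall>L\<in>N. \<forall>t\<in>frames L. Q (plucker t) \<noteq> 0 \<and> s L = P (plucker t) / Q (plucker t)))"

lemma regular_on_iff: "regular_on U s \<longleftrightarrow> (\<forall>K\<in>U. \<exists>N\<in>opens. K \<in> N \<and> N \<subseteq> U \<and> frac_on N s)"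
  by (simp only: regular_on_def frac_on_def)

lemma frac_mono: "frac_on N s \<Longrightarrow> N' \<subseteq> N \<Longrightarrow> frac_on N' s"
  unfolding frac_on_def by (meson subsetD)

lemma frac_cong: assumes "frac_on N s" "\<And>K. K \<in> N \<Longrightarrow> s' K = s K" shows "frac_on N s'"
  using assms(1) unfolding frac_on_def by (simp add: assms(2))

lemma regular_mono: assumes "regular_on U s" "U' \<subseteq> U" "U' \<in> opens" shows "regular_on U' s"
  unfolding regular_on_iff
proof
  fix K assume K: "K \<in> U'"
  then obtain N where "N \<in> opens" "K \<in> N" "frac_on N s" using assms unfolding regular_on_iff by blast
  then show "\<exists>N\<in>opens. K \<in> N \<and> N \<subseteq> U' \<and> frac_on N s"
    using K assms(3) by (intro bexI[of _ "N \<inter> U'"]) (auto intro: opens_Int frac_mono)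
qed

lemma regular_local:
  assumes "\<And>K. K \<in> U \<Longrightarrow> \<exists>N\<in>opens. K \<in> N \<and> N \<subseteq> U \<and> regular_on N s"
  shows "regular_on U s"
  unfolding regular_on_iff
proof
  fix K assume "K \<in> U"
  then obtain N where N: "K \<in> N" "N \<subseteq> U" "regular_on N s" using assms by blast
  then obtain N' where "N' \<in> opens" "K \<in> N'" "N' \<subseteq> N" "frac_on N' s" unfolding regular_on_iff by blast
  then show "\<exists>N\<in>opens. K \<in> N \<and> N \<subseteq> U \<and> frac_on N s" using N(2) by blast
qed

lemma regular_cong:
  assumes "regular_on U s" "\<And>K. K \<in> U \<Longrightarrow> s' K = s K" shows "regular_on U s'"
  unfolding regular_on_iff
proof
  fix K assume "K \<in> U"
  then obtain N where N: "N \<in> opens" "K \<in> N" "N \<subseteq> U" "frac_on N s" using assms(1) unfolding regular_on_iff by blast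
  have "frac_on N s'" using N(3) assms(2) by (intro frac_cong[OF N(4)]) blast
  with N show "\<exists>N\<in>opens. K \<in> N \<and> N \<subseteq> U \<and> frac_on N s'" by blast
qed

lemma regular_const: assumes "U \<in> opens" shows "regular_on U (\<lambda>L. c)"
proof -
  have "frac_on U (\<lambda>L. c)" unfolding frac_on_def
    by (rule exI[of _ 0], rule exI[of _ "\<lambda>p. c"], rule exI[of _ "\<lambda>p. 1"]) (auto intro: hom_poly_const)
  then show ?thesis using assms unfolding regular_on_iff by blast
qed

text \<open>Two local fractions are combined on the intersection of their domains, once for sum and
  product alike; R computes the numerator.\<close>

lemma regular_binary:
  fixes f :: "'k \<Rightarrow> 'k \<Rightarrow> 'k::field" and U :: "('k^'n::finite) set set"
  assumes "regular_on U s" "regular_on U s'"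
    and num: "\<And>d e P Q P' (Q' :: ('n \<times> 'n \<Rightarrow> 'k) \<Rightarrow> 'k). hom_poly d P \<Longrightarrow> hom_poly d Q \<Longrightarrow> hom_poly e P' \<Longrightarrow> hom_poly e Q'
      \<Longrightarrow> hom_poly (d + e) (\<lambda>p. R (P p) (Q p) (P' p) (Q' p))"
    and f: "\<And>a b a' b'. b \<noteq> 0 \<Longrightarrow> b' \<noteq> 0 \<Longrightarrow> f (a / b) (a' / b') = R a b a' b' / (b * b')"
  shows "regular_on U (\<lambda>L. f (s L) (s' L))"
  unfolding regular_on_iff
proof
  fix K assume K: "K \<in> U"
  obtain N where N: "N \<in> opens" "K \<in> N" "N \<subseteq> U" "frac_on N s"
    using K assms(1) unfolding regular_on_iff by blast
  obtain N' where N': "N' \<in> opens" "K \<in> N'" "N' \<subseteq> U" "frac_on N' s'"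
    using K assms(2) unfolding regular_on_iff by blast
  obtain d P Q where q1: "hom_poly d P" "hom_poly d Q" "\<forall>L\<in>N. \<forall>t\<in>frames L. Q (plucker t) \<noteq> 0 \<and> s L = P (plucker t) / Q (plucker t)"
    using N(4) unfolding frac_on_def by metis
  obtain e P' Q' where q2: "hom_poly e P'" "hom_poly e Q'" "\<forall>L\<in>N'. \<forall>t\<in>frames L. Q' (plucker t) \<noteq> 0 \<and> s' L = P' (plucker t) / Q' (plucker t)"
    using N'(4) unfolding frac_on_def by metis
  have "frac_on (N \<inter> N') (\<lambda>L. f (s L) (s' L))" unfolding frac_on_def
  proof (intro exI conjI)
    show "hom_poly (d + e) (\<lambda>p. R (P p) (Q p) (P' p) (Q' p))" by (intro num q1 q2)
    show "hom_poly (d + e) (\<lambda>p. Q p * Q' p)" by (intro hom_poly_mult q1 q2)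
    show "\<forall>L\<in>N \<inter> N'. \<forall>t\<in>frames L. Q (plucker t) * Q' (plucker t) \<noteq> 0 \<and>
        f (s L) (s' L) = R (P (plucker t)) (Q (plucker t)) (P' (plucker t)) (Q' (plucker t)) / (Q (plucker t) * Q' (plucker t))"
    proof (intro ballI)
      fix L t assume "L \<in> N \<inter> N'" and t: "t \<in> frames L"
      then have "Q (plucker t) \<noteq> 0 \<and> s L = P (plucker t) / Q (plucker t)"
        "Q' (plucker t) \<noteq> 0 \<and> s' L = P' (plucker t) / Q' (plucker t)" using q1(3) q2(3) by blast+
      then show "Q (plucker t) * Q' (plucker t) \<noteq> 0 \<and>
        f (s L) (s' L) = R (P (plucker t)) (Q (plucker t)) (P' (plucker t)) (Q' (plucker t)) / (Q (plucker t) * Q' (plucker t))"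
        by (simp add: f)
    qed
  qed
  then show "\<exists>N\<in>opens. K \<in> N \<and> N \<subseteq> U \<and> frac_on N (\<lambda>L. f (s L) (s' L))"
    using opens_Int[OF N(1) N'(1)] N(2,3) N'(2) by blast
qed

lemma regular_add: "regular_on U s \<Longrightarrow> regular_on U s' \<Longrightarrow> regular_on U (\<lambda>L. s L + s' L)"
proof (rule regular_binary[where f = "(+)" and R = "\<lambda>a b a' b'. a * b' + b * a'"])
  fix d e and P Q P' Q' :: "('b \<times> 'b \<Rightarrow> 'a) \<Rightarrow> 'a"
  assume "hom_poly d P" "hom_poly d Q" "hom_poly e P'" "hom_poly e Q'"
  then show "hom_poly (d + e) (\<lambda>p. P p * Q' p + Q p * P' p)" by (intro hom_poly_add hom_poly_mult)
qed (auto simp: field_simps)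

lemma regular_mult: "regular_on U s \<Longrightarrow> regular_on U s' \<Longrightarrow> regular_on U (\<lambda>L. s L * s' L)"
  by (rule regular_binary[where f = "(*)" and R = "\<lambda>a b a' b'. a * a'"]) (auto intro: hom_poly_mult)

lemma regular_sum:
  "U \<in> opens \<Longrightarrow> (\<And>i. i \<in> A \<Longrightarrow> regular_on U (s i)) \<Longrightarrow> regular_on U (\<lambda>L. \<Sum>i\<in>A. s i L)"
  by (induction A rule: infinite_finite_induct) (auto intro: regular_const regular_add)

text \<open>The frame of \<open>L\<close> that sends the basis vectors \<open>i\<close> and \<open>j\<close> to \<open>(1, 0)\<close> and \<open>(0, 1)\<close>.\<close>

definition nf :: "'n \<Rightarrow> 'n \<Rightarrow> ('k::field^'n::finite) set \<Rightarrow> ('k, 'n) frame" where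
  "nf i j L = (let t = fr L; p = plucker t (i, j); y = zc t (axis i 1); z = zc t (axis j 1)
     in gfr ((snd z / p, - fst z / p), (- snd y / p, fst y / p)) t)"

lemma zc_nf_fr:
  "zc (nf i j L) v = (det2 (zc (fr L) v) (zc (fr L) (axis j 1)) / plucker (fr L) (i, j),
     det2 (zc (fr L) (axis i 1)) (zc (fr L) v) / plucker (fr L) (i, j))"
  by (simp add: nf_def Let_def zc_gfr gact_def det2_def diff_divide_distrib algebra_simps)

lemma nf_frames: assumes "L \<in> chart i j" shows "nf i j L \<in> frames L"
proof -
  have L: "L \<in> Gr" using assms by (rule chart_Gr)
  have p: "plucker (fr L) (i, j) \<noteq> 0" using assms chart_iff[OF L fr[OF L]] by simp
  let ?t = "fr L" let ?p = "plucker ?t (i, j)" let ?y = "zc ?t (axis i 1)" let ?z = "zc ?t (axis j 1)"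
  have "gdet ((snd ?z / ?p, - fst ?z / ?p), (- snd ?y / ?p, fst ?y / ?p)) = det2 ?y ?z / (?p * ?p)"
    by (simp add: gdet_def det2_def diff_divide_distrib algebra_simps)
  then have "gdet ((snd ?z / ?p, - fst ?z / ?p), (- snd ?y / ?p, fst ?y / ?p)) \<noteq> 0"
    using p by (simp add: plucker_det2)
  then show ?thesis using fr[OF L] by (simp add: nf_def Let_def frames_iff kern_gfr)
qed

text \<open>Numerators and denominator are all multiplied by the same determinant under a change of
  frame, so any frame t computes the normal one.\<close>

lemma zc_nf:
  assumes L: "L \<in> chart i j" and t: "t \<in> frames L"
  shows "zc (nf i j L) v = (det2 (zc t v) (zc t (axis j 1)) / plucker t (i, j),
     det2 (zc t (axis i 1)) (zc t v) / plucker t (i, j))"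
proof -
  obtain g where g: "gdet g \<noteq> 0" "t = gfr g (fr L)" using frames_gfr[OF chart_Gr[OF L] fr[OF chart_Gr[OF L]] t] .
  then show ?thesis unfolding zc_nf_fr g(2) by (simp add: zc_gfr det2_gact plucker_gfr)
qed

lemma zc_nf_axis:
  assumes L: "L \<in> chart i j"
  shows "zc (nf i j L) (axis i 1) = (1, 0)" "zc (nf i j L) (axis j 1) = (0, 1)"
proof -
  have "plucker (fr L) (i, j) \<noteq> 0" using L chart_iff[OF chart_Gr[OF L] fr[OF chart_Gr[OF L]]] by simp
  then show "zc (nf i j L) (axis i 1) = (1, 0)" "zc (nf i j L) (axis j 1) = (0, 1)"
    by (simp_all add: zc_nf_fr plucker_det2) (simp_all add: det2_def)
qed

lemma det2_expand:
  "det2 (zc t v) z = (\<Sum>k\<in>UNIV. v $ k * det2 (zc t (axis k 1)) z)"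
  "det2 z (zc t v) = (\<Sum>k\<in>UNIV. v $ k * det2 z (zc t (axis k 1)))"
  by (simp_all add: det2_def zc_axis right_diff_distrib sum_subtractf)
    (simp_all add: zc_def sum_distrib_left sum_distrib_right mult_ac)

lemma regular_ratio:
  fixes U :: "('k::field^'n::finite) set set"
  assumes "U \<in> opens" "hom_poly d P" "hom_poly d Q"
    and "\<And>L t. L \<in> U \<Longrightarrow> t \<in> frames L \<Longrightarrow> Q (plucker t) \<noteq> 0 \<and> s L = P (plucker t) / Q (plucker t)"
  shows "regular_on U s"
proof -
  have "frac_on U s" unfolding frac_on_def
    by (rule exI[of _ d], rule exI[of _ P], rule exI[of _ Q]) (simp add: assms)
  then show ?thesis using assms(1) unfolding regular_on_iff by blast
qed

lemma regular_nf:
  fixes v :: "'k::field^'n::finite"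
  shows "regular_on (chart i j) (\<lambda>L. fst (zc (nf i j L) v))"
  "regular_on (chart i j) (\<lambda>L. snd (zc (nf i j L) v))"
proof -
  have q: "plucker t (i, j) \<noteq> 0" if "L \<in> chart i j" "t \<in> frames L" for L :: "('k^'n) set" and t
    using that chart_iff[OF chart_Gr] by blast
  show "regular_on (chart i j) (\<lambda>L. fst (zc (nf i j L) v))"
  proof (rule regular_ratio[OF chart_opens _ hom_poly_var[of "(i, j)"]])
    show "hom_poly 1 (\<lambda>p. \<Sum>k\<in>UNIV. v $ k * p (k, j))"
      by (intro hom_poly_sum hom_poly_cmult hom_poly_var)
  next
    fix L :: "('k^'n) set" and t assume *: "L \<in> chart i j" "t \<in> frames L"
    show "plucker t (i, j) \<noteq> 0 \<and> fst (zc (nf i j L) v) = (\<Sum>k\<in>UNIV. v $ k * plucker t (k, j)) / plucker t (i, j)"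
      using q[OF *] by (simp add: zc_nf[OF *] det2_expand(1)[of t v] plucker_det2)
  qed
  show "regular_on (chart i j) (\<lambda>L. snd (zc (nf i j L) v))"
  proof (rule regular_ratio[OF chart_opens _ hom_poly_var[of "(i, j)"]])
    show "hom_poly 1 (\<lambda>p. \<Sum>k\<in>UNIV. v $ k * p (i, k))"
      by (intro hom_poly_sum hom_poly_cmult hom_poly_var)
  next
    fix L :: "('k^'n) set" and t assume *: "L \<in> chart i j" "t \<in> frames L"
    show "plucker t (i, j) \<noteq> 0 \<and> snd (zc (nf i j L) v) = (\<Sum>k\<in>UNIV. v $ k * plucker t (i, k)) / plucker t (i, j)"
      using q[OF *] by (simp add: zc_nf[OF *] det2_expand(2)[of _ t v] plucker_det2)
  qed
qed

definition regp :: "('k::field^'n::finite) set set \<Rightarrow> (('k^'n) set \<Rightarrow> 'k poly) \<Rightarrow> bool" where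
  "regp U h \<longleftrightarrow> (\<forall>m. regular_on U (\<lambda>L. coeff (h L) m))"

lemma regp_const: "U \<in> opens \<Longrightarrow> regp U (\<lambda>L. P)"
  by (simp add: regp_def regular_const)

lemma regp_add: "regp U h \<Longrightarrow> regp U h' \<Longrightarrow> regp U (\<lambda>L. h L + h' L)"
  by (simp add: regp_def regular_add)

lemma regp_psmult: "regular_on U a \<Longrightarrow> regp U h \<Longrightarrow> regp U (\<lambda>L. psmult (a L) (h L))"
  by (simp add: regp_def regular_mult)

lemma regp_mult: "U \<in> opens \<Longrightarrow> regp U h \<Longrightarrow> regp U h' \<Longrightarrow> regp U (\<lambda>L. h L * h' L)"
  by (simp add: regp_def coeff_mult regular_sum regular_mult)

lemma regp_sum: "U \<in> opens \<Longrightarrow> (\<And>i. i \<in> A \<Longrightarrow> regp U (h i)) \<Longrightarrow> regp U (\<lambda>L. \<Sum>i\<in>A. h i L)"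
  by (simp add: regp_def coeff_sum regular_sum)

lemma regp_prod_list: "U \<in> opens \<Longrightarrow> (\<And>i. i \<in> set A \<Longrightarrow> regp U (h i)) \<Longrightarrow> regp U (\<lambda>L. \<Prod>i\<leftarrow>A. h i L)"
  by (induction A) (auto intro: regp_const regp_mult)

lemma regular_prod: "U \<in> opens \<Longrightarrow> (\<And>i. i \<in> A \<Longrightarrow> regular_on U (h i)) \<Longrightarrow> regular_on U (\<lambda>L. \<Prod>i\<in>A. h i L)"
  by (induction A rule: infinite_finite_induct) (auto intro: regular_const regular_mult)

lemma regp_pderiv: "U \<in> opens \<Longrightarrow> regp U h \<Longrightarrow> regp U (\<lambda>L. pderiv (h L))"
  by (simp add: regp_def coeff_pderiv regular_mult regular_const)

lemma regp_cong: "regp U h \<Longrightarrow> (\<And>K. K \<in> U \<Longrightarrow> h' K = h K) \<Longrightarrow> regp U h'"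
  unfolding regp_def by (metis (no_types, lifting) regular_cong)

lemma regp_mono: "regp U h \<Longrightarrow> U' \<subseteq> U \<Longrightarrow> U' \<in> opens \<Longrightarrow> regp U' h"
  unfolding regp_def using regular_mono by blast

lemma regp_local: "(\<And>K. K \<in> U \<Longrightarrow> \<exists>N\<in>opens. K \<in> N \<and> N \<subseteq> U \<and> regp N h) \<Longrightarrow> regp U h"
  unfolding regp_def by (intro allI regular_local) blast

lemma regp_lin_nf:
  assumes "U \<in> opens" "U \<subseteq> chart i j" shows "regp U (\<lambda>L. lin (zc (nf i j L) v))"
proof -
  have "regp U (\<lambda>L. psmult (fst (zc (nf i j L) v)) 1 + psmult (snd (zc (nf i j L) v)) [:0, 1:])"
    using assms regular_nf regular_mono by (intro regp_add regp_psmult regp_const) blast+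
  then show ?thesis by (rule regp_cong) (simp add: lin_def)
qed

lemma regp_evw:
  assumes "U \<in> opens" "U \<subseteq> chart i j" shows "regp U (\<lambda>L. evw l (zc (nf i j L)) vs)"
proof -
  have r: "regular_on U (\<lambda>L. fst (zc (nf i j L) v))" "regular_on U (\<lambda>L. snd (zc (nf i j L) v))" for v
    using assms regular_nf regular_mono by blast+
  have "regular_on U (\<lambda>L. fst (zc (nf i j L) v) * snd (zc (nf i j L) w) + (- 1) * (snd (zc (nf i j L) v) * fst (zc (nf i j L) w)))" for v w
    by (intro regular_add regular_mult regular_const r assms)
  then have "regular_on U (\<lambda>L. det2 (zc (nf i j L) v) (zc (nf i j L) w))" for v w
    by (rule regular_cong) (simp add: det2_def)
  then show ?thesis
    unfolding evw_def wdet_def by (intro regp_psmult regular_prod regp_prod_list regp_lin_nf assms)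
qed

section \<open>Sections of the Schur powers\<close>

lemma fib_add:
  fixes K :: "('k::field_char_0^'n::finite) set"
  assumes "K \<in> Gr" "C \<in> carrier (schur_fibre l K)" "C' \<in> carrier (schur_fibre l K)"
  shows "C \<oplus>\<^bsub>schur_fibre l K\<^esub> C' \<in> carrier (schur_fibre l K)"
    "t \<in> frames K \<Longrightarrow> vl t l (C \<oplus>\<^bsub>schur_fibre l K\<^esub> C') = vl t l C + vl t l C'"
  using plane.schur_power_add[OF plane_fibre[OF assms(1)], of _ C l C'] assms fr[OF assms(1)]
  by (auto simp: schur_fibre_def)

lemma fib_smult:
  fixes K :: "('k::field_char_0^'n::finite) set"
  assumes "K \<in> Gr" "C \<in> carrier (schur_fibre l K)"
  shows "c \<odot>\<^bsub>schur_fibre l K\<^esub> C \<in> carrier (schur_fibre l K)"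
    "t \<in> frames K \<Longrightarrow> vl t l (c \<odot>\<^bsub>schur_fibre l K\<^esub> C) = psmult c (vl t l C)"
  using plane.schur_power_smult[OF plane_fibre[OF assms(1)], of _ C l c] assms fr[OF assms(1)]
  by (auto simp: schur_fibre_def)

lemma fib_zero:
  fixes K :: "('k::field_char_0^'n::finite) set"
  assumes "K \<in> Gr"
  shows "\<zero>\<^bsub>schur_fibre l K\<^esub> \<in> carrier (schur_fibre l K)"
    "t \<in> frames K \<Longrightarrow> vl t l (\<zero>\<^bsub>schur_fibre l K\<^esub>) = 0"
  using plane.schur_power_zero[OF plane_fibre[OF assms(1)], of _ l] fr[OF assms(1)]
  by (auto simp: schur_fibre_def)

lemma fib_finsum:
  fixes K :: "('k::field_char_0^'n::finite) set"
  assumes "K \<in> Gr" "\<And>i. i \<in> I \<Longrightarrow> h i \<in> carrier (schur_fibre l K)"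
  shows "(\<Oplus>\<^bsub>schur_fibre l K\<^esub>i\<in>I. h i) \<in> carrier (schur_fibre l K)"
    "t \<in> frames K \<Longrightarrow> vl t l (\<Oplus>\<^bsub>schur_fibre l K\<^esub>i\<in>I. h i) = (\<Sum>i\<in>I. vl t l (h i))"
  using plane.val_finsum[OF plane_fibre[OF assms(1)], of _ I h l] assms fr[OF assms(1)]
  by (auto simp: schur_fibre_def)

lemma fib_inj:
  fixes K :: "('k::field_char_0^'n::finite) set"
  assumes "K \<in> Gr" "t \<in> frames K" "C \<in> carrier (schur_fibre l K)" "C' \<in> carrier (schur_fibre l K)" "vl t l C = vl t l C'"
  shows "C = C'"
  using plane.val_inj[OF plane_fibre[OF assms(1,2)]] assms by (simp add: schur_fibre_def)

lemma fib_degree: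
  fixes K :: "('k::field_char_0^'n::finite) set"
  assumes "K \<in> Gr" "t \<in> frames K" "C \<in> carrier (schur_fibre l K)"
  shows "degree (vl t l C) \<le> sdeg l"
  using plane.degree_val[OF plane_fibre[OF assms(1,2)]] assms by (simp add: schur_fibre_def)

definition gens :: "int \<times> int \<Rightarrow> (('k::field^'n) set \<Rightarrow> ('k, 'n) schur_elem) set" where
  "gens l = {schur_section l vs | vs. length vs = deg l}"

definition comb_on :: "int \<times> int \<Rightarrow> ('k::field^'n::finite) set set \<Rightarrow> (('k^'n) set \<Rightarrow> ('k, 'n) schur_elem) \<Rightarrow> bool" where
  "comb_on l N s \<longleftrightarrow> (\<exists>J a. finite J \<and> J \<subseteq> gens l \<and> (\<forall>g\<in>J. regular_on N (a g)) \<and>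
     (\<forall>L\<in>N. s L = (\<Oplus>\<^bsub>schur_fibre l L\<^esub>g\<in>J. a g L \<odot>\<^bsub>schur_fibre l L\<^esub> g L)))"

lemma comb_onE:
  assumes "comb_on l N s"
  obtains J a where "finite J" "J \<subseteq> gens l" "\<forall>g\<in>J. regular_on N (a g)"
    "\<forall>L\<in>N. s L = (\<Oplus>\<^bsub>schur_fibre l L\<^esub>g\<in>J. a g L \<odot>\<^bsub>schur_fibre l L\<^esub> g L)"
  using assms unfolding comb_on_def by (elim exE conjE) (rule that)

lemma SW_carrier: "s \<in> carrier (SW l U) \<longleftrightarrow> s \<in> Pi\<^sub>E U (\<lambda>K. carrier (schur_fibre l K)) \<and>
    (\<forall>K\<in>U. \<exists>N\<in>opens. K \<in> N \<and> N \<subseteq> U \<and> comb_on l N s)"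
  by (simp add: SW_def bundle_sheaf_def comb_on_def gens_def)

text \<open>Generating sections have forms with regular coefficients in the normal frames, and so
  have their regular combinations. Conversely, on a chart the standard words in the axes i and j
  evaluate to the monomials, so the coefficients of the form express the section by global
  generators.\<close>

lemma SW_carrier_iff:
  fixes U :: "('k::field_char_0^'n::finite) set set"
  assumes U: "U \<in> opens"
  shows "s \<in> carrier (SW l U) \<longleftrightarrow> s \<in> Pi\<^sub>E U (\<lambda>K. carrier (schur_fibre l K)) \<and>
    (\<forall>i j. regp (U \<inter> chart i j) (\<lambda>L. vl (nf i j L) l (s L)))" (is "?L \<longleftrightarrow> ?R")
proof
  assume L: ?L
  then have s: "s \<in> Pi\<^sub>E U (\<lambda>K. carrier (schur_fibre l K))" by (simp add: SW_carrier)
  have "regp (U \<inter> chart i j) (\<lambda>L. vl (nf i j L) l (s L))" for i j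
  proof (rule regp_local)
    fix K assume K: "K \<in> U \<inter> chart i j"
    then obtain N where N: "N \<in> opens" "K \<in> N" "N \<subseteq> U" "comb_on l N s"
      using L unfolding SW_carrier by blast
    from N(4) obtain J a where J: "finite J" "J \<subseteq> gens l" and a: "\<forall>g\<in>J. regular_on N (a g)"
      and sL: "\<forall>L\<in>N. s L = (\<Oplus>\<^bsub>schur_fibre l L\<^esub>g\<in>J. a g L \<odot>\<^bsub>schur_fibre l L\<^esub> g L)"
      by (rule comb_onE)
    define M where "M = N \<inter> chart i j"
    have M: "M \<in> opens" unfolding M_def using N(1) chart_opens by (rule opens_Int)
    have "\<forall>g\<in>J. \<exists>vs. g = schur_section l vs \<and> length vs = deg l" using J(2) unfolding gens_def by blast
    then obtain v where v: "\<And>g. g \<in> J \<Longrightarrow> g = schur_section l (v g) \<and> length (v g) = deg l" by metis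
    have "regp M (\<lambda>L. \<Sum>g\<in>J. psmult (a g L) (evw l (zc (nf i j L)) (v g)))"
      using a M N(1) by (intro regp_sum regp_psmult regp_evw) (auto simp: M_def intro: regular_mono)
    moreover have "vl (nf i j L) l (s L) = (\<Sum>g\<in>J. psmult (a g L) (evw l (zc (nf i j L)) (v g)))" if "L \<in> M" for L
    proof -
      have *: "L \<in> Gr" "nf i j L \<in> frames L" using that chart_Gr nf_frames unfolding M_def by blast+
      have g: "g L \<in> carrier (schur_fibre l L)" "vl (nf i j L) l (g L) = evw l (zc (nf i j L)) (v g)" if "g \<in> J" for g
        using schur_section_facts[OF *, of "v g" l] v[OF that] by auto
      have "vl (nf i j L) l (s L) = (\<Sum>g\<in>J. vl (nf i j L) l (a g L \<odot>\<^bsub>schur_fibre l L\<^esub> g L))"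
        using that fib_finsum(2)[OF *(1) _ *(2), of J "\<lambda>g. a g L \<odot>\<^bsub>schur_fibre l L\<^esub> g L" l] fib_smult(1)[OF *(1)] g
        by (simp add: sL M_def)
      also have "\<dots> = (\<Sum>g\<in>J. psmult (a g L) (evw l (zc (nf i j L)) (v g)))"
        by (intro sum.cong refl) (simp add: fib_smult(2)[OF *(1) g(1) *(2)] g(2))
      finally show ?thesis .
    qed
    ultimately have "regp M (\<lambda>L. vl (nf i j L) l (s L))" by (rule regp_cong)
    then show "\<exists>N\<in>opens. K \<in> N \<and> N \<subseteq> U \<inter> chart i j \<and> regp N (\<lambda>L. vl (nf i j L) l (s L))"
      using M K N by (intro bexI[of _ M]) (auto simp: M_def)
  qed
  with s show ?R by blast
next
  assume R: ?R
  have "\<exists>N\<in>opens. K \<in> N \<and> N \<subseteq> U \<and> comb_on l N s"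
    if K: "K \<in> U" for K
  proof -
    have KG: "K \<in> Gr" using K opens_subset_Gr[OF U] by blast
    obtain i j where ij: "K \<in> chart i j" using chart_cover[OF KG] by blast
    define G where "G m = (schur_section l (std_word l (axis i 1) (axis j 1) m) :: ('k^'n) set \<Rightarrow> _)" for m
    have G: "G m L \<in> carrier (schur_fibre l L)" "vl (nf i j L) l (G m L) = monom 1 m"
      if "L \<in> chart i j" "m \<le> sdeg l" for L m
      using schur_section_facts[OF chart_Gr[OF that(1)] nf_frames[OF that(1)] length_std_word[OF that(2)]]
        evw_std_word[where \<theta> = "zc (nf i j L)", OF that(2) zc_nf_axis[OF that(1)]] by (auto simp: G_def)
    \<comment> \<open>The sum in \<open>comb_on\<close> runs over a set of sections, so different m
      must give different sections.\<close>
    have inj: "inj_on G {..sdeg l}"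
    proof (rule inj_onI)
      fix m m' assume "m \<in> {..sdeg l}" "m' \<in> {..sdeg l}" "G m = G m'"
      then have "monom 1 m = (monom 1 m' :: 'k poly)" using G(2)[OF ij] by (metis atMost_iff)
      then show "m = m'" by (metis degree_monom_eq one_neq_zero)
    qed
    define c where "c m L = coeff (vl (nf i j L) l (s L)) m" for m L
    define a where "a g = c (the_inv_into {..sdeg l} G g)" for g
    have a: "a (G m) = c m" if "m \<le> sdeg l" for m using that by (simp add: a_def the_inv_into_f_f[OF inj])
    have "s L = (\<Oplus>\<^bsub>schur_fibre l L\<^esub>g\<in>G ` {..sdeg l}. a g L \<odot>\<^bsub>schur_fibre l L\<^esub> g L)" if "L \<in> U \<inter> chart i j" for L
    proof (rule fib_inj)
      have L: "L \<in> chart i j" using that by simp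
      show LG: "L \<in> Gr" and t: "nf i j L \<in> frames L" using chart_Gr[OF L] nf_frames[OF L] by auto
      show sL: "s L \<in> carrier (schur_fibre l L)" using R that by (auto simp: PiE_iff)
      have c: "a g L \<odot>\<^bsub>schur_fibre l L\<^esub> g L \<in> carrier (schur_fibre l L)" if "g \<in> G ` {..sdeg l}" for g
        using that G(1)[OF L] by (auto intro: fib_smult(1)[OF LG])
      show "(\<Oplus>\<^bsub>schur_fibre l L\<^esub>g\<in>G ` {..sdeg l}. a g L \<odot>\<^bsub>schur_fibre l L\<^esub> g L) \<in> carrier (schur_fibre l L)"
        by (rule fib_finsum(1)[OF LG c])
      have "vl (nf i j L) l (\<Oplus>\<^bsub>schur_fibre l L\<^esub>g\<in>G ` {..sdeg l}. a g L \<odot>\<^bsub>schur_fibre l L\<^esub> g L)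
          = (\<Sum>g\<in>G ` {..sdeg l}. vl (nf i j L) l (a g L \<odot>\<^bsub>schur_fibre l L\<^esub> g L))"
        by (rule fib_finsum(2)[OF LG c t])
      also have "\<dots> = (\<Sum>m\<le>sdeg l. vl (nf i j L) l (a (G m) L \<odot>\<^bsub>schur_fibre l L\<^esub> G m L))"
        by (simp add: sum.reindex[OF inj])
      also have "\<dots> = (\<Sum>m\<le>sdeg l. monom (c m L) m)"
        by (intro sum.cong refl) (simp add: fib_smult(2)[OF LG G(1)[OF L] t] G(2)[OF L] a smult_monom)
      also have "\<dots> = vl (nf i j L) l (s L)"
        unfolding c_def by (rule poly_sum_monoms[symmetric]) (rule fib_degree[OF LG t sL])
      finally show "vl (nf i j L) l (s L) = vl (nf i j L) l (\<Oplus>\<^bsub>schur_fibre l L\<^esub>g\<in>G ` {..sdeg l}. a g L \<odot>\<^bsub>schur_fibre l L\<^esub> g L)" ..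
    qed
    moreover have "regular_on (U \<inter> chart i j) (a g)" if "g \<in> G ` {..sdeg l}" for g
      using that R by (auto simp: a c_def[abs_def] regp_def)
    moreover have "G ` {..sdeg l} \<subseteq> gens l"
    proof (rule image_subsetI)
      fix m assume "m \<in> {..sdeg l}"
      then have "length (std_word l (axis i 1) (axis j 1) m :: ('k^'n) list) = deg l" by (simp add: length_std_word)
      then show "G m \<in> gens l" unfolding G_def gens_def by blast
    qed
    ultimately have "comb_on l (U \<inter> chart i j) s"
      unfolding comb_on_def by (intro exI[of _ "G ` {..sdeg l}"] exI[of _ a]) simp
    then show ?thesis
      using K ij opens_Int[OF U chart_opens, of i j] by blast
  qed
  then show ?L using R unfolding SW_carrier by simp
qed

lemma structure_sheaf_carrier: "a \<in> carrier (structure_sheaf U) \<longleftrightarrow> a \<in> extensional U \<and> regular_on U a"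
  by (simp add: structure_sheaf_def)

lemma SW_add_apply: "K \<in> U \<Longrightarrow> (s \<oplus>\<^bsub>SW l U\<^esub> s') K = s K \<oplus>\<^bsub>schur_fibre l K\<^esub> s' K"
  by (simp add: SW_def bundle_sheaf_def)

lemma SW_smult_apply: "K \<in> U \<Longrightarrow> (a \<odot>\<^bsub>SW l U\<^esub> s) K = a K \<odot>\<^bsub>schur_fibre l K\<^esub> s K"
  by (simp add: SW_def bundle_sheaf_def)

lemma SW_zero_apply: "K \<in> U \<Longrightarrow> \<zero>\<^bsub>SW l U\<^esub> K = \<zero>\<^bsub>schur_fibre l K\<^esub>"
  by (simp add: SW_def bundle_sheaf_def)

lemma SW_op_extensional:
  "s \<oplus>\<^bsub>SW l U\<^esub> s' \<in> extensional U" "a \<odot>\<^bsub>SW l U\<^esub> s \<in> extensional U" "\<zero>\<^bsub>SW l U\<^esub> \<in> extensional U"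
  by (simp_all add: SW_def bundle_sheaf_def)

context
  fixes U :: "('k::field_char_0^'n::finite) set set"
  assumes U: "U \<in> opens"
begin

lemma U_Gr: "K \<in> U \<Longrightarrow> K \<in> Gr"
  using opens_subset_Gr[OF U] by blast

lemma SW_fibre: "s \<in> carrier (SW l U) \<Longrightarrow> K \<in> U \<Longrightarrow> s K \<in> carrier (schur_fibre l K)"
  by (auto simp: SW_carrier PiE_iff)

lemma SW_regp: "s \<in> carrier (SW l U) \<Longrightarrow> regp (U \<inter> chart i j) (\<lambda>L. vl (nf i j L) l (s L))"
  by (simp add: SW_carrier_iff[OF U])

lemma SW_intro:
  assumes "s \<in> extensional U" "\<And>K. K \<in> U \<Longrightarrow> s K \<in> carrier (schur_fibre l K)"
    and "\<And>i j. regp (U \<inter> chart i j) (h i j)"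
    and "\<And>i j L. L \<in> U \<Longrightarrow> L \<in> chart i j \<Longrightarrow> vl (nf i j L) l (s L) = h i j L"
  shows "s \<in> carrier (SW l U)"
  unfolding SW_carrier_iff[OF U]
proof (intro conjI allI)
  show "s \<in> Pi\<^sub>E U (\<lambda>K. carrier (schur_fibre l K))" using assms(1,2) by (auto simp: PiE_iff)
  show "regp (U \<inter> chart i j) (\<lambda>L. vl (nf i j L) l (s L))" for i j
    by (rule regp_cong[OF assms(3)[of i j]]) (simp add: assms(4))
qed

lemma SW_add:
  assumes s: "s \<in> carrier (SW l U)" and s': "s' \<in> carrier (SW l U)"
  shows "s \<oplus>\<^bsub>SW l U\<^esub> s' \<in> carrier (SW l U)"
proof (rule SW_intro)
  show "regp (U \<inter> chart i j) (\<lambda>L. vl (nf i j L) l (s L) + vl (nf i j L) l (s' L))" for i j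
    by (intro regp_add SW_regp s s')
qed (simp_all add: SW_op_extensional SW_add_apply fib_add SW_fibre s s' U_Gr nf_frames)

lemma SW_add_val: "s \<in> carrier (SW l U) \<Longrightarrow> s' \<in> carrier (SW l U) \<Longrightarrow> K \<in> U \<Longrightarrow> t \<in> frames K
  \<Longrightarrow> vl t l ((s \<oplus>\<^bsub>SW l U\<^esub> s') K) = vl t l (s K) + vl t l (s' K)"
  by (simp add: SW_add_apply fib_add SW_fibre U_Gr)

lemma SW_smult:
  assumes s: "s \<in> carrier (SW l U)" and a: "a \<in> carrier (structure_sheaf U)"
  shows "a \<odot>\<^bsub>SW l U\<^esub> s \<in> carrier (SW l U)"
proof (rule SW_intro)
  show "regp (U \<inter> chart i j) (\<lambda>L. psmult (a L) (vl (nf i j L) l (s L)))" for i j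
    using a opens_Int[OF U chart_opens]
    by (intro regp_psmult SW_regp s) (auto simp: structure_sheaf_carrier intro: regular_mono)
qed (simp_all add: SW_op_extensional SW_smult_apply fib_smult SW_fibre s U_Gr nf_frames)

lemma SW_smult_val: "s \<in> carrier (SW l U) \<Longrightarrow> K \<in> U \<Longrightarrow> t \<in> frames K
  \<Longrightarrow> vl t l ((a \<odot>\<^bsub>SW l U\<^esub> s) K) = psmult (a K) (vl t l (s K))"
  by (simp add: SW_smult_apply fib_smult SW_fibre U_Gr)

lemma SW_zero: "\<zero>\<^bsub>SW l U\<^esub> \<in> carrier (SW l U)"
proof (rule SW_intro)
  show "regp (U \<inter> chart i j) (\<lambda>L. 0)" for i j
    by (intro regp_const opens_Int U chart_opens)
qed (simp_all add: SW_op_extensional SW_zero_apply fib_zero U_Gr nf_frames)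

lemma SW_zero_val: "K \<in> U \<Longrightarrow> t \<in> frames K \<Longrightarrow> vl t l (\<zero>\<^bsub>SW l U\<^esub> K) = 0"
  by (simp add: SW_zero_apply fib_zero U_Gr)

lemma SW_restrict:
  assumes s: "s \<in> carrier (SW l U)" and U': "U' \<in> opens" "U' \<subseteq> U"
  shows "restrict s U' \<in> carrier (SW l U')"
  unfolding SW_carrier_iff[OF U'(1)]
proof (intro conjI allI)
  show "restrict s U' \<in> Pi\<^sub>E U' (\<lambda>K. carrier (schur_fibre l K))" using SW_fibre[OF s] U'(2) by auto
  fix i j
  have "regp (U' \<inter> chart i j) (\<lambda>L. vl (nf i j L) l (s L))"
    by (rule regp_mono[OF SW_regp[OF s]]) (use U'(2) opens_Int[OF U'(1) chart_opens] in auto)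
  then show "regp (U' \<inter> chart i j) (\<lambda>L. vl (nf i j L) l (restrict s U' L))" by (rule regp_cong) simp
qed

lemma SW_section: assumes "length vs = deg l" shows "restrict (schur_section l vs) U \<in> carrier (SW l U)"
proof (rule SW_intro)
  show "regp (U \<inter> chart i j) (\<lambda>L. evw l (zc (nf i j L)) vs)" for i j
    by (intro regp_evw opens_Int U chart_opens) simp
qed (simp_all add: schur_section_facts assms U_Gr chart_Gr nf_frames schur_section_facts(1)[OF _ fr])

lemma SW_eqI:
  assumes s: "s \<in> carrier (SW l U)" "s' \<in> carrier (SW l U)"
    and "\<And>K. K \<in> U \<Longrightarrow> vl (fr K) l (s K) = vl (fr K) l (s' K)"
  shows "s = s'"
proof (rule extensionalityI)
  show "s \<in> extensional U" "s' \<in> extensional U" using s by (auto simp: SW_carrier PiE_iff)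
  show "s K = s' K" if "K \<in> U" for K
    by (rule fib_inj[OF U_Gr[OF that] fr[OF U_Gr[OF that]] SW_fibre[OF s(1) that] SW_fibre[OF s(2) that] assms(3)[OF that]])
qed

text \<open>A recursion in place of a finite sum of sections, so that linearity of a homomorphism
  applies one step at a time.\<close>

primrec lc :: "int \<times> int \<Rightarrow> (nat \<Rightarrow> ('k^'n) set \<Rightarrow> 'k) \<Rightarrow> (nat \<Rightarrow> ('k^'n) set \<Rightarrow> ('k, 'n) schur_elem) \<Rightarrow> nat
    \<Rightarrow> ('k^'n) set \<Rightarrow> ('k, 'n) schur_elem" where
  "lc l A S 0 = \<zero>\<^bsub>SW l U\<^esub>"
| "lc l A S (Suc m) = lc l A S m \<oplus>\<^bsub>SW l U\<^esub> (A m \<odot>\<^bsub>SW l U\<^esub> S m)"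

lemma lc_carrier:
  assumes "\<And>m. m < M \<Longrightarrow> A m \<in> carrier (structure_sheaf U)" "\<And>m. m < M \<Longrightarrow> S m \<in> carrier (SW l U)"
  shows "lc l A S M \<in> carrier (SW l U)"
  using assms by (induction M) (auto simp: SW_zero SW_add SW_smult)

lemma lc_val:
  assumes "\<And>m. m < M \<Longrightarrow> A m \<in> carrier (structure_sheaf U)" "\<And>m. m < M \<Longrightarrow> S m \<in> carrier (SW l U)"
    and "K \<in> U" "t \<in> frames K"
  shows "vl t l (lc l A S M K) = (\<Sum>m<M. psmult (A m K) (vl t l (S m K)))"
  using assms by (induction M) (auto simp: SW_zero_val SW_add_val SW_smult_val lc_carrier SW_smult)

end

section \<open>Homomorphisms act fibrewise\<close>

lemma const_structure: "U \<in> opens \<Longrightarrow> restrict (\<lambda>L. c) U \<in> carrier (structure_sheaf U)"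
  unfolding structure_sheaf_carrier by (auto intro: regular_cong[OF regular_const])

lemma restrict_structure: "regular_on U a \<Longrightarrow> restrict a U \<in> carrier (structure_sheaf U)"
  unfolding structure_sheaf_carrier by (auto intro: regular_cong)

context
  fixes l l' :: "int \<times> int" and \<phi> :: "('k::field_char_0, 'n::finite, ('k, 'n) schur_elem) gr_hom"
  assumes \<phi>: "\<phi> \<in> sheaf_homs (SW l) (SW l')"
begin

lemma hom_lin_maps: "U \<in> opens \<Longrightarrow> \<phi> U \<in> lin_maps (structure_sheaf U) (SW l U) (SW l' U)"
  using \<phi> by (auto simp: sheaf_homs_def)

lemma hom_closed: "U \<in> opens \<Longrightarrow> s \<in> carrier (SW l U) \<Longrightarrow> \<phi> U s \<in> carrier (SW l' U)"
  using hom_lin_maps[of U] by (auto simp: lin_maps_def)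

lemma hom_add: "U \<in> opens \<Longrightarrow> s \<in> carrier (SW l U) \<Longrightarrow> s' \<in> carrier (SW l U)
  \<Longrightarrow> \<phi> U (s \<oplus>\<^bsub>SW l U\<^esub> s') = \<phi> U s \<oplus>\<^bsub>SW l' U\<^esub> \<phi> U s'"
  using hom_lin_maps[of U] by (auto simp: lin_maps_def)

lemma hom_smult: "U \<in> opens \<Longrightarrow> s \<in> carrier (SW l U) \<Longrightarrow> a \<in> carrier (structure_sheaf U)
  \<Longrightarrow> \<phi> U (a \<odot>\<^bsub>SW l U\<^esub> s) = a \<odot>\<^bsub>SW l' U\<^esub> \<phi> U s"
  using hom_lin_maps[of U] by (auto simp: lin_maps_def)

lemma hom_restrict: "U \<in> opens \<Longrightarrow> U' \<in> opens \<Longrightarrow> U' \<subseteq> U \<Longrightarrow> s \<in> carrier (SW l U)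
  \<Longrightarrow> \<phi> U' (restrict s U') = restrict (\<phi> U s) U'"
  using \<phi> by (auto simp: sheaf_homs_def)

lemma hom_zero_val:
  assumes U: "U \<in> opens" and K: "K \<in> U" "t \<in> frames K"
  shows "vl t l' (\<phi> U \<zero>\<^bsub>SW l U\<^esub> K) = 0"
proof -
  let ?a = "restrict (\<lambda>L. 0) U"
  have "?a \<odot>\<^bsub>SW l U\<^esub> \<zero>\<^bsub>SW l U\<^esub> = \<zero>\<^bsub>SW l U\<^esub>"
    using U by (intro SW_eqI[where l = l, OF U] SW_smult SW_zero const_structure)
      (simp_all add: SW_smult_val[OF U] SW_zero SW_zero_val fr U_Gr)
  then have "\<phi> U \<zero>\<^bsub>SW l U\<^esub> = ?a \<odot>\<^bsub>SW l' U\<^esub> \<phi> U \<zero>\<^bsub>SW l U\<^esub>"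
    using hom_smult[OF U SW_zero[OF U] const_structure[OF U, of 0]] by simp
  then have "vl t l' (\<phi> U \<zero>\<^bsub>SW l U\<^esub> K) = vl t l' ((?a \<odot>\<^bsub>SW l' U\<^esub> \<phi> U \<zero>\<^bsub>SW l U\<^esub>) K)" by simp
  also have "\<dots> = 0"
    unfolding SW_smult_val[OF U hom_closed[OF U SW_zero[OF U]] K] using K(1) by simp
  finally show ?thesis .
qed

lemma hom_lc_val:
  assumes U: "U \<in> opens" and K: "K \<in> U" "t \<in> frames K"
    and "\<And>m. m < M \<Longrightarrow> A m \<in> carrier (structure_sheaf U)" "\<And>m. m < M \<Longrightarrow> S m \<in> carrier (SW l U)"
  shows "vl t l' (\<phi> U (lc U l A S M) K) = (\<Sum>m<M. psmult (A m K) (vl t l' (\<phi> U (S m) K)))"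
  using assms(4,5)
proof (induction M)
  case 0
  show ?case by (simp add: hom_zero_val[OF U K] lc.simps[OF U])
next
  case (Suc M)
  have c: "lc U l A S M \<in> carrier (SW l U)" "A M \<odot>\<^bsub>SW l U\<^esub> S M \<in> carrier (SW l U)"
    using Suc.prems by (auto intro: lc_carrier[OF U] SW_smult[OF U])
  show ?case
    using Suc by (simp add: lc.simps[OF U] hom_add[OF U c] hom_smult[OF U] SW_add_val[OF U] SW_smult_val[OF U] K
        hom_closed[OF U] SW_smult[OF U] lc_carrier[OF U])
qed

text \<open>Near K the section is a combination of sections whose forms are the monomials, with
  regular coefficients that vanish at K; linearity over regular functions carries the vanishing to
  the image.\<close>

lemma hom_vanish:
  assumes U: "U \<in> opens" and K: "K \<in> U" "t \<in> frames K" and s: "s \<in> carrier (SW l U)" and z: "vl t l (s K) = 0"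
  shows "vl t l' (\<phi> U s K) = 0"
proof -
  have KG: "K \<in> Gr" by (rule U_Gr[OF U K(1)])
  obtain i j where ij: "K \<in> chart i j" using chart_cover[OF KG] by blast
  define V where "V = U \<inter> chart i j"
  have V: "V \<in> opens" "V \<subseteq> U" "K \<in> V" "V \<subseteq> chart i j" using K ij opens_Int[OF U chart_opens] by (auto simp: V_def)
  define A where "A m = restrict (\<lambda>L. coeff (vl (nf i j L) l (s L)) m) V" for m
  define S where "S m = restrict (schur_section l (std_word l (axis i 1) (axis j 1) m)) V" for m
  have A: "A m \<in> carrier (structure_sheaf V)" for m
    using SW_regp[OF U s, of i j] unfolding A_def regp_def V_def by (intro restrict_structure) blast
  have S: "S m \<in> carrier (SW l V)" if "m < Suc (sdeg l)" for m
    using that unfolding S_def by (intro SW_section V length_std_word) simp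
  have vS: "vl (nf i j L) l (S m L) = monom 1 m" if "L \<in> V" "m < Suc (sdeg l)" for m L
  proof -
    have L: "L \<in> chart i j" and m: "m \<le> sdeg l" using that V(4) by auto
    show ?thesis
      using that(1) schur_section_facts(2)[OF chart_Gr[OF L] nf_frames[OF L] length_std_word[OF m], of "axis i 1" "axis j 1"]
        evw_std_word[where \<theta> = "zc (nf i j L)", OF m zc_nf_axis[OF L]] by (simp add: S_def)
  qed
  have "restrict s V = lc V l A S (Suc (sdeg l))"
  proof (rule SW_eqI[OF V(1)])
    show r: "restrict s V \<in> carrier (SW l V)" by (rule SW_restrict[OF U s V(1,2)])
    show c: "lc V l A S (Suc (sdeg l)) \<in> carrier (SW l V)" using A S by (intro lc_carrier V)
    fix L assume L: "L \<in> V"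
    then have LG: "L \<in> Gr" and f: "nf i j L \<in> frames L" using V(4) chart_Gr nf_frames by blast+
    have "vl (nf i j L) l (lc V l A S (Suc (sdeg l)) L) = (\<Sum>m<Suc (sdeg l). psmult (A m L) (vl (nf i j L) l (S m L)))"
      by (rule lc_val[OF V(1) A S L f])
    also have "\<dots> = (\<Sum>m\<le>sdeg l. monom (coeff (vl (nf i j L) l (s L)) m) m)"
      using L by (intro sum.cong) (auto simp: vS A_def smult_monom)
    also have "\<dots> = vl (nf i j L) l (s L)"
      using L V(2) by (intro poly_sum_monoms[symmetric] fib_degree[OF LG f] SW_fibre[OF U s]) auto
    finally have "restrict s V L = lc V l A S (Suc (sdeg l)) L"
      using L by (intro fib_inj[OF LG f SW_fibre[OF V(1) r L] SW_fibre[OF V(1) c L]]) simp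
    then show "vl (fr L) l (restrict s V L) = vl (fr L) l (lc V l A S (Suc (sdeg l)) L)" by simp
  qed
  then have "vl t l' (\<phi> U s K) = vl t l' (\<phi> V (lc V l A S (Suc (sdeg l))) K)"
    using hom_restrict[OF U V(1,2) s] V(3) by (metis restrict_apply')
  also have "\<dots> = (\<Sum>m<Suc (sdeg l). psmult (A m K) (vl t l' (\<phi> V (S m) K)))"
    by (rule hom_lc_val[OF V(1,3) K(2) A S])
  also have "\<dots> = 0"
  proof (rule sum.neutral, intro ballI)
    fix m
    have "s K = \<zero>\<^bsub>schur_fibre l K\<^esub>"
      using z by (intro fib_inj[OF KG K(2) SW_fibre[OF U s K(1)] fib_zero(1)[OF KG]]) (simp add: fib_zero(2)[OF KG K(2)])
    then have "A m K = 0" using V(3) fib_zero(2)[OF KG nf_frames[OF ij], of l] by (simp add: A_def)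
    then show "psmult (A m K) (vl t l' (\<phi> V (S m) K)) = 0" by simp
  qed
  finally show ?thesis .
qed

end

text \<open>Choose vectors x and y that the frame sends to the unit vectors. The standard words in x
  and y have the monomials as values at this point, and constant coefficients combine them to any
  form: the Schur powers are globally generated.\<close>

lemma global_section_exists:
  fixes t :: "('k::field_char_0, 'n::finite) frame"
  assumes t: "good t" and P: "degree P \<le> sdeg l"
  shows "\<exists>s\<in>carrier (SW l Gr). vl t l (s (kern t)) = P"
proof -
  obtain x y where xy: "zc t x = (1, 0)" "zc t y = (0, 1)" using good_surj[OF t] by metis
  define S where "S m = restrict (schur_section l (std_word l x y m)) Gr" for m
  define A where "A m = restrict (\<lambda>L. coeff P m) (Gr :: ('k^'n) set set)" for m
  have K: "kern t \<in> Gr" "t \<in> frames (kern t)" using kern_Gr[OF t] by (auto simp: frames_iff)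
  have A: "A m \<in> carrier (structure_sheaf Gr)" for m unfolding A_def by (rule const_structure[OF Gr_opens])
  have S: "S m \<in> carrier (SW l Gr)" if "m < Suc (sdeg l)" for m
    using that unfolding S_def by (intro SW_section Gr_opens length_std_word) simp
  have vS: "vl t l (S m (kern t)) = monom 1 m" if "m < Suc (sdeg l)" for m
    using that schur_section_facts(2)[OF K length_std_word, of m l x y] evw_std_word[where \<theta> = "zc t", OF _ xy, of m l] K
    by (simp add: S_def)
  have "vl t l (lc Gr l A S (Suc (sdeg l)) (kern t)) = (\<Sum>m<Suc (sdeg l). psmult (A m (kern t)) (vl t l (S m (kern t))))"
    by (rule lc_val[OF Gr_opens A S K])
  also have "\<dots> = (\<Sum>m\<le>sdeg l. monom (coeff P m) m)"
    using K by (intro sum.cong) (auto simp: vS A_def smult_monom)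
  also have "\<dots> = P" by (rule poly_sum_monoms[OF P, symmetric])
  finally have "vl t l (lc Gr l A S (Suc (sdeg l)) (kern t)) = P" .
  moreover have "lc Gr l A S (Suc (sdeg l)) \<in> carrier (SW l Gr)" using A S by (intro lc_carrier Gr_opens)
  ultimately show ?thesis by blast
qed

text \<open>The action of \<open>\<phi>\<close> on the fibre at \<open>kern t\<close>, in the coordinates given by \<open>t\<close>. Every element of the fibre
  is the value of a global section.\<close>

definition Lf :: "int \<times> int \<Rightarrow> int \<times> int \<Rightarrow> ('k::field_char_0, 'n::finite, ('k, 'n) schur_elem) gr_hom
    \<Rightarrow> ('k, 'n) frame \<Rightarrow> 'k poly \<Rightarrow> 'k poly" where
  "Lf l l' \<phi> t P = vl t l' (\<phi> Gr (SOME s. s \<in> carrier (SW l Gr) \<and> vl t l (s (kern t)) = P) (kern t))"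

text \<open>Two sections with the same value at K differ by one that vanishes there, so by
  \<open>hom_vanish\<close> the image at K depends on the value only.\<close>

lemma hom_fibre:
  assumes \<phi>: "\<phi> \<in> sheaf_homs (SW l) (SW l')" and U: "U \<in> opens" and K: "K \<in> U" "t \<in> frames K" and s: "s \<in> carrier (SW l U)"
  shows "vl t l' (\<phi> U s K) = Lf l l' \<phi> t (vl t l (s K))"
proof -
  have KG: "K \<in> Gr" by (rule U_Gr[OF U K(1)])
  have t: "good t" "K = kern t" using frames_good[OF KG K(2)] K(2) by (auto simp: frames_iff)
  define r where "r = (SOME s'. s' \<in> carrier (SW l Gr) \<and> vl t l (s' (kern t)) = vl t l (s K))"
  have r: "r \<in> carrier (SW l Gr)" "vl t l (r (kern t)) = vl t l (s K)"
    using someI_ex[of "\<lambda>s'. s' \<in> carrier (SW l Gr) \<and> vl t l (s' (kern t)) = vl t l (s K)"]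
      global_section_exists[OF t(1) fib_degree[OF KG K(2) SW_fibre[OF U s K(1)]]] unfolding r_def by blast+
  define r' where "r' = restrict r U"
  have r'K: "r' K = r K" using K(1) by (simp add: r'_def)
  have r': "r' \<in> carrier (SW l U)" unfolding r'_def by (rule SW_restrict[OF Gr_opens r(1) U opens_subset_Gr[OF U]])
  have a: "restrict (\<lambda>L. -1) U \<in> carrier (structure_sheaf U)" by (rule const_structure[OF U])
  have m: "restrict (\<lambda>L. -1) U \<odot>\<^bsub>SW l U\<^esub> s \<in> carrier (SW l U)" by (rule SW_smult[OF U s a])
  have "vl t l' (\<phi> U (r' \<oplus>\<^bsub>SW l U\<^esub> (restrict (\<lambda>L. -1) U \<odot>\<^bsub>SW l U\<^esub> s)) K) = 0"
  proof (rule hom_vanish[OF \<phi> U K SW_add[OF U r' m]])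
    show "vl t l ((r' \<oplus>\<^bsub>SW l U\<^esub> (restrict (\<lambda>L. -1) U \<odot>\<^bsub>SW l U\<^esub> s)) K) = 0"
      using K(1) r(2) by (simp add: SW_add_val[OF U r' m K] SW_smult_val[OF U s K] r'K t(2)[symmetric])
  qed
  moreover have "vl t l' (\<phi> U (r' \<oplus>\<^bsub>SW l U\<^esub> (restrict (\<lambda>L. -1) U \<odot>\<^bsub>SW l U\<^esub> s)) K)
      = vl t l' (\<phi> U r' K) - vl t l' (\<phi> U s K)"
    using K by (simp add: hom_add[OF \<phi> U r' m] hom_smult[OF \<phi> U s a] SW_add_val[OF U _ _ K] SW_smult_val[OF U _ K]
        hom_closed[OF \<phi> U] r' s SW_smult[OF U _ a])
  moreover have "\<phi> U r' K = \<phi> Gr r K"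
    unfolding r'_def using hom_restrict[OF \<phi> Gr_opens U opens_subset_Gr[OF U] r(1)] K(1) by simp
  moreover have "Lf l l' \<phi> t (vl t l (s K)) = vl t l' (\<phi> Gr r K)" unfolding Lf_def r_def t(2)[symmetric] ..
  ultimately show ?thesis by simp
qed

lemma Lf_eqI:
  assumes \<phi>: "\<phi> \<in> sheaf_homs (SW l) (SW l')" and t: "good t" and P: "degree P \<le> sdeg l"
    and *: "\<And>s. s \<in> carrier (SW l Gr) \<Longrightarrow> vl t l' (\<phi> Gr s (kern t)) = G (vl t l (s (kern t)))"
  shows "Lf l l' \<phi> t P = G P"
proof -
  obtain s where s: "s \<in> carrier (SW l Gr)" "vl t l (s (kern t)) = P" using global_section_exists[OF t P] by blast
  have "t \<in> frames (kern t)" by (simp add: frames_iff)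
  from hom_fibre[OF \<phi> Gr_opens kern_Gr[OF t] this s(1)] *[OF s(1)] show ?thesis by (simp add: s(2))
qed

lemma Lf_linear:
  assumes \<phi>: "\<phi> \<in> sheaf_homs (SW l) (SW l')" and t: "good t" and P: "degree P \<le> sdeg l"
  shows Lf_add: "degree Q \<le> sdeg l \<Longrightarrow> Lf l l' \<phi> t (P + Q) = Lf l l' \<phi> t P + Lf l l' \<phi> t Q"
    and Lf_psmult: "Lf l l' \<phi> t (psmult c P) = psmult c (Lf l l' \<phi> t P)"
    and Lf_degree: "degree (Lf l l' \<phi> t P) \<le> sdeg l'"
proof -
  have K: "kern t \<in> Gr" "t \<in> frames (kern t)" using kern_Gr[OF t] by (auto simp: frames_iff)
  note O = Gr_opens
  obtain s where s: "s \<in> carrier (SW l Gr)" "vl t l (s (kern t)) = P" using global_section_exists[OF t P] by blast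
  note h = hom_fibre[OF \<phi> O K]
  show "degree (Lf l l' \<phi> t P) \<le> sdeg l'"
    using fib_degree[OF K SW_fibre[OF O hom_closed[OF \<phi> O s(1)] K(1)]] h[OF s(1)] s(2) by simp
  have a: "restrict (\<lambda>L. c) Gr \<in> carrier (structure_sheaf (Gr :: ('a^'b) set set))" by (rule const_structure[OF O])
  show "Lf l l' \<phi> t (psmult c P) = psmult c (Lf l l' \<phi> t P)"
    using h[OF SW_smult[OF O s(1) a]] h[OF s(1)] K s(2)
    by (simp add: SW_smult_val[OF O _ K] s(1) hom_smult[OF \<phi> O s(1) a] hom_closed[OF \<phi> O])
  assume "degree Q \<le> sdeg l"
  then obtain r where r: "r \<in> carrier (SW l Gr)" "vl t l (r (kern t)) = Q" using global_section_exists[OF t] by blast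
  show "Lf l l' \<phi> t (P + Q) = Lf l l' \<phi> t P + Lf l l' \<phi> t Q"
    using h[OF SW_add[OF O s(1) r(1)]] h[OF s(1)] h[OF r(1)] s(2) r(2)
    by (simp add: SW_add_val[OF O _ _ K] s(1) r(1) hom_add[OF \<phi> O s(1) r(1)] hom_closed[OF \<phi> O])
qed

text \<open>Argument and value both transform as in \<open>vl_gfr\<close>. The determinant powers
  stay on both sides, since \<open>wedges l\<close> may exceed \<open>wedges l'\<close>.\<close>

lemma Lf_gfr:
  assumes \<phi>: "\<phi> \<in> sheaf_homs (SW l) (SW l')" and t: "good t" and g: "gdet g \<noteq> 0" and P: "degree P \<le> sdeg l"
  shows "psmult (gdet g ^ wedges l) (Lf l l' \<phi> (gfr g t) (gsub (sdeg l) g P))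
    = psmult (gdet g ^ wedges l') (gsub (sdeg l') g (Lf l l' \<phi> t P))"
proof -
  have K: "kern t \<in> Gr" "t \<in> frames (kern t)" using kern_Gr[OF t] by (auto simp: frames_iff)
  have t': "gfr g t \<in> frames (kern t)" by (simp add: frames_iff kern_gfr[OF g])
  note O = Gr_opens
  obtain s where s: "s \<in> carrier (SW l Gr)" "vl t l (s (kern t)) = P" using global_section_exists[OF t P] by blast
  have 1: "vl (gfr g t) l (s (kern t)) = psmult (gdet g ^ wedges l) (gsub (sdeg l) g P)"
    using vl_gfr[OF K g SW_fibre[OF O s(1) K(1)]] s(2) by simp
  have "degree (gsub (sdeg l) g P) \<le> sdeg l" unfolding gsub_def by (rule degree_hsub_le) auto
  then have "psmult (gdet g ^ wedges l) (Lf l l' \<phi> (gfr g t) (gsub (sdeg l) g P)) = vl (gfr g t) l' (\<phi> Gr s (kern t))"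
    unfolding hom_fibre[OF \<phi> O K(1) t' s(1)] 1 by (subst Lf_psmult[OF \<phi> good_gfr[OF g t]]) auto
  also have "\<dots> = psmult (gdet g ^ wedges l') (gsub (sdeg l') g (vl t l' (\<phi> Gr s (kern t))))"
    by (rule vl_gfr[OF K g SW_fibre[OF O hom_closed[OF \<phi> O s(1)] K(1)]])
  finally show ?thesis by (simp add: hom_fibre[OF \<phi> O K s(1)] s(2))
qed

text \<open>In all normal frames of the chart the monomial is the value of one and the same global
  section, whose image is again a section.\<close>

lemma Lf_regular:
  fixes \<phi> :: "('k::field_char_0, 'n::finite, ('k, 'n) schur_elem) gr_hom"
  assumes \<phi>: "\<phi> \<in> sheaf_homs (SW l) (SW l')" and m: "m \<le> sdeg l"
  shows "regp (chart i j) (\<lambda>L. Lf l l' \<phi> (nf i j L) (monom 1 m))"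
proof -
  define s where "s = restrict (schur_section l (std_word l (axis i 1) (axis j 1) m)) (Gr :: ('k^'n) set set)"
  have s: "s \<in> carrier (SW l Gr)" unfolding s_def by (intro SW_section Gr_opens length_std_word m)
  have "regp (Gr \<inter> chart i j) (\<lambda>L. vl (nf i j L) l' (\<phi> Gr s L))"
    by (rule SW_regp[OF Gr_opens hom_closed[OF \<phi> Gr_opens s]])
  moreover have "Gr \<inter> chart i j = chart i j" by (auto simp: chart_Gr)
  moreover have "vl (nf i j L) l' (\<phi> Gr s L) = Lf l l' \<phi> (nf i j L) (monom 1 m)" if L: "L \<in> chart i j" for L
  proof -
    have LG: "L \<in> Gr" and f: "nf i j L \<in> frames L" using chart_Gr[OF L] nf_frames[OF L] by auto
    have "vl (nf i j L) l (s L) = monom 1 m"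
      using schur_section_facts(2)[OF LG f length_std_word[OF m], of "axis i 1" "axis j 1"]
        evw_std_word[where \<theta> = "zc (nf i j L)", OF m zc_nf_axis[OF L]] LG by (simp add: s_def)
    then show ?thesis using hom_fibre[OF \<phi> Gr_opens LG f s] by simp
  qed
  ultimately show ?thesis using regp_cong by (metis (no_types, lifting))
qed

lemma hom_eqI:
  assumes \<phi>: "\<phi> \<in> sheaf_homs (SW l) (SW l')" and \<psi>: "\<psi> \<in> sheaf_homs (SW l) (SW l')"
    and *: "\<And>t P. good t \<Longrightarrow> degree P \<le> sdeg l \<Longrightarrow> Lf l l' \<phi> t P = Lf l l' \<psi> t P"
  shows "\<phi> = \<psi>"
proof (rule extensionalityI)
  show "\<phi> \<in> extensional opens" "\<psi> \<in> extensional opens" using \<phi> \<psi> by (auto simp: sheaf_homs_def)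
  fix U :: "('a^'b) set set" assume U: "U \<in> opens"
  show "\<phi> U = \<psi> U"
  proof (rule extensionalityI)
    show "\<phi> U \<in> extensional (carrier (SW l U))" "\<psi> U \<in> extensional (carrier (SW l U))"
      using \<phi> \<psi> U by (auto simp: sheaf_homs_def)
    fix s assume s: "s \<in> carrier (SW l U)"
    show "\<phi> U s = \<psi> U s"
    proof (rule SW_eqI[OF U hom_closed[OF \<phi> U s] hom_closed[OF \<psi> U s]])
      fix K assume K: "K \<in> U"
      have f: "fr K \<in> frames K" by (rule fr[OF U_Gr[OF U K]])
      show "vl (fr K) l' (\<phi> U s K) = vl (fr K) l' (\<psi> U s K)"
        unfolding hom_fibre[OF \<phi> U K f s] hom_fibre[OF \<psi> U K f s]
        by (intro * frames_good[OF U_Gr[OF U K] f] fib_degree[OF U_Gr[OF U K] f] SW_fibre[OF U s K])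
    qed
  qed
qed

section \<open>Matrix entries of a homomorphism along lines\<close>

definition polyframe :: "('k::field \<Rightarrow> ('k, 'n::finite) frame) \<Rightarrow> bool" where
  "polyframe T \<longleftrightarrow> (\<forall>i. (\<exists>p. \<forall>x. fst (T x) $ i = poly p x) \<and> (\<exists>p. \<forall>x. snd (T x) $ i = poly p x))"

lemma polyframe_plucker:
  assumes "polyframe T" shows "\<exists>p. \<forall>x. plucker (T x) ij = poly p x"
proof -
  obtain i j where ij: "ij = (i, j)" by (cases ij)
  obtain a b c d where "\<forall>x. fst (T x) $ i = poly a x" "\<forall>x. snd (T x) $ j = poly b x"
    "\<forall>x. fst (T x) $ j = poly c x" "\<forall>x. snd (T x) $ i = poly d x"
    using assms unfolding polyframe_def by metis
  then show ?thesis
    by (intro exI[of _ "a * b - c * d"]) (simp add: ij plucker_det2 zc_axis det2_def mult.commute)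
qed

lemma polyframe_hom_poly:
  assumes "polyframe T" shows "hom_poly d P \<Longrightarrow> \<exists>p. \<forall>x. P (plucker (T x)) = poly p x"
proof (induction rule: hom_poly.induct)
  case (hom_poly_const c)
  show ?case by (intro exI[of _ "[:c:]"]) simp
next
  case (hom_poly_var i)
  show ?case by (rule polyframe_plucker[OF assms])
qed (metis poly_add, metis poly_mult)

text \<open>Near \<open>x0\<close> the function is a fraction of homogeneous polynomials, valid
  where some \<open>P1\<close> does not vanish; along the family of frames all three become
  polynomials in the parameter.\<close>

lemma rr_regular:
  assumes T: "polyframe T" "\<And>x. good (T x)" and h: "regular_on U h" and x0: "kern (T x0) \<in> U"
  shows "rr x0 (\<lambda>x. h (kern (T x)))"
proof -
  have K: "kern (T x) \<in> Gr" "T x \<in> frames (kern (T x))" for x using kern_Gr[OF T(2)] by (auto simp: frames_iff)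
  obtain N where N: "N \<in> opens" "kern (T x0) \<in> N" "frac_on N h" using h x0 unfolding regular_on_iff by blast
  then obtain S where S: "\<forall>P\<in>S. \<exists>d. hom_poly d P" "N = {K \<in> Gr. \<exists>P\<in>S. \<exists>t\<in>frames K. P (plucker t) \<noteq> 0}"
    unfolding opens_def by blast
  obtain P1 t1 d1 where P1: "P1 \<in> S" "t1 \<in> frames (kern (T x0))" "P1 (plucker t1) \<noteq> 0" "hom_poly d1 P1"
    using N(2) S by blast
  have P1x0: "P1 (plucker (T x0)) \<noteq> 0" using hom_poly_frames[OF P1(4) K(1) P1(2) K(2)] P1(3) by blast
  obtain d P Q where PQ: "hom_poly d P" "hom_poly d Q" "\<forall>L\<in>N. \<forall>t\<in>frames L. Q (plucker t) \<noteq> 0 \<and> h L = P (plucker t) / Q (plucker t)"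
    using N(3) unfolding frac_on_def by (elim exE conjE) (rule that)
  obtain r where r: "\<And>x. P1 (plucker (T x)) = poly r x" using polyframe_hom_poly[OF T(1) P1(4)] by blast
  obtain p where p: "\<And>x. P (plucker (T x)) = poly p x" using polyframe_hom_poly[OF T(1) PQ(1)] by blast
  obtain q where q: "\<And>x. Q (plucker (T x)) = poly q x" using polyframe_hom_poly[OF T(1) PQ(2)] by blast
  have N': "kern (T x) \<in> N" if "poly r x \<noteq> 0" for x
    unfolding S(2) using that P1(1) K[of x] by (auto simp flip: r)
  show ?thesis
  proof (rule rr_cong)
    have "poly q x0 \<noteq> 0" using PQ(3) N(2) K(2) by (metis q)
    then show "rr x0 (\<lambda>x. poly p x / poly q x)" by (intro rr_divide rr_poly[OF refl])
    show "poly r x0 \<noteq> 0" using P1x0 r by metis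
    show "h (kern (T x)) = poly p x / poly q x" if "poly r x \<noteq> 0" for x
      using PQ(3) N'[OF that] K(2)[of x] by (metis p q)
  qed
qed

definition rrp :: "'k::field \<Rightarrow> ('k \<Rightarrow> 'k poly) \<Rightarrow> bool" where
  "rrp x0 h \<longleftrightarrow> (\<forall>r. rr x0 (\<lambda>x. coeff (h x) r))"

lemma rrp_const: "rrp x0 (\<lambda>x. P)"
  by (simp add: rrp_def rr_const)

lemma rrp_psmult: "rr x0 a \<Longrightarrow> rrp x0 h \<Longrightarrow> rrp x0 (\<lambda>x. psmult (a x) (h x))"
  by (simp add: rrp_def rr_mult)

lemma rrp_mult: "rrp x0 h \<Longrightarrow> rrp x0 h' \<Longrightarrow> rrp x0 (\<lambda>x. h x * h' x)"
  by (simp add: rrp_def coeff_mult rr_sum rr_mult)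

lemma rrp_power: "rrp x0 h \<Longrightarrow> rrp x0 (\<lambda>x. h x ^ n)"
  by (induction n) (auto intro: rrp_const rrp_mult)

lemma rrp_sum: "(\<And>i. i \<in> A \<Longrightarrow> rrp x0 (h i)) \<Longrightarrow> rrp x0 (\<lambda>x. \<Sum>i\<in>A. h i x)"
  by (simp add: rrp_def coeff_sum rr_sum)

lemma rrp_pair: "rr x0 a \<Longrightarrow> rr x0 b \<Longrightarrow> rrp x0 (\<lambda>x. [:a x, b x:])"
  by (auto simp: rrp_def coeff_pCons split: nat.splits intro: rr_const) (case_tac r; auto intro: rr_const; case_tac nat; auto intro: rr_const)

lemma rrp_gsub:
  assumes "rr x0 a" "rr x0 b" "rr x0 c" "rr x0 d" "rrp x0 h"
  shows "rrp x0 (\<lambda>x. gsub N ((a x, b x), (c x, d x)) (h x))"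
  unfolding gsub_def hsub_def fst_conv snd_conv
  using assms(5) by (intro rrp_sum rrp_psmult rrp_mult rrp_power rrp_pair assms(1-4)) (simp add: rrp_def)

text \<open>The adjugate replaces the inverse, so that entries stay polynomial in a parameter; the
  price is a power of the determinant.\<close>

lemma gsub_adjoint:
  assumes "degree P \<le> N"
  shows "gsub N ((a, b), (c, d)) (gsub N ((d, - b), (- c, a)) P) = psmult ((a * d - b * c) ^ N) P"
proof -
  have 1: "hsub 1 [:d, - c:] [:a, c:] [:b, d:] = [:a * d - b * c:]" "hsub 1 [:- b, a:] [:a, c:] [:b, d:] = [:0, a * d - b * c:]"
    by (simp_all add: hsub_def algebra_simps)
  have "gsub N ((a, b), (c, d)) (gsub N ((d, - b), (- c, a)) P) = hsub N P [:a * d - b * c:] [:0, a * d - b * c:]"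
    unfolding gsub_def fst_conv snd_conv by (subst hsub_hsub) (simp_all only: 1, simp_all)
  also have "\<dots> = (\<Sum>i\<le>N. psmult ((a * d - b * c) ^ N) (monom (coeff P i) i))"
    unfolding hsub_def
  proof (intro sum.cong refl)
    fix i assume "i \<in> {..N}"
    then have e: "(a * d - b * c) ^ N = (a * d - b * c) ^ (N - i) * (a * d - b * c) ^ i" by (simp flip: power_add)
    have "[:0, a * d - b * c:] = psmult (a * d - b * c) [:0, 1:]" by simp
    then have "[:0, a * d - b * c:] ^ i = psmult ((a * d - b * c) ^ i) (monom 1 i)"
      by (simp only: smult_power) (simp add: monom_altdef)
    then show "psmult (coeff P i) ([:a * d - b * c:] ^ (N - i) * [:0, a * d - b * c:] ^ i) = psmult ((a * d - b * c) ^ N) (monom (coeff P i) i)"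
      unfolding e by (simp add: poly_const_pow smult_monom mult_ac)
  qed
  also have "\<dots> = psmult ((a * d - b * c) ^ N) P"
    unfolding psmult_sum[symmetric] by (subst poly_sum_monoms[OF assms, symmetric]) (rule refl)
  finally show ?thesis .
qed

text \<open>The normal frame is the identity in the columns i and j, so the matrix leading from it
  to t consists of these columns of t.\<close>

lemma nf_recover:
  assumes t: "good t" and ij: "plucker t (i, j) \<noteq> 0"
  shows "t = gfr ((fst t $ i, fst t $ j), (snd t $ i, snd t $ j)) (nf i j (kern t))"
proof -
  have K: "kern t \<in> chart i j" "t \<in> frames (kern t)" using chart_iff[OF kern_Gr[OF t]] ij by (auto simp: frames_iff)
  have nz: "det2 (zc t (axis i 1)) (zc t (axis j 1)) \<noteq> 0" using ij by (simp add: plucker_det2)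
  define t' where "t' = gfr ((fst t $ i, fst t $ j), (snd t $ i, snd t $ j)) (nf i j (kern t))"
  have Z: "zc t' (axis v 1) = zc t (axis v 1)" for v
    using cramer[OF nz, of "zc t (axis v 1)"] unfolding t'_def zc_gfr zc_nf[OF K] plucker_det2 gact_def
    by (simp add: zc_axis prod_eq_iff mult.commute)
  have "t' = t"
  proof (rule prod_eqI)
    show "fst t' = fst t" "snd t' = snd t" using Z by (simp_all add: zc_axis vec_eq_iff)
  qed
  then show ?thesis by (simp add: t'_def)
qed

lemma Lf_sum_monoms:
  assumes \<phi>: "\<phi> \<in> sheaf_homs (SW l) (SW l')" and t: "good t"
  shows "M \<le> sdeg l \<Longrightarrow> Lf l l' \<phi> t (\<Sum>m\<le>M. monom (c m) m) = (\<Sum>m\<le>M. psmult (c m) (Lf l l' \<phi> t (monom 1 m)))"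
proof (induction M)
  case 0
  have "Lf l l' \<phi> t (psmult (c 0) (monom 1 0)) = psmult (c 0) (Lf l l' \<phi> t (monom 1 0))"
    by (rule Lf_psmult[OF \<phi> t]) simp
  then show ?case by (simp add: smult_monom monom_0)
next
  case (Suc M)
  have "Lf l l' \<phi> t (psmult (c (Suc M)) (monom 1 (Suc M))) = psmult (c (Suc M)) (Lf l l' \<phi> t (monom 1 (Suc M)))"
    using Suc.prems by (intro Lf_psmult[OF \<phi> t] order.trans[OF degree_monom_le])
  moreover have "Lf l l' \<phi> t ((\<Sum>m\<le>M. monom (c m) m) + monom (c (Suc M)) (Suc M))
      = Lf l l' \<phi> t (\<Sum>m\<le>M. monom (c m) m) + Lf l l' \<phi> t (monom (c (Suc M)) (Suc M))"
    using Suc.prems by (intro Lf_add[OF \<phi> t] degree_sum_le order.trans[OF degree_monom_le]) auto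
  ultimately show ?case using Suc by (simp add: smult_monom)
qed

lemma Lf_expand:
  assumes \<phi>: "\<phi> \<in> sheaf_homs (SW l) (SW l')" and t: "good t" and P: "degree P \<le> sdeg l"
  shows "Lf l l' \<phi> t P = (\<Sum>m\<le>sdeg l. psmult (coeff P m) (Lf l l' \<phi> t (monom 1 m)))"
  by (subst poly_sum_monoms[OF P]) (rule Lf_sum_monoms[OF \<phi> t order.refl])

text \<open>Near \<open>x0\<close> the frames arise from the normal frames of one chart by a matrix
  with polynomial entries. Equivariance expresses the entry, up to powers of the determinant
  \<open>p\<close>, by regular functions on the chart, and \<open>p\<close> does not vanish at
  \<open>x0\<close>.\<close>

lemma rr_Lf:
  assumes \<phi>: "\<phi> \<in> sheaf_homs (SW l) (SW l')" and T: "polyframe T" "\<And>x. good (T x)" and m: "m \<le> sdeg l"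
  shows "rr x0 (\<lambda>x. coeff (Lf l l' \<phi> (T x) (monom 1 m)) r)"
proof -
  obtain i j where ij: "plucker (T x0) (i, j) \<noteq> 0" using T(2)[of x0] by (auto simp: good_def)
  obtain p where p: "\<And>x. plucker (T x) (i, j) = poly p x" using polyframe_plucker[OF T(1)] by blast
  define a b c d where "a x = fst (T x) $ i" and "b x = fst (T x) $ j" and "c x = snd (T x) $ i" and "d x = snd (T x) $ j" for x
  note abcd = a_def b_def c_def d_def
  have poly: "rr x0 a" "rr x0 b" "rr x0 c" "rr x0 d" "rr x0 (\<lambda>x. - b x)" "rr x0 (\<lambda>x. - c x)"
  proof -
    obtain pa pb pc pdd where "\<forall>x. a x = poly pa x" "\<forall>x. b x = poly pb x" "\<forall>x. c x = poly pc x" "\<forall>x. d x = poly pdd x"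
      using T(1) unfolding polyframe_def abcd by metis
    then show "rr x0 a" "rr x0 b" "rr x0 c" "rr x0 d" "rr x0 (\<lambda>x. - b x)" "rr x0 (\<lambda>x. - c x)"
      by (auto intro: rr_poly[of _ pa] rr_poly[of _ pb] rr_poly[of _ pc] rr_poly[of _ pdd] rr_poly[of _ "- pb"] rr_poly[of _ "- pc"])
  qed
  have det: "a x * d x - b x * c x = poly p x" for x
    by (simp add: abcd p[symmetric] plucker_det2 zc_axis det2_def mult.commute)
  define L where "L x = nf i j (kern (T x))" for x
  \<comment> \<open>The adjugate applied to the monomial; the matrix itself takes it back to
    \<open>p^N\<close> times the monomial.\<close>
  define Q where "Q x = gsub (sdeg l) ((d x, - b x), (- c x, a x)) (monom 1 m)" for x
  define H where "H x = (\<Sum>m'\<le>sdeg l. psmult (coeff (Q x) m') (Lf l l' \<phi> (L x) (monom 1 m')))" for x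
  define R where "R x = psmult (poly p x ^ wedges l') (gsub (sdeg l') ((a x, b x), (c x, d x)) (H x))" for x
  have dm: "degree (monom (1::'a) m) \<le> sdeg l" using degree_monom_le[of "1::'a" m] m by linarith
  have Q: "rrp x0 Q" unfolding Q_def[abs_def] by (intro rrp_gsub poly rrp_const)
  have "kern (T x0) \<in> chart i j" using chart_iff[OF kern_Gr[OF T(2)], of "T x0" x0 i j] ij by (simp add: frames_iff)
  then have "rrp x0 (\<lambda>x. Lf l l' \<phi> (L x) (monom 1 m'))" if "m' \<le> sdeg l" for m'
    using Lf_regular[OF \<phi> that, of i j] rr_regular[OF T] unfolding rrp_def regp_def L_def by blast
  then have "rrp x0 H" unfolding H_def[abs_def] using Q by (intro rrp_sum rrp_psmult) (auto simp: rrp_def)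
  moreover have pp: "rr x0 (\<lambda>x. poly p x ^ e)" for e by (intro rr_power rr_poly[OF refl])
  ultimately have "rrp x0 R" unfolding R_def[abs_def] by (intro rrp_psmult rrp_gsub poly)
  then have "rr x0 (\<lambda>x. coeff (R x) r / poly p x ^ (wedges l + sdeg l))"
    using ij by (intro rr_divide pp) (auto simp: rrp_def p)
  then show ?thesis
  proof (rule rr_cong)
    show "poly p x0 \<noteq> 0" using ij p by simp
    fix x assume x: "poly p x \<noteq> 0"
    have Tx: "T x = gfr ((a x, b x), (c x, d x)) (L x)"
      unfolding abcd L_def by (rule nf_recover[OF T(2)]) (simp add: p x)
    have g: "gdet ((a x, b x), (c x, d x)) = poly p x" by (simp add: gdet_def det2_def det)
    have ch: "kern (T x) \<in> chart i j" using chart_iff[OF kern_Gr[OF T(2)], of "T x" x i j] x p by (simp add: frames_iff)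
    have gL: "good (L x)" unfolding L_def by (rule frames_good[OF chart_Gr[OF ch] nf_frames[OF ch]])
    have dQ: "degree (Q x) \<le> sdeg l" unfolding Q_def gsub_def by (rule degree_hsub_le) auto
    have "psmult (poly p x ^ wedges l) (Lf l l' \<phi> (T x) (gsub (sdeg l) ((a x, b x), (c x, d x)) (Q x)))
        = psmult (poly p x ^ wedges l') (gsub (sdeg l') ((a x, b x), (c x, d x)) (Lf l l' \<phi> (L x) (Q x)))"
      using Lf_gfr[OF \<phi> gL _ dQ, of "((a x, b x), (c x, d x))"] x unfolding g Tx[symmetric] by blast
    moreover have "Lf l l' \<phi> (T x) (gsub (sdeg l) ((a x, b x), (c x, d x)) (Q x)) = psmult (poly p x ^ sdeg l) (Lf l l' \<phi> (T x) (monom 1 m))"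
      unfolding Q_def gsub_adjoint[OF dm] det by (rule Lf_psmult[OF \<phi> T(2) dm])
    moreover have "Lf l l' \<phi> (L x) (Q x) = H x" unfolding H_def by (rule Lf_expand[OF \<phi> gL dQ])
    ultimately have "psmult (poly p x ^ (wedges l + sdeg l)) (Lf l l' \<phi> (T x) (monom 1 m)) = R x"
      by (simp add: R_def power_add)
    then have "poly p x ^ (wedges l + sdeg l) * coeff (Lf l l' \<phi> (T x) (monom 1 m)) r = coeff (R x) r" by (metis coeff_smult)
    then show "coeff (Lf l l' \<phi> (T x) (monom 1 m)) r = coeff (R x) r / poly p x ^ (wedges l + sdeg l)"
      using x by (simp add: field_simps)
  qed
qed

lemma good_iff_ind2: "good (a, b) \<longleftrightarrow> ind2 a b"
proof
  assume "good (a, b)"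
  then obtain i j where ij: "a $ i * b $ j - a $ j * b $ i \<noteq> 0" by (auto simp: good_def plucker_def)
  show "ind2 a b" unfolding ind2_def
  proof (intro allI impI)
    fix x y assume *: "x *s a + y *s b = 0"
    have e: "x * a $ k + y * b $ k = 0" for k using arg_cong[OF *, of "\<lambda>v. v $ k"] by simp
    have "x * (a $ i * b $ j - a $ j * b $ i) = (x * a $ i + y * b $ i) * b $ j - (x * a $ j + y * b $ j) * b $ i"
      "y * (a $ i * b $ j - a $ j * b $ i) = (x * a $ j + y * b $ j) * a $ i - (x * a $ i + y * b $ i) * a $ j"
      by (simp_all add: algebra_simps)
    then show "x = 0 \<and> y = 0" using ij unfolding e by simp
  qed
next
  assume ind: "ind2 a b"
  show "good (a, b)"
  proof (rule ccontr)
    assume "\<not> good (a, b)"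
    then have p: "a $ i * b $ j = a $ j * b $ i" for i j by (auto simp: good_def plucker_def)
    have "a \<noteq> 0" using ind2_nonzero[OF ind, of 0] by simp
    then obtain i where i: "a $ i \<noteq> 0" by (auto simp: vec_eq_iff)
    have "(b $ i) *s a + (- a $ i) *s b = 0" using p[of i] by (simp add: vec_eq_iff mult.commute)
    then have "b $ i = 0 \<and> - a $ i = 0" using ind unfolding ind2_def by blast
    then show False using i by simp
  qed
qed

lemma coeff_gsub_diagonal:
  assumes "i \<le> N" shows "coeff (gsub N ((r, 0), (0, s)) P) i = r ^ (N - i) * s ^ i * coeff P i"
proof -
  have "[:r:] ^ e * [:0, s:] ^ f = monom (r ^ e * s ^ f) f" for e f
  proof -
    have "[:0, s:] = psmult s [:0, 1:]" by simp
    then have "[:0, s:] ^ f = psmult (s ^ f) (monom 1 f)"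
      by (simp only: smult_power) (simp add: monom_altdef)
    then show ?thesis by (simp add: poly_const_pow smult_monom)
  qed
  then have "gsub N ((r, 0), (0, s)) P = (\<Sum>j\<le>N. monom (coeff P j * (r ^ (N - j) * s ^ j)) j)"
    by (simp add: gsub_def hsub_def smult_monom)
  then show ?thesis using assms by (simp add: coeff_sum if_distrib mult.commute cong: if_cong)
qed

lemma gsub_diagonal_monom:
  assumes "m \<le> N" shows "gsub N ((r, 0), (0, s)) (monom 1 m) = psmult (r ^ (N - m) * s ^ m) (monom 1 m)"
proof -
  have "[:0, s:] = psmult s [:0, 1:]" by simp
  then have "[:0, s:] ^ m = psmult (s ^ m) (monom 1 m)"
    by (simp only: smult_power) (simp add: monom_altdef)
  then show ?thesis by (simp add: gsub_def hsub_monom[OF assms] poly_const_pow mult.commute)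
qed

lemma Lf_diagonal:
  assumes \<phi>: "\<phi> \<in> sheaf_homs (SW l) (SW l')" and t: "good t" and m: "m \<le> sdeg l" and i: "i \<le> sdeg l'" and rs: "r \<noteq> 0" "s \<noteq> 0"
  shows "(r * s) ^ wedges l * (r ^ (sdeg l - m) * s ^ m) * coeff (Lf l l' \<phi> (gfr ((r, 0), (0, s)) t) (monom 1 m)) i
    = (r * s) ^ wedges l' * (r ^ (sdeg l' - i) * s ^ i) * coeff (Lf l l' \<phi> t (monom 1 m)) i"
proof -
  have g: "gdet ((r, 0), (0, s)) = r * s" by (simp add: gdet_def det2_def)
  have dm: "degree (monom (1::'a) m) \<le> sdeg l" using degree_monom_le[of "1::'a" m] m by linarith
  have nz: "gdet ((r, 0), (0, s)) \<noteq> 0" using rs by (simp add: g)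
  have "Lf l l' \<phi> (gfr ((r, 0), (0, s)) t) (gsub (sdeg l) ((r, 0), (0, s)) (monom 1 m))
      = psmult (r ^ (sdeg l - m) * s ^ m) (Lf l l' \<phi> (gfr ((r, 0), (0, s)) t) (monom 1 m))"
    unfolding gsub_diagonal_monom[OF m] by (rule Lf_psmult[OF \<phi> good_gfr[OF nz t] dm])
  with Lf_gfr[OF \<phi> t nz dm] have "psmult ((r * s) ^ wedges l) (psmult (r ^ (sdeg l - m) * s ^ m) (Lf l l' \<phi> (gfr ((r, 0), (0, s)) t) (monom 1 m)))
      = psmult ((r * s) ^ wedges l') (gsub (sdeg l') ((r, 0), (0, s)) (Lf l l' \<phi> t (monom 1 m)))"
    unfolding g by simp
  from arg_cong[OF this, of "\<lambda>P. coeff P i"] show ?thesis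
    by (simp add: coeff_gsub_diagonal[OF i] mult.assoc)
qed

text \<open>On a line that misses the dependent pairs the entry has no pole, hence is polynomial.
  For the degree write \<open>b + x b' = x (b' + b / x)\<close>: scaling one row by the torus
  relates the line to the reversed one by a known power of x, which gives a bound independent of the
  line.\<close>

lemma entry_polyfun:
  fixes \<phi> :: "('k::{alg_closed_field, field_char_0}, 'n::finite, ('k, 'n) schur_elem) gr_hom"
  assumes four: "CARD('n) \<ge> 4" and \<phi>: "\<phi> \<in> sheaf_homs (SW l) (SW l')" and m: "m \<le> sdeg l" and i: "i \<le> sdeg l'"
  obtains F where "polyfun F" "\<And>a b. good (a, b) \<Longrightarrow> F (mat_of a b) = coeff (Lf l l' \<phi> (a, b) (monom 1 m)) i"
proof -
  define f where "f a b = coeff (Lf l l' \<phi> (a, b) (monom 1 m)) i" for a b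
  \<comment> \<open>The target contributes a power of x of at most this exponent; the power from the
    source only lowers the bound.\<close>
  define D where "D = wedges l' + sdeg l'"
  have lineq: "polyframe (\<lambda>x. (a + x *s a', b + x *s b'))" for a b a' b' :: "'k^'n"
    unfolding polyframe_def
  proof (intro allI conjI)
    fix v
    show "\<exists>p. \<forall>x. fst (a + x *s a', b + x *s b') $ v = poly p x" by (rule exI[of _ "[:a $ v, a' $ v:]"]) simp
    show "\<exists>p. \<forall>x. snd (a + x *s a', b + x *s b') $ v = poly p x" by (rule exI[of _ "[:b $ v, b' $ v:]"]) simp
  qed
  have lines: "\<exists>p. \<forall>x. f (a + x *s a') (b + x *s b') = poly p x" if "\<And>x. good (a + x *s a', b + x *s b')" for a b a' b'
    unfolding f_def by (rule rr_everywhere_imp_poly) (rule rr_Lf[OF \<phi> lineq that m])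
  have snd_line: "poly_le D (\<lambda>x. f a (b + x *s b'))" if ind: "ind3 a b b'" for a b b'
  proof -
    have ind': "ind2 a (x *s b + y *s b')" if "x \<noteq> 0 \<or> y \<noteq> 0" for x y
      unfolding ind2_def
    proof (intro allI impI)
      fix u v assume "u *s a + v *s (x *s b + y *s b') = 0"
      then have "u *s a + (v * x) *s b + (v * y) *s b' = 0" by (simp add: algebra_simps)
      then have "u = 0 \<and> v * x = 0 \<and> v * y = 0" using ind unfolding ind3_def by blast
      then show "u = 0 \<and> v = 0" using that by auto
    qed
    obtain p where p: "\<And>x. f a (b + x *s b') = poly p x"
      using lines[of a 0 b b'] ind'[of 1] by (auto simp: good_iff_ind2)
    obtain q where q: "\<And>x. f a (b' + x *s b) = poly q x"
      using lines[of a 0 b' b] ind'[of _ 1] by (auto simp: good_iff_ind2 add.commute)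
    have "poly p x = x powi (int (wedges l' + i) - int (wedges l + m)) * poly q (inverse x)" if x: "x \<noteq> 0" for x
    proof -
      have "good (a, b' + inverse x *s b)" using ind'[of "inverse x" 1] by (simp add: good_iff_ind2 add.commute)
      from Lf_diagonal[OF \<phi> this m i, of 1 x] x
      have "x ^ (wedges l + m) * f a (x *s (b' + inverse x *s b)) = x ^ (wedges l' + i) * f a (b' + inverse x *s b)"
        by (simp add: gfr_def f_def power_add)
      moreover have "x *s (b' + inverse x *s b) = b + x *s b'" using x by (simp add: algebra_simps)
      ultimately have "x ^ (wedges l + m) * poly p x = x ^ (wedges l' + i) * poly q (inverse x)" by (simp add: p q)
      then show ?thesis using x unfolding power_int_diff[OF disjI1[OF x]] power_int_of_nat by (simp add: field_simps)
    qed
    then have "degree p \<le> nat (int (wedges l' + i) - int (wedges l + m))" by (rule poly_le_of_inversion)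
    also have "\<dots> \<le> D" using i by (auto simp: D_def)
    finally show ?thesis unfolding poly_le_def using p by blast
  qed
  have fst_line: "poly_le D (\<lambda>x. f (a + x *s a') b)" if ind: "ind3 a a' b" for a a' b
  proof -
    have ind': "ind2 (x *s a + y *s a') b" if "x \<noteq> 0 \<or> y \<noteq> 0" for x y
      unfolding ind2_def
    proof (intro allI impI)
      fix u v assume "u *s (x *s a + y *s a') + v *s b = 0"
      then have "(u * x) *s a + (u * y) *s a' + v *s b = 0" by (simp add: algebra_simps)
      then have "u * x = 0 \<and> u * y = 0 \<and> v = 0" using ind unfolding ind3_def by blast
      then show "u = 0 \<and> v = 0" using that by auto
    qed
    obtain p where p: "\<And>x. f (a + x *s a') b = poly p x"
      using lines[of a a' b 0] ind'[of 1] by (auto simp: good_iff_ind2)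
    obtain q where q: "\<And>x. f (a' + x *s a) b = poly q x"
      using lines[of a' a b 0] ind'[of _ 1] by (auto simp: good_iff_ind2 add.commute)
    have "poly p x = x powi (int (wedges l' + (sdeg l' - i)) - int (wedges l + (sdeg l - m))) * poly q (inverse x)" if x: "x \<noteq> 0" for x
    proof -
      have "good (a' + inverse x *s a, b)" using ind'[of "inverse x" 1] by (simp add: good_iff_ind2 add.commute)
      from Lf_diagonal[OF \<phi> this m i, of x 1] x
      have "x ^ (wedges l + (sdeg l - m)) * f (x *s (a' + inverse x *s a)) b = x ^ (wedges l' + (sdeg l' - i)) * f (a' + inverse x *s a) b"
        by (simp add: gfr_def f_def power_add)
      moreover have "x *s (a' + inverse x *s a) = a + x *s a'" using x by (simp add: algebra_simps)
      ultimately have "x ^ (wedges l + (sdeg l - m)) * poly p x = x ^ (wedges l' + (sdeg l' - i)) * poly q (inverse x)" by (simp add: p q)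
      then show ?thesis using x unfolding power_int_diff[OF disjI1[OF x]] power_int_of_nat by (simp add: field_simps)
    qed
    then have "degree p \<le> nat (int (wedges l' + (sdeg l' - i)) - int (wedges l + (sdeg l - m)))" by (rule poly_le_of_inversion)
    also have "\<dots> \<le> D" by (auto simp: D_def)
    finally show ?thesis unfolding poly_le_def using p by blast
  qed
  obtain F where "polyfun F" "\<And>a b. ind2 a b \<Longrightarrow> F (mat_of a b) = f a b"
    using row_extension_polyfun[OF four snd_line fst_line] by blast
  then show ?thesis using that by (simp add: good_iff_ind2 f_def)
qed

section \<open>Every homomorphism is a combination of paths\<close>

text \<open>Besides the \<open>n\<close> columns of a frame there are two columns for the vector \<open>y\<close>
  whose \<open>N\<close>-th power is the argument and for the vector \<open>x\<close> that represents a point of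
  evaluation.\<close>

type_synonym 'n cols = "'n + bool"

definition col :: "('j, 'k) mat2 \<Rightarrow> 'j \<Rightarrow> 'k \<times> 'k" where
  "col p j = (p (j, True), p (j, False))"

lemma br_det2: "br i j p = det2 (col p i) (col p j)"
  by (simp add: br_def det2_def col_def)

definition tmat :: "('n cols, 'k) mat2 \<Rightarrow> 'n \<times> bool \<Rightarrow> 'k" where
  "tmat p = (\<lambda>(i, r). p (Inl i, r))"

definition tfr :: "('n::finite cols, 'k::field) mat2 \<Rightarrow> ('k, 'n) frame" where
  "tfr p = (row True (tmat p), row False (tmat p))"

lemma zc_tfr: "zc (tfr p) (axis i 1) = col p (Inl i)"
  by (simp add: zc_axis tfr_def row_def tmat_def col_def)

abbreviation ycol :: "('n cols, 'k) mat2 \<Rightarrow> 'k \<times> 'k" where "ycol p \<equiv> col p (Inr True)"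
abbreviation xcol :: "('n cols, 'k) mat2 \<Rightarrow> 'k \<times> 'k" where "xcol p \<equiv> col p (Inr False)"

definition mact :: "'k::field gl2 \<Rightarrow> ('j, 'k) mat2 \<Rightarrow> ('j, 'k) mat2" where
  "mact g p = (\<lambda>(j, r). if r then fst (gact g (col p j)) else snd (gact g (col p j)))"

lemma col_mact: "col (mact g p) j = gact g (col p j)"
  by (simp add: col_def mact_def)

lemma tfr_mact: "tfr (mact g p) = gfr g (tfr p)"
  by (simp add: tfr_def gfr_def row_def tmat_def mact_def gact_def col_def vec_eq_iff)

text \<open>Evaluation at x turned by a right angle, so that \<open>lin z\<close> takes the value
  \<open>det2 z x\<close>: a pairing of forms and vectors that GL(2) preserves up to
  determinants.\<close>

definition peval :: "nat \<Rightarrow> 'k::field poly \<Rightarrow> 'k \<times> 'k \<Rightarrow> 'k" where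
  "peval N P x = heval N P (snd x) (- fst x)"

lemma peval_gsub: "peval N (gsub N g P) (gact g x) = gdet g ^ N * peval N P x"
proof -
  have "peval N (gsub N g P) (gact g x) = heval N P (gdet g * snd x) (gdet g * - fst x)"
    unfolding peval_def gsub_def
    by (subst heval_hsub) (auto simp: heval_def gact_def gdet_def det2_def algebra_simps)
  also have "\<dots> = (\<Sum>i\<le>N. gdet g ^ N * (coeff P i * (snd x ^ (N - i) * (- fst x) ^ i)))"
    unfolding heval_def
  proof (intro sum.cong refl)
    fix i assume "i \<in> {..N}"
    then have "gdet g ^ N = gdet g ^ (N - i) * gdet g ^ i" by (simp flip: power_add)
    then show "coeff P i * ((gdet g * snd x) ^ (N - i) * (gdet g * - fst x) ^ i) = gdet g ^ N * (coeff P i * (snd x ^ (N - i) * (- fst x) ^ i))"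
      by (simp only: power_mult_distrib mult_ac)
  qed
  finally show ?thesis by (simp add: peval_def heval_def sum_distrib_left)
qed

lemma gsub_power_lin: "gsub N g (lin y ^ N) = lin (gact g y) ^ N"
  unfolding gsub_def lin_gact by (rule hsub_power[OF degree_lin])

text \<open>Restrict both functions to the line from p to \<open>p1\<close>, where polynomials in
  one variable have no zero divisors.\<close>

lemma polyfun_mult_zero:
  assumes f: "polyfun f" and g: "polyfun g" and z: "\<And>p. f p * g p = 0" and p1: "g p1 \<noteq> 0"
  shows "f p = 0"
proof -
  define q where "q i = p1 i - p i" for i
  have "poly (line_poly f p q * line_poly g p q) x = 0" for x
    by (simp only: poly_mult poly_line_poly f g z)
  then have "line_poly f p q * line_poly g p q = 0" using poly_all_0_iff_0 by blast
  moreover have "poly (line_poly g p q) 1 \<noteq> 0" using p1 by (simp add: poly_line_poly[OF g] q_def)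
  then have "line_poly g p q \<noteq> 0" by auto
  ultimately have "line_poly f p q = 0" by simp
  then show ?thesis using poly_line_poly[OF f, of p q 0] by simp
qed

lemma degree_power_lin: "degree (lin y ^ N) \<le> N"
  using degree_power_le[of "lin y" N] degree_lin[of y] by (metis le_trans mult_le_mono1 mult_1)

lemma polyfun_coeff_power_lin: "polyfun (\<lambda>p. coeff (lin (col p j) ^ N) m)"
proof (induction N arbitrary: m)
  case 0
  show ?case by (simp add: polyfun_const)
next
  case (Suc N)
  have "polyfun (\<lambda>p. coeff (lin (col p j)) i)" for i
    by (cases i; (cases "i - 1")?) (auto simp: lin_def col_def coeff_pCons split: nat.splits intro: polyfun_var polyfun_const)
  then show ?case by (auto simp: coeff_mult intro!: polyfun_sum polyfun_mult Suc)
qed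

text \<open>The extended entries are assembled with the coefficients of \<open>y^N\<close> and the
  powers of x into one function of \<open>n + 2\<close> columns. Equivariance holds on good frames
  and extends by density. The weight is the difference of the numbers of wedges plus the degree N'
  that \<open>peval\<close> contributes.\<close>

lemma hom_equivariant_polyfun:
  fixes \<phi> :: "('k::{alg_closed_field, field_char_0}, 'n::finite, ('k, 'n) schur_elem) gr_hom"
  assumes four: "CARD('n) \<ge> 4" and \<phi>: "\<phi> \<in> sheaf_homs (SW l) (SW l')" and w: "wedges l \<le> wedges l'"
  obtains F where "br_span (wedges l' - wedges l + sdeg l') F"
    "\<And>p :: ('n cols, 'k) mat2. good (tfr p) \<Longrightarrow> F p = peval (sdeg l') (Lf l l' \<phi> (tfr p) (lin (ycol p) ^ sdeg l)) (xcol p)"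
proof -
  let ?N = "sdeg l" and ?N' = "sdeg l'"
  have "\<exists>F. polyfun F \<and> (\<forall>a b. good (a, b) \<longrightarrow> F (mat_of a b) = coeff (Lf l l' \<phi> (a, b) (monom 1 m)) i)"
    if "m \<le> ?N" "i \<le> ?N'" for m i using entry_polyfun[OF four \<phi> that] by metis
  then obtain E where E: "\<And>m i. m \<le> ?N \<Longrightarrow> i \<le> ?N' \<Longrightarrow> polyfun (E m i)"
    "\<And>m i a b. m \<le> ?N \<Longrightarrow> i \<le> ?N' \<Longrightarrow> good (a, b) \<Longrightarrow> E m i (mat_of a b) = coeff (Lf l l' \<phi> (a, b) (monom 1 m)) i" by metis
  define F :: "('n cols, 'k) mat2 \<Rightarrow> 'k" where
    "F p = (\<Sum>m\<le>?N. \<Sum>i\<le>?N'. coeff (lin (ycol p) ^ ?N) m * E m i (tmat p) * (snd (xcol p) ^ (?N' - i) * (- fst (xcol p)) ^ i))" for p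
  have "polyfun (\<lambda>p. E m i (tmat p))" if "m \<le> ?N" "i \<le> ?N'" for m i
    by (rule polyfun_subst[OF E(1)[OF that]]) (auto simp: tmat_def intro: polyfun_var)
  then have F: "polyfun F"
    unfolding F_def[abs_def]
    by (intro polyfun_sum polyfun_mult polyfun_power polyfun_uminus polyfun_coeff_power_lin)
      (auto simp: col_def intro: polyfun_var)
  have FL: "F p = peval ?N' (Lf l l' \<phi> (tfr p) (lin (ycol p) ^ ?N)) (xcol p)" if g: "good (tfr p)" for p
  proof -
    have "E m i (tmat p) = coeff (Lf l l' \<phi> (tfr p) (monom 1 m)) i" if "m \<le> ?N" "i \<le> ?N'" for m i
      using E(2)[OF that, of "row True (tmat p)" "row False (tmat p)"] g by (simp add: tfr_def)
    then have "F p = (\<Sum>m\<le>?N. coeff (lin (ycol p) ^ ?N) m * peval ?N' (Lf l l' \<phi> (tfr p) (monom 1 m)) (xcol p))"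
      by (simp add: F_def peval_def heval_def sum_distrib_left mult.assoc)
    also have "\<dots> = peval ?N' (\<Sum>m\<le>?N. psmult (coeff (lin (ycol p) ^ ?N) m) (Lf l l' \<phi> (tfr p) (monom 1 m))) (xcol p)"
      by (simp add: peval_def heval_sum heval_smult)
    finally show ?thesis by (simp only: Lf_expand[OF \<phi> g degree_power_lin])
  qed
  define h where "h = wedges l' - wedges l + ?N'"
  have equi: "F (mact g p) = gdet g ^ h * F p" if g: "gdet g \<noteq> 0" for g p
  proof -
    have 1: "F (mact g p) = gdet g ^ h * F p" if gp: "good (tfr p)" for p
    proof -
      have "psmult (gdet g ^ wedges l) (Lf l l' \<phi> (gfr g (tfr p)) (lin (gact g (ycol p)) ^ ?N))
          = psmult (gdet g ^ wedges l') (gsub ?N' g (Lf l l' \<phi> (tfr p) (lin (ycol p) ^ ?N)))"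
        using Lf_gfr[OF \<phi> gp g degree_power_lin] by (simp only: gsub_power_lin)
      then have "gdet g ^ wedges l * F (mact g p) = gdet g ^ wedges l' * (gdet g ^ ?N' * F p)"
        unfolding FL[OF gp] FL[OF good_gfr[OF g gp, folded tfr_mact]] unfolding tfr_mact col_mact peval_gsub[symmetric]
        by (simp add: peval_def flip: heval_smult)
      moreover have "gdet g ^ wedges l' = gdet g ^ wedges l * gdet g ^ (wedges l' - wedges l)"
        using w by (simp flip: power_add)
      ultimately show ?thesis using g by (simp add: h_def power_add)
    qed
    have "F (mact g p) + - (gdet g ^ h * F p) = 0"
    proof -
      have "\<not> card (UNIV :: 'n set) \<le> Suc 0" using four by simp
      then obtain i j where ij: "i \<noteq> (j :: 'n)" by (auto simp: card_le_Suc0_iff_eq)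
      let ?P = "\<lambda>p :: ('n cols, 'k) mat2. br (Inl i) (Inl j) p"
      define p1 :: "('n cols, 'k) mat2" where "p1 = (\<lambda>(c, r). if c = Inl i \<and> r \<or> c = Inl j \<and> \<not> r then 1 else 0)"
      show ?thesis
      \<comment> \<open>Where one chosen minor of the frame is nonzero the identity is known;
        multiplied by this minor it holds everywhere, and the minor is then cancelled.\<close>
      proof (rule polyfun_mult_zero[of "\<lambda>p. F (mact g p) + - (gdet g ^ h * F p)" ?P])
        have m: "polyfun (\<lambda>p. mact g p c)" for c :: "'n cols \<times> bool"
          by (cases c; cases "snd c") (auto simp: mact_def gact_def col_def det2_def intro!: polyfun.intros)
        show "polyfun (\<lambda>p. F (mact g p) + - (gdet g ^ h * F p))"
          by (intro polyfun_add polyfun_uminus polyfun_mult polyfun_const polyfun_subst[OF F m] F)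
        show "polyfun ?P" unfolding br_def by (intro polyfun_diff polyfun_mult polyfun_var)
        show "?P p1 \<noteq> 0" using ij by (simp add: br_def p1_def)
        fix p :: "('n cols, 'k) mat2"
        show "(F (mact g p) + - (gdet g ^ h * F p)) * ?P p = 0"
        proof (cases "?P p = 0")
          case False
          then have "plucker (tfr p) (i, j) \<noteq> 0" by (simp add: plucker_det2 zc_tfr br_det2)
          then have "good (tfr p)" unfolding good_def by blast
          then show ?thesis using 1 by simp
        qed simp
      qed
    qed
    then show ?thesis by simp
  qed
  have "br_span h F"
  proof (rule gl2_semi_invariant_imp_br_span[OF F])
    fix x :: 'k and p :: "('n cols, 'k) mat2"
    have "(\<lambda>(j, r). if r then p (j, True) else p (j, False) + x * p (j, True)) = mact ((1, 0), (x, 1)) p"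
      by (auto simp: mact_def gact_def col_def)
    then show "F (\<lambda>(j, r). if r then p (j, True) else p (j, False) + x * p (j, True)) = F p"
      using equi[of "((1, 0), (x, 1))" p] by (simp add: gdet_def det2_def)
  next
    fix x :: 'k and s and p :: "('n cols, 'k) mat2"
    assume x: "x \<noteq> 0"
    define g :: "'k gl2" where "g = (if s then ((x, 0), (0, 1)) else ((1, 0), (0, x)))"
    have "(\<lambda>(j, r). if r = s then x * p (j, r) else p (j, r)) = mact g p"
      by (auto simp: mact_def gact_def col_def g_def)
    moreover have "gdet g = x" by (simp add: g_def gdet_def det2_def)
    ultimately show "F (\<lambda>(j, r). if r = s then x * p (j, r) else p (j, r)) = x ^ h * F p"
      using equi[of g p] x by simp
  qed
  then show ?thesis using that FL unfolding h_def by blast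
qed

section \<open>Monomials in brackets\<close>

fun cdeg :: "'j \<Rightarrow> ('j \<times> 'j) list \<Rightarrow> nat" where
  "cdeg j [] = 0"
| "cdeg j ((a, b) # M) = of_bool (a = j) + of_bool (b = j) + cdeg j M"

definition bmono :: "('j \<times> 'j) list \<Rightarrow> ('j, 'k::field_char_0) mat2 \<Rightarrow> 'k" where
  "bmono M p = (\<Prod>(i, j)\<leftarrow>M. br i j p)"

definition cscale :: "'j \<Rightarrow> 'k::field \<Rightarrow> ('j, 'k) mat2 \<Rightarrow> ('j, 'k) mat2" where
  "cscale j c p = (\<lambda>(i, r). if i = j then c * p (i, r) else p (i, r))"

lemma bmono_cscale: "bmono M (cscale j c p) = c ^ cdeg j M * bmono M p"
proof (induction M)
  case (Cons x M)
  obtain a b where x: "x = (a, b)" by (cases x)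
  have "br a b (cscale j c p) = c ^ (of_bool (a = j) + of_bool (b = j)) * br a b p"
    by (auto simp: br_def cscale_def algebra_simps power2_eq_square)
  then show ?case using Cons by (simp add: bmono_def x power_add)
qed (simp add: bmono_def)

text \<open>Both sides of the hypothesis are polynomials in the scaling parameter c; comparing
  coefficients of degree N leaves only the monomials of that degree in the column.\<close>

lemma homogeneous_part:
  assumes hom: "\<And>c. c \<noteq> 0 \<Longrightarrow> (\<Sum>(k, M)\<leftarrow>L. k * (c ^ cdeg j M * bmono M p)) = c ^ N * (f::'k::field_char_0)"
  shows "f = (\<Sum>(k, M)\<leftarrow>filter (\<lambda>(k, M). cdeg j M = N) L. k * bmono M p)"
proof -
  define P where "P = (\<Sum>(k, M)\<leftarrow>L. monom (k * bmono M p) (cdeg j M))"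
  have e: "poly (\<Sum>(k, M)\<leftarrow>L. monom (k * bmono M p) (cdeg j M)) c = (\<Sum>(k, M)\<leftarrow>L. k * (c ^ cdeg j M * bmono M p))" for c
    by (induction L) (auto simp: poly_monom)
  have "[:0, 1:] * (P - monom f N) = 0"
  proof (rule poly_all_0_iff_0[THEN iffD1], intro allI)
    fix c show "poly ([:0, 1:] * (P - monom f N)) c = 0"
      using hom[of c] by (cases "c = 0") (auto simp: P_def e poly_monom)
  qed
  then have "P = monom f N" by (metis eq_iff_diff_eq_0 mult_eq_0_iff one_neq_zero pCons_eq_0_iff)
  then have "f = coeff P N" by simp
  also have "\<dots> = (\<Sum>(k, M)\<leftarrow>filter (\<lambda>(k, M). cdeg j M = N) L. k * bmono M p)"
    unfolding P_def by (induction L) (auto simp: coeff_monom)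
  finally show ?thesis .
qed

text \<open>Brackets sorted by kind: two frame columns, y with a frame column, a frame column with
  x, and y with x. The factor e collects the signs; the type argument fixes the coefficient
  field.\<close>

definition classified :: "('n cols \<times> 'n cols) list \<Rightarrow> 'k \<Rightarrow> ('n \<times> 'n) list \<Rightarrow> 'n list \<Rightarrow> 'n list \<Rightarrow> nat \<Rightarrow> 'k::field_char_0 itself \<Rightarrow> bool" where
  "classified M e ZZ WY VX c = (\<lambda>_. cdeg (Inr True) M = length WY + c \<and> cdeg (Inr False) M = length VX + c \<and>
     length M = length ZZ + length WY + length VX + c \<and>
     (\<forall>p. bmono M p = e * (\<Prod>(v, w)\<leftarrow>ZZ. det2 (col p (Inl v)) (col p (Inl w))) * (\<Prod>w\<leftarrow>WY. det2 (ycol p) (col p (Inl w)))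
        * (\<Prod>v\<leftarrow>VX. det2 (col p (Inl v)) (xcol p)) * det2 (ycol p) (xcol p) ^ c))"

lemma det2_swap: "det2 x y = - det2 y x"
  by (simp add: det2_def algebra_simps)

text \<open>Orienting a bracket costs a sign. A bracket (y, y) or (x, x) makes the whole product
  vanish, which is the first alternative.\<close>

lemma classify:
  fixes M :: "('n cols \<times> 'n cols) list"
  shows "(\<forall>p. bmono M p = (0::'k::field_char_0)) \<or> (\<exists>e ZZ WY VX c. classified M e ZZ WY VX c TYPE('k))"
proof (induction M)
  case Nil
  have "classified [] 1 [] [] [] 0 TYPE('k)" by (simp add: classified_def bmono_def)
  then show ?case by blast
next
  case (Cons x M)
  obtain a b where x: "x = (a, b)" by (cases x)
  have step: "bmono (x # M) p = det2 (col p a) (col p b) * bmono M p" for p :: "('n cols, 'k) mat2"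
    by (simp add: bmono_def x br_det2)
  show ?case
  proof (cases "\<forall>p. bmono M p = (0::'k)")
    case True
    then show ?thesis by (simp add: step)
  next
    case False
    then obtain e :: 'k and ZZ WY VX c where C: "classified M e ZZ WY VX c TYPE('k)" using Cons by blast
    note c = C[unfolded classified_def] 
    consider (zz) v w where "a = Inl v" "b = Inl w" | (zy) w where "a = Inl w" "b = Inr True" | (yz) w where "a = Inr True" "b = Inl w"
      | (zx) v where "a = Inl v" "b = Inr False" | (xz) v where "a = Inr False" "b = Inl v"
      | (yx) "a = Inr True" "b = Inr False" | (xy) "a = Inr False" "b = Inr True" | (same) "a = b"
      by (metis (full_types) obj_sumE)
    then show ?thesis
    proof cases
      case zz
      have "classified (x # M) e ((v, w) # ZZ) WY VX c TYPE('k)" using c by (simp add: classified_def step) (simp add: x zz)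
      then show ?thesis by blast
    next
      case zy
      have "classified (x # M) (- e) ZZ (w # WY) VX c TYPE('k)"
        using c by (simp add: classified_def step) (simp add: x zy det2_swap[of "col _ (Inl w)" "ycol _"])
      then show ?thesis by blast
    next
      case yz
      have "classified (x # M) e ZZ (w # WY) VX c TYPE('k)" using c by (simp add: classified_def step) (simp add: x yz)
      then show ?thesis by blast
    next
      case zx
      have "classified (x # M) e ZZ WY (v # VX) c TYPE('k)" using c by (simp add: classified_def step) (simp add: x zx)
      then show ?thesis by blast
    next
      case xz
      have "classified (x # M) (- e) ZZ WY (v # VX) c TYPE('k)"
        using c by (simp add: classified_def step) (simp add: x xz det2_swap[of "xcol _" "col _ (Inl v)"])
      then show ?thesis by blast
    next
      case yx
      have "classified (x # M) e ZZ WY VX (Suc c) TYPE('k)" using c by (simp add: classified_def step) (simp add: x yx)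
      then show ?thesis by blast
    next
      case xy
      have "classified (x # M) (- e) ZZ WY VX (Suc c) TYPE('k)"
        using c by (simp add: classified_def step) (simp add: x xy det2_swap[of "xcol _" "ycol _"])
      then show ?thesis by blast
    next
      case same
      then have "\<forall>p. bmono (x # M) p = (0::'k)" by (simp add: step det2_def)
      then show ?thesis by blast
    qed
  qed
qed

text \<open>Each g lowers the power of y by one and brings down the current exponent; the falling
  factorial is written without division, with \<open>fact m\<close> on the left.\<close>

lemma gops_power_lin:
  "psmult (fact m) (gops (length ws + m) ws z (lin y ^ (length ws + m)))
    = psmult (fact (length ws + m) * (\<Prod>w\<leftarrow>ws. det2 y (z w))) (lin y ^ m)"
proof (induction ws)
  case (Cons w ws)
  have "psmult (fact m) (gops (length (w # ws) + m) (w # ws) z (lin y ^ (length (w # ws) + m)))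
      = psmult (of_nat (Suc (length ws + m)) * det2 y (z w)) (psmult (fact m) (gops (length ws + m) ws z (lin y ^ (length ws + m))))"
    by (simp add: Dz_power_lin gops_smult mult_ac del: power_Suc of_nat_Suc)
  then show ?case by (simp only: Cons) (simp add: mult_ac)
qed simp

lemma degree_gops:
  assumes "length ws \<le> N" "degree P \<le> N"
  shows "degree (gops N ws z P) \<le> N - length ws"
  using assms
proof (induction ws arbitrary: N P)
  case (Cons w ws)
  then obtain N' where N: "N = Suc N'" by (cases N) auto
  show ?case using Cons.IH[of N' "Dz N (z w) P"] Cons.prems degree_Dz[of P N'] by (simp add: N)
qed simp

lemma degree_pth:
  assumes "length ws \<le> \<alpha> + length vs" "degree P \<le> \<alpha>"
  shows "degree (pth \<alpha> vs ws z P) \<le> \<alpha> + length vs - length ws"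
proof -
  have "degree ((\<Prod>v\<leftarrow>vs. lin (z v)) * P) \<le> length vs + \<alpha>"
    by (rule order.trans[OF degree_mult_le add_mono[OF degree_prod_lin assms(2)]])
  then show ?thesis unfolding pth_def using assms(1) by (intro degree_gops) auto
qed

lemma pth_add: "pth \<alpha> vs ws z (P + Q) = pth \<alpha> vs ws z P + pth \<alpha> vs ws z Q"
  by (simp add: pth_def ring_distribs gops_add)

lemma pth_smult: "pth \<alpha> vs ws z (psmult c P) = psmult c (pth \<alpha> vs ws z P)"
  by (simp add: pth_def gops_smult)

lemma path_span_facts:
  assumes "path_span \<alpha> k l Op"
  shows path_span_Op_add: "Op z (P + Q) = Op z P + Op z Q"
    and path_span_Op_smult: "Op z (psmult c P) = psmult c (Op z P)"
    and path_span_Op_degree: "l \<le> \<alpha> + k \<Longrightarrow> degree P \<le> \<alpha> \<Longrightarrow> degree (Op z P) \<le> \<alpha> + k - l"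
proof -
  obtain L where L: "\<forall>(c, vs, ws)\<in>set L. length vs = k \<and> length ws = l"
    and Op: "\<And>z P. Op z P = (\<Sum>(c, vs, ws)\<leftarrow>L. psmult c (pth \<alpha> vs ws z P))"
    using assms unfolding path_span_def by metis
  show "Op z (P + Q) = Op z P + Op z Q"
    unfolding Op by (induction L) (auto simp: pth_add smult_add_right)
  show "Op z (psmult c P) = psmult c (Op z P)"
    unfolding Op by (induction L) (auto simp: pth_smult smult_add_right mult.commute)
  assume l: "l \<le> \<alpha> + k" and P: "degree P \<le> \<alpha>"
  show "degree (Op z P) \<le> \<alpha> + k - l"
    unfolding Op using L
  proof (induction L)
    case (Cons x L)
    obtain c vs ws where x: "x = (c, vs, ws)" by (cases x)
    have "degree (psmult c (pth \<alpha> vs ws z P)) \<le> \<alpha> + k - l"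
      using degree_pth[of ws \<alpha> vs P z] l P Cons.prems by (intro order.trans[OF degree_smult_le]) (auto simp: x)
    then show ?case using Cons by (auto simp: x intro: degree_add_le)
  qed simp
qed

lemma path_span_Op_sum:
  assumes "path_span \<alpha> k l Op"
  shows "Op z (\<Sum>i\<in>I. psmult (c i) (P i)) = (\<Sum>i\<in>I. psmult (c i) (Op z (P i)))"
proof -
  have "Op z 0 = 0" using path_span_Op_smult[OF assms, of z 0 0] by simp
  then show ?thesis
    by (induction I rule: infinite_finite_induct) (auto simp: path_span_Op_add[OF assms] path_span_Op_smult[OF assms])
qed

lemma heval_one_prod: "heval n (\<Prod>v\<leftarrow>vs. lin (z v)) (snd x) (- fst x) = (\<Prod>v\<leftarrow>vs. det2 (z v) x)" if "n = length vs"
  unfolding that heval_prod_lin by (simp add: det2_def algebra_simps)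

text \<open>The brackets (y, w) are performed as steps g on \<open>y^N\<close>, which leaves
  \<open>y^c\<close>; the brackets (v, x) become multiplications by v, and the c brackets (y, x)
  appear when \<open>y^c\<close> is evaluated at x. Counting columns gives \<open>k1\<close> and
  \<open>k2\<close>, and the closure properties of \<open>path_span\<close> put the steps f in
  front.\<close>

lemma bmono_path:
  fixes M :: "('n cols \<times> 'n cols) list"
  assumes M: "cdeg (Inr True) M = N" "cdeg (Inr False) M = N'" "length M = k2 + N'" "N' + k2 = N + k1"
  shows "\<exists>Op. path_span N k1 k2 Op \<and>
    (\<forall>p :: ('n cols, 'k::field_char_0) mat2. bmono M p = peval N' (Op (\<lambda>i. col p (Inl i)) (lin (ycol p) ^ N)) (xcol p))"
proof (cases "\<forall>p :: ('n cols, 'k) mat2. bmono M p = 0")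
  case True
  then show ?thesis
    by (intro exI[of _ "\<lambda>z P. 0"]) (auto simp: path_span_0 peval_def heval_def)
next
  case False
  then obtain e :: 'k and ZZ WY VX c where "classified M e ZZ WY VX c TYPE('k)" using classify by blast
  note c = this[unfolded classified_def]
  then have N: "N = length WY + c" and N': "N' = length VX + c" and k2: "k2 = length WY + length ZZ" and k1: "k1 = 0 + length VX + length ZZ"
    using M by auto
  \<comment> \<open>The factor \<open>c! / N!\<close> cancels the falling factorial produced by the
    steps g.\<close>
  define d :: 'k where "d = e * fact c / fact N"
  define Op where "Op z P = psmult d (psmult (\<Prod>(v, w)\<leftarrow>ZZ. det2 (z v) (z w)) ((\<Prod>v\<leftarrow>VX. lin (z v)) * gops N WY z P))" for z :: "'n \<Rightarrow> 'k \<times> 'k" and P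
  have "path_span N k1 k2 Op"
    unfolding Op_def[abs_def] k1 k2
    by (intro path_span_smult path_span_prod_det2 path_span_prod_lin path_span_gops) (simp add: N)
  moreover have "bmono M p = peval N' (Op (\<lambda>i. col p (Inl i)) (lin (ycol p) ^ N)) (xcol p)" for p :: "('n cols, 'k) mat2"
  proof -
    let ?z = "\<lambda>i. col p (Inl i)" and ?y = "ycol p" and ?x = "xcol p"
    let ?A = "\<Prod>(v, w)\<leftarrow>ZZ. det2 (?z v) (?z w)" and ?B = "\<Prod>w\<leftarrow>WY. det2 ?y (?z w)" and ?V = "\<Prod>v\<leftarrow>VX. lin (?z v)"
    have "psmult (fact c) (gops N WY ?z (lin ?y ^ N)) = psmult (fact N * ?B) (lin ?y ^ c)"
      using gops_power_lin[of c WY ?z ?y] by (simp add: N)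
    then have "psmult (1 / fact N) (psmult (fact c) (gops N WY ?z (lin ?y ^ N))) = psmult ?B (lin ?y ^ c)" by simp
    then have "psmult (fact c / fact N) (gops N WY ?z (lin ?y ^ N)) = psmult ?B (lin ?y ^ c)" by simp
    moreover have "Op ?z (lin ?y ^ N) = psmult (e * ?A) (?V * psmult (fact c / fact N) (gops N WY ?z (lin ?y ^ N)))"
      by (simp add: Op_def d_def mult_ac)
    ultimately have "Op ?z (lin ?y ^ N) = psmult (e * ?A) (?V * psmult ?B (lin ?y ^ c))" by simp
    then have "Op ?z (lin ?y ^ N) = psmult (e * ?A * ?B) (?V * lin ?y ^ c)" by simp
    moreover have "peval N' (?V * lin ?y ^ c) ?x = (\<Prod>v\<leftarrow>VX. det2 (?z v) ?x) * det2 ?y ?x ^ c"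
      unfolding peval_def N'
      by (subst heval_mult[OF degree_prod_lin degree_power_lin])
        (simp only: heval_one_prod heval_power[OF degree_lin] heval_lin, simp add: det2_def)
    ultimately show ?thesis using c by (simp add: peval_def heval_smult mult_ac)
  qed
  ultimately show ?thesis by blast
qed

lemma bmono_sum_path:
  fixes L :: "('k::field_char_0 \<times> ('n cols \<times> 'n cols) list) list"
  assumes "\<And>c M. (c, M) \<in> set L \<Longrightarrow> cdeg (Inr True) M = N \<and> cdeg (Inr False) M = N' \<and> length M = k2 + N'" "N' + k2 = N + k1"
  shows "\<exists>Op. path_span N k1 k2 Op \<and>
    (\<forall>p. (\<Sum>(c, M)\<leftarrow>L. c * bmono M p) = peval N' (Op (\<lambda>i. col p (Inl i)) (lin (ycol p) ^ N)) (xcol p))"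
  using assms(1)
proof (induction L)
  case Nil
  then show ?case by (intro exI[of _ "\<lambda>z P. 0"]) (auto simp: path_span_0 peval_def heval_def)
next
  case (Cons x L)
  obtain c M where x: "x = (c, M)" by (cases x)
  from Cons obtain O1 where O1: "path_span N k1 k2 O1"
    "\<And>p. (\<Sum>(c, M)\<leftarrow>L. c * bmono M p) = peval N' (O1 (\<lambda>i. col p (Inl i)) (lin (ycol p) ^ N)) (xcol p)" by auto
  have "cdeg (Inr True) M = N" "cdeg (Inr False) M = N'" "length M = k2 + N'" using Cons.prems[of c M] by (auto simp: x)
  from bmono_path[OF this assms(2)] obtain O2 where O2: "path_span N k1 k2 O2"
    "\<And>p :: ('n cols, 'k) mat2. bmono M p = peval N' (O2 (\<lambda>i. col p (Inl i)) (lin (ycol p) ^ N)) (xcol p)" by blast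
  show ?case
    by (intro exI[of _ "\<lambda>z P. psmult c (O2 z P) + O1 z P"] conjI path_span_add path_span_smult O1 O2)
      (simp add: x O1 O2 peval_def heval_add heval_smult)
qed

lemma heval_scale: "heval N P (c * x) (c * y) = c ^ N * heval N P x y"
proof -
  have "coeff P i * ((c * x) ^ (N - i) * (c * y) ^ i) = c ^ N * (coeff P i * (x ^ (N - i) * y ^ i))" if "i \<le> N" for i
  proof -
    have "c ^ N = c ^ (N - i) * c ^ i" using that by (simp flip: power_add)
    then show ?thesis by (simp only: power_mult_distrib mult_ac)
  qed
  then show ?thesis unfolding heval_def sum_distrib_left by (intro sum.cong) auto
qed

text \<open>For \<open>y = (1, s)\<close> the coefficients of the power are binomial numbers,
  nonzero in characteristic zero, times \<open>s^m\<close>. The hypothesis thus says that a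
  polynomial in s vanishes identically: powers of linear forms span all forms.\<close>

lemma linear_vanish_power_lin:
  fixes D :: "nat \<Rightarrow> 'k::field_char_0 poly"
  assumes "\<And>y. (\<Sum>m\<le>N. psmult (coeff (lin y ^ N) m) (D m)) = 0" and m: "m \<le> N"
  shows "D m = 0"
proof (rule poly_eqI)
  fix i
  have co: "coeff (lin (1, s) ^ N) m = of_nat (N choose m) * s ^ m" for s :: 'k and m
  proof (cases "m \<le> N")
    case True then show ?thesis unfolding lin_def by (simp add: coeff_linear_poly_power)
  next
    case False
    then show ?thesis using degree_power_lin[of "(1, s)" N] by (simp add: coeff_eq_0)
  qed
  define Q where "Q = (\<Sum>m\<le>N. monom (of_nat (N choose m) * coeff (D m) i) m)"
  have "poly Q s = coeff (\<Sum>m\<le>N. psmult (coeff (lin (1, s) ^ N) m) (D m)) i" for s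
    by (simp add: Q_def poly_sum poly_monom coeff_sum co mult_ac)
  then have "Q = 0" using assms(1) by (simp flip: poly_all_0_iff_0)
  then have "coeff Q m = 0" by simp
  moreover have "coeff Q m = of_nat (N choose m) * coeff (D m) i" using m by (simp add: Q_def coeff_sum coeff_monom)
  ultimately show "coeff (D m) i = coeff 0 i" using m by (simp add: binomial_eq_0_iff)
qed

text \<open>The semi-invariant attached to \<phi> is a sum of bracket monomials. Those of degree N
  in y and N' in x give a combination of paths that agrees with \<phi> on the powers
  \<open>y^N\<close>, and these span all forms.\<close>

theorem hom_is_path_combination:
  fixes \<phi> :: "('k::{alg_closed_field, field_char_0}, 'n::finite, ('k, 'n) schur_elem) gr_hom"
  assumes four: "CARD('n) \<ge> 4" and \<phi>: "\<phi> \<in> sheaf_homs (SW l) (SW l')" and w: "wedges l' = wedges l + k2"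
    and s: "sdeg l' + k2 = sdeg l + k1"
  obtains L where "\<And>c vs ws. (c, vs, ws) \<in> set L \<Longrightarrow> length vs = k1 \<and> length ws = k2"
    "\<And>t P. good t \<Longrightarrow> degree P \<le> sdeg l
      \<Longrightarrow> Lf l l' \<phi> t P = (\<Sum>(c, vs, ws)\<leftarrow>L. psmult c (pth (sdeg l) vs ws (\<lambda>i. zc t (axis i 1)) P))"
proof -
  let ?N = "sdeg l" and ?N' = "sdeg l'"
  obtain F where "br_span (wedges l' - wedges l + ?N') F"
    and F: "\<And>p :: ('n cols, 'k) mat2. good (tfr p) \<Longrightarrow> F p = peval ?N' (Lf l l' \<phi> (tfr p) (lin (ycol p) ^ ?N)) (xcol p)"
    using hom_equivariant_polyfun[OF four \<phi>] w by auto
  then obtain L where L: "\<And>c M. (c, M) \<in> set L \<Longrightarrow> length M = k2 + ?N'"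
    and FL: "\<And>p. F p = (\<Sum>(c, M)\<leftarrow>L. c * bmono M p)"
    unfolding br_span_def bmono_def w by fastforce
  have tfr: "tfr (cscale (Inr b) c p) = tfr p" for b and c :: 'k and p :: "('n cols, 'k) mat2"
    by (simp add: tfr_def row_def tmat_def cscale_def)
  have y: "F (cscale (Inr True) c p) = c ^ ?N * F p" if g: "good (tfr p)" for c p
  proof -
    have "lin (ycol (cscale (Inr True) c p)) = psmult c (lin (ycol p))" "xcol (cscale (Inr True) c p) = xcol p"
      by (auto simp: lin_def col_def cscale_def)
    then show ?thesis using g by (simp add: F tfr smult_power Lf_psmult[OF \<phi> g degree_power_lin] peval_def heval_smult)
  qed
  have x: "F (cscale (Inr False) c p) = c ^ ?N' * F p" if g: "good (tfr p)" for c p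
  proof -
    have "ycol (cscale (Inr False) c p) = ycol p" by (simp add: col_def cscale_def)
    moreover have "peval ?N' P (xcol (cscale (Inr False) c p)) = c ^ ?N' * peval ?N' P (xcol p)" for P
      using heval_scale[of ?N' P c "snd (xcol p)" "- fst (xcol p)"] by (simp add: peval_def col_def cscale_def)
    ultimately show ?thesis using g by (simp add: F tfr)
  qed
  \<comment> \<open>On good frames the function is homogeneous of degree N in y and N' in x, so only
    the monomials of these degrees are kept.\<close>
  define L1 where "L1 = filter (\<lambda>(k, M). cdeg (Inr True) M = ?N) L"
  define L2 where "L2 = filter (\<lambda>(k, M). cdeg (Inr False) M = ?N') L1"
  have 1: "F p = (\<Sum>(k, M)\<leftarrow>L1. k * bmono M p)" if "good (tfr p)" for p
    unfolding L1_def by (rule homogeneous_part) (use y[OF that] in \<open>simp add: FL bmono_cscale\<close>)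
  have 2: "F p = (\<Sum>(k, M)\<leftarrow>L2. k * bmono M p)" if g: "good (tfr p)" for p
    unfolding L2_def by (rule homogeneous_part) (use x[OF g] 1[of "cscale (Inr False) _ p"] g in \<open>simp add: tfr bmono_cscale\<close>)
  have L2: "cdeg (Inr True) M = ?N \<and> cdeg (Inr False) M = ?N' \<and> length M = k2 + ?N'" if "(c, M) \<in> set L2" for c M
    using L that by (auto simp: L2_def L1_def)
  have "\<exists>Op. path_span ?N k1 k2 Op \<and> (\<forall>p. (\<Sum>(c, M)\<leftarrow>L2. c * bmono M p) = peval ?N' (Op (\<lambda>i. col p (Inl i)) (lin (ycol p) ^ ?N)) (xcol p))"
    by (rule bmono_sum_path[OF _ s]) (rule L2)
  then obtain Op where Op: "path_span ?N k1 k2 Op"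
    and OpL: "\<And>p. (\<Sum>(c, M)\<leftarrow>L2. c * bmono M p) = peval ?N' (Op (\<lambda>i. col p (Inl i)) (lin (ycol p) ^ ?N)) (xcol p)" by blast
  let ?z = "\<lambda>t :: ('k, 'n) frame. \<lambda>i. zc t (axis i 1)"
  have lin: "Lf l l' \<phi> t (lin y ^ ?N) = Op (?z t) (lin y ^ ?N)" if g: "good t" for t y
  proof (rule heval_eqI)
    show "degree (Lf l l' \<phi> t (lin y ^ ?N)) \<le> ?N'" by (rule Lf_degree[OF \<phi> g degree_power_lin])
    show "degree (Op (?z t) (lin y ^ ?N)) \<le> ?N'"
      using path_span_Op_degree[OF Op _ degree_power_lin, of "?z t" y] s by simp
    fix x1 x2 :: 'k
    \<comment> \<open>The column x is \<open>(- x2, x1)\<close>, which \<open>peval\<close> turns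
      into evaluation at \<open>x1\<close>, \<open>x2\<close>.\<close>
    define p :: "('n cols, 'k) mat2" where
      "p = (\<lambda>(c, r). case c of Inl i \<Rightarrow> (if r then fst t $ i else snd t $ i)
         | Inr b \<Rightarrow> if b then (if r then fst y else snd y) else (if r then - x2 else x1))"
    have "tfr p = t" by (simp add: tfr_def row_def tmat_def p_def prod_eq_iff vec_eq_iff)
    moreover have "ycol p = y" "xcol p = (- x2, x1)" by (auto simp: col_def p_def)
    moreover have "(\<lambda>i. col p (Inl i)) = ?z (tfr p)" by (simp add: zc_tfr)
    ultimately have "peval ?N' (Lf l l' \<phi> t (lin y ^ ?N)) (- x2, x1) = peval ?N' (Op (?z t) (lin y ^ ?N)) (- x2, x1)"
      using F[of p] 2[of p] OpL[of p] g by simp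
    then show "heval ?N' (Lf l l' \<phi> t (lin y ^ ?N)) x1 x2 = heval ?N' (Op (?z t) (lin y ^ ?N)) x1 x2" by (simp add: peval_def)
  qed
  have mono: "Lf l l' \<phi> t (monom 1 m) = Op (?z t) (monom 1 m)" if g: "good t" and m: "m \<le> ?N" for t m
  proof -
    define D where "D m = Lf l l' \<phi> t (monom 1 m) - Op (?z t) (monom 1 m)" for m
    have "(\<Sum>m\<le>?N. psmult (coeff (lin y ^ ?N) m) (D m)) = 0" for y
    proof -
      have "Op (?z t) (lin y ^ ?N) = Op (?z t) (\<Sum>m\<le>?N. psmult (coeff (lin y ^ ?N) m) (monom 1 m))"
        using poly_sum_monoms[OF degree_power_lin[of y ?N]] by (simp add: smult_monom)
      also have "\<dots> = (\<Sum>m\<le>?N. psmult (coeff (lin y ^ ?N) m) (Op (?z t) (monom 1 m)))" by (rule path_span_Op_sum[OF Op])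
      finally show ?thesis using lin[OF g, of y] Lf_expand[OF \<phi> g degree_power_lin[of y ?N]]
        by (simp add: D_def smult_diff_right sum_subtractf)
    qed
    then have "D m = 0" using linear_vanish_power_lin m by blast
    then show ?thesis by (simp add: D_def)
  qed
  have all: "Lf l l' \<phi> t P = Op (?z t) P" if g: "good t" and P: "degree P \<le> ?N" for t P
  proof -
    have "Op (?z t) P = Op (?z t) (\<Sum>m\<le>?N. psmult (coeff P m) (monom 1 m))"
      using poly_sum_monoms[OF P] by (simp add: smult_monom)
    also have "\<dots> = (\<Sum>m\<le>?N. psmult (coeff P m) (Op (?z t) (monom 1 m)))" by (rule path_span_Op_sum[OF Op])
    finally show ?thesis using Lf_expand[OF \<phi> g P] mono[OF g] by simp
  qed
  obtain LL where len: "\<forall>(c, vs, ws)\<in>set LL. length vs = k1 \<and> length ws = k2"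
    and LL: "\<And>z P. Op z P = (\<Sum>(c, vs, ws)\<leftarrow>LL. psmult c (pth ?N vs ws z P))"
    using Op unfolding path_span_def by metis
  show ?thesis
  proof (rule that)
    show "length vs = k1 \<and> length ws = k2" if "(c, vs, ws) \<in> set LL" for c vs ws using len that by auto
    show "Lf l l' \<phi> t P = (\<Sum>(c, vs, ws)\<leftarrow>LL. psmult c (pth ?N vs ws (?z t) P))" if "good t" "degree P \<le> ?N" for t P
      using all[OF that] by (simp only: LL)
  qed
qed

section \<open>Building homomorphisms fibrewise\<close>

text \<open>Sections are compared through their forms in the fibres, so linearity and compatibility
  with restriction reduce to linearity of \<Lambda> on forms. All homomorphisms below are built in
  this way.\<close>

lemma hom_intro:
  fixes \<Phi> :: "('k::field_char_0^'n::finite) set set \<Rightarrow> (('k^'n) set \<Rightarrow> ('k, 'n) schur_elem) \<Rightarrow> ('k^'n) set \<Rightarrow> ('k, 'n) schur_elem"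
  assumes cl: "\<And>U s. U \<in> opens \<Longrightarrow> s \<in> carrier (SW l U) \<Longrightarrow> \<Phi> U s \<in> carrier (SW l' U)"
    and val: "\<And>U s K t. U \<in> opens \<Longrightarrow> s \<in> carrier (SW l U) \<Longrightarrow> K \<in> U \<Longrightarrow> good t \<Longrightarrow> t \<in> frames K
      \<Longrightarrow> vl t l' (\<Phi> U s K) = \<Lambda> t (vl t l (s K))"
    and add: "\<And>t P Q. good t \<Longrightarrow> degree P \<le> sdeg l \<Longrightarrow> degree Q \<le> sdeg l \<Longrightarrow> \<Lambda> t (P + Q) = \<Lambda> t P + \<Lambda> t Q"
    and smult: "\<And>t P c. good t \<Longrightarrow> degree P \<le> sdeg l \<Longrightarrow> \<Lambda> t (psmult c P) = psmult c (\<Lambda> t P)"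
  defines "\<phi> \<equiv> (\<lambda>U\<in>opens. \<lambda>s\<in>carrier (SW l U). \<Phi> U s)"
  shows hom_intro_closed: "\<phi> \<in> sheaf_homs (SW l) (SW l')"
    and hom_intro_Lf: "good t \<Longrightarrow> degree P \<le> sdeg l \<Longrightarrow> Lf l l' \<phi> t P = \<Lambda> t P"
proof -
  have fr': "good (fr K)" "fr K \<in> frames K" if "U \<in> opens" "K \<in> U" for U and K :: "('k^'n) set"
    using frames_good[OF U_Gr[OF that] fr[OF U_Gr[OF that]]] fr[OF U_Gr[OF that]] by simp_all
  have deg: "degree (vl (fr K) l (s K)) \<le> sdeg l" if "U \<in> opens" "K \<in> U" "s \<in> carrier (SW l U)" for U and K :: "('k^'n) set" and s
    by (rule fib_degree[OF U_Gr[OF that(1,2)] fr'(2)[OF that(1,2)] SW_fibre[OF that(1) that(3) that(2)]])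
  show hom: "\<phi> \<in> sheaf_homs (SW l) (SW l')"
    unfolding sheaf_homs_def mem_Collect_eq
  proof (intro conjI ballI impI IntI)
    show "\<phi> \<in> extensional opens" by (simp add: \<phi>_def)
    fix U :: "('k^'n) set set" assume U: "U \<in> opens"
    show "\<phi> U \<in> extensional (carrier (SW l U))" using U by (simp add: \<phi>_def)
    show "\<phi> U \<in> lin_maps (structure_sheaf U) (SW l U) (SW l' U)"
      unfolding lin_maps_def mem_Collect_eq
    proof (intro conjI ballI)
      show "\<phi> U \<in> carrier (SW l U) \<rightarrow> carrier (SW l' U)" using U cl by (simp add: \<phi>_def)
      fix s assume s: "s \<in> carrier (SW l U)"
      { fix s' assume s': "s' \<in> carrier (SW l U)"
        have "\<Phi> U (s \<oplus>\<^bsub>SW l U\<^esub> s') = \<Phi> U s \<oplus>\<^bsub>SW l' U\<^esub> \<Phi> U s'"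
          by (rule SW_eqI[where l = l', OF U]) (simp_all add: U s s' cl SW_add val[OF U] fr'[OF U] SW_add_val[OF U] add deg[OF U])
        then show "\<phi> U (s \<oplus>\<^bsub>SW l U\<^esub> s') = \<phi> U s \<oplus>\<^bsub>SW l' U\<^esub> \<phi> U s'"
          using U s s' by (simp add: \<phi>_def SW_add) }
      { fix a assume a: "a \<in> carrier (structure_sheaf U)"
        have "\<Phi> U (a \<odot>\<^bsub>SW l U\<^esub> s) = a \<odot>\<^bsub>SW l' U\<^esub> \<Phi> U s"
          by (rule SW_eqI[where l = l', OF U]) (simp_all add: U s a cl SW_smult val[OF U] fr'[OF U] SW_smult_val[OF U] smult deg[OF U])
        then show "\<phi> U (a \<odot>\<^bsub>SW l U\<^esub> s) = a \<odot>\<^bsub>SW l' U\<^esub> \<phi> U s"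
          using U s a by (simp add: \<phi>_def SW_smult) }
    qed
    fix U' s assume U': "U' \<in> opens" "U' \<subseteq> U" and s: "s \<in> carrier (SW l U)"
    have r: "restrict s U' \<in> carrier (SW l U')" by (rule SW_restrict[OF U s U'])
    have "\<Phi> U' (restrict s U') = restrict (\<Phi> U s) U'"
    proof (rule SW_eqI[where l = l', OF U'(1)])
      show "\<Phi> U' (restrict s U') \<in> carrier (SW l' U')" by (rule cl[OF U'(1) r])
      show "restrict (\<Phi> U s) U' \<in> carrier (SW l' U')" by (rule SW_restrict[OF U cl[OF U s] U'])
      fix K assume K: "K \<in> U'"
      then have "vl (fr K) l' (\<Phi> U' (restrict s U') K) = \<Lambda> (fr K) (vl (fr K) l (s K))"
        using val[OF U'(1) r K fr'[OF U'(1) K]] by simp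
      also have "\<dots> = vl (fr K) l' (\<Phi> U s K)" using val[OF U s _ fr'[OF U'(1) K]] K U'(2) by auto
      finally show "vl (fr K) l' (\<Phi> U' (restrict s U') K) = vl (fr K) l' (restrict (\<Phi> U s) U' K)" using K by simp
    qed
    then show "\<phi> U' (restrict s U') = restrict (\<phi> U s) U'" using U U' s r by (simp add: \<phi>_def)
  qed
  show "Lf l l' \<phi> t P = \<Lambda> t P" if t: "good t" and P: "degree P \<le> sdeg l"
  proof (rule Lf_eqI[OF hom t P])
    fix s :: "('k^'n) set \<Rightarrow> ('k, 'n) schur_elem" assume s: "s \<in> carrier (SW l Gr)"
    have "t \<in> frames (kern t)" by (simp add: frames_iff)
    from val[OF Gr_opens s kern_Gr[OF t] t this]
    show "vl t l' (\<phi> Gr s (kern t)) = \<Lambda> t (vl t l (s (kern t)))" using s by (simp add: \<phi>_def Gr_opens)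
  qed
qed

lemma f_map_facts:
  fixes v :: "'k::field_char_0^'n::finite"
  assumes l: "is_part l"
  shows f_map_closed: "f_map l v \<in> sheaf_homs (SW l) (SW (l + e1))"
    and f_map_Lf: "good t \<Longrightarrow> degree P \<le> sdeg l \<Longrightarrow> Lf l (l + e1) (f_map l v) t P = lin (zc t v) * P"
proof -
  let ?\<Phi> = "\<lambda>U s. \<lambda>K\<in>U. schur_f l (taut_fibre K) (taut_section v K) (s K)"
  have facts: "schur_f l (taut_fibre K) (taut_section v K) C \<in> carrier (schur_fibre (l + e1) K)"
    "vl t (l + e1) (schur_f l (taut_fibre K) (taut_section v K) C) = lin (zc t v) * vl t l C"
    if K: "K \<in> Gr" and t: "t \<in> frames K" and C: "C \<in> carrier (schur_fibre l K)" for K t C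
    using plane.schur_f_facts[OF plane_fibre[OF K t] l, of C "taut_section v K"] C
    by (simp_all add: schur_fibre_def carrier_taut_fibre[OF K] th_taut_section[OF K t])
  have cl: "?\<Phi> U s \<in> carrier (SW (l + e1) U)" if U: "U \<in> opens" and s: "s \<in> carrier (SW l U)" for U s
  proof (rule SW_intro[OF U])
    show "regp (U \<inter> chart i j) (\<lambda>L. lin (zc (nf i j L) v) * vl (nf i j L) l (s L))" for i j
      by (intro regp_mult regp_lin_nf SW_regp[OF U s] opens_Int U chart_opens) simp
  qed (simp_all add: facts(1)[OF _ fr] facts(2) SW_fibre[OF U s] U_Gr[OF U] nf_frames)
  have val: "vl t (l + e1) (?\<Phi> U s K) = lin (zc t v) * vl t l (s K)"
    if "U \<in> opens" "s \<in> carrier (SW l U)" "K \<in> U" "t \<in> frames K" for U s K t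
    using facts[OF U_Gr[OF that(1,3)] that(4) SW_fibre[OF that(1-3)]] that by simp
  show "f_map l v \<in> sheaf_homs (SW l) (SW (l + e1))"
    unfolding f_map_def
    by (rule hom_intro_closed[where \<Lambda> = "\<lambda>t P. lin (zc t v) * P"]) (simp_all only: cl val distrib_left mult_smult_right)
  show "Lf l (l + e1) (f_map l v) t P = lin (zc t v) * P" if "good t" "degree P \<le> sdeg l"
    unfolding f_map_def
    by (rule hom_intro_Lf[where \<Lambda> = "\<lambda>t P. lin (zc t v) * P", OF _ _ _ _ that]) (simp_all only: cl val distrib_left mult_smult_right)
qed

lemma g_map_facts:
  fixes v :: "'k::field_char_0^'n::finite"
  assumes l: "is_part l" "is_part (l + e2)"
  shows g_map_closed: "g_map l v \<in> sheaf_homs (SW l) (SW (l + e2))"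
    and g_map_Lf: "good t \<Longrightarrow> degree P \<le> sdeg l \<Longrightarrow> Lf l (l + e2) (g_map l v) t P = Dz (sdeg l) (zc t v) P"
proof -
  let ?\<Phi> = "\<lambda>U s. \<lambda>K\<in>U. schur_g l (taut_fibre K) (taut_section v K) (s K)"
  have facts: "schur_g l (taut_fibre K) (taut_section v K) C \<in> carrier (schur_fibre (l + e2) K)"
    "vl t (l + e2) (schur_g l (taut_fibre K) (taut_section v K) C) = Dz (sdeg l) (zc t v) (vl t l C)"
    if K: "K \<in> Gr" and t: "t \<in> frames K" and C: "C \<in> carrier (schur_fibre l K)" for K t C
    using plane.schur_g_facts[OF plane_fibre[OF K t] l, of C "taut_section v K"] C
    by (simp_all add: schur_fibre_def carrier_taut_fibre[OF K] th_taut_section[OF K t])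
  have cl: "?\<Phi> U s \<in> carrier (SW (l + e2) U)" if U: "U \<in> opens" and s: "s \<in> carrier (SW l U)" for U s
  proof (rule SW_intro[OF U])
    fix i j
    let ?U = "U \<inter> chart i j"
    have O: "?U \<in> opens" by (rule opens_Int[OF U chart_opens])
    have lin: "regp ?U (\<lambda>L. lin (zc (nf i j L) v))" by (rule regp_lin_nf[OF O]) simp
    then have "regular_on ?U (\<lambda>L. coeff (lin (zc (nf i j L) v)) 1)" unfolding regp_def by blast
    then have "regular_on ?U (\<lambda>L. of_nat (sdeg l) * snd (zc (nf i j L) v))"
      by (intro regular_mult regular_const O) (simp add: lin_def)
    then have "regp ?U (\<lambda>L. psmult (of_nat (sdeg l) * snd (zc (nf i j L) v)) (vl (nf i j L) l (s L))
        + psmult (-1) (lin (zc (nf i j L) v) * pderiv (vl (nf i j L) l (s L))))"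
      by (intro regp_add regp_psmult regp_mult lin regp_pderiv SW_regp[OF U s] O regular_const)
    then show "regp ?U (\<lambda>L. Dz (sdeg l) (zc (nf i j L) v) (vl (nf i j L) l (s L)))"
      by (simp add: Dz_def)
  qed (simp_all add: facts(1)[OF _ fr] facts(2) SW_fibre[OF U s] U_Gr[OF U] nf_frames)
  have val: "vl t (l + e2) (?\<Phi> U s K) = Dz (sdeg l) (zc t v) (vl t l (s K))"
    if "U \<in> opens" "s \<in> carrier (SW l U)" "K \<in> U" "t \<in> frames K" for U s K t
    using facts[OF U_Gr[OF that(1,3)] that(4) SW_fibre[OF that(1-3)]] that by simp
  show "g_map l v \<in> sheaf_homs (SW l) (SW (l + e2))"
    unfolding g_map_def
    by (rule hom_intro_closed[where \<Lambda> = "\<lambda>t P. Dz (sdeg l) (zc t v) P"]) (simp_all only: cl val Dz_add Dz_smult)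
  show "Lf l (l + e2) (g_map l v) t P = Dz (sdeg l) (zc t v) P" if "good t" "degree P \<le> sdeg l"
    unfolding g_map_def
    by (rule hom_intro_Lf[where \<Lambda> = "\<lambda>t P. Dz (sdeg l) (zc t v) P", OF _ _ _ _ that]) (simp_all only: cl val Dz_add Dz_smult)
qed

section \<open>The vector space of homomorphisms and composition\<close>

lemma carrier_Hom [simp]: "carrier (Hom A B) = sheaf_homs A B"
  by (simp add: Hom_def)

context
  fixes l l' :: "int \<times> int" and \<phi> :: "('k::field_char_0, 'n::finite, ('k, 'n) schur_elem) gr_hom"
  assumes \<phi>: "\<phi> \<in> sheaf_homs (SW l) (SW l')"
begin

lemma Hom_add_facts:
  assumes \<psi>: "\<psi> \<in> sheaf_homs (SW l) (SW l')"
  shows Hom_add_closed: "\<phi> \<oplus>\<^bsub>Hom (SW l) (SW l')\<^esub> \<psi> \<in> sheaf_homs (SW l) (SW l')"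
    and Hom_add_Lf: "good t \<Longrightarrow> degree P \<le> sdeg l
      \<Longrightarrow> Lf l l' (\<phi> \<oplus>\<^bsub>Hom (SW l) (SW l')\<^esub> \<psi>) t P = Lf l l' \<phi> t P + Lf l l' \<psi> t P"
proof -
  let ?\<Phi> = "\<lambda>U s. \<phi> U s \<oplus>\<^bsub>SW l' U\<^esub> \<psi> U s" and ?\<Lambda> = "\<lambda>t P. Lf l l' \<phi> t P + Lf l l' \<psi> t P"
  have eq: "\<phi> \<oplus>\<^bsub>Hom (SW l) (SW l')\<^esub> \<psi> = (\<lambda>U\<in>opens. \<lambda>s\<in>carrier (SW l U). ?\<Phi> U s)" by (simp add: Hom_def)
  note facts = hom_intro[of l ?\<Phi> l' ?\<Lambda>, folded eq]
  have 1: "?\<Phi> U s \<in> carrier (SW l' U)" if "U \<in> opens" "s \<in> carrier (SW l U)" for U s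
    using that by (intro SW_add hom_closed[OF \<phi>] hom_closed[OF \<psi>])
  have 2: "vl t l' (?\<Phi> U s K) = ?\<Lambda> t (vl t l (s K))" if "U \<in> opens" "s \<in> carrier (SW l U)" "K \<in> U" "t \<in> frames K" for U s K t
    using that by (simp add: SW_add_val hom_closed[OF \<phi>] hom_closed[OF \<psi>] hom_fibre[OF \<phi>] hom_fibre[OF \<psi>])
  note 3 = Lf_add[OF \<phi>] Lf_add[OF \<psi>] Lf_psmult[OF \<phi>] Lf_psmult[OF \<psi>]
  show "\<phi> \<oplus>\<^bsub>Hom (SW l) (SW l')\<^esub> \<psi> \<in> sheaf_homs (SW l) (SW l')"
    by (rule facts(1)[OF 1 2]) (simp_all add: 3 smult_add_right)
  show "Lf l l' (\<phi> \<oplus>\<^bsub>Hom (SW l) (SW l')\<^esub> \<psi>) t P = ?\<Lambda> t P" if "good t" "degree P \<le> sdeg l"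
    by (rule facts(2)[OF 1 2 _ _ that]) (simp_all add: 3 smult_add_right)
qed

lemma Hom_smult_facts:
  shows Hom_smult_closed: "c \<odot>\<^bsub>Hom (SW l) (SW l')\<^esub> \<phi> \<in> sheaf_homs (SW l) (SW l')"
    and Hom_smult_Lf: "good t \<Longrightarrow> degree P \<le> sdeg l
      \<Longrightarrow> Lf l l' (c \<odot>\<^bsub>Hom (SW l) (SW l')\<^esub> \<phi>) t P = psmult c (Lf l l' \<phi> t P)"
proof -
  let ?\<Phi> = "\<lambda>U s. (\<lambda>K\<in>U. c) \<odot>\<^bsub>SW l' U\<^esub> \<phi> U s" and ?\<Lambda> = "\<lambda>t P. psmult c (Lf l l' \<phi> t P)"
  have eq: "c \<odot>\<^bsub>Hom (SW l) (SW l')\<^esub> \<phi> = (\<lambda>U\<in>opens. \<lambda>s\<in>carrier (SW l U). ?\<Phi> U s)" by (simp add: Hom_def)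
  note facts = hom_intro[of l ?\<Phi> l' ?\<Lambda>, folded eq]
  have 1: "?\<Phi> U s \<in> carrier (SW l' U)" if "U \<in> opens" "s \<in> carrier (SW l U)" for U s
    using that by (intro SW_smult hom_closed[OF \<phi>] const_structure)
  have 2: "vl t l' (?\<Phi> U s K) = ?\<Lambda> t (vl t l (s K))" if "U \<in> opens" "s \<in> carrier (SW l U)" "K \<in> U" "t \<in> frames K" for U s K t
    using that by (simp add: SW_smult_val hom_closed[OF \<phi>] hom_fibre[OF \<phi>])
  note 3 = Lf_add[OF \<phi>] Lf_psmult[OF \<phi>]
  show "c \<odot>\<^bsub>Hom (SW l) (SW l')\<^esub> \<phi> \<in> sheaf_homs (SW l) (SW l')"
    by (rule facts(1)[OF 1 2]) (simp_all add: 3 smult_add_right mult.commute)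
  show "Lf l l' (c \<odot>\<^bsub>Hom (SW l) (SW l')\<^esub> \<phi>) t P = ?\<Lambda> t P" if "good t" "degree P \<le> sdeg l"
    by (rule facts(2)[OF 1 2 _ _ that]) (simp_all add: 3 smult_add_right mult.commute)
qed

lemma hom_comp_facts:
  assumes \<psi>: "\<psi> \<in> sheaf_homs (SW l') (SW l'')"
  shows hom_comp_closed: "hom_comp (SW l) \<psi> \<phi> \<in> sheaf_homs (SW l) (SW l'')"
    and hom_comp_Lf: "good t \<Longrightarrow> degree P \<le> sdeg l
      \<Longrightarrow> Lf l l'' (hom_comp (SW l) \<psi> \<phi>) t P = Lf l' l'' \<psi> t (Lf l l' \<phi> t P)"
proof -
  let ?\<Phi> = "\<lambda>U s. \<psi> U (\<phi> U s)" and ?\<Lambda> = "\<lambda>t P. Lf l' l'' \<psi> t (Lf l l' \<phi> t P)"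
  have eq: "hom_comp (SW l) \<psi> \<phi> = (\<lambda>U\<in>opens. \<lambda>s\<in>carrier (SW l U). ?\<Phi> U s)" by (simp add: hom_comp_def compose_def)
  note facts = hom_intro[of l ?\<Phi> l'' ?\<Lambda>, folded eq]
  have 1: "?\<Phi> U s \<in> carrier (SW l'' U)" if "U \<in> opens" "s \<in> carrier (SW l U)" for U s
    using that by (intro hom_closed[OF \<phi>] hom_closed[OF \<psi>])
  have 2: "vl t l'' (?\<Phi> U s K) = ?\<Lambda> t (vl t l (s K))" if "U \<in> opens" "s \<in> carrier (SW l U)" "K \<in> U" "t \<in> frames K" for U s K t
    using that by (simp add: hom_closed[OF \<phi>] hom_fibre[OF \<phi>] hom_fibre[OF \<psi>])
  note 3 = Lf_add[OF \<phi>] Lf_psmult[OF \<phi>] Lf_add[OF \<psi>] Lf_psmult[OF \<psi>] Lf_degree[OF \<phi>]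
  show "hom_comp (SW l) \<psi> \<phi> \<in> sheaf_homs (SW l) (SW l'')"
    by (rule facts(1)[OF 1 2]) (simp_all add: 3)
  show "Lf l l'' (hom_comp (SW l) \<psi> \<phi>) t P = ?\<Lambda> t P" if "good t" "degree P \<le> sdeg l"
    by (rule facts(2)[OF 1 2 _ _ that]) (simp_all add: 3)
qed

end

lemma hom_id_facts:
  shows hom_id_closed: "(hom_id (SW l) :: ('k::field_char_0, 'n::finite, ('k, 'n) schur_elem) gr_hom) \<in> sheaf_homs (SW l) (SW l)"
    and hom_id_Lf: "good t \<Longrightarrow> degree P \<le> sdeg l
      \<Longrightarrow> Lf l l (hom_id (SW l) :: ('k, 'n, ('k, 'n) schur_elem) gr_hom) t P = P"
  unfolding hom_id_def
  by (rule hom_intro_closed[where \<Lambda> = "\<lambda>t P. P"]; simp) (rule hom_intro_Lf[where \<Lambda> = "\<lambda>t P. P"]; simp)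

lemma Hom_zero_facts:
  shows Hom_zero_closed: "(\<zero>\<^bsub>Hom (SW l) (SW l')\<^esub> :: ('k::field_char_0, 'n::finite, ('k, 'n) schur_elem) gr_hom) \<in> sheaf_homs (SW l) (SW l')"
    and Hom_zero_Lf: "good t \<Longrightarrow> degree P \<le> sdeg l
      \<Longrightarrow> Lf l l' (\<zero>\<^bsub>Hom (SW l) (SW l')\<^esub> :: ('k, 'n, ('k, 'n) schur_elem) gr_hom) t P = 0"
proof -
  have eq: "(\<zero>\<^bsub>Hom (SW l) (SW l')\<^esub> :: ('k, 'n, ('k, 'n) schur_elem) gr_hom) = (\<lambda>U\<in>opens. \<lambda>s\<in>carrier (SW l U). \<zero>\<^bsub>SW l' U\<^esub>)"
    by (simp add: Hom_def)
  show "(\<zero>\<^bsub>Hom (SW l) (SW l')\<^esub> :: ('k, 'n, ('k, 'n) schur_elem) gr_hom) \<in> sheaf_homs (SW l) (SW l')"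
    unfolding eq by (rule hom_intro_closed[where \<Lambda> = "\<lambda>t P. 0"]) (simp_all add: SW_zero SW_zero_val)
  show "Lf l l' (\<zero>\<^bsub>Hom (SW l) (SW l')\<^esub> :: ('k, 'n, ('k, 'n) schur_elem) gr_hom) t P = 0" if "good t" "degree P \<le> sdeg l"
    unfolding eq by (rule hom_intro_Lf[where \<Lambda> = "\<lambda>t P. 0", OF _ _ _ _ that]) (simp_all add: SW_zero SW_zero_val)
qed

text \<open>The finite sums in the definition of \<open>Theta\<close> can be computed once Hom is
  known to be a commutative monoid; its laws are checked on fibres.\<close>

lemma Hom_abelian_monoid: "abelian_monoid (Hom (SW l) (SW l') :: ('k::field_char_0, ('k, 'n::finite, ('k, 'n) schur_elem) gr_hom) module)"
proof (rule abelian_monoidI, unfold carrier_Hom)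
  let ?H = "sheaf_homs (SW l) (SW l') :: ('k, 'n, ('k, 'n) schur_elem) gr_hom set"
  note cl = Hom_add_closed Hom_zero_closed
  show "\<zero>\<^bsub>Hom (SW l) (SW l')\<^esub> \<in> ?H" by (rule Hom_zero_closed)
  fix x y z assume x: "x \<in> ?H" and y: "y \<in> ?H" and z: "z \<in> ?H"
  show "x \<oplus>\<^bsub>Hom (SW l) (SW l')\<^esub> y \<in> ?H" by (rule Hom_add_closed[OF x y])
  show "x \<oplus>\<^bsub>Hom (SW l) (SW l')\<^esub> y \<oplus>\<^bsub>Hom (SW l) (SW l')\<^esub> z = x \<oplus>\<^bsub>Hom (SW l) (SW l')\<^esub> (y \<oplus>\<^bsub>Hom (SW l) (SW l')\<^esub> z)"
    using x y z by (intro hom_eqI[of _ l l']) (simp_all add: Hom_add_Lf cl)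
  show "\<zero>\<^bsub>Hom (SW l) (SW l')\<^esub> \<oplus>\<^bsub>Hom (SW l) (SW l')\<^esub> x = x"
    using x by (intro hom_eqI[of _ l l']) (simp_all add: Hom_add_Lf Hom_zero_Lf cl)
  show "x \<oplus>\<^bsub>Hom (SW l) (SW l')\<^esub> y = y \<oplus>\<^bsub>Hom (SW l) (SW l')\<^esub> x"
    using x y by (intro hom_eqI[of _ l l']) (simp_all add: Hom_add_Lf cl)
qed

lemma Hom_finsum_facts:
  fixes h :: "'a \<Rightarrow> ('k::field_char_0, 'n::finite, ('k, 'n) schur_elem) gr_hom"
  assumes "finite I" "\<And>i. i \<in> I \<Longrightarrow> h i \<in> sheaf_homs (SW l) (SW l')"
  shows Hom_finsum_closed: "(\<Oplus>\<^bsub>Hom (SW l) (SW l')\<^esub>i\<in>I. h i) \<in> sheaf_homs (SW l) (SW l')"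
    and Hom_finsum_Lf: "good t \<Longrightarrow> degree P \<le> sdeg l
      \<Longrightarrow> Lf l l' (\<Oplus>\<^bsub>Hom (SW l) (SW l')\<^esub>i\<in>I. h i) t P = (\<Sum>i\<in>I. Lf l l' (h i) t P)"
proof -
  interpret abelian_monoid "Hom (SW l) (SW l') :: ('k, ('k, 'n, ('k, 'n) schur_elem) gr_hom) module"
    by (rule Hom_abelian_monoid)
  have "(\<Oplus>\<^bsub>Hom (SW l) (SW l')\<^esub>i\<in>I. h i) \<in> sheaf_homs (SW l) (SW l') \<and> (good t \<longrightarrow> degree P \<le> sdeg l \<longrightarrow>
      Lf l l' (\<Oplus>\<^bsub>Hom (SW l) (SW l')\<^esub>i\<in>I. h i) t P = (\<Sum>i\<in>I. Lf l l' (h i) t P))" for P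
    using assms
  proof (induction I)
    case empty
    show ?case by (simp add: Hom_zero_closed Hom_zero_Lf)
  next
    case (insert i I)
    have "(\<Oplus>\<^bsub>Hom (SW l) (SW l')\<^esub>i\<in>insert i I. h i) = h i \<oplus>\<^bsub>Hom (SW l) (SW l')\<^esub> (\<Oplus>\<^bsub>Hom (SW l) (SW l')\<^esub>i\<in>I. h i)"
      using insert by (intro finsum_insert) auto
    then show ?case using insert by (simp add: Hom_add_closed Hom_add_Lf)
  qed
  then show "(\<Oplus>\<^bsub>Hom (SW l) (SW l')\<^esub>i\<in>I. h i) \<in> sheaf_homs (SW l) (SW l')"
    "good t \<Longrightarrow> degree P \<le> sdeg l
      \<Longrightarrow> Lf l l' (\<Oplus>\<^bsub>Hom (SW l) (SW l')\<^esub>i\<in>I. h i) t P = (\<Sum>i\<in>I. Lf l l' (h i) t P)" by blast+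
qed

section \<open>Chains of homomorphisms\<close>

text \<open>The list \<open>step_homs\<close> as a recursion along the intermediate partitions,
  suited to induction from the source.\<close>

primrec hom_chain :: "int \<times> int \<Rightarrow> (int \<times> int) list \<Rightarrow> ('k::field, ('k, 'n::finite, ('k, 'n) schur_elem) gr_hom) module list" where
  "hom_chain l [] = []"
| "hom_chain l (l' # ls) = Hom (SW l) (SW l') # hom_chain l' ls"

text \<open>The fibre map of a composite. The second equation ends the recursion; for words of a
  chain both lists run out together.\<close>

fun chain_Lf :: "int \<times> int \<Rightarrow> (int \<times> int) list \<Rightarrow> ('k::field_char_0, 'n::finite, ('k, 'n) schur_elem) gr_hom list
    \<Rightarrow> ('k, 'n) frame \<Rightarrow> 'k poly \<Rightarrow> 'k poly" where
  "chain_Lf l (l' # ls) (\<phi> # \<phi>s) t P = chain_Lf l' ls \<phi>s t (Lf l l' \<phi> t P)"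
| "chain_Lf l _ _ t P = P"

lemma words_Cons_iff: "w \<in> words (M # Ms) \<longleftrightarrow> (\<exists>x w'. w = x # w' \<and> x \<in> carrier M \<and> w' \<in> words Ms)"
  by (cases w) (auto simp: words_def)

lemma words_Nil_iff: "w \<in> words [] \<longleftrightarrow> w = []"
  by (auto simp: words_def)

lemma chain_Lf_linear:
  assumes "\<phi>s \<in> words (hom_chain l ls)" "good t" "degree P \<le> sdeg l" "degree Q \<le> sdeg l"
  shows chain_Lf_add: "chain_Lf l ls \<phi>s t (P + Q) = chain_Lf l ls \<phi>s t P + chain_Lf l ls \<phi>s t Q"
    and chain_Lf_psmult: "chain_Lf l ls \<phi>s t (psmult c P) = psmult c (chain_Lf l ls \<phi>s t P)"
    and degree_chain_Lf: "degree (chain_Lf l ls \<phi>s t P) \<le> sdeg (last (l # ls))"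
proof -
  have "chain_Lf l ls \<phi>s t (P + Q) = chain_Lf l ls \<phi>s t P + chain_Lf l ls \<phi>s t Q
    \<and> chain_Lf l ls \<phi>s t (psmult c P) = psmult c (chain_Lf l ls \<phi>s t P)
    \<and> degree (chain_Lf l ls \<phi>s t P) \<le> sdeg (last (l # ls))"
    using assms
  proof (induction ls arbitrary: l \<phi>s P Q)
    case Nil
    then show ?case by (simp add: words_Nil_iff)
  next
    case (Cons l' ls)
    then obtain \<phi> \<phi>s' where \<phi>: "\<phi>s = \<phi> # \<phi>s'" "\<phi> \<in> sheaf_homs (SW l) (SW l')" "\<phi>s' \<in> words (hom_chain l' ls)"
      by (auto simp: words_Cons_iff)
    show ?case
      using Cons.IH[OF \<phi>(3) \<open>good t\<close>, of "Lf l l' \<phi> t P" "Lf l l' \<phi> t Q"] Cons.prems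
      by (simp add: \<phi>(1) Lf_add[OF \<phi>(2)] Lf_psmult[OF \<phi>(2)] Lf_degree[OF \<phi>(2)])
  qed
  then show "chain_Lf l ls \<phi>s t (P + Q) = chain_Lf l ls \<phi>s t P + chain_Lf l ls \<phi>s t Q"
    "chain_Lf l ls \<phi>s t (psmult c P) = psmult c (chain_Lf l ls \<phi>s t P)"
    "degree (chain_Lf l ls \<phi>s t P) \<le> sdeg (last (l # ls))" by blast+
qed

lemma hom_comp_list_facts:
  fixes \<phi>s :: "('k::field_char_0, 'n::finite, ('k, 'n) schur_elem) gr_hom list"
  assumes "\<phi>s \<in> words (hom_chain l ls)"
  shows hom_comp_list_closed: "hom_comp_list (SW l) \<phi>s \<in> sheaf_homs (SW l) (SW (last (l # ls)))"
    and hom_comp_list_Lf: "good t \<Longrightarrow> degree P \<le> sdeg l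
      \<Longrightarrow> Lf l (last (l # ls)) (hom_comp_list (SW l) \<phi>s) t P = chain_Lf l ls \<phi>s t P"
proof -
  \<comment> \<open>Generalised to an arbitrary accumulator \<psi> with source \<open>l0\<close>,
    because the composition is folded from the left.\<close>
  have "foldl (\<lambda>\<psi> \<phi>. hom_comp (SW l0) \<phi> \<psi>) \<psi> \<phi>s \<in> sheaf_homs (SW l0) (SW (last (l # ls))) \<and>
    (\<forall>t P. good t \<longrightarrow> degree P \<le> sdeg l0 \<longrightarrow>
      Lf l0 (last (l # ls)) (foldl (\<lambda>\<psi> \<phi>. hom_comp (SW l0) \<phi> \<psi>) \<psi> \<phi>s) t P = chain_Lf l ls \<phi>s t (Lf l0 l \<psi> t P))"
    if "\<psi> \<in> sheaf_homs (SW l0) (SW l)" for l0 and \<psi> :: "('k, 'n, ('k, 'n) schur_elem) gr_hom"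
    using assms that
  proof (induction ls arbitrary: l \<phi>s \<psi>)
    case Nil
    then show ?case by (simp add: words_Nil_iff)
  next
    case (Cons l' ls)
    then obtain \<phi> \<phi>s' where \<phi>: "\<phi>s = \<phi> # \<phi>s'" "\<phi> \<in> sheaf_homs (SW l) (SW l')" "\<phi>s' \<in> words (hom_chain l' ls)"
      by (auto simp: words_Cons_iff)
    show ?case
      using Cons.IH[OF \<phi>(3) hom_comp_closed[OF Cons.prems(2) \<phi>(2)]]
      by (simp add: \<phi>(1) hom_comp_Lf[OF Cons.prems(2) \<phi>(2)])
  qed
  note * = this[OF hom_id_closed, folded hom_comp_list_def]
  show "hom_comp_list (SW l) \<phi>s \<in> sheaf_homs (SW l) (SW (last (l # ls)))" using * by blast
  show "Lf l (last (l # ls)) (hom_comp_list (SW l) \<phi>s) t P = chain_Lf l ls \<phi>s t P"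
    if "good t" "degree P \<le> sdeg l"
    using * that by (simp only: hom_id_Lf)
qed

lemma words_update: "w \<in> words Ms \<Longrightarrow> i < length Ms \<Longrightarrow> x \<in> carrier (Ms ! i) \<Longrightarrow> w[i := x] \<in> words Ms"
  using list_all2_update_cong[of "\<lambda>x M. x \<in> carrier M" w Ms x "Ms ! i" i] by (simp add: words_def)

lemma length_hom_chain [simp]: "length (hom_chain l ls) = length ls"
  by (induction ls arbitrary: l) simp_all

lemma hom_chain_nth: "i < length ls \<Longrightarrow> \<exists>a b. hom_chain l ls ! i = Hom (SW a) (SW b)"
proof (induction ls arbitrary: l i)
  case (Cons l' ls)
  show ?case
  proof (cases i)
    case 0
    then show ?thesis unfolding hom_chain.simps by (metis nth_Cons_0)
  next
    case (Suc j)
    then show ?thesis using Cons.IH[of j l'] Cons.prems by simp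
  qed
qed simp

lemma chain_Lf_multilinear:
  assumes "w \<in> words (hom_chain l ls)" "i < length ls" "good t" "degree P \<le> sdeg l"
    and "x \<in> carrier (hom_chain l ls ! i)" "y \<in> carrier (hom_chain l ls ! i)"
  shows "chain_Lf l ls (w[i := c \<odot>\<^bsub>hom_chain l ls ! i\<^esub> x \<oplus>\<^bsub>hom_chain l ls ! i\<^esub> d \<odot>\<^bsub>hom_chain l ls ! i\<^esub> y]) t P
    = psmult c (chain_Lf l ls (w[i := x]) t P) + psmult d (chain_Lf l ls (w[i := y]) t P)"
  using assms
proof (induction ls arbitrary: l w i P)
  case (Cons l' ls)
  then obtain \<phi> w' where w: "w = \<phi> # w'" "\<phi> \<in> sheaf_homs (SW l) (SW l')" "w' \<in> words (hom_chain l' ls)"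
    by (auto simp: words_Cons_iff)
  show ?case
  proof (cases i)
    case 0
    then have xy: "x \<in> sheaf_homs (SW l) (SW l')" "y \<in> sheaf_homs (SW l) (SW l')" using Cons.prems by simp_all
    note cl = Hom_smult_closed[OF xy(1)] Hom_smult_closed[OF xy(2)]
    have d: "degree (Lf l l' x t P) \<le> sdeg l'" "degree (Lf l l' y t P) \<le> sdeg l'"
      using Cons.prems xy by (simp_all add: Lf_degree)
    then have d': "degree (psmult c (Lf l l' x t P)) \<le> sdeg l'" "degree (psmult d (Lf l l' y t P)) \<le> sdeg l'"
      using degree_smult_le order.trans by blast+
    show ?thesis
      using Cons.prems xy w d d' by (simp add: 0 words_Cons_iff Hom_add_closed[OF cl] Hom_add_Lf[OF cl]
          Hom_smult_Lf chain_Lf_add[OF w(3)] chain_Lf_psmult[OF w(3)])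
  next
    case (Suc j)
    have "j < length ls" "x \<in> carrier (hom_chain l' ls ! j)" "y \<in> carrier (hom_chain l' ls ! j)"
      using Cons.prems by (simp_all add: Suc)
    from Cons.IH[OF w(3) this(1) \<open>good t\<close> Lf_degree[OF w(2) \<open>good t\<close> \<open>degree P \<le> sdeg l\<close>] this(2,3)]
    show ?thesis using w by (simp add: Suc words_Cons_iff)
  qed
qed simp

text \<open>Makes \<open>Theta\<close> independent of the representative: a composite of fibre maps
  is linear in each entry, so the relations act on every fibre as 0.\<close>

lemma span_multilinear_rels:
  fixes l :: "int \<times> int" and ls :: "(int \<times> int) list"
  defines "Ms \<equiv> hom_chain l ls :: ('k::field_char_0, ('k, 'n::finite, ('k, 'n) schur_elem) gr_hom) module list"
  shows span_multilinear_rels_keys: "free.span (multilinear_rels Ms) \<subseteq> {p. Poly_Mapping.keys p \<subseteq> words Ms}" (is ?thesis1)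
    and span_multilinear_rels_ext: "r \<in> free.span (multilinear_rels Ms) \<Longrightarrow> good t \<Longrightarrow> degree P \<le> sdeg l
      \<Longrightarrow> ext (\<lambda>w. chain_Lf l ls w t P) r = 0"
proof -
  have rel: "Poly_Mapping.keys r \<subseteq> words Ms"
    "good t \<Longrightarrow> degree P \<le> sdeg l \<Longrightarrow> ext (\<lambda>w. chain_Lf l ls w t P) r = 0"
    if "r \<in> multilinear_rels Ms" for r t P
  proof -
    from that obtain w i c d x y where w: "w \<in> words Ms" and i: "i < length Ms" and xy: "x \<in> carrier (Ms ! i)" "y \<in> carrier (Ms ! i)"
      and r: "r = gen (w[i := c \<odot>\<^bsub>Ms ! i\<^esub> x \<oplus>\<^bsub>Ms ! i\<^esub> d \<odot>\<^bsub>Ms ! i\<^esub> y]) - fscale c (gen (w[i := x])) - fscale d (gen (w[i := y]))"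
      unfolding multilinear_rels_def by blast
    have i': "i < length ls" using i by (simp add: Ms_def)
    note * = chain_Lf_multilinear[OF w[unfolded Ms_def] i' _ _ xy[unfolded Ms_def], of _ _ c d, folded Ms_def]
    show "ext (\<lambda>w. chain_Lf l ls w t P) r = 0" if "good t" "degree P \<le> sdeg l"
      using *[OF that] by (simp add: r ext_diff ext_fscale)
    show "Poly_Mapping.keys r \<subseteq> words Ms"
    proof -
      obtain a b where H: "Ms ! i = Hom (SW a) (SW b)" using hom_chain_nth[OF i', of l] unfolding Ms_def by blast
      have "c \<odot>\<^bsub>Ms ! i\<^esub> x \<oplus>\<^bsub>Ms ! i\<^esub> d \<odot>\<^bsub>Ms ! i\<^esub> y \<in> carrier (Ms ! i)"
        using xy by (simp add: H Hom_add_closed Hom_smult_closed)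
      then have "gen v \<in> {p :: _ \<Rightarrow>\<^sub>0 'k. Poly_Mapping.keys p \<subseteq> words Ms}"
        if "v \<in> {w[i := c \<odot>\<^bsub>Ms ! i\<^esub> x \<oplus>\<^bsub>Ms ! i\<^esub> d \<odot>\<^bsub>Ms ! i\<^esub> y], w[i := x], w[i := y]}" for v
        using that words_update[OF w] i xy by auto
      then have "r \<in> {p. Poly_Mapping.keys p \<subseteq> words Ms}"
        unfolding r by (intro free.subspace_diff[OF keys_subspace] free.subspace_scale[OF keys_subspace]) simp_all
      then show ?thesis by simp
    qed
  qed
  show ?thesis1 by (rule free.span_minimal[OF _ keys_subspace]) (use rel(1) in blast)
  show "ext (\<lambda>w. chain_Lf l ls w t P) r = 0" if "r \<in> free.span (multilinear_rels Ms)" "good t" "degree P \<le> sdeg l"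
    using free.span_minimal[OF _ ext_subspace[of "\<lambda>w. chain_Lf l ls w t P"], of "multilinear_rels Ms"] rel(2)[OF _ that(2,3)] that(1) by blast
qed


section \<open>The composition map\<close>

text \<open>The definition applies \<open>the_elem\<close> to the values on all representatives, so
  these must agree: two representatives differ by multilinear relations, which act as 0 on fibres,
  and the fibre maps determine a homomorphism.\<close>

lemma Theta_facts:
  fixes lam mu :: "int \<times> int" and ls :: "(int \<times> int) list"
  defines "Ms \<equiv> step_homs lam mu :: ('k::field_char_0, ('k, 'n::finite, ('k, 'n) schur_elem) gr_hom) module list"
  defines "N \<equiv> free.span (multilinear_rels Ms)"
  assumes Ms: "Ms = hom_chain lam ls" and mu: "last (lam # ls) = mu"
  shows carrier_tensor: "carrier (tensor_module Ms) = cls N ` {p. Poly_Mapping.keys p \<subseteq> words Ms}"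
    and tensor_add: "cls N p \<oplus>\<^bsub>tensor_module Ms\<^esub> cls N q = cls N (p + q)"
    and tensor_smult: "c \<odot>\<^bsub>tensor_module Ms\<^esub> cls N p = cls N (fscale c p)"
    and pure_tensor_cls: "pure_tensor Ms w = cls N (gen w)"
    and Theta_closed: "Poly_Mapping.keys p \<subseteq> words Ms \<Longrightarrow> Theta lam mu (cls N p) \<in> sheaf_homs (SW lam) (SW mu)"
    and Theta_Lf: "Poly_Mapping.keys p \<subseteq> words Ms \<Longrightarrow> good t \<Longrightarrow> degree P \<le> sdeg lam
      \<Longrightarrow> Lf lam mu (Theta lam mu (cls N p)) t P = ext (\<lambda>w. chain_Lf lam ls w t P) p"
proof -
  have NC: "N \<subseteq> {p. Poly_Mapping.keys p \<subseteq> words Ms}" unfolding N_def Ms by (rule span_multilinear_rels_keys)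
  note quot = free.quot_module_facts[OF keys_subspace free.subspace_span NC[unfolded N_def], folded free_module_def presented_def tensor_module_def, folded N_def]
  show "carrier (tensor_module Ms) = cls N ` {p. Poly_Mapping.keys p \<subseteq> words Ms}" by (rule quot(2))
  show "cls N p \<oplus>\<^bsub>tensor_module Ms\<^esub> cls N q = cls N (p + q)" by (rule quot(4))
  show "c \<odot>\<^bsub>tensor_module Ms\<^esub> cls N p = cls N (fscale c p)" by (rule quot(5))
  show "pure_tensor Ms w = cls N (gen w)" using quot(1)[of "gen w"] by (simp only: pure_tensor_def presented_class_def N_def)
  let ?S = "\<lambda>p. \<Oplus>\<^bsub>Hom (SW lam) (SW mu)\<^esub>\<phi>s\<in>Poly_Mapping.keys p.
     Poly_Mapping.lookup p \<phi>s \<odot>\<^bsub>Hom (SW lam) (SW mu)\<^esub> hom_comp_list (SW lam) \<phi>s"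
  have S: "?S p \<in> sheaf_homs (SW lam) (SW mu)"
    "\<And>t P. good t \<Longrightarrow> degree P \<le> sdeg lam \<Longrightarrow> Lf lam mu (?S p) t P = ext (\<lambda>w. chain_Lf lam ls w t P) p"
    if p: "Poly_Mapping.keys p \<subseteq> words Ms" for p
  proof -
    have w: "hom_comp_list (SW lam) w \<in> sheaf_homs (SW lam) (SW mu)"
      "\<And>t P. good t \<Longrightarrow> degree P \<le> sdeg lam \<Longrightarrow> Lf lam mu (hom_comp_list (SW lam) w) t P = chain_Lf lam ls w t P"
      if "w \<in> Poly_Mapping.keys p" for w
      using hom_comp_list_closed[of w lam ls] hom_comp_list_Lf[of w lam ls] that p unfolding Ms mu by blast+
    show "?S p \<in> sheaf_homs (SW lam) (SW mu)"
      by (intro Hom_finsum_closed Hom_smult_closed w) simp_all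
    show "Lf lam mu (?S p) t P = ext (\<lambda>w. chain_Lf lam ls w t P) p" if "good t" "degree P \<le> sdeg lam" for t P
      using that by (simp add: Hom_finsum_Lf Hom_smult_closed Hom_smult_Lf w ext_def)
  qed
  have Theta: "Theta lam mu (cls N p) = ?S p" if p: "Poly_Mapping.keys p \<subseteq> words Ms" for p
  proof -
    have "?S q = ?S p" if q: "q \<in> cls N p" for q
    proof -
      have d: "q - p \<in> N" using q by (simp add: cls_def)
      then have "q - p \<in> {p. Poly_Mapping.keys p \<subseteq> words Ms}" using NC by blast
      from free.subspace_add[OF keys_subspace this, of p] p have q: "Poly_Mapping.keys q \<subseteq> words Ms" by simp
      show ?thesis
      proof (rule hom_eqI[OF S(1)[OF q] S(1)[OF p]])
        fix t :: "('k, 'n) frame" and P :: "'k poly" assume tP: "good t" "degree P \<le> sdeg lam"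
        show "Lf lam mu (?S q) t P = Lf lam mu (?S p) t P"
          using span_multilinear_rels_ext[OF d[unfolded N_def Ms] tP] unfolding S(2)[OF q tP] S(2)[OF p tP] by (simp add: ext_diff)
      qed
    qed
    moreover have "p \<in> cls N p" by (simp add: cls_def N_def free.span_zero)
    ultimately have "?S ` cls N p = {?S p}" by blast
    then show ?thesis unfolding Theta_def by (simp only: the_elem_eq)
  qed
  show "Theta lam mu (cls N p) \<in> sheaf_homs (SW lam) (SW mu)" if "Poly_Mapping.keys p \<subseteq> words Ms"
    unfolding Theta[OF that] by (rule S(1)[OF that])
  show "Lf lam mu (Theta lam mu (cls N p)) t P = ext (\<lambda>w. chain_Lf lam ls w t P) p"
    if "Poly_Mapping.keys p \<subseteq> words Ms" "good t" "degree P \<le> sdeg lam"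
    unfolding Theta[OF that(1)] by (rule S(2)[OF that])
qed

section \<open>Paths of basis homomorphisms\<close>

lemma gops_map: "gops N (map h ws) z P = gops N ws (\<lambda>i. z (h i)) P"
  by (induction ws arbitrary: N P) simp_all

lemma pth_map: "pth \<alpha> (map h vs) (map h ws) z P = pth \<alpha> vs ws (\<lambda>i. z (h i)) P"
  by (simp add: pth_def gops_map o_def)

lemma hom_chain_map:
  "hom_chain (T i) (map T [Suc i..<Suc (i + d)]) = map (\<lambda>k. Hom (SW (T (k - 1))) (SW (T k))) [Suc i..<Suc (i + d)]"
proof (induction d arbitrary: i)
  case (Suc d)
  have "[Suc i..<Suc (i + Suc d)] = Suc i # [Suc (Suc i)..<Suc (Suc i + d)]" by (simp add: upt_conv_Cons del: upt_Suc)
  then show ?case using Suc[of "Suc i"] by (simp del: upt_Suc)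
qed simp

lemma chain_Lf_snoc:
  "length ls = length \<phi>s \<Longrightarrow> chain_Lf l (ls @ [l']) (\<phi>s @ [\<phi>]) t P = Lf (last (l # ls)) l' \<phi> t (chain_Lf l ls \<phi>s t P)"
  by (induction ls \<phi>s arbitrary: l P rule: list_induct2) simp_all

context
  fixes lam mu :: "int \<times> int"
  assumes lam: "is_part lam" and mu: "is_part mu" and le: "lam \<le> mu"
begin

abbreviation (input) "T \<equiv> tau lam mu"
abbreviation (input) "k1 \<equiv> m1 lam mu"
abbreviation (input) "k2 \<equiv> m2 lam mu"
abbreviation (input) "ls \<equiv> map T [1..<Suc (k1 + k2)]"

lemma int_m: "int k1 = fst mu - fst lam" "int k2 = snd mu - snd lam"
  using le by (simp_all add: m1_def m2_def less_eq_prod_def)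

lemma tau_fst_part: "k \<le> k1 \<Longrightarrow> T k = (fst lam + int k, snd lam)"
  by (simp add: tau_def prod_eq_iff)

lemma tau_snd_part: "T (k1 + k) = (fst mu, snd lam + int k)"
  using int_m(1) by (cases k) (simp_all add: tau_def prod_eq_iff)

lemma tau_0: "T 0 = lam" and tau_last: "T (k1 + k2) = mu"
  using tau_snd_part[of k2] int_m by (simp_all add: tau_fst_part prod_eq_iff)

lemma tau_step_e1: "k < k1 \<Longrightarrow> T (Suc k) = T k + e1"
  by (simp add: tau_fst_part e1_def)

lemma tau_step_e2: "T (Suc (k1 + k)) = T (k1 + k) + e2"
  using tau_snd_part[of k] tau_snd_part[of "Suc k"] by (simp add: e2_def)

lemma tau_part: assumes "k \<le> k1 + k2" shows "is_part (T k)"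
proof (cases "k \<le> k1")
  case True
  then show ?thesis using lam by (simp add: tau_fst_part is_part_def)
next
  case False
  then obtain j where "k = k1 + j" "j \<le> k2" using assms by (metis add_le_cancel_left le_Suc_ex nat_le_linear)
  then show ?thesis using lam mu int_m by (simp add: tau_snd_part is_part_def)
qed

lemma sdeg_tau_fst: "k \<le> k1 \<Longrightarrow> sdeg (T k) = sdeg lam + k"
  using lam by (simp add: tau_fst_part sdeg_def is_part_def) arith

text \<open>The steps g never exhaust the degree because \<mu> is a partition; this keeps the
  subtraction of natural numbers exact.\<close>

lemma sdeg_tau_snd: assumes "k \<le> k2" shows "sdeg (T (k1 + k)) = sdeg lam + k1 - k" "k \<le> sdeg lam + k1"
proof -
  have "int k \<le> int k2" using assms by simp
  then show "sdeg (T (k1 + k)) = sdeg lam + k1 - k" "k \<le> sdeg lam + k1"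
    using lam mu int_m by (auto simp: tau_snd_part sdeg_def is_part_def)
qed

lemma sdeg_wedges_mu: "sdeg mu + k2 = sdeg lam + k1" "wedges mu = wedges lam + k2"
  using sdeg_tau_snd[of k2] int_m lam le by (auto simp: tau_last wedges_def is_part_def less_eq_prod_def)

lemma last_tau: "last (lam # map T [1..<Suc k]) = T k"
  by (cases k) (simp_all add: tau_0)

lemma step_homs_chain: "step_homs lam mu = hom_chain lam ls"
  by (simp add: step_homs_def hom_chain_map[of T 0 "k1 + k2", unfolded tau_0 add_0] del: upt_Suc)

lemma basis_path_words:
  fixes v :: "nat \<Rightarrow> 'k::field_char_0^'n::finite"
  shows "basis_path lam mu v \<in> words (step_homs lam mu)"
proof -
  have "f_map (T i) (v (Suc i)) \<in> sheaf_homs (SW (T i)) (SW (T (Suc i)))" if "Suc i \<le> k1" for i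
    using that f_map_closed[OF tau_part[of i]] by (simp add: tau_step_e1)
  moreover have "g_map (T i) (v (Suc i)) \<in> sheaf_homs (SW (T i)) (SW (T (Suc i)))"
    if i: "\<not> Suc i \<le> k1" "i < k1 + k2" for i
  proof -
    obtain j where j: "i = k1 + j" using i(1) by (metis le_Suc_ex not_less_eq_eq)
    show ?thesis using i g_map_closed[OF tau_part[of i]] tau_part[of "Suc i"] by (simp add: j tau_step_e2)
  qed
  ultimately show ?thesis
    by (simp add: words_def basis_path_def step_homs_def list_all2_conv_all_nth del: upt_Suc)
qed

text \<open>The path is cut at \<open>k1\<close>: up to there the product of linear forms grows,
  beyond it the derivations accumulate. Each step needs a degree bound on the previous value, as
  fibre maps are described only on forms of admissible degree.\<close>

lemma basis_path_chain_Lf: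
  fixes v :: "nat \<Rightarrow> 'k::field_char_0^'n::finite"
  assumes t: "good t" and P: "degree P \<le> sdeg lam"
  shows "chain_Lf lam ls (basis_path lam mu v) t P = pth (sdeg lam) [1..<Suc k1] [Suc k1..<Suc (k1 + k2)] (\<lambda>k. zc t (v k)) P"
proof -
  define B where "B k = (if k \<le> k1 then f_map (T (k - 1)) (v k) else g_map (T (k - 1)) (v k))" for k
  let ?z = "\<lambda>k. zc t (v k)"
  have f: "chain_Lf lam (map T [1..<Suc k]) (map B [1..<Suc k]) t P = (\<Prod>j\<leftarrow>[1..<Suc k]. lin (?z j)) * P" if "k \<le> k1" for k
    using that
  proof (induction k)
    case (Suc k)
    let ?X = "(\<Prod>j\<leftarrow>[1..<Suc k]. lin (?z j)) * P"
    have IH: "chain_Lf lam (map T [1..<Suc k]) (map B [1..<Suc k]) t P = ?X" using Suc by (simp del: upt_Suc)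
    have "degree ?X \<le> sdeg (T k)"
      using order.trans[OF degree_mult_le add_mono[OF degree_prod_lin[where ys = "[1..<Suc k]" and z = ?z] P]] Suc.prems by (simp add: sdeg_tau_fst add.commute del: upt_Suc)
    then have "Lf (T k) (T (Suc k)) (B (Suc k)) t ?X = lin (?z (Suc k)) * ?X"
      using Suc.prems f_map_Lf[OF tau_part[of k] t] by (simp add: B_def tau_step_e1)
    moreover have "chain_Lf lam (map T [1..<Suc k] @ [T (Suc k)]) (map B [1..<Suc k] @ [B (Suc k)]) t P = Lf (T k) (T (Suc k)) (B (Suc k)) t ?X"
      by (subst chain_Lf_snoc) (simp, simp only: last_tau IH)
    moreover have "[1..<Suc (Suc k)] = [1..<Suc k] @ [Suc k]" by simp
    ultimately show ?case by (simp del: upt_Suc)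
  qed simp
  have g: "chain_Lf lam (map T [1..<Suc (k1 + k)]) (map B [1..<Suc (k1 + k)]) t P
      = pth (sdeg lam) [1..<Suc k1] [Suc k1..<Suc (k1 + k)] ?z P" if "k \<le> k2" for k
    using that
  proof (induction k)
    case 0
    show ?case using f[of k1] by (simp add: pth_def del: upt_Suc)
  next
    case (Suc k)
    let ?X = "pth (sdeg lam) [1..<Suc k1] [Suc k1..<Suc (k1 + k)] ?z P"
    note s = sdeg_tau_snd[of k]
    have IH: "chain_Lf lam (map T [1..<Suc (k1 + k)]) (map B [1..<Suc (k1 + k)]) t P = ?X" using Suc by (simp del: upt_Suc)
    have "degree ?X \<le> sdeg (T (k1 + k))"
      using degree_pth[OF _ P, of "[Suc k1..<Suc (k1 + k)]" "[1..<Suc k1]" ?z] s Suc.prems by (simp del: upt_Suc)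
    then have "Lf (T (k1 + k)) (T (Suc (k1 + k))) (B (Suc (k1 + k))) t ?X = Dz (sdeg (T (k1 + k))) (?z (Suc (k1 + k))) ?X"
      using Suc.prems g_map_Lf[OF tau_part[of "k1 + k"] _ t] tau_part[of "Suc (k1 + k)"] by (simp add: B_def tau_step_e2)
    moreover have "chain_Lf lam (map T [1..<Suc (k1 + k)] @ [T (Suc (k1 + k))]) (map B [1..<Suc (k1 + k)] @ [B (Suc (k1 + k))]) t P
        = Lf (T (k1 + k)) (T (Suc (k1 + k))) (B (Suc (k1 + k))) t ?X"
      by (subst chain_Lf_snoc) (simp, simp only: last_tau IH)
    moreover have "[1..<Suc (k1 + Suc k)] = [1..<Suc (k1 + k)] @ [Suc (k1 + k)]" "[Suc k1..<Suc (k1 + Suc k)] = [Suc k1..<Suc (k1 + k)] @ [Suc (k1 + k)]" by simp_all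
    ultimately show ?case using s Suc.prems by (simp add: pth_def gops_append del: upt_Suc)
  qed
  show ?thesis using g[of k2] by (simp add: basis_path_def B_def[abs_def] del: upt_Suc)
qed

text \<open>Translates the two index lists of a path into the vectors of a basis path. Steps are
  counted from 1 and list entries from 0, hence \<open>k - 1\<close>.\<close>

lemma basis_path_axis_chain_Lf:
  fixes t :: "('k::field_char_0, 'n::finite) frame"
  assumes t: "good t" and P: "degree P \<le> sdeg lam" and len: "length vs = k1" "length ws = k2"
  shows "chain_Lf lam ls (basis_path lam mu (\<lambda>k. axis ((vs @ ws) ! (k - 1)) 1)) t P = pth (sdeg lam) vs ws (\<lambda>i. zc t (axis i 1)) P"
proof -
  let ?h = "\<lambda>k. (vs @ ws) ! (k - 1)"
  have "map ?h [1..<Suc k1] = vs" "map ?h [Suc k1..<Suc (k1 + k2)] = ws"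
    using len by (auto intro!: nth_equalityI simp: nth_append simp del: upt_Suc)
  then show ?thesis
    using pth_map[of "sdeg lam" ?h "[1..<Suc k1]" "[Suc k1..<Suc (k1 + k2)]" "\<lambda>i. zc t (axis i 1)" P]
    unfolding basis_path_chain_Lf[OF t P] by (simp del: upt_Suc)
qed

end

theorem theorem2p12:
  fixes u :: "'n::finite \<Rightarrow> 'k::{alg_closed_field, field_char_0} ^ 'n"
    and lam mu :: "int \<times> int"
  assumes "CARD('n) \<ge> 4"
    and "inj u" and "vec.independent (range u)" and "vec.span (range u) = UNIV"
    and "lam \<in> Young (int CARD('n) - 2)" and "mu \<in> Young (int CARD('n) - 2)"
    and "lam < mu"
  shows "(Theta lam mu :: _ \<Rightarrow> ('k, 'n, ('k, 'n) schur_elem) gr_hom)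
      \<in> lin_maps field_ring (tensor_module (step_homs lam mu)) (Hom (SW lam) (SW mu))
    \<and> (\<forall>i :: nat \<Rightarrow> 'n.
      Theta lam mu (pure_tensor (step_homs lam mu) (basis_path lam mu (\<lambda>k. u (i k))))
        = hom_comp_list (SW lam) (basis_path lam mu (\<lambda>k. u (i k))))
    \<and> (Theta lam mu :: _ \<Rightarrow> ('k, 'n, ('k, 'n) schur_elem) gr_hom)
      ` carrier (tensor_module (step_homs lam mu)) = carrier (Hom (SW lam) (SW mu))"
proof -
  have part: "is_part lam" "is_part mu" using assms(5,6) by (auto simp: Young_def is_part_def)
  have le: "lam \<le> mu" using assms(7) by simp
  note ctx = part le
  let ?H = "Hom (SW lam) (SW mu) :: ('k, ('k, 'n, ('k, 'n) schur_elem) gr_hom) module"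
  define Ms where "Ms = (step_homs lam mu :: ('k, ('k, 'n, ('k, 'n) schur_elem) gr_hom) module list)"
  define ls where "ls = map (tau lam mu) [1..<Suc (m1 lam mu + m2 lam mu)]"
  define N where "N = free.span (multilinear_rels Ms)"
  let ?\<Theta> = "Theta lam mu :: _ \<Rightarrow> ('k, 'n, ('k, 'n) schur_elem) gr_hom"
  have chain: "Ms = hom_chain lam ls" unfolding Ms_def ls_def by (rule step_homs_chain[OF ctx])
  have last: "last (lam # ls) = mu" unfolding ls_def by (simp only: last_tau[OF ctx] tau_last[OF ctx])
  note \<Theta> = Theta_facts[OF chain[unfolded Ms_def] last, folded Ms_def, folded N_def]
  have keys_add': "Poly_Mapping.keys (p + q) \<subseteq> words Ms" and keys_fscale': "Poly_Mapping.keys (fscale c p) \<subseteq> words Ms"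
    if "Poly_Mapping.keys p \<subseteq> words Ms" "Poly_Mapping.keys q \<subseteq> words Ms" for p q c
    using free.subspace_add[OF keys_subspace, of p "words Ms" q] free.subspace_scale[OF keys_subspace, of p "words Ms" c] that by auto
  have "?\<Theta> \<in> lin_maps field_ring (tensor_module Ms) ?H"
    unfolding lin_maps_def mem_Collect_eq
  proof (intro conjI ballI)
    show "?\<Theta> \<in> carrier (tensor_module Ms) \<rightarrow> carrier ?H" using \<Theta>(1,5) by auto
    fix X assume "X \<in> carrier (tensor_module Ms)"
    then obtain p where X: "X = cls N p" and p: "Poly_Mapping.keys p \<subseteq> words Ms" by (auto simp: \<Theta>(1))
    { fix Y assume "Y \<in> carrier (tensor_module Ms)"
      then obtain q where Y: "Y = cls N q" and q: "Poly_Mapping.keys q \<subseteq> words Ms" by (auto simp: \<Theta>(1))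
      show "?\<Theta> (X \<oplus>\<^bsub>tensor_module Ms\<^esub> Y) = ?\<Theta> X \<oplus>\<^bsub>?H\<^esub> ?\<Theta> Y"
        unfolding X Y \<Theta>(2) using p q
        by (intro hom_eqI[of _ lam mu]) (simp_all add: \<Theta>(5,6) keys_add' Hom_add_closed Hom_add_Lf ext_add) }
    { fix c :: 'k
      show "?\<Theta> (c \<odot>\<^bsub>tensor_module Ms\<^esub> X) = c \<odot>\<^bsub>?H\<^esub> ?\<Theta> X"
        unfolding X \<Theta>(3) using p
        by (intro hom_eqI[of _ lam mu]) (simp_all add: \<Theta>(5,6) keys_fscale'[OF p p] Hom_smult_closed Hom_smult_Lf ext_fscale) }
  qed
  moreover have "?\<Theta> (pure_tensor Ms (basis_path lam mu v)) = hom_comp_list (SW lam) (basis_path lam mu v)" for v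
  proof -
    have w: "basis_path lam mu v \<in> words Ms" unfolding Ms_def by (rule basis_path_words[OF ctx])
    note w' = w[unfolded chain]
    show ?thesis
      unfolding \<Theta>(4) using w hom_comp_list_closed[OF w'] hom_comp_list_Lf[OF w']
      by (intro hom_eqI[of _ lam mu]) (simp_all only: \<Theta>(5,6) last, simp_all add: \<Theta>(5,6))
  qed
  moreover have "?\<Theta> ` carrier (tensor_module Ms) = carrier ?H"
  proof
    show "?\<Theta> ` carrier (tensor_module Ms) \<subseteq> carrier ?H" using \<Theta>(1,5) by auto
    show "carrier ?H \<subseteq> ?\<Theta> ` carrier (tensor_module Ms)"
    proof
      fix \<phi> assume "\<phi> \<in> carrier ?H"
      then have \<phi>: "\<phi> \<in> sheaf_homs (SW lam) (SW mu)" by simp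
      obtain L where L: "\<And>c vs ws. (c, vs, ws) \<in> set L \<Longrightarrow> length vs = m1 lam mu \<and> length ws = m2 lam mu"
        and \<phi>L: "\<And>t P. good t \<Longrightarrow> degree P \<le> sdeg lam
          \<Longrightarrow> Lf lam mu \<phi> t P = (\<Sum>(c, vs, ws)\<leftarrow>L. psmult c (pth (sdeg lam) vs ws (\<lambda>i. zc t (axis i 1)) P))"
        using hom_is_path_combination[OF assms(1) \<phi> sdeg_wedges_mu(2)[OF ctx] sdeg_wedges_mu(1)[OF ctx]] by blast
      \<comment> \<open>The columns of a frame are its values at the axis vectors, so the paths
        obtained from brackets run along these vectors; their maps f and g lie in the same Hom
        spaces.\<close>
      define b where "b vs ws = basis_path lam mu (\<lambda>k. axis ((vs @ ws) ! (k - 1)) (1::'k))" for vs ws :: "'n list"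
      have b: "b vs ws \<in> words Ms" for vs ws unfolding b_def Ms_def by (rule basis_path_words[OF ctx])
      define p where "p = (\<Sum>(c, vs, ws)\<leftarrow>L. fscale c (gen (b vs ws)))"
      have p: "Poly_Mapping.keys p \<subseteq> words Ms"
      proof -
        have "(\<Sum>(c, vs, ws)\<leftarrow>L. fscale c (gen (b vs ws))) \<in> {p. Poly_Mapping.keys p \<subseteq> words Ms}" for L
          by (induction L) (auto dest!: subsetD[OF Poly_Mapping.keys_add] subsetD[OF keys_fscale] simp: b)
        then show ?thesis by (simp add: p_def)
      qed
      have L': "\<forall>x\<in>set L. length (fst (snd x)) = m1 lam mu \<and> length (snd (snd x)) = m2 lam mu" using L by auto
      have "ext (\<lambda>w. chain_Lf lam ls w t P) p = (\<Sum>(c, vs, ws)\<leftarrow>L. psmult c (pth (sdeg lam) vs ws (\<lambda>i. zc t (axis i 1)) P))"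
        if tP: "good t" "degree P \<le> sdeg lam" for t :: "('k, 'n) frame" and P
        unfolding p_def using L'
      proof (induction L)
        case (Cons x L)
        obtain c vs ws where x: "x = (c, vs, ws)" by (cases x)
        have "length vs = m1 lam mu" "length ws = m2 lam mu" using Cons.prems by (simp_all add: x)
        from basis_path_axis_chain_Lf[OF ctx tP this, folded ls_def, folded b_def]
        show ?case using Cons by (simp add: x ext_add ext_fscale)
      qed simp
      \<comment> \<open>Both sides have the same fibre map in every frame.\<close>
      then have "\<phi> = ?\<Theta> (cls N p)"
        using \<phi> \<phi>L p by (intro hom_eqI[of _ lam mu]) (simp_all add: \<Theta>(5,6))
      then show "\<phi> \<in> ?\<Theta> ` carrier (tensor_module Ms)" using p by (auto simp: \<Theta>(1))
    qed
  qed
  ultimately show ?thesis unfolding Ms_def by blast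
qed

end
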